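(* Let $X=(\omega_{i,i}^R,\omega_{i,j}^R,\omega_{i,j}^I)_{1\le i<j\le N}$ be a random vector in $\mathbb{R}^{N^2}$ with law $\mathbb{P}^N\sim ID(\beta,0,\nu)$ such that $\mathbb{E}^N[e^{t\|X\|}]<+\infty$ for some $t>0$. Let $T=\sup\{t\ge 0:\mathbb{E}^N[e^{t\|X\|}]<+\infty\}$ and let $h^{-1}$ be the inverse of $$h(s)=\int_{\mathbb{R}^{N^2}}\|u\|\big(e^{s\|u\|}-1\big)\nu(du),\qquad 0<s<T.$$ Let $\mathbf{X_A}$ be the associated $N\times N$ random Hermitian matrix, $(\mathbf{X_A})_{i,j}=\frac{1}{\sqrt N}A_{i,j}\omega_{i,j}$, with $|A_{i,j}|\le a$. (i) For any compact set $\mathcal{K}\subset\mathbb{R}$, $$\mathbb{P}^N\Big(\sup_{f\in Lip_{\mathcal{K}}(1)}\big|tr_N(f(\mathbf{X_A}))-\mathbb{E}^N[tr_N(f(\mathbf{X_A}))]\big|\ge\delta\Big)\le\frac{8|\mathcal{K}|}{\delta}\exp\Big\{-\int_0^{\frac{N\delta^2}{8\sqrt2 a|\mathcal{K}|}}h^{-1}(s)\,ds\Big\},$$ for all $\delta>0$ such that $\delta^2<8\sqrt2 a|\mathcal{K}|h(T^-)/N$. (ii) For any $b>0$, $$\mathbb{P}^N\Big(\sup_{f\in Lip_b(1)}\big|tr_N(f(\mathbf{X_A}))-\mathbb{E}^N[tr_N(f(\mathbf{X_A}))]\big|\ge\delta\Big)\le\frac{C(\delta,b)}{\delta}\exp\Big\{-\int_0^{\frac{N\delta^2}{\sqrt2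 a\,C(\delta,b)}}h^{-1}(s)\,ds\Big\},$$ for all $\delta>0$ such that $\delta^2\le\sqrt2 a\,C(\delta,b)h(T^-)/N$, where $$C(\delta,b)=C\Big(\frac{\sqrt2 a}{\sqrt N}\big(G_2(\gamma)+h(t_0)\big)+b\Big),$$ with $C$ a universal constant, with $\gamma>0$ any number such that $\bar\nu(p_\gamma)\le 1/4$ (the quantity $G_2(\gamma)$ being defined in the context), and with $t_0$ the solution, in $t$, of $th(t)-\int_0^t h(s)\,ds-\ln(12b/\delta)=0$.
   Context: Matrix model. $N\ge1$; $\mathbf{A}=(A_{i,j})_{1\le i,j\le N}$ is a non-random Hermitian matrix with $|A_{i,j}|\le a$ for all $i,j$, where $a>0$. The complex random variables $\omega_{i,j}=\omega_{i,j}^R+\sqrt{-1}\,\omega_{i,j}^I$ satisfy $\omega_{i,j}=\overline{\omega_{j,i}}$ and $\omega_{i,i}^I=0$. $\mathbf{X_A}$ is the $N\times N$ Hermitian matrix with entries $(\mathbf{X_A})_{i,j}=\frac1{\sqrt N}A_{i,j}\omega_{i,j}$. $X=(\omega_{i,i}^R,\omega_{i,j}^R,\omega_{i,j}^I)_{1\le i<j\le N}$ (with $1\le i\le N$ for $\omega_{i,i}^R$) is the vector in $\mathbb{R}^{N^2}$ of real parameters, $\mathbb{P}^N$ its law and $\mathbb{E}^N$ the expectation. $\|\cdot\|$ is the Euclidean norm. For $f:\mathbb{R}\to\mathbb{R}$ and Hermitian $\mathbf{M}=\mathbf{U}\,\mathrm{diag}(\lambda_1,\dots,\lambda_N)\mathbf{U}^*$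 with $\mathbf U$ unitary, $f(\mathbf{M})=\mathbf{U}\,\mathrm{diag}(f(\lambda_1),\dots,f(\lambda_N))\mathbf{U}^*$, and $tr_N(\mathbf{M})=\frac1N\sum_{i=1}^N\mathbf{M}_{i,i}$. $\|f\|_{Lip}=\sup_{x\ne y}|f(x)-f(y)|/\|x-y\|$. For $b,c>0$, $Lip_b(c)=\{f:\mathbb{R}\to\mathbb{R}:\|f\|_{Lip}\le c,\ \|f\|_\infty\le b\}$. For compact $\mathcal{K}\subset\mathbb{R}$, $|\mathcal{K}|=\sup_{x,y\in\mathcal{K}}|x-y|$ and $Lip_{\mathcal{K}}(c)=\{f:\mathbb{R}\to\mathbb{R}:\|f\|_{Lip}\le c,\ \mathrm{supp}(f)\subset\mathcal{K}\}$. $X\sim ID(\beta,0,\nu)$ in $\mathbb{R}^d$ means $\mathbb{E}e^{i\langle t,X\rangle}=\exp\{i\langle t,\beta\rangle+\int_{\mathbb{R}^d}(e^{i\langle t,u\rangle}-1-i\langle t,u\rangle\mathbf{1}_{\|u\|\le1})\nu(du)\}$, where $\beta\in\mathbb{R}^d$ and the Lévy measure $\nu\not\equiv0$ is a positive Borel measure without atom at the origin with $\int(1\wedge\|u\|^2)\nu(du)<\infty$. $h(T^-)$ is the left limit of $h$ at $T$. Definition of $G_2(\gamma)$: let $V^2(x)=\int_{\|u\|\le x}\|u\|^2\nu(du)$, $\bar\nu(x)=\int_{\|u\|>x}\nu(du)$, and for $\gamma>0$ let $p_\gamma=\inf\{x>0:0<V^2(x)/x^2\le\gamma\}$. Let $k_\gamma(x)$,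 $x>0$, be the solution, in $y$, of $y-(y+\gamma)\ln(1+y/\gamma)=\ln x$, and $$E_\gamma=\Big(\sum_{k=1}^{N^2}\Big(\langle e_k,\beta\rangle-\int_{p_\gamma<\|y\|\le1}\langle e_k,y\rangle\nu(dy)+\int_{1<\|y\|\le p_\gamma}\langle e_k,y\rangle\nu(dy)\Big)^2\Big)^{1/2},$$ with $e_1,\dots,e_{N^2}$ the canonical basis of $\mathbb{R}^{N^2}$. Then $G_2(\gamma)=p_\gamma\big(\sqrt\gamma+k_\gamma(1/4)\big)+E_\gamma$. *)

theory Defs
  imports
    "HOL-Probability.Probability"
    "Jordan_Normal_Form.Matrix"
    "Jordan_Normal_Form.Schur_Decomposition"
begin

text \<open>
  Since the constant of the theorem does not depend on the matrix size \<open>N\<close>, the size is a natural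
  number and not a type: matrices are \<open>N \<times> N\<close> matrices of type \<open>complex mat\<close> (indices \<open>0, \<dots>, N - 1\<close>),
  and Euclidean space of dimension \<open>N\<^sup>2\<close> is the product of copies of the real line over the index
  set \<open>coords N\<close>. A vector \<open>x\<close> of this space collects the real parameters of a Hermitian matrix
  \<open>\<omega>\<close>: \<open>x (i, i)\<close> is the real part of \<open>\<omega>\<^sub>i\<^sub>i\<close> and, for \<open>i < j\<close>, \<open>x (i, j)\<close> and \<open>x (j, i)\<close> are the
  real and the imaginary part of \<open>\<omega>\<^sub>i\<^sub>j\<close>.
\<close>

definition coords :: "nat \<Rightarrow> (nat \<times> nat) set" where
  "coords N = {..<N} \<times> {..<N}"

definition RN :: "nat \<Rightarrow> (nat \<times> nat \<Rightarrow> real) measure" where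
  "RN N = PiM (coords N) (\<lambda>_. borel)"

definition enorm :: "nat \<Rightarrow> (nat \<times> nat \<Rightarrow> real) \<Rightarrow> real" where
  "enorm N u = L2_set u (coords N)"

definition einner :: "nat \<Rightarrow> (nat \<times> nat \<Rightarrow> real) \<Rightarrow> (nat \<times> nat \<Rightarrow> real) \<Rightarrow> real" where
  "einner N t u = (\<Sum>k\<in>coords N. t k * u k)"

definition omega :: "(nat \<times> nat \<Rightarrow> real) \<Rightarrow> nat \<Rightarrow> nat \<Rightarrow> complex" where
  "omega x i j =
     (if i = j then complex_of_real (x (i, i))
      else if i < j then Complex (x (i, j)) (x (j, i))
      else cnj (Complex (x (j, i)) (x (i, j))))"

definition XA :: "nat \<Rightarrow> complex mat \<Rightarrow> (nat \<times> nat \<Rightarrow> real) \<Rightarrow> complex mat" where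
  "XA N A x = mat N N (\<lambda>(i, j). complex_of_real (1 / sqrt (real N)) * A $$ (i, j) * omega x i j)"

definition hermitian :: "complex mat \<Rightarrow> bool" where
  "hermitian M \<longleftrightarrow> square_mat M \<and> mat_adjoint M = M"

definition unitary :: "complex mat \<Rightarrow> bool" where
  "unitary U \<longleftrightarrow> square_mat U \<and> U * mat_adjoint U = 1\<^sub>m (dim_row U)"

text \<open>
  For Hermitian \<open>M\<close> the matrix below does not depend on the choice of the diagonalisation.
\<close>

definition mat_fun :: "(real \<Rightarrow> real) \<Rightarrow> complex mat \<Rightarrow> complex mat" where
  "mat_fun f M =
     (THE B. \<exists>U l. unitary U \<and> dim_row U = dim_row M \<and>
        M = U * mat_diag (dim_row M) (\<lambda>i. complex_of_real (l i)) * mat_adjoint U \<and>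
        B = U * mat_diag (dim_row M) (\<lambda>i. complex_of_real (f (l i))) * mat_adjoint U)"

definition tr_N :: "complex mat \<Rightarrow> complex" where
  "tr_N M = (\<Sum>i<dim_row M. M $$ (i, i)) / of_nat (dim_row M)"

definition lip_seminorm :: "(real \<Rightarrow> real) \<Rightarrow> ereal" where
  "lip_seminorm f = (SUP (x, y)\<in>{(x, y). x \<noteq> y}. ereal (\<bar>f x - f y\<bar> / \<bar>x - y\<bar>))"

definition Lip_b :: "real \<Rightarrow> real \<Rightarrow> (real \<Rightarrow> real) set" where
  "Lip_b b c = {f. lip_seminorm f \<le> ereal c \<and> (SUP x. ereal \<bar>f x\<bar>) \<le> ereal b}"

definition Lip_K :: "real set \<Rightarrow> real \<Rightarrow> (real \<Rightarrow> real) set" where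
  "Lip_K K c = {f. lip_seminorm f \<le> ereal c \<and> closure {x. f x \<noteq> 0} \<subseteq> K}"

definition levy_measure :: "nat \<Rightarrow> (nat \<times> nat \<Rightarrow> real) measure \<Rightarrow> bool" where
  "levy_measure N \<nu> \<longleftrightarrow>
     sets \<nu> = sets (RN N) \<and>
     emeasure \<nu> (space \<nu>) \<noteq> 0 \<and>
     emeasure \<nu> {\<lambda>k\<in>coords N. 0} = 0 \<and>
     (\<integral>\<^sup>+u. ennreal (min 1 ((enorm N u)\<^sup>2)) \<partial>\<nu>) < \<infinity>"

text \<open>\<open>P\<close> is the law of an infinitely divisible vector without Gaussian component.\<close>

definition ID ::
  "nat \<Rightarrow> (nat \<times> nat \<Rightarrow> real) \<Rightarrow> (nat \<times> nat \<Rightarrow> real) measure \<Rightarrow> (nat \<times> nat \<Rightarrow> real) measure \<Rightarrow> bool"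
where
  "ID N \<beta> \<nu> P \<longleftrightarrow>
     \<beta> \<in> space (RN N) \<and> levy_measure N \<nu> \<and> prob_space P \<and> sets P = sets (RN N) \<and>
     (\<forall>t\<in>space (RN N).
        (LINT x|P. exp (\<i> * complex_of_real (einner N t x))) =
        exp (\<i> * complex_of_real (einner N t \<beta>) +
          (LINT u|\<nu>. exp (\<i> * complex_of_real (einner N t u)) - 1 -
             \<i> * complex_of_real (einner N t u * indicator {u. enorm N u \<le> 1} u))))"

definition exp_moment :: "nat \<Rightarrow> (nat \<times> nat \<Rightarrow> real) measure \<Rightarrow> real \<Rightarrow> ennreal" where
  "exp_moment N P t = (\<integral>\<^sup>+x. ennreal (exp (t * enorm N x)) \<partial>P)"

definition T_sup :: "nat \<Rightarrow> (nat \<times> nat \<Rightarrow> real) measure \<Rightarrow> ereal" where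
  "T_sup N P = Sup (ereal ` {t. 0 \<le> t \<and> exp_moment N P t < \<infinity>})"

definition h_fun :: "nat \<Rightarrow> (nat \<times> nat \<Rightarrow> real) measure \<Rightarrow> real \<Rightarrow> real" where
  "h_fun N \<nu> s = (LINT u|\<nu>. enorm N u * (exp (s * enorm N u) - 1))"

definition h_inv ::
  "nat \<Rightarrow> (nat \<times> nat \<Rightarrow> real) measure \<Rightarrow> (nat \<times> nat \<Rightarrow> real) measure \<Rightarrow> real \<Rightarrow> real" where
  "h_inv N P \<nu> = the_inv_into {s. 0 < s \<and> ereal s < T_sup N P} (h_fun N \<nu>)"

text \<open>The point \<open>T\<close> and the left limit may both be infinite, so the limit is taken in \<open>ereal\<close>.\<close>

definition left_limit :: "(real \<Rightarrow> real) \<Rightarrow> ereal \<Rightarrow> ereal" where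
  "left_limit g T = Lim (at_left T) (\<lambda>s. ereal (g (real_of_ereal s)))"

definition V2 :: "nat \<Rightarrow> (nat \<times> nat \<Rightarrow> real) measure \<Rightarrow> real \<Rightarrow> real" where
  "V2 N \<nu> x = (LINT u:{u. enorm N u \<le> x}|\<nu>. (enorm N u)\<^sup>2)"

definition nu_bar :: "nat \<Rightarrow> (nat \<times> nat \<Rightarrow> real) measure \<Rightarrow> real \<Rightarrow> ennreal" where
  "nu_bar N \<nu> x = emeasure \<nu> {u \<in> space \<nu>. enorm N u > x}"

definition p_gam :: "nat \<Rightarrow> (nat \<times> nat \<Rightarrow> real) measure \<Rightarrow> real \<Rightarrow> real" where
  "p_gam N \<nu> \<gamma> = Inf {x. 0 < x \<and> 0 < V2 N \<nu> x / x\<^sup>2 \<and> V2 N \<nu> x / x\<^sup>2 \<le> \<gamma>}"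

text \<open>
  The left-hand side decreases from \<open>0\<close> to \<open>-\<infinity>\<close> on the nonnegative half-line, so for \<open>0 < x \<le> 1\<close>
  there is exactly one nonnegative solution. The constraint \<open>0 \<le> y\<close> is needed for uniqueness: on
  \<open>-\<gamma> < y < 0\<close> the left-hand side increases from \<open>-\<gamma>\<close> to \<open>0\<close>, which gives a second, spurious root
  when \<open>-\<gamma> < ln x < 0\<close>.
\<close>

definition k_gam :: "real \<Rightarrow> real \<Rightarrow> real" where
  "k_gam \<gamma> x = (THE y. 0 \<le> y \<and> y - (y + \<gamma>) * ln (1 + y / \<gamma>) = ln x)"

definition E_gam ::
  "nat \<Rightarrow> (nat \<times> nat \<Rightarrow> real) \<Rightarrow> (nat \<times> nat \<Rightarrow> real) measure \<Rightarrow> real \<Rightarrow> real" where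
  "E_gam N \<beta> \<nu> \<gamma> =
     sqrt (\<Sum>k\<in>coords N.
       (\<beta> k
        - (LINT y:{y. p_gam N \<nu> \<gamma> < enorm N y \<and> enorm N y \<le> 1}|\<nu>. y k)
        + (LINT y:{y. 1 < enorm N y \<and> enorm N y \<le> p_gam N \<nu> \<gamma>}|\<nu>. y k))\<^sup>2)"

definition G2 ::
  "nat \<Rightarrow> (nat \<times> nat \<Rightarrow> real) \<Rightarrow> (nat \<times> nat \<Rightarrow> real) measure \<Rightarrow> real \<Rightarrow> real" where
  "G2 N \<beta> \<nu> \<gamma> = p_gam N \<nu> \<gamma> * (sqrt \<gamma> + k_gam \<gamma> (1 / 4)) + E_gam N \<beta> \<nu> \<gamma>"

text \<open>
  For \<open>F = Lip_K K 1\<close> (\<open>K\<close> compact) and \<open>F = Lip_b b 1\<close> the functions in \<open>F\<close> are uniformly bounded, so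
  the real-valued supremum is a genuine one, and it is measurable in \<open>x\<close> as a supremum of
  continuous functions.
\<close>

definition dev_prob ::
  "nat \<Rightarrow> complex mat \<Rightarrow> (nat \<times> nat \<Rightarrow> real) measure \<Rightarrow> (real \<Rightarrow> real) set \<Rightarrow> real \<Rightarrow> real" where
  "dev_prob N A P F \<delta> =
     measure P {x \<in> space P.
       (SUP f\<in>F. cmod (tr_N (mat_fun f (XA N A x)) - (LINT y|P. tr_N (mat_fun f (XA N A y))))) \<ge> \<delta>}"

end

theory Submission
  imports Defs "Jordan_Normal_Form.Spectral_Radius"
begin

text \<open>
  Approximate the infinitely divisible law by sums of independent rare jumps. For such sums the bound
  \<open>E exp (t (F - E F)) \<le> exp (\<psi> t)\<close> for 1-Lipschitz \<open>F\<close>, with \<open>\<psi> t = \<integral> (exp (t |u|) - 1 - t |u|) \<nu>(du)\<close>,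
  follows step by step from \<open>1 + y \<le> exp y\<close>, and it passes to the limit. Since \<open>h\<close> is the derivative of \<open>\<psi>\<close>,
  Markov's inequality and Young's equality for \<open>h\<close> and its inverse give
  \<open>P (F - E F \<ge> x) \<le> exp (- \<integral>\<^sub>0\<^sup>x h\<^sup>-\<^sup>1)\<close>. The spectral statistic of a 1-Lipschitz \<open>f\<close> is a
  \<open>\<surd>2 a / N\<close>-Lipschitz function of the parameters. Uniformity in \<open>f\<close> comes from interpolation: on a grid of
  mesh \<open>\<Delta>\<close>, every 1-Lipschitz function is within \<open>\<Delta> / 2\<close> of a combination of finitely many fixed ramps with
  coefficients in \<open>[-1, 1]\<close>, so it suffices to control the deviations of the ramps. In part (ii) the grid covers
  \<open>[-R, R]\<close> and the spectrum leaves this interval with probability at most \<open>\<delta> / (12 b)\<close>, by the same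
  concentration bound applied to the norm and the definition of \<open>t0\<close>.
\<close>

section \<open>Convergence of characteristic functions\<close>

text \<open>Two obstacles shape the proof. First, \<open>T\<close> is defined by moments of the law
  while \<open>h\<close> and \<open>\<psi>\<close> are integrals over \<open>\<nu>\<close>, so
  exponential moments must be carried from \<open>P\<close> to the part of \<open>\<nu>\<close> far
  from the origin. Second, the mean of the norm must be bounded by the data of the theorem. For this
  the law is split at the level \<open>p = p_gam\<close> into a drift of norm \<open>E_gam\<close>,
  compensated small jumps with fluctuation at most
  \<open>sqrt (V2 p) \<le> p * sqrt \<gamma>\<close>, and large jumps whose total first moment is,
  in the nontrivial case, at most \<open>h t0\<close>. Hence the walks are built for an arbitrary
  truncation level.

  The left limit of \<open>h\<close> at \<open>T\<close> need not be attained and \<open>T\<close>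
  may be infinite; the integral of the inverse is therefore bounded by an area argument that uses
  all \<open>t < T\<close> at once instead of optimising over \<open>t\<close>.

  The \<open>8\<close> of (i) comes from a threshold \<open>\<delta>^2 / (8 |K|)\<close> for each of
  at most \<open>4 |K| / \<delta>\<close> ramps, which spends one half of \<open>\<delta>\<close>.
  In (ii) the constant \<open>40\<close> makes the threshold small enough that the test functions
  spend \<open>3 / 10\<close> of \<open>\<delta>\<close>.\<close>

abbreviation RI :: "'i set \<Rightarrow> ('i \<Rightarrow> real) measure" where
  "RI I \<equiv> Pi\<^sub>M I (\<lambda>_. borel)"

definition charI :: "'i set \<Rightarrow> ('i \<Rightarrow> real) measure \<Rightarrow> ('i \<Rightarrow> real) \<Rightarrow> complex" where
  "charI I Q t = (LINT x|Q. iexp (\<Sum>k\<in>I. t k * x k))"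

text \<open>Only extensional points are compared. Points that differ outside \<open>I\<close> have
  distance \<open>0\<close> in this seminorm, so a condition on all functions would also force
  \<open>F\<close> to ignore the coordinates outside \<open>I\<close>.\<close>

definition lip_on :: "'i set \<Rightarrow> real \<Rightarrow> (('i \<Rightarrow> real) \<Rightarrow> real) \<Rightarrow> bool" where
  "lip_on I L F \<longleftrightarrow> (\<forall>x\<in>space (RI I). \<forall>y\<in>space (RI I). \<bar>F x - F y\<bar> \<le> L * L2_set (\<lambda>k. x k - y k) I)"

lemma lip_onD: "lip_on I L F \<Longrightarrow> x \<in> space (RI I) \<Longrightarrow> y \<in> space (RI I) \<Longrightarrow>
   \<bar>F x - F y\<bar> \<le> L * L2_set (\<lambda>k. x k - y k) I"
  by (auto simp: lip_on_def)

lemma L2_set_measurable[measurable (raw)]: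
  assumes "finite I" "\<And>k. k \<in> I \<Longrightarrow> f k \<in> borel_measurable M"
  shows "(\<lambda>x. L2_set (\<lambda>k. f k x) I) \<in> borel_measurable M"
  unfolding L2_set_def using assms by auto

section \<open>Gaussian smoothing on a finite product of lines\<close>

definition gkern :: "'i set \<Rightarrow> real \<Rightarrow> ('i \<Rightarrow> real) \<Rightarrow> ('i \<Rightarrow> real) \<Rightarrow> real" where
  "gkern I s x y = (\<Prod>k\<in>I. normal_density (x k) s (y k))"

lemma gkern_nonneg: "0 \<le> gkern I s x y"
  by (simp add: gkern_def prod_nonneg)

lemma gkern_le: "gkern I s x y \<le> (1 / sqrt (2 * pi * s\<^sup>2)) ^ card I"
proof -
  have "gkern I s x y \<le> (\<Prod>k\<in>I. 1 / sqrt (2 * pi * s\<^sup>2))"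
    unfolding gkern_def
    by (intro prod_mono) (auto simp: normal_density_def intro!: divide_right_mono mult_left_le)
  then show ?thesis by simp
qed

lemma gkern_measurable[measurable]:
  assumes "finite I"
  shows "(\<lambda>(x, y). gkern I s x y) \<in> borel_measurable (RI I \<Otimes>\<^sub>M RI I)"
  unfolding gkern_def normal_density_def using assms by measurable

lemma iexp_add: "iexp (a + b) = iexp a * iexp b"
  by (simp add: exp_add distrib_left)

lemma iexp_prod: "finite I \<Longrightarrow> iexp (\<Sum>k\<in>I. f k) = (\<Prod>k\<in>I. iexp (f k))"
  by (induction I rule: finite_induct) (simp_all add: iexp_add del: of_real_add of_real_sum)

text \<open>The Gaussian kernel is itself an average of characters, which turns convergence of characteristic
  functions into convergence of Gaussian smoothings.\<close>

lemma gkern_eq_char: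
  assumes "finite I" "s > 0"
  shows "complex_of_real (gkern I s x y) = complex_of_real ((1 / sqrt (2 * pi * s\<^sup>2)) ^ card I) *
    (LINT g|Pi\<^sub>M I (\<lambda>_. std_normal_distribution). iexp (\<Sum>k\<in>I. g k / s * x k) * iexp (- (\<Sum>k\<in>I. g k / s * y k)))"
proof -
  interpret std: real_distribution std_normal_distribution
    by (rule real_dist_normal_dist)
  interpret product_prob_space "\<lambda>_. std_normal_distribution" by standard
  have a: "iexp (\<Sum>k\<in>I. g k / s * x k) * iexp (- (\<Sum>k\<in>I. g k / s * y k)) = (\<Prod>k\<in>I. iexp ((x k - y k) / s * g k))" for g
  proof -
    have "(\<Sum>k\<in>I. g k / s * x k) + (- (\<Sum>k\<in>I. g k / s * y k)) = (\<Sum>k\<in>I. (x k - y k) / s * g k)"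
      by (simp add: sum_negf[symmetric] sum.distrib[symmetric] field_simps diff_divide_distrib)
    then show ?thesis
      unfolding iexp_add[symmetric] iexp_prod[OF \<open>finite I\<close>, symmetric] by simp
  qed
  have b: "(LINT g|Pi\<^sub>M I (\<lambda>_. std_normal_distribution). (\<Prod>k\<in>I. iexp ((x k - y k) / s * g k))) =
     (\<Prod>k\<in>I. LINT g|std_normal_distribution. iexp ((x k - y k) / s * g))"
    by (rule product_integral_prod) (use assms in \<open>auto intro!: std.integrable_iexp simp del: of_real_mult of_real_divide of_real_diff\<close>)
  have c: "(LINT g|std_normal_distribution. iexp ((x k - y k) / s * g)) = exp (- ((x k - y k) / s)\<^sup>2 / 2)" for k
    using fun_cong[OF char_std_normal_distribution, of "(x k - y k) / s"] by (simp add: char_def)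
  have d: "normal_density (x k) s (y k) = 1 / sqrt (2 * pi * s\<^sup>2) * exp (- ((x k - y k) / s)\<^sup>2 / 2)" for k
    unfolding normal_density_def by (simp add: power2_commute power_divide)
  show ?thesis
    unfolding a b c gkern_def d by (simp only: prod.distrib prod_constant of_real_mult of_real_prod)
qed

lemma charI_measurable[measurable]:
  assumes "finite I" "prob_space Q" "sets Q = sets (RI I)"
  shows "charI I Q \<in> borel_measurable (RI I)"
proof -
  interpret Q: prob_space Q by fact
  note [measurable_cong] = assms(3)
  show ?thesis unfolding charI_def using assms(1) by measurable
qed

lemma norm_charI_le:
  assumes "prob_space Q"
  shows "cmod (charI I Q t) \<le> 1"
proof -
  interpret Q: prob_space Q by fact
  have "cmod (charI I Q t) \<le> (LINT x|Q. cmod (iexp (\<Sum>k\<in>I. t k * x k)))"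
    unfolding charI_def by (rule integral_norm_bound)
  then show ?thesis by (simp add: Q.prob_space)
qed

text \<open>Fubini turns the representation of the kernel by characters into one of the smoothed
  density: it depends on \<open>Q\<close> only through \<open>charI I Q\<close>, evaluated at
  Gaussian frequencies of scale \<open>1 / s\<close>.\<close>

lemma integral_gkern_eq_char:
  assumes I: "finite I" and s: "s > 0" and Q: "prob_space Q" "sets Q = sets (RI I)"
  shows "complex_of_real (LINT x|Q. gkern I s x y) = complex_of_real ((1 / sqrt (2 * pi * s\<^sup>2)) ^ card I) *
    (LINT g|Pi\<^sub>M I (\<lambda>_. std_normal_distribution). charI I Q (\<lambda>k. g k / s) * iexp (- (\<Sum>k\<in>I. g k / s * y k)))"
proof -
  interpret std: real_distribution std_normal_distribution
    by (rule real_dist_normal_dist)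
  interpret G: product_prob_space "\<lambda>_. std_normal_distribution" I by standard
  interpret Q: prob_space Q by fact
  interpret QG: pair_prob_space Q "Pi\<^sub>M I (\<lambda>_. std_normal_distribution)" ..
  note [measurable_cong] = Q(2)
  have [measurable_cong]: "sets (Pi\<^sub>M I (\<lambda>_. std_normal_distribution)) = sets (RI I)"
    by (rule sets_PiM_cong) auto
  have "complex_of_real (LINT x|Q. gkern I s x y) = (LINT x|Q. complex_of_real (gkern I s x y))"
    by simp
  also have "\<dots> = complex_of_real ((1 / sqrt (2 * pi * s\<^sup>2)) ^ card I) * (LINT x|Q.
    (LINT g|Pi\<^sub>M I (\<lambda>_. std_normal_distribution). iexp (\<Sum>k\<in>I. g k / s * x k) * iexp (- (\<Sum>k\<in>I. g k / s * y k))))"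
    unfolding gkern_eq_char[OF I s] by simp
  also have "(LINT x|Q.
    (LINT g|Pi\<^sub>M I (\<lambda>_. std_normal_distribution). iexp (\<Sum>k\<in>I. g k / s * x k) * iexp (- (\<Sum>k\<in>I. g k / s * y k)))) =
    (LINT g|Pi\<^sub>M I (\<lambda>_. std_normal_distribution). LINT x|Q. iexp (\<Sum>k\<in>I. g k / s * x k) * iexp (- (\<Sum>k\<in>I. g k / s * y k)))"
  proof (rule QG.Fubini_integral[symmetric])
    show "integrable (Q \<Otimes>\<^sub>M Pi\<^sub>M I (\<lambda>_. std_normal_distribution))
       (\<lambda>(x,g). iexp (\<Sum>k\<in>I. g k / s * x k) * iexp (- (\<Sum>k\<in>I. g k / s * y k)))"
      by (rule QG.integrable_const_bound[where B=1]) (use I in \<open>auto simp: norm_mult simp del: of_real_sum\<close>)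
  qed
  finally show ?thesis
    by (simp add: charI_def)
qed

text \<open>Characteristic functions are bounded by \<open>1\<close> and the Gaussian measure of the
  frequencies is finite, so pointwise convergence passes under the integral.\<close>

lemma integral_gkern_tendsto:
  assumes I: "finite I" and s: "s > 0"
    and Q: "\<And>m. prob_space (Q m)" "\<And>m. sets (Q m) = sets (RI I)"
    and P: "prob_space P" "sets P = sets (RI I)"
    and lim: "\<And>t. t \<in> space (RI I) \<Longrightarrow> (\<lambda>m. charI I (Q m) t) \<longlonglongrightarrow> charI I P t"
  shows "(\<lambda>m. LINT x|Q m. gkern I s x y) \<longlonglongrightarrow> (LINT x|P. gkern I s x y)"
proof -
  interpret std: real_distribution std_normal_distribution
    by (rule real_dist_normal_dist)
  interpret G: product_prob_space "\<lambda>_. std_normal_distribution" I by standard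
  have [measurable_cong]: "sets (Pi\<^sub>M I (\<lambda>_. std_normal_distribution)) = sets (RI I)"
    by (rule sets_PiM_cong) auto
  \<comment> \<open>The hypothesis \<open>lim\<close> covers only extensional frequencies, and
    \<open>charI\<close> does not see values outside \<open>I\<close>.\<close>
  have charI_restrict: "charI I M (\<lambda>k. g k / s) = charI I M (\<lambda>k\<in>I. g k / s)" for g M
    unfolding charI_def by (intro Bochner_Integration.integral_cong refl arg_cong[where f=iexp] sum.cong) auto
  have "(\<lambda>m. (LINT g|Pi\<^sub>M I (\<lambda>_. std_normal_distribution). charI I (Q m) (\<lambda>k. g k / s) * iexp (- (\<Sum>k\<in>I. g k / s * y k))))
     \<longlonglongrightarrow> (LINT g|Pi\<^sub>M I (\<lambda>_. std_normal_distribution). charI I P (\<lambda>k. g k / s) * iexp (- (\<Sum>k\<in>I. g k / s * y k)))"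
  proof (rule integral_dominated_convergence[where w="\<lambda>_. 1"])
    note [measurable] = charI_measurable[OF I Q] charI_measurable[OF I P]
    show "(\<lambda>g. charI I P (\<lambda>k. g k / s) * iexp (- (\<Sum>k\<in>I. g k / s * y k))) \<in> borel_measurable (Pi\<^sub>M I (\<lambda>_. std_normal_distribution))"
      unfolding charI_restrict using I by measurable
    show "(\<lambda>g. charI I (Q m) (\<lambda>k. g k / s) * iexp (- (\<Sum>k\<in>I. g k / s * y k))) \<in> borel_measurable (Pi\<^sub>M I (\<lambda>_. std_normal_distribution))" for m
      unfolding charI_restrict using I by measurable
    show "AE g in Pi\<^sub>M I (\<lambda>_. std_normal_distribution). (\<lambda>m. charI I (Q m) (\<lambda>k. g k / s) * iexp (- (\<Sum>k\<in>I. g k / s * y k)))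
      \<longlonglongrightarrow> charI I P (\<lambda>k. g k / s) * iexp (- (\<Sum>k\<in>I. g k / s * y k))"
      unfolding charI_restrict by (intro AE_I2 tendsto_mult_right lim) (simp add: space_PiM)
    show "AE g in Pi\<^sub>M I (\<lambda>_. std_normal_distribution). cmod (charI I (Q m) (\<lambda>k. g k / s) * iexp (- (\<Sum>k\<in>I. g k / s * y k))) \<le> 1" for m
      using norm_charI_le[OF Q(1)] by (simp add: norm_mult del: of_real_sum)
  qed simp
  then have "(\<lambda>m. complex_of_real (LINT x|Q m. gkern I s x y)) \<longlonglongrightarrow> complex_of_real (LINT x|P. gkern I s x y)"
    unfolding integral_gkern_eq_char[OF I s Q] integral_gkern_eq_char[OF I s P] by (intro tendsto_mult_left)
  then show ?thesis using tendsto_of_real_iff by blast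
qed

lemma integrable_gkern:
  assumes "finite I" "s > 0"
  shows "integrable (Pi\<^sub>M I (\<lambda>_. lborel)) (gkern I s x)" "(LINT y|Pi\<^sub>M I (\<lambda>_. lborel). gkern I s x y) = 1"
proof -
  interpret product_sigma_finite "\<lambda>_. lborel :: real measure" by standard
  show "integrable (Pi\<^sub>M I (\<lambda>_. lborel)) (gkern I s x)" unfolding gkern_def
    by (rule product_integrable_prod) (use assms in auto)
  show "(LINT y|Pi\<^sub>M I (\<lambda>_. lborel). gkern I s x y) = 1" unfolding gkern_def
    by (subst product_integral_prod) (use assms in auto)
qed

lemma gkern_abs_moment:
  assumes I: "finite I" and s: "s > 0" and k: "k \<in> I"
  shows "integrable (Pi\<^sub>M I (\<lambda>_. lborel)) (\<lambda>y. \<bar>y k - x k\<bar> * gkern I s x y)"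
    and "(LINT y|Pi\<^sub>M I (\<lambda>_. lborel). \<bar>y k - x k\<bar> * gkern I s x y) = s * sqrt (2 / pi)"
proof -
  interpret product_sigma_finite "\<lambda>_. lborel :: real measure" by standard
  define f where "f j z = (if j = k then normal_density (x k) s z * \<bar>z - x k\<bar> else normal_density (x j) s z)" for j z
  have e: "\<bar>y k - x k\<bar> * gkern I s x y = (\<Prod>j\<in>I. f j (y j))" for y
    unfolding gkern_def f_def using I k by (simp add: prod.remove[of I k])
  have i: "integrable lborel (f j)" for j
    unfolding f_def using integrable_normal_moment_abs[OF s, of "x k" 1] integrable_normal_density[OF s] by (cases "j = k") auto
  show "integrable (Pi\<^sub>M I (\<lambda>_. lborel)) (\<lambda>y. \<bar>y k - x k\<bar> * gkern I s x y)"
    unfolding e by (rule product_integrable_prod) (use I i in auto)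
  have "(LINT y|Pi\<^sub>M I (\<lambda>_. lborel). \<bar>y k - x k\<bar> * gkern I s x y) = (\<Prod>j\<in>I. LINT z|lborel. f j z)"
    unfolding e by (rule product_integral_prod) (use I i in auto)
  also have "\<dots> = (LINT z|lborel. f k z)"
    using I k s by (simp add: prod.remove[of I k] f_def)
  also have "\<dots> = s * sqrt (2 / pi)"
    using integral_normal_moment_abs_odd[OF s, of "x k" 0] by (simp add: f_def mult.commute)
  finally show "(LINT y|Pi\<^sub>M I (\<lambda>_. lborel). \<bar>y k - x k\<bar> * gkern I s x y) = s * sqrt (2 / pi)" .
qed

text \<open>A Lipschitz function moves by at most \<open>L\<close> times the sum of the coordinate
  displacements, each of which has mean \<open>s * sqrt (2 / pi)\<close> under the Gaussian density
  of width \<open>s\<close>. The bound is uniform in \<open>x\<close>, so it survives integration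
  against any law.\<close>

lemma gauss_smooth_approx:
  assumes I: "finite I" and s: "s > 0" and x: "x \<in> space (RI I)"
    and F: "F \<in> borel_measurable (RI I)" "\<And>y. \<bar>F y\<bar> \<le> B" "lip_on I L F" "0 \<le> L"
  shows "\<bar>(LINT y|Pi\<^sub>M I (\<lambda>_. lborel). F y * gkern I s x y) - F x\<bar> \<le> L * (card I * (s * sqrt (2 / pi)))"
proof -
  have [measurable_cong]: "sets (Pi\<^sub>M I (\<lambda>_. lborel)) = sets (RI I)"
    by (rule sets_PiM_cong) auto
  have sp: "space (Pi\<^sub>M I (\<lambda>_. lborel)) = space (RI I)" by (simp add: space_PiM)
  note [measurable] = F(1)
  note g = integrable_gkern[OF I s, of x] and m = gkern_abs_moment[OF I s, of _ x]
  have gm[measurable]: "gkern I s x \<in> borel_measurable (RI I)"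
    unfolding gkern_def[abs_def] normal_density_def using I by measurable
  have i1: "integrable (Pi\<^sub>M I (\<lambda>_. lborel)) (\<lambda>y. F y * gkern I s x y)"
  proof (rule Bochner_Integration.integrable_bound[of _ "\<lambda>y. B * gkern I s x y"])
    show "AE y in Pi\<^sub>M I (\<lambda>_. lborel). norm (F y * gkern I s x y) \<le> norm (B * gkern I s x y)"
      by (intro AE_I2) (auto simp: abs_mult intro!: mult_right_mono order_trans[OF F(2)])
  qed (use g in auto)
  have i2: "integrable (Pi\<^sub>M I (\<lambda>_. lborel)) (\<lambda>y. F x * gkern I s x y)"
    using g by simp
  have i3: "integrable (Pi\<^sub>M I (\<lambda>_. lborel)) (\<lambda>y. L * (\<Sum>k\<in>I. \<bar>y k - x k\<bar> * gkern I s x y))"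
    using m by simp
  have "(LINT y|Pi\<^sub>M I (\<lambda>_. lborel). F y * gkern I s x y) - F x = (LINT y|Pi\<^sub>M I (\<lambda>_. lborel). F y * gkern I s x y - F x * gkern I s x y)"
    using g i1 i2 by simp
  also have "\<bar>\<dots>\<bar> \<le> (LINT y|Pi\<^sub>M I (\<lambda>_. lborel). L * (\<Sum>k\<in>I. \<bar>y k - x k\<bar> * gkern I s x y))"
  proof (rule order_trans[OF integral_abs_bound], rule integral_mono)
    fix y assume y: "y \<in> space (Pi\<^sub>M I (\<lambda>_. lborel :: real measure))"
    have "\<bar>F y * gkern I s x y - F x * gkern I s x y\<bar> = \<bar>F y - F x\<bar> * gkern I s x y"
      by (simp add: left_diff_distrib[symmetric] abs_mult gkern_nonneg)
    also have "\<dots> \<le> (L * (\<Sum>k\<in>I. \<bar>y k - x k\<bar>)) * gkern I s x y"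
      using y F(4) x by (intro mult_right_mono gkern_nonneg order_trans[OF lip_onD[OF F(3)]] mult_left_mono L2_set_le_sum_abs) (auto simp: sp)
    finally show "\<bar>F y * gkern I s x y - F x * gkern I s x y\<bar> \<le> L * (\<Sum>k\<in>I. \<bar>y k - x k\<bar> * gkern I s x y)"
      by (simp add: sum_distrib_left sum_distrib_right mult.assoc)
  qed (use i1 i2 i3 in auto)
  also have "\<dots> = L * (card I * (s * sqrt (2 / pi)))"
    using m by simp
  finally show ?thesis .
qed

text \<open>The smoothing error is the same for all laws, so it is enough to treat the smoothed
  function. After Fubini its integral is a Lebesgue integral of \<open>F\<close> against smoothed
  densities, which converge pointwise; the bounded support makes dominated convergence
  available.\<close>

lemma weak_conv_compact_support:
  assumes I: "finite I"
    and Q: "\<And>m. prob_space (Q m)" "\<And>m. sets (Q m) = sets (RI I)"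
    and P: "prob_space P" "sets P = sets (RI I)"
    and lim: "\<And>t. t \<in> space (RI I) \<Longrightarrow> (\<lambda>m. charI I (Q m) t) \<longlonglongrightarrow> charI I P t"
    and F: "F \<in> borel_measurable (RI I)" "\<And>y. \<bar>F y\<bar> \<le> B" "lip_on I L F" "0 \<le> L"
    and supp: "\<And>y k. k \<in> I \<Longrightarrow> \<bar>y k\<bar> > R \<Longrightarrow> F y = 0"
  shows "(\<lambda>m. LINT x|Q m. F x) \<longlonglongrightarrow> (LINT x|P. F x)"
proof -
  interpret L: product_sigma_finite "\<lambda>_. lborel :: real measure" by standard
  interpret L: sigma_finite_measure "Pi\<^sub>M I (\<lambda>_. lborel :: real measure)" by (rule L.sigma_finite) fact
  have [measurable_cong]: "sets (Pi\<^sub>M I (\<lambda>_. lborel)) = sets (RI I)"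
    by (rule sets_PiM_cong) auto
  have sp: "space (Pi\<^sub>M I (\<lambda>_. lborel)) = space (RI I)" by (simp add: space_PiM)
  note [measurable] = F(1) gkern_measurable[OF I]
  \<comment> \<open>The indicator of a cube that contains the support of \<open>F\<close>;
    multiplied by constant bounds of \<open>F\<close> and the kernel it is a Lebesgue integrable
    majorant.\<close>
  define box :: "('a \<Rightarrow> real) \<Rightarrow> real" where "box y = (\<Prod>k\<in>I. indicator {-R..R} (y k))" for y
  have box_int: "integrable (Pi\<^sub>M I (\<lambda>_. lborel)) box"
    unfolding box_def by (rule L.product_integrable_prod[OF I]) (simp add: integrable_indicator_iff emeasure_lborel_Icc_eq)
  have Fbox: "\<bar>F y\<bar> \<le> B * box y" for y
  proof (cases "\<exists>k\<in>I. \<bar>y k\<bar> > R")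
    case True
    then have "F y = 0" "box y = 0" using supp I by (auto simp: box_def indicator_def abs_le_iff not_le intro!: bexI)
    then show ?thesis by simp
  next
    case False
    then have "box y = 1" unfolding box_def by (intro prod.neutral) (auto simp: abs_le_iff not_less)
    then show ?thesis using F(2)[of y] by simp
  qed
  have B0: "0 \<le> B" using F(2)[of undefined] by linarith
  have box0: "0 \<le> box y" for y by (auto simp: box_def intro!: prod_nonneg)
  define Fs where "Fs s x = (LINT y|Pi\<^sub>M I (\<lambda>_. lborel). F y * gkern I s x y)" for s x
  have Fs_meas[measurable]: "Fs s \<in> borel_measurable (RI I)" for s
    unfolding Fs_def by measurable
  have Fs_int: "(LINT x|M. Fs s x) = (LINT y|Pi\<^sub>M I (\<lambda>_. lborel). F y * (LINT x|M. gkern I s x y))"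
    and Fs_integrable: "integrable M (Fs s)"
    if M: "prob_space M" "sets M = sets (RI I)" and s: "s > 0" for M s
  proof -
    interpret M: prob_space M by fact
    interpret QL: pair_sigma_finite M "Pi\<^sub>M I (\<lambda>_. lborel :: real measure)" ..
    note [measurable_cong] = M(2)
    have bI: "integrable (M \<Otimes>\<^sub>M Pi\<^sub>M I (\<lambda>_. lborel :: real measure)) (\<lambda>(x, y). B * (1 / sqrt (2 * pi * s\<^sup>2)) ^ card I * box y)"
    proof (subst integrable_iff_bounded, intro conjI)
      show "(\<lambda>(x, y). B * (1 / sqrt (2 * pi * s\<^sup>2)) ^ card I * box y) \<in> borel_measurable (M \<Otimes>\<^sub>M Pi\<^sub>M I (\<lambda>_. lborel :: real measure))"
        unfolding box_def using I by measurable
      have bm[measurable]: "box \<in> borel_measurable (RI I)" using box_int by measurable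
      have "(\<integral>\<^sup>+ p. norm (case p of (x, y) \<Rightarrow> B * (1 / sqrt (2 * pi * s\<^sup>2)) ^ card I * box y) \<partial>(M \<Otimes>\<^sub>M Pi\<^sub>M I (\<lambda>_. lborel :: real measure)))
        = (\<integral>\<^sup>+ x. \<integral>\<^sup>+ y. ennreal (norm (B * (1 / sqrt (2 * pi * s\<^sup>2)) ^ card I * box y)) \<partial>Pi\<^sub>M I (\<lambda>_. lborel :: real measure) \<partial>M)"
        by (subst L.nn_integral_fst[symmetric]) auto
      also have "\<dots> = (\<integral>\<^sup>+ y. ennreal (norm (B * (1 / sqrt (2 * pi * s\<^sup>2)) ^ card I * box y)) \<partial>Pi\<^sub>M I (\<lambda>_. lborel :: real measure))"
        by (simp add: M.emeasure_space_1)
      also have "\<dots> < \<infinity>"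
        using integrable_mult_right[OF box_int, of "B * (1 / sqrt (2 * pi * s\<^sup>2)) ^ card I"] by (simp only: integrable_iff_bounded)
      finally show "(\<integral>\<^sup>+ p. norm (case p of (x, y) \<Rightarrow> B * (1 / sqrt (2 * pi * s\<^sup>2)) ^ card I * box y) \<partial>(M \<Otimes>\<^sub>M Pi\<^sub>M I (\<lambda>_. lborel :: real measure))) < \<infinity>" .
    qed
    have int: "integrable (M \<Otimes>\<^sub>M Pi\<^sub>M I (\<lambda>_. lborel :: real measure)) (\<lambda>(x, y). F y * gkern I s x y)"
    proof (rule Bochner_Integration.integrable_bound[OF bI])
      show "AE p in M \<Otimes>\<^sub>M Pi\<^sub>M I (\<lambda>_. lborel). norm (case p of (x, y) \<Rightarrow> F y * gkern I s x y)
         \<le> norm (case p of (x, y) \<Rightarrow> B * (1 / sqrt (2 * pi * s\<^sup>2)) ^ card I * box y)"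
      proof (intro AE_I2)
        fix p :: "('a \<Rightarrow> real) \<times> ('a \<Rightarrow> real)"
        obtain x y where p: "p = (x, y)" by force
        have "\<bar>F y\<bar> * gkern I s x y \<le> (B * box y) * (1 / sqrt (2 * pi * s\<^sup>2)) ^ card I"
          using B0 box0 by (intro mult_mono Fbox gkern_le gkern_nonneg) auto
        then show "norm (case p of (x, y) \<Rightarrow> F y * gkern I s x y)
         \<le> norm (case p of (x, y) \<Rightarrow> B * (1 / sqrt (2 * pi * s\<^sup>2)) ^ card I * box y)"
          using B0 box0 by (simp add: p abs_mult gkern_nonneg mult.commute mult.left_commute)
      qed
    qed measurable
    show "(LINT x|M. Fs s x) = (LINT y|Pi\<^sub>M I (\<lambda>_. lborel). F y * (LINT x|M. gkern I s x y))"
      unfolding Fs_def using QL.Fubini_integral[OF int] by simp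
    show "integrable M (Fs s)" unfolding Fs_def using QL.integrable_fst'[OF int] by simp
  qed
  have conv_s: "(\<lambda>m. LINT x|Q m. Fs s x) \<longlonglongrightarrow> (LINT x|P. Fs s x)" if s: "s > 0" for s
    unfolding Fs_int[OF Q s] Fs_int[OF P s]
  proof (rule integral_dominated_convergence[where w="\<lambda>y. B * (1 / sqrt (2 * pi * s\<^sup>2)) ^ card I * box y"])
    have meas: "(\<lambda>y. F y * (LINT x|M. gkern I s x y)) \<in> borel_measurable (RI I)"
      if M: "prob_space M" "sets M = sets (RI I)" for M
    proof -
      interpret M: prob_space M by fact
      note [measurable_cong] = M(2)
      show ?thesis by measurable
    qed
    show "(\<lambda>y. F y * (LINT x|P. gkern I s x y)) \<in> borel_measurable (Pi\<^sub>M I (\<lambda>_. lborel))"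
      "\<And>m. (\<lambda>y. F y * (LINT x|Q m. gkern I s x y)) \<in> borel_measurable (Pi\<^sub>M I (\<lambda>_. lborel))"
      using meas[OF P] meas[OF Q] by simp_all
    show "integrable (Pi\<^sub>M I (\<lambda>_. lborel)) (\<lambda>y. B * (1 / sqrt (2 * pi * s\<^sup>2)) ^ card I * box y)"
      using box_int by simp
    show "AE y in Pi\<^sub>M I (\<lambda>_. lborel). (\<lambda>m. F y * (LINT x|Q m. gkern I s x y)) \<longlonglongrightarrow> F y * (LINT x|P. gkern I s x y)"
      by (intro AE_I2 tendsto_mult_left integral_gkern_tendsto I s Q P lim)
    show "AE y in Pi\<^sub>M I (\<lambda>_. lborel). norm (F y * (LINT x|Q m. gkern I s x y)) \<le> B * (1 / sqrt (2 * pi * s\<^sup>2)) ^ card I * box y" for m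
    proof (intro AE_I2)
      fix y
      interpret M: prob_space "Q m" by fact
      note [measurable_cong] = Q(2)[of m]
      have "(LINT x|Q m. gkern I s x y) \<le> (LINT x|Q m. (1 / sqrt (2 * pi * s\<^sup>2)) ^ card I)"
        by (intro integral_mono_AE' AE_I2 gkern_le gkern_nonneg) auto
      then have 1: "(LINT x|Q m. gkern I s x y) \<le> (1 / sqrt (2 * pi * s\<^sup>2)) ^ card I" by (simp add: M.prob_space)
      have 2: "0 \<le> (LINT x|Q m. gkern I s x y)" by (intro Bochner_Integration.integral_nonneg gkern_nonneg)
      have "\<bar>F y\<bar> * (LINT x|Q m. gkern I s x y) \<le> (B * box y) * (1 / sqrt (2 * pi * s\<^sup>2)) ^ card I"
        using B0 box0 by (intro mult_mono Fbox 1 2) auto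
      then show "norm (F y * (LINT x|Q m. gkern I s x y)) \<le> B * (1 / sqrt (2 * pi * s\<^sup>2)) ^ card I * box y"
        using 2 by (simp add: abs_mult mult.commute mult.left_commute)
    qed
  qed
  have approx: "\<bar>(LINT x|M. Fs s x) - (LINT x|M. F x)\<bar> \<le> L * (card I * (s * sqrt (2 / pi)))"
    if M: "prob_space M" "sets M = sets (RI I)" and s: "s > 0" for M s
  proof -
    interpret M: prob_space M by fact
    note [measurable_cong] = M(2)
    have sM: "space M = space (RI I)" using M(2) by (rule sets_eq_imp_space_eq)
    have iF: "integrable M F" by (rule M.integrable_const_bound[where B=B]) (use F in auto)
    have "\<bar>(LINT x|M. Fs s x) - (LINT x|M. F x)\<bar> = \<bar>LINT x|M. Fs s x - F x\<bar>"
      using iF Fs_integrable[OF M s] by simp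
    also have "\<dots> \<le> (LINT x|M. L * (card I * (s * sqrt (2 / pi))))"
      using gauss_smooth_approx[OF I s _ F, folded Fs_def] iF Fs_integrable[OF M s]
      by (intro order_trans[OF integral_abs_bound] integral_mono) (auto simp: sM)
    finally show ?thesis by (simp add: M.prob_space)
  qed
  show ?thesis
  proof (rule LIMSEQ_I)
    fix e :: real assume e: "e > 0"
    \<comment> \<open>The summand \<open>1\<close> keeps the denominator of \<open>s\<close>
      positive when \<open>L = 0\<close>. The smoothing error then uses one third of
      \<open>e\<close> for each of \<open>Q m\<close> and \<open>P\<close>.\<close>
    define c where "c = L * (card I * sqrt (2 / pi)) + 1"
    have c: "c > 0" using F(4) by (simp add: c_def add_nonneg_pos)
    define s where "s = e / (3 * c)"
    have s: "s > 0" using e c by (simp add: s_def)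
    have "L * (card I * (s * sqrt (2 / pi))) = s * (c - 1)" by (simp add: c_def)
    also have "\<dots> \<le> e / 3" using e c by (simp add: s_def field_simps)
    finally have small: "L * (card I * (s * sqrt (2 / pi))) \<le> e / 3" .
    obtain n0 where n0: "\<And>m. m \<ge> n0 \<Longrightarrow> \<bar>(LINT x|Q m. Fs s x) - (LINT x|P. Fs s x)\<bar> < e / 3"
      using LIMSEQ_D[OF conv_s[OF s], of "e / 3"] e by auto
    show "\<exists>n0. \<forall>m\<ge>n0. norm ((LINT x|Q m. F x) - (LINT x|P. F x)) < e"
    proof (intro exI[of _ n0] allI impI)
      fix m assume "m \<ge> n0"
      from n0[OF this] approx[OF Q s, of m] approx[OF P s] small
      show "norm ((LINT x|Q m. F x) - (LINT x|P. F x)) < e" unfolding real_norm_def by linarith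
    qed
  qed
qed

section \<open>Cut-offs and bounded Lipschitz test functions\<close>

lemma abs_le_L2_set: "finite I \<Longrightarrow> k \<in> I \<Longrightarrow> \<bar>x k\<bar> \<le> L2_set x I"
  using member_le_L2_set[of I k "\<lambda>k. \<bar>x k\<bar>"] by (simp add: L2_set_def)

lemma L2_set_diff_triangle: "\<bar>L2_set x I - L2_set y I\<bar> \<le> L2_set (\<lambda>k. x k - y k) I"
proof -
  have a: "L2_set x I \<le> L2_set y I + L2_set (\<lambda>k. x k - y k) I" for x y :: "'a \<Rightarrow> real"
    using L2_set_triangle_ineq[of y "\<lambda>k. x k - y k" I] by simp
  have "L2_set (\<lambda>k. y k - x k) I = L2_set (\<lambda>k. x k - y k) I"
    by (simp add: L2_set_def power2_commute)
  then show ?thesis using a[of x y] a[of y x] by linarith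
qed

definition chi :: "'i set \<Rightarrow> real \<Rightarrow> ('i \<Rightarrow> real) \<Rightarrow> real" where
  "chi I R x = max 0 (1 - L2_set x I / R)"

lemma chi_bounds: "R > 0 \<Longrightarrow> 0 \<le> chi I R x" "R > 0 \<Longrightarrow> chi I R x \<le> 1"
  by (auto simp: chi_def L2_set_nonneg)

lemma abs_chi_le: "R > 0 \<Longrightarrow> \<bar>chi I R x\<bar> \<le> 1"
  using chi_bounds[of R I x] by simp

lemma chi_lip: "R > 0 \<Longrightarrow> \<bar>chi I R x - chi I R y\<bar> \<le> 1 / R * L2_set (\<lambda>k. x k - y k) I"
proof -
  assume R: "R > 0"
  have "\<bar>chi I R x - chi I R y\<bar> \<le> \<bar>(L2_set x I - L2_set y I) / R\<bar>"
    unfolding chi_def by (auto simp: diff_divide_distrib max_def)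
  also have "\<dots> \<le> 1 / R * L2_set (\<lambda>k. x k - y k) I"
    using R L2_set_diff_triangle[of x I y] by (simp add: divide_right_mono)
  finally show ?thesis .
qed

text \<open>No mass escapes to infinity: the cut-off \<open>chi I R\<close> is itself Lipschitz with
  bounded support, so its integrals under \<open>Q m\<close> converge to the one under
  \<open>P\<close>, which is close to \<open>1\<close> for large \<open>R\<close>. Replacing
  \<open>F\<close> by \<open>F * chi I R\<close> therefore costs little, uniformly for large
  \<open>m\<close>.\<close>

lemma weak_conv_bounded_lipschitz:
  assumes I: "finite I"
    and Q: "\<And>m. prob_space (Q m)" "\<And>m. sets (Q m) = sets (RI I)"
    and P: "prob_space P" "sets P = sets (RI I)"
    and lim: "\<And>t. t \<in> space (RI I) \<Longrightarrow> (\<lambda>m. charI I (Q m) t) \<longlonglongrightarrow> charI I P t"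
    and F: "F \<in> borel_measurable (RI I)" "\<And>y. \<bar>F y\<bar> \<le> B" "lip_on I L F" "0 \<le> L"
  shows "(\<lambda>m. LINT x|Q m. F x) \<longlonglongrightarrow> (LINT x|P. F x)"
proof -
  have B0: "0 \<le> B" using F(2)[of undefined] by linarith
  have chi_meas[measurable]: "chi I R \<in> borel_measurable (RI I)" for R
    unfolding chi_def[abs_def] using I by measurable
  note [measurable] = F(1)
  have supp: "chi I R y = 0" if "k \<in> I" "\<bar>y k\<bar> > R" "R > 0" for k y R
  proof -
    have "L2_set y I \<ge> R" using abs_le_L2_set[OF I that(1), of y] that(2) by linarith
    then show ?thesis using that(3) by (simp add: chi_def)
  qed
  have conv_chi: "(\<lambda>m. LINT x|Q m. chi I R x) \<longlonglongrightarrow> (LINT x|P. chi I R x)" if R: "R > 0" for R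
    by (rule weak_conv_compact_support[OF I Q P lim, where B=1 and L="1/R" and R=R])
       (use R supp chi_lip[OF R] abs_chi_le[OF R] in \<open>auto simp: lip_on_def simp del: abs_le_iff\<close>)
  have conv_F: "(\<lambda>m. LINT x|Q m. F x * chi I R x) \<longlonglongrightarrow> (LINT x|P. F x * chi I R x)" if R: "R > 0" for R
  proof (rule weak_conv_compact_support[OF I Q P lim, where B=B and L="L + B / R" and R=R])
    show "\<bar>F y * chi I R y\<bar> \<le> B" for y
      using mult_mono[OF F(2)[of y] chi_bounds(2)[OF R, of I y]] chi_bounds[OF R, of I y] B0 by (simp add: abs_mult)
    show "lip_on I (L + B / R) (\<lambda>x. F x * chi I R x)" unfolding lip_on_def
    proof (intro ballI)
      fix x y :: "'a \<Rightarrow> real" assume xy: "x \<in> space (RI I)" "y \<in> space (RI I)"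
      have "F x * chi I R x - F y * chi I R y = (F x - F y) * chi I R x + F y * (chi I R x - chi I R y)"
        by (simp add: algebra_simps)
      also have "\<bar>\<dots>\<bar> \<le> \<bar>F x - F y\<bar> * chi I R x + \<bar>F y\<bar> * \<bar>chi I R x - chi I R y\<bar>"
        using chi_bounds[OF R, of I x] by (auto intro: order_trans[OF abs_triangle_ineq] simp: abs_mult)
      also have "\<dots> \<le> (L * L2_set (\<lambda>k. x k - y k) I) * 1 + B * (1 / R * L2_set (\<lambda>k. x k - y k) I)"
        using chi_bounds[OF R] F(4) B0
        by (intro add_mono mult_mono lip_onD[OF F(3)] xy F(2) chi_lip R) (auto simp: L2_set_nonneg)
      finally show "\<bar>F x * chi I R x - F y * chi I R y\<bar> \<le> (L + B / R) * L2_set (\<lambda>k. x k - y k) I"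
        by (simp add: algebra_simps)
    qed
  qed (use R supp F(4) B0 in auto)
  have split: "\<bar>(LINT x|M. F x) - (LINT x|M. F x * chi I R x)\<bar> \<le> B * (1 - (LINT x|M. chi I R x))"
    if M: "prob_space M" "sets M = sets (RI I)" and R: "R > 0" for M R
  proof -
    interpret M: prob_space M by fact
    note [measurable_cong] = M(2)
    have iF: "integrable M F" by (rule M.integrable_const_bound[where B=B]) (use F in auto)
    have iC: "integrable M (chi I R)" by (rule M.integrable_const_bound[where B=1]) (use abs_chi_le[OF R] in auto)
    have iFC: "integrable M (\<lambda>x. F x * chi I R x)"
    proof (rule M.integrable_const_bound[where B=B], intro AE_I2)
      fix y show "norm (F y * chi I R y) \<le> B"
        using mult_mono[OF F(2)[of y] chi_bounds(2)[OF R, of I y]] chi_bounds[OF R, of I y] B0 by (simp add: abs_mult)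
    qed auto
    have "\<bar>(LINT x|M. F x) - (LINT x|M. F x * chi I R x)\<bar> = \<bar>LINT x|M. F x - F x * chi I R x\<bar>"
      using iF iFC by simp
    also have "\<dots> \<le> (LINT x|M. B * (1 - chi I R x))"
    proof (intro order_trans[OF integral_abs_bound] integral_mono)
      fix x
      have "F x - F x * chi I R x = F x * (1 - chi I R x)" by (simp add: algebra_simps)
      then show "\<bar>F x - F x * chi I R x\<bar> \<le> B * (1 - chi I R x)"
        using chi_bounds[OF R, of I x] F(2)[of x] by (simp add: abs_mult mult_right_mono)
    qed (use iF iC iFC in auto)
    also have "\<dots> = B * (1 - (LINT x|M. chi I R x))"
      using iC by (simp add: M.prob_space right_diff_distrib)
    finally show ?thesis .
  qed
  interpret P: prob_space P by fact
  note [measurable_cong] = P(2)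
  have chi_lim: "(\<lambda>n. LINT x|P. chi I (real (Suc n)) x) \<longlonglongrightarrow> (LINT x|P. 1)"
  proof (rule integral_dominated_convergence[where w="\<lambda>_. 1"])
    show "AE x in P. (\<lambda>n. chi I (real (Suc n)) x) \<longlonglongrightarrow> 1"
    proof (intro AE_I2)
      fix x
      have "(\<lambda>n. max 0 (1 - L2_set x I / real (Suc n))) \<longlonglongrightarrow> max 0 (1 - 0)"
        by (intro tendsto_intros tendsto_divide_0[OF tendsto_const] filterlim_compose[OF filterlim_real_sequentially, THEN filterlim_at_top_imp_at_infinity] filterlim_Suc)
      then show "(\<lambda>n. chi I (real (Suc n)) x) \<longlonglongrightarrow> 1" by (simp add: chi_def)
    qed
    show "AE x in P. norm (chi I (real (Suc n)) x) \<le> 1" for n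
      using chi_bounds[of "real (Suc n)" I] by (auto simp: abs_le_iff intro!: AE_I2)
  qed auto
  show ?thesis
  proof (rule LIMSEQ_I)
    fix e :: real assume e: "e > 0"
    have B1: "B + 1 > 0" using B0 by simp
    obtain n where n: "\<bar>(LINT x|P. chi I (real (Suc n)) x) - 1\<bar> < e / (8 * (B + 1))"
      using LIMSEQ_D[OF chi_lim, of "e / (8 * (B + 1))"] e B1 by (auto simp: P.prob_space)
    define R where "R = real (Suc n)"
    have R: "R > 0" by (simp add: R_def)
    obtain n1 where n1: "\<And>m. m \<ge> n1 \<Longrightarrow> \<bar>(LINT x|Q m. chi I R x) - (LINT x|P. chi I R x)\<bar> < e / (8 * (B + 1))"
      using LIMSEQ_D[OF conv_chi[OF R], of "e / (8 * (B + 1))"] e B1 by auto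
    obtain n2 where n2: "\<And>m. m \<ge> n2 \<Longrightarrow> \<bar>(LINT x|Q m. F x * chi I R x) - (LINT x|P. F x * chi I R x)\<bar> < e / 4"
      using LIMSEQ_D[OF conv_F[OF R], of "e / 4"] e by auto
    have small: "B * z \<le> e / 4" if "z \<le> 2 * (e / (8 * (B + 1)))" for z
    proof -
      have "B * z \<le> B * (2 * (e / (8 * (B + 1))))" using that B0 by (intro mult_left_mono) auto
      also have "\<dots> \<le> (B + 1) * (2 * (e / (8 * (B + 1))))" using e B1 by (intro mult_right_mono) auto
      also have "\<dots> = e / 4" using B1 by (simp add: field_simps)
      finally show ?thesis .
    qed
    show "\<exists>n0. \<forall>m\<ge>n0. norm ((LINT x|Q m. F x) - (LINT x|P. F x)) < e"
    proof (intro exI[of _ "max n1 n2"] allI impI)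
      fix m assume m: "m \<ge> max n1 n2"
      have d: "0 < e / (8 * (B + 1))" using e B1 by simp
      have p1: "B * (1 - (LINT x|P. chi I R x)) \<le> e / 4"
        using n d by (intro small) (simp add: R_def)
      have p2: "B * (1 - (LINT x|Q m. chi I R x)) \<le> e / 4"
        using n n1[of m] m by (intro small) (simp add: R_def)
      show "norm ((LINT x|Q m. F x) - (LINT x|P. F x)) < e"
        using split[OF Q R, of m] split[OF P R] p1 p2 n2[of m] m unfolding real_norm_def by linarith
    qed
  qed
qed

section \<open>Sums of independent rare jumps\<close>

definition add_measure :: "'a measure \<Rightarrow> 'a measure \<Rightarrow> 'a measure" where
  "add_measure M N = measure_of (space M) (sets M) (\<lambda>A. emeasure M A + emeasure N A)"

lemma sets_add_measure[simp, measurable_cong]: "sets (add_measure M N) = sets M"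
  by (simp add: add_measure_def sets.sets_measure_of_eq)

lemma space_add_measure[simp]: "space (add_measure M N) = space M"
  by (simp add: add_measure_def space_measure_of_conv)

lemma emeasure_add_measure:
  assumes "sets N = sets M" "A \<in> sets M"
  shows "emeasure (add_measure M N) A = emeasure M A + emeasure N A"
proof (rule emeasure_measure_of[OF add_measure_def])
  show "sets M \<subseteq> Pow (space M)" by (rule sets.space_closed)
  show "A \<in> sets (add_measure M N)" using assms by simp
  show "positive (sets (add_measure M N)) (\<lambda>A. emeasure M A + emeasure N A)"
    by (simp add: positive_def)
  show "countably_additive (sets (add_measure M N)) (\<lambda>A. emeasure M A + emeasure N A)"
    unfolding countably_additive_def
  proof (intro allI impI)
    fix A :: "nat \<Rightarrow> 'a set" assume A: "range A \<subseteq> sets (add_measure M N)" "disjoint_family A"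
    have "(\<Sum>i. emeasure M (A i) + emeasure N (A i)) = (\<Sum>i. emeasure M (A i)) + (\<Sum>i. emeasure N (A i))"
      by (rule suminf_add[symmetric]) auto
    then show "(\<Sum>i. emeasure M (A i) + emeasure N (A i)) = emeasure M (\<Union> (range A)) + emeasure N (\<Union> (range A))"
      using A assms by (simp add: suminf_emeasure)
  qed
qed

lemma nn_integral_add_measure:
  assumes N: "sets N = sets M" and f: "f \<in> borel_measurable M"
  shows "(\<integral>\<^sup>+x. f x \<partial>add_measure M N) = (\<integral>\<^sup>+x. f x \<partial>M) + (\<integral>\<^sup>+x. f x \<partial>N)"
  using f
proof (induction rule: borel_measurable_induct)
  case (cong f g)
  have "space N = space M" using N by (rule sets_eq_imp_space_eq)
  with cong show ?case
    by (metis (no_types, lifting) nn_integral_cong space_add_measure)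
next
  case (set A)
  then show ?case using N by (simp add: emeasure_add_measure)
next
  case (mult u c)
  then have "u \<in> borel_measurable N" by (metis measurable_cong_sets[OF N refl])
  with mult show ?case by (simp add: nn_integral_cmult distrib_left)
next
  case (add u v)
  then have "u \<in> borel_measurable N" "v \<in> borel_measurable N" by (metis measurable_cong_sets[OF N refl])+
  with add show ?case by (simp add: nn_integral_add ac_simps)
next
  case (seq U)
  have m: "\<And>i. U i \<in> borel_measurable M" "\<And>i. U i \<in> borel_measurable N" "\<And>i. U i \<in> borel_measurable (add_measure M N)"
    using seq(1) measurable_cong_sets[OF N refl] by auto
  have "(\<integral>\<^sup>+x. (SUP i. U i x) \<partial>K) = (SUP i. \<integral>\<^sup>+x. U i x \<partial>K)" if "\<And>i. U i \<in> borel_measurable K" for K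
    by (rule nn_integral_monotone_convergence_SUP) (use that seq in auto)
  note e = this[OF m(1)] this[OF m(2)] this[OF m(3)]
  show ?case
    unfolding SUP_apply image_image e using seq
    by (subst ennreal_SUP_add[symmetric]) (auto simp: incseq_def le_fun_def intro!: nn_integral_mono)
qed

lemma integrable_add_measure:
  fixes f :: "'a \<Rightarrow> 'b::{banach, second_countable_topology}"
  assumes N: "sets N = sets M"
  shows "integrable (add_measure M N) f \<longleftrightarrow> integrable M f \<and> integrable N f"
proof -
  have m: "f \<in> borel_measurable N \<longleftrightarrow> f \<in> borel_measurable M" using measurable_cong_sets[OF N refl] by auto
  show ?thesis
    unfolding integrable_iff_bounded m using N
    by (auto simp: nn_integral_add_measure cong: measurable_cong_sets)
qed

lemma integral_add_measure:
  fixes f :: "'a \<Rightarrow> 'b::{banach, second_countable_topology}"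
  assumes N: "sets N = sets M" and f: "integrable M f" "integrable N f"
  shows "(LINT x|add_measure M N. f x) = (LINT x|M. f x) + (LINT x|N. f x)"
proof -
  have sp: "space N = space M" using N by (rule sets_eq_imp_space_eq)
  have "integrable (add_measure M N) f" using f N by (simp add: integrable_add_measure)
  then show ?thesis
  proof (induction rule: integrable_induct)
    case (base A c)
    then have "integrable (add_measure M N) (indicat_real A)" by (simp add: integrable_indicator_iff)
    then have "integrable M (indicat_real A)" "integrable N (indicat_real A)" using N by (auto simp: integrable_add_measure)
    then have "emeasure M A < \<infinity>" "emeasure N A < \<infinity>" using base N
      by (auto simp: integrable_indicator_iff sp)
    then show ?case using base N
      by (simp add: scaleR_add_left[symmetric] measure_def emeasure_add_measure enn2real_plus sp)
  next
    case (add f g)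
    then show ?case using N by (simp add: integrable_add_measure)
  next
    case (lim f s)
    have i: "integrable M f" "integrable N f" "\<And>i. integrable M (s i)" "\<And>i. integrable N (s i)"
      using lim N by (auto simp: integrable_add_measure)
    have c: "(\<lambda>i. LINT x|K. s i x) \<longlonglongrightarrow> (LINT x|K. f x)"
      if "\<And>i. integrable K (s i)" "integrable K f" "space K = space M" for K
      by (rule integral_dominated_convergence[where w="\<lambda>x. 2 * norm (f x)"]) (use that lim in \<open>auto intro!: AE_I2\<close>)
    have "(\<lambda>i. LINT x|add_measure M N. s i x) \<longlonglongrightarrow> (LINT x|add_measure M N. f x)"
      using lim by (intro c) auto
    moreover have "(\<lambda>i. LINT x|add_measure M N. s i x) \<longlonglongrightarrow> (LINT x|M. f x) + (LINT x|N. f x)"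
      unfolding lim(5) using i sp by (intro tendsto_add c) auto
    ultimately show ?case by (rule LIMSEQ_unique)
  qed
qed

section \<open>Walks with independent steps\<close>

definition vadd :: "'i set \<Rightarrow> ('i \<Rightarrow> real) \<Rightarrow> ('i \<Rightarrow> real) \<Rightarrow> 'i \<Rightarrow> real" where
  "vadd I x y = (\<lambda>k\<in>I. x k + y k)"

definition vzero :: "'i set \<Rightarrow> 'i \<Rightarrow> real" where
  "vzero I = (\<lambda>k\<in>I. 0)"

lemma vadd_space[simp]: "vadd I x y \<in> space (RI I)"
  by (simp add: vadd_def space_PiM)

lemma vzero_space[simp]: "vzero I \<in> space (RI I)"
  by (simp add: vzero_def space_PiM)

lemma vadd_measurable[measurable (raw)]:
  assumes "f \<in> M \<rightarrow>\<^sub>M RI I" "g \<in> M \<rightarrow>\<^sub>M RI I"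
  shows "(\<lambda>x. vadd I (f x) (g x)) \<in> M \<rightarrow>\<^sub>M RI I"
  unfolding vadd_def using assms by measurable

lemma vadd_apply[simp]: "k \<in> I \<Longrightarrow> vadd I x y k = x k + y k"
  by (simp add: vadd_def)

lemma vzero_apply[simp]: "k \<in> I \<Longrightarrow> vzero I k = 0"
  by (simp add: vzero_def)

lemma vadd_zero[simp]: "x \<in> space (RI I) \<Longrightarrow> vadd I x (vzero I) = x" "x \<in> space (RI I) \<Longrightarrow> vadd I (vzero I) x = x"
  by (auto simp: vadd_def space_PiM fun_eq_iff PiE_def extensional_def)

text \<open>A step \<open>(b, \<mu>)\<close> with \<open>\<mu>\<close> of total mass at most \<open>1\<close> moves by \<open>b\<close> plus a jump: the jump is distributed
  according to \<open>\<mu>\<close>, and with the missing mass there is no jump. \<open>slaw\<close> is the law of the sum of independent steps.\<close>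

definition good_step :: "'i set \<Rightarrow> ('i \<Rightarrow> real) \<times> ('i \<Rightarrow> real) measure \<Rightarrow> bool" where
  "good_step I s \<longleftrightarrow> fst s \<in> space (RI I) \<and> finite_measure (snd s) \<and> sets (snd s) = sets (RI I) \<and>
     measure (snd s) (space (snd s)) \<le> 1"

definition stepM :: "'i set \<Rightarrow> ('i \<Rightarrow> real) \<Rightarrow> ('i \<Rightarrow> real) measure \<Rightarrow> ('i \<Rightarrow> real) measure" where
  "stepM I b \<mu> = add_measure (distr \<mu> (RI I) (vadd I b))
     (density (return (RI I) b) (\<lambda>_. ennreal (1 - measure \<mu> (space \<mu>))))"

fun slaw :: "'i set \<Rightarrow> (('i \<Rightarrow> real) \<times> ('i \<Rightarrow> real) measure) list \<Rightarrow> ('i \<Rightarrow> real) measure" where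
  "slaw I [] = return (RI I) (vzero I)"
| "slaw I (s # l) = distr (stepM I (fst s) (snd s) \<Otimes>\<^sub>M slaw I l) (RI I) (\<lambda>(d, x). vadd I d x)"

lemma sets_stepM[simp, measurable_cong]: "sets (stepM I b \<mu>) = sets (RI I)"
  by (simp add: stepM_def)

lemma sets_slaw[simp, measurable_cong]: "sets (slaw I l) = sets (RI I)"
  by (cases l) auto

lemma sets_stepM_slaw[measurable_cong]: "sets (stepM I b \<mu> \<Otimes>\<^sub>M slaw I l) = sets (RI I \<Otimes>\<^sub>M RI I)"
  by (rule sets_pair_measure_cong) simp_all

lemma space_slaw[simp]: "space (slaw I l) = space (RI I)"
  by (rule sets_eq_imp_space_eq) simp

lemma space_stepM[simp]: "space (stepM I b \<mu>) = space (RI I)"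
  by (rule sets_eq_imp_space_eq) simp

context
  fixes I :: "'i set" and b :: "'i \<Rightarrow> real" and \<mu> :: "('i \<Rightarrow> real) measure"
  assumes good: "good_step I (b, \<mu>)"
begin

interpretation mu: finite_measure \<mu> using good by (simp add: good_step_def)

lemma good_step_sets: "b \<in> space (RI I)" "sets \<mu> = sets (RI I)" "measure \<mu> (space \<mu>) \<le> 1"
  using good by (simp_all add: good_step_def)

private lemma vadd_const_measurable: "vadd I b \<in> \<mu> \<rightarrow>\<^sub>M RI I"
  unfolding measurable_cong_sets[OF good_step_sets(2) refl] using good_step_sets(1) by measurable

lemma nn_integral_stepM:
  assumes f[measurable]: "f \<in> borel_measurable (RI I)"
  shows "(\<integral>\<^sup>+x. f x \<partial>stepM I b \<mu>) = (\<integral>\<^sup>+u. f (vadd I b u) \<partial>\<mu>) + ennreal (1 - measure \<mu> (space \<mu>)) * f b"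
proof -
  note [measurable_cong] = good_step_sets(2)
  note [measurable] = vadd_const_measurable
  show ?thesis
  unfolding stepM_def using good_step_sets
  by (subst nn_integral_add_measure) (simp_all add: nn_integral_distr nn_integral_density nn_integral_return nn_integral_cmult)
qed

lemma prob_space_stepM: "prob_space (stepM I b \<mu>)"
proof
  note [measurable_cong] = good_step_sets(2)
  have "emeasure (stepM I b \<mu>) (space (stepM I b \<mu>)) = (\<integral>\<^sup>+x. 1 \<partial>stepM I b \<mu>)" by simp
  also have "\<dots> = emeasure \<mu> (space \<mu>) + ennreal (1 - measure \<mu> (space \<mu>))"
    by (subst nn_integral_stepM) auto
  also have "\<dots> = 1"
    using good_step_sets(3) by (simp add: mu.emeasure_eq_measure flip: ennreal_plus)
  finally show "emeasure (stepM I b \<mu>) (space (stepM I b \<mu>)) = 1" .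
qed

lemma integral_stepM:
  fixes f :: "_ \<Rightarrow> 'b::{banach, second_countable_topology}"
  assumes f[measurable]: "f \<in> borel_measurable (RI I)" and i: "integrable \<mu> (\<lambda>u. f (vadd I b u))"
  shows "integrable (stepM I b \<mu>) f"
    "(LINT x|stepM I b \<mu>. f x) = (LINT u|\<mu>. f (vadd I b u)) + (1 - measure \<mu> (space \<mu>)) *\<^sub>R f b"
proof -
  note [measurable_cong] = good_step_sets(2)
  note [measurable] = vadd_const_measurable
  have 1: "integrable (distr \<mu> (RI I) (vadd I b)) f" using i by (simp add: integrable_distr_eq)
  have "integrable (return (RI I) b) f" using good_step_sets(1)
    by (auto simp: integrable_iff_bounded nn_integral_return)
  then have 2: "integrable (density (return (RI I) b) (\<lambda>_. ennreal (1 - measure \<mu> (space \<mu>)))) f"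
    using good_step_sets by (subst integrable_density) auto
  show "integrable (stepM I b \<mu>) f" unfolding stepM_def using 1 2 by (subst integrable_add_measure) auto
  show "(LINT x|stepM I b \<mu>. f x) = (LINT u|\<mu>. f (vadd I b u)) + (1 - measure \<mu> (space \<mu>)) *\<^sub>R f b"
    unfolding stepM_def using 1 2 good_step_sets
    by (subst integral_add_measure) (auto simp: integral_distr integral_density integral_return)
qed

end

lemma prob_space_slaw: "list_all (good_step I) l \<Longrightarrow> prob_space (slaw I l)"
proof (induction l)
  case Nil
  then show ?case by (simp add: prob_space_return)
next
  case (Cons s l)
  then interpret L: prob_space "slaw I l" by simp
  interpret S: prob_space "stepM I (fst s) (snd s)" using Cons by (intro prob_space_stepM) simp
  interpret SL: pair_prob_space "stepM I (fst s) (snd s)" "slaw I l" ..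
  show ?case by (simp add: SL.prob_space_distr)
qed

text \<open>Conditioning on the first step. The second form separates its jump, drawn from
  \<open>\<mu>\<close>, from the event that only the shift \<open>b\<close> happens.\<close>

lemma nn_integral_slaw_Cons:
  assumes g: "good_step I (b, \<mu>)" "list_all (good_step I) l" and f[measurable]: "f \<in> borel_measurable (RI I)"
  shows "(\<integral>\<^sup>+x. f x \<partial>slaw I ((b, \<mu>) # l)) = (\<integral>\<^sup>+d. \<integral>\<^sup>+x. f (vadd I d x) \<partial>slaw I l \<partial>stepM I b \<mu>)"
    "(\<integral>\<^sup>+x. f x \<partial>slaw I ((b, \<mu>) # l)) =
      (\<integral>\<^sup>+u. \<integral>\<^sup>+x. f (vadd I (vadd I b u) x) \<partial>slaw I l \<partial>\<mu>) +
      ennreal (1 - measure \<mu> (space \<mu>)) * (\<integral>\<^sup>+x. f (vadd I b x) \<partial>slaw I l)"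
proof -
  interpret L: prob_space "slaw I l" using g by (simp add: prob_space_slaw)
  show 1: "(\<integral>\<^sup>+x. f x \<partial>slaw I ((b, \<mu>) # l)) = (\<integral>\<^sup>+d. \<integral>\<^sup>+x. f (vadd I d x) \<partial>slaw I l \<partial>stepM I b \<mu>)"
    by (simp add: nn_integral_distr split_beta' L.nn_integral_fst[symmetric])
  show "(\<integral>\<^sup>+x. f x \<partial>slaw I ((b, \<mu>) # l)) =
      (\<integral>\<^sup>+u. \<integral>\<^sup>+x. f (vadd I (vadd I b u) x) \<partial>slaw I l \<partial>\<mu>) +
      ennreal (1 - measure \<mu> (space \<mu>)) * (\<integral>\<^sup>+x. f (vadd I b x) \<partial>slaw I l)"
    unfolding 1 by (subst nn_integral_stepM[OF g(1)]) auto
qed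

lemma integral_slaw_Cons:
  fixes f :: "_ \<Rightarrow> 'b::{banach, second_countable_topology}"
  assumes g: "good_step I (b, \<mu>)" "list_all (good_step I) l" and f[measurable]: "f \<in> borel_measurable (RI I)"
    and B: "\<And>x. norm (f x) \<le> B"
  shows "(LINT x|slaw I ((b, \<mu>) # l). f x) = (LINT d|stepM I b \<mu>. LINT x|slaw I l. f (vadd I d x))"
    "(LINT x|slaw I ((b, \<mu>) # l). f x) =
      (LINT u|\<mu>. LINT x|slaw I l. f (vadd I (vadd I b u) x)) +
      (1 - measure \<mu> (space \<mu>)) *\<^sub>R (LINT x|slaw I l. f (vadd I b x))"
proof -
  interpret L: prob_space "slaw I l" using g by (simp add: prob_space_slaw)
  interpret S: prob_space "stepM I b \<mu>" using g by (intro prob_space_stepM) simp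
  interpret SL: pair_prob_space "stepM I b \<mu>" "slaw I l" ..
  interpret mu: finite_measure \<mu> using g by (simp add: good_step_def)
  have [measurable_cong]: "sets \<mu> = sets (RI I)" using g(1) by (simp add: good_step_def)
  have bs[measurable]: "b \<in> space (RI I)" using g(1) by (simp add: good_step_def)
  have int: "integrable (stepM I b \<mu> \<Otimes>\<^sub>M slaw I l) (\<lambda>(d, x). f (vadd I d x))"
    by (rule SL.integrable_const_bound[where B=B]) (use B in \<open>auto simp: split_beta'\<close>)
  show 1: "(LINT x|slaw I ((b, \<mu>) # l). f x) = (LINT d|stepM I b \<mu>. LINT x|slaw I l. f (vadd I d x))"
    using SL.integral_fst'[OF int] by (simp add: integral_distr split_beta')
  have "norm (LINT x|slaw I l. f (vadd I d x)) \<le> B" for d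
  proof -
    have "norm (LINT x|slaw I l. f (vadd I d x)) \<le> (LINT x|slaw I l. norm (f (vadd I d x)))" by simp
    also have "\<dots> \<le> (LINT x|slaw I l. B)"
      using B order_trans[OF norm_ge_zero B] by (intro integral_mono_AE') auto
    finally show ?thesis using L.prob_space by simp
  qed
  then have "integrable \<mu> (\<lambda>u. LINT x|slaw I l. f (vadd I (vadd I b u) x))"
    by (intro mu.integrable_const_bound[where B=B]) auto
  then show "(LINT x|slaw I ((b, \<mu>) # l). f x) =
      (LINT u|\<mu>. LINT x|slaw I l. f (vadd I (vadd I b u) x)) +
      (1 - measure \<mu> (space \<mu>)) *\<^sub>R (LINT x|slaw I l. f (vadd I b x))"
    unfolding 1 by (intro integral_stepM[OF g(1)]) auto
qed

section \<open>Characteristic functions of walks\<close>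

definition dot :: "'i set \<Rightarrow> ('i \<Rightarrow> real) \<Rightarrow> ('i \<Rightarrow> real) \<Rightarrow> real" where
  "dot I t x = (\<Sum>k\<in>I. t k * x k)"

lemma dot_measurable: "finite I \<Longrightarrow> dot I t \<in> borel_measurable (RI I)"
  unfolding dot_def[abs_def] by measurable

lemma charI_dot: "charI I Q t = (LINT x|Q. iexp (dot I t x))"
  by (simp add: charI_def dot_def)

lemma dot_vadd: "dot I t (vadd I x y) = dot I t x + dot I t y"
  by (simp add: dot_def distrib_left sum.distrib)

lemma dot_vzero[simp]: "dot I t (vzero I) = 0"
  by (simp add: dot_def)

text \<open>Independence gives a product, and the missing mass of a step turns the integral of the
  character into \<open>1\<close> plus the integral of the character minus \<open>1\<close>, the
  form from which a compound Poisson exponent emerges.\<close>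

lemma charI_slaw:
  assumes I: "finite I" and l: "list_all (good_step I) l"
  shows "charI I (slaw I l) t =
    (\<Prod>s\<leftarrow>l. iexp (dot I t (fst s)) * (1 + (LINT u|snd s. iexp (dot I t u) - 1)))"
  using l
proof (induction l)
  case Nil
  have "(\<lambda>x. iexp (dot I t x)) \<in> borel_measurable (RI I)"
    using dot_measurable[OF I] by measurable
  then show ?case unfolding charI_dot slaw.simps
    by (subst integral_return) simp_all
next
  case (Cons s l)
  obtain b \<mu> where s: "s = (b, \<mu>)" by force
  have g: "good_step I (b, \<mu>)" "list_all (good_step I) l" using Cons(2) by (simp_all add: s)
  interpret mu: finite_measure \<mu> using g by (simp add: good_step_def)
  have [measurable_cong]: "sets \<mu> = sets (RI I)" using g(1) by (simp add: good_step_def)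
  have f: "(\<lambda>x. iexp (dot I t x)) \<in> borel_measurable (RI I)"
    using dot_measurable[OF I] by measurable
  have i: "integrable \<mu> (\<lambda>u. iexp (dot I t u))"
    by (rule mu.integrable_const_bound[where B=1]) (use f in auto)
  have "charI I (slaw I (s # l)) t = (LINT u|\<mu>. LINT x|slaw I l. iexp (dot I t (vadd I (vadd I b u) x))) +
      (1 - measure \<mu> (space \<mu>)) *\<^sub>R (LINT x|slaw I l. iexp (dot I t (vadd I b x)))"
    unfolding charI_dot s by (rule integral_slaw_Cons[OF g f, where B=1]) simp
  also have "\<dots> = iexp (dot I t b) * (1 + (LINT u|\<mu>. iexp (dot I t u) - 1)) * charI I (slaw I l) t"
    unfolding dot_vadd iexp_add charI_dot using i
    by (simp add: algebra_simps scaleR_conv_of_real)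
  also have "charI I (slaw I l) t = (\<Prod>s\<leftarrow>l. iexp (dot I t (fst s)) * (1 + (LINT u|snd s. iexp (dot I t u) - 1)))"
    by (rule Cons.IH) fact
  finally show ?case by (simp add: s)
qed

section \<open>Exponential bound for Lipschitz functions of a walk\<close>

lemma sinh_ge: "0 \<le> y \<Longrightarrow> 2 * y \<le> exp y - exp (- y)" for y :: real
proof -
  assume y: "0 \<le> y"
  have "exp 0 - exp (- 0) - 2 * 0 \<le> exp y - exp (- y) - 2 * y"
  proof (rule DERIV_nonneg_imp_nondecreasing[OF y])
    fix x :: real assume "0 \<le> x" "x \<le> y"
    \<comment> \<open>Expanding the square of \<open>exp (x / 2) - exp (- x / 2)\<close> gives this
      inequality.\<close>
    have "2 \<le> exp x + exp (- x)"
      using sum_squares_ge_zero[of "exp (x/2) - exp (- x/2)" 0]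
      by (simp add: power2_eq_square algebra_simps flip: exp_add)
    then show "\<exists>z. ((\<lambda>x. exp x - exp (- x) - 2 * x) has_real_derivative z) (at x) \<and> 0 \<le> z"
      by (intro exI[of _ "exp x + exp (- x) - 2"]) (auto intro!: derivative_eq_intros)
  qed
  then show ?thesis by simp
qed

text \<open>For \<open>z < 0\<close> the remainder does not decrease when \<open>z\<close> is
  replaced by \<open>- z\<close>, since \<open>2 * y \<le> exp y - exp (- y)\<close>; on the
  nonnegative half-line it increases. Thus the increment of a 1-Lipschitz function may be replaced
  by the norm of the jump.\<close>

lemma exp_remainder_mono:
  fixes z w :: real
  assumes "\<bar>z\<bar> \<le> w"
  shows "exp z - 1 - z \<le> exp w - 1 - w"
proof -
  have a: "exp z - z \<le> exp \<bar>z\<bar> - \<bar>z\<bar>"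
    using sinh_ge[of "- z"] by (cases "z \<ge> 0") auto
  have "w - \<bar>z\<bar> \<le> exp \<bar>z\<bar> * (w - \<bar>z\<bar>)"
    using assms by (simp add: mult_le_cancel_right1)
  also have "\<dots> \<le> exp \<bar>z\<bar> * (exp (w - \<bar>z\<bar>) - 1)"
    using exp_ge_add_one_self[of "w - \<bar>z\<bar>"] by (intro mult_left_mono) (linarith, simp)
  also have "\<dots> = exp w - exp \<bar>z\<bar>" by (simp add: right_diff_distrib flip: exp_add)
  finally show ?thesis using a by linarith
qed

lemma abs_integral_le_bound:
  assumes "prob_space M" "\<And>x. \<bar>f x\<bar> \<le> B"
  shows "\<bar>LINT x|M. f x\<bar> \<le> (B::real)"
proof -
  interpret prob_space M by fact
  have "\<bar>LINT x|M. f x\<bar> \<le> (LINT x|M. \<bar>f x\<bar>)" by (rule integral_abs_bound)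
  also have "\<dots> \<le> (LINT x|M. B)"
    using assms(2) order_trans[OF abs_ge_zero assms(2)] by (intro integral_mono_AE') auto
  finally show ?thesis by (simp add: prob_space)
qed

text \<open>With \<open>v\<close> the increment caused by a jump, the expectation is
  \<open>exp (t * G b)\<close> times \<open>1 + \<integral> (exp (t * v) - 1)\<close>, and
  \<open>1 + y \<le> exp y\<close> puts everything into the exponent. There the linear part of
  \<open>exp (t * v) - 1\<close> restores exactly the mean of \<open>G\<close>, and the remainder is
  at most the one formed with the norm.\<close>

lemma stepM_exp_bound:
  assumes I: "finite I" and g: "good_step I (b, \<mu>)"
    and G: "G \<in> borel_measurable (RI I)" "\<And>x. \<bar>G x\<bar> \<le> B" "lip_on I 1 G" and t: "0 \<le> t"
    and e: "integrable \<mu> (\<lambda>u. exp (t * L2_set u I))"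
  shows "(LINT x|stepM I b \<mu>. exp (t * G x)) \<le>
     exp (t * (LINT x|stepM I b \<mu>. G x) + (LINT u|\<mu>. exp (t * L2_set u I) - 1 - t * L2_set u I))"
proof -
  interpret mu: finite_measure \<mu> using g by (simp add: good_step_def)
  note [measurable_cong] = good_step_sets(2)[OF g]
  note [measurable] = good_step_sets(1)[OF g] G(1)
  have sp: "space \<mu> = space (RI I)" by (rule sets_eq_imp_space_eq) (rule good_step_sets[OF g])
  define m where "m = measure \<mu> (space \<mu>)"
  define v where "v u = G (vadd I b u) - G b" for u
  have v: "\<bar>v u\<bar> \<le> L2_set u I" for u
  proof -
    have "\<bar>v u\<bar> \<le> 1 * L2_set (\<lambda>k. vadd I b u k - b k) I" unfolding v_def
      by (intro lip_onD[OF G(3)]) (use good_step_sets[OF g] in auto)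
    also have "L2_set (\<lambda>k. vadd I b u k - b k) I = L2_set u I"
      by (intro L2_set_cong) auto
    finally show ?thesis by simp
  qed
  have [measurable]: "v \<in> borel_measurable \<mu>" unfolding v_def by measurable
  have vB: "\<bar>v u\<bar> \<le> 2 * B" for u using G(2)[of "vadd I b u"] G(2)[of b] unfolding v_def by linarith
  have iv: "integrable \<mu> v"
    by (rule mu.integrable_const_bound[where B="2 * B"]) (use vB in auto)
  have iev: "integrable \<mu> (\<lambda>u. exp (t * v u))"
    by (rule mu.integrable_const_bound[where B="exp (t * (2 * B))"])
       (use vB t in \<open>auto intro!: mult_left_mono simp: abs_le_iff\<close>)
  have iu: "integrable \<mu> (\<lambda>u. t * L2_set u I)"
    by (rule Bochner_Integration.integrable_bound[OF e])
       (use I t in \<open>auto intro!: AE_I2 simp: abs_mult order_trans[OF _ exp_ge_add_one_self]\<close>)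
  have i1: "integrable \<mu> (\<lambda>u. G (vadd I b u))"
    by (rule mu.integrable_const_bound[where B=B]) (use G in auto)
  have i2: "integrable \<mu> (\<lambda>u. exp (t * G (vadd I b u)))"
    by (rule mu.integrable_const_bound[where B="exp (t * B)"])
       (use G t in \<open>auto intro!: mult_left_mono simp: abs_le_iff\<close>)
  have "(LINT u|\<mu>. v u) = (LINT u|\<mu>. G (vadd I b u)) - m * G b"
    using i1 by (simp add: v_def m_def)
  then have iG: "(LINT x|stepM I b \<mu>. G x) = G b + (LINT u|\<mu>. v u)"
    by (subst integral_stepM[OF g G(1) i1]) (simp add: m_def algebra_simps)
  have "(LINT x|stepM I b \<mu>. exp (t * G x)) = (LINT u|\<mu>. exp (t * G (vadd I b u))) + (1 - m) * exp (t * G b)"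
    by (subst integral_stepM[OF g _ i2]) (simp_all add: m_def)
  also have "(\<lambda>u. exp (t * G (vadd I b u))) = (\<lambda>u. exp (t * G b) * exp (t * v u))"
    by (simp add: v_def algebra_simps fun_eq_iff flip: exp_add)
  also have "(LINT u|\<mu>. exp (t * G b) * exp (t * v u)) + (1 - m) * exp (t * G b) = exp (t * G b) * (1 + (LINT u|\<mu>. exp (t * v u) - 1))"
    using iev by (simp add: m_def algebra_simps)
  also have "\<dots> \<le> exp (t * G b) * exp (LINT u|\<mu>. exp (t * v u) - 1)"
    by (intro mult_left_mono exp_ge_add_one_self) auto
  also have "\<dots> \<le> exp (t * G b) * exp (t * (LINT u|\<mu>. v u) + (LINT u|\<mu>. exp (t * L2_set u I) - 1 - t * L2_set u I))"
  proof (intro mult_left_mono)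
    have "(LINT u|\<mu>. exp (t * v u) - 1) \<le> (LINT u|\<mu>. t * v u + (exp (t * L2_set u I) - 1 - t * L2_set u I))"
    proof (intro integral_mono)
      fix u
      have "exp (t * v u) - 1 - t * v u \<le> exp (t * L2_set u I) - 1 - t * L2_set u I"
        using t v[of u] by (intro exp_remainder_mono) (simp add: abs_mult mult_left_mono)
      then show "exp (t * v u) - 1 \<le> t * v u + (exp (t * L2_set u I) - 1 - t * L2_set u I)" by simp
    qed (use iev iv e iu in auto)
    then show "exp (LINT u|\<mu>. exp (t * v u) - 1) \<le> exp (t * (LINT u|\<mu>. v u) + (LINT u|\<mu>. exp (t * L2_set u I) - 1 - t * L2_set u I))"
      using iv e iu by simp
  qed simp
  finally show ?thesis unfolding iG by (simp add: algebra_simps flip: exp_add)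
qed

text \<open>The one-step bound passes to sums because averaging \<open>F\<close> over the remaining steps keeps it 1-Lipschitz.\<close>

lemma slaw_exp_bound:
  assumes I: "finite I" and l: "list_all (good_step I) l" and t: "0 \<le> t"
    and e: "\<And>s. s \<in> set l \<Longrightarrow> integrable (snd s) (\<lambda>u. exp (t * L2_set u I))"
    and F: "F \<in> borel_measurable (RI I)" "\<And>x. \<bar>F x\<bar> \<le> B" "lip_on I 1 F"
  shows "(LINT x|slaw I l. exp (t * F x)) \<le> exp (t * (LINT x|slaw I l. F x) +
     (\<Sum>s\<leftarrow>l. LINT u|snd s. exp (t * L2_set u I) - 1 - t * L2_set u I))"
  using l e F
proof (induction l arbitrary: F)
  case Nil
  note [measurable] = Nil(3)
  show ?case by (simp add: integral_return)
next
  case (Cons s l)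
  obtain b \<mu> where s: "s = (b, \<mu>)" by force
  have g: "good_step I (b, \<mu>)" "list_all (good_step I) l" using Cons(2) by (simp_all add: s)
  note [measurable] = Cons(4)
  interpret L: prob_space "slaw I l" using g by (simp add: prob_space_slaw)
  interpret S: prob_space "stepM I b \<mu>" using g by (intro prob_space_stepM) simp
  define \<Psi> where "\<Psi> = (\<Sum>s\<leftarrow>l. LINT u|snd s. exp (t * L2_set u I) - 1 - t * L2_set u I)"
  define G where "G d = (LINT x|slaw I l. F (vadd I d x))" for d
  have G1: "G \<in> borel_measurable (RI I)" unfolding G_def by measurable
  note [measurable] = G1
  have GB: "\<bar>G d\<bar> \<le> B" for d unfolding G_def by (intro abs_integral_le_bound L.prob_space_axioms Cons(5))
  have iF: "integrable (slaw I l) (\<lambda>x. F (vadd I d x))" if "d \<in> space (RI I)" for d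
    by (rule L.integrable_const_bound[where B=B]) (use Cons(5) that in auto)
  have vd: "L2_set (\<lambda>k. vadd I d x k - vadd I d' y k) I \<le> L2_set (\<lambda>k. d k - d' k) I + L2_set (\<lambda>k. x k - y k) I" for d d' x y
  proof -
    have "L2_set (\<lambda>k. vadd I d x k - vadd I d' y k) I = L2_set (\<lambda>k. (d k - d' k) + (x k - y k)) I"
      by (intro L2_set_cong) auto
    then show ?thesis using L2_set_triangle_ineq by metis
  qed
  have Glip: "lip_on I 1 G" unfolding lip_on_def
  proof (intro ballI)
    fix d d' :: "'a \<Rightarrow> real" assume d: "d \<in> space (RI I)" "d' \<in> space (RI I)"
    have "\<bar>G d - G d'\<bar> = \<bar>LINT x|slaw I l. F (vadd I d x) - F (vadd I d' x)\<bar>"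
      unfolding G_def using iF d by simp
    also have "\<dots> \<le> L2_set (\<lambda>k. d k - d' k) I"
    proof (intro abs_integral_le_bound L.prob_space_axioms)
      fix x
      have "\<bar>F (vadd I d x) - F (vadd I d' x)\<bar> \<le> 1 * L2_set (\<lambda>k. vadd I d x k - vadd I d' x k) I"
        by (intro lip_onD[OF Cons(6)]) auto
      also have "\<dots> \<le> L2_set (\<lambda>k. d k - d' k) I" using vd[of d x d' x] by (simp add: L2_set_def)
      finally show "\<bar>F (vadd I d x) - F (vadd I d' x)\<bar> \<le> L2_set (\<lambda>k. d k - d' k) I" .
    qed
    finally show "\<bar>G d - G d'\<bar> \<le> 1 * L2_set (\<lambda>k. d k - d' k) I" by simp
  qed
  have eB: "\<bar>exp (t * F x)\<bar> \<le> exp (t * B)" for x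
    using Cons(5)[of x] t by (auto intro!: mult_left_mono simp: abs_le_iff)
  have eGB: "\<bar>exp (t * G x)\<bar> \<le> exp (t * B)" for x
    using GB[of x] t by (auto intro!: mult_left_mono simp: abs_le_iff)
  have "(LINT x|slaw I (s # l). exp (t * F x)) = (LINT d|stepM I b \<mu>. LINT x|slaw I l. exp (t * F (vadd I d x)))"
    unfolding s by (rule integral_slaw_Cons[OF g, where B="exp (t * B)"]) (use eB in auto)
  also have "\<dots> \<le> (LINT d|stepM I b \<mu>. exp \<Psi> * exp (t * G d))"
  proof (rule integral_mono)
    show "integrable (stepM I b \<mu>) (\<lambda>d. LINT x|slaw I l. exp (t * F (vadd I d x)))"
      by (rule S.integrable_const_bound[where B="exp (t * B)"])
         (use abs_integral_le_bound[OF L.prob_space_axioms eB] in auto)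
    show "integrable (stepM I b \<mu>) (\<lambda>d. exp \<Psi> * exp (t * G d))"
      by (intro integrable_mult_right S.integrable_const_bound[where B="exp (t * B)"])
         (use eGB in auto)
    fix d assume "d \<in> space (stepM I b \<mu>)"
    then have d[measurable]: "d \<in> space (RI I)" by simp
    have "(LINT x|slaw I l. exp (t * F (vadd I d x))) \<le> exp (t * (LINT x|slaw I l. F (vadd I d x)) + \<Psi>)"
      unfolding \<Psi>_def
    proof (rule Cons.IH)
      show "lip_on I 1 (\<lambda>x. F (vadd I d x))" unfolding lip_on_def
      proof (intro ballI)
        fix x y :: "'a \<Rightarrow> real" assume d: "x \<in> space (RI I)" "y \<in> space (RI I)"
        have "\<bar>F (vadd I d x) - F (vadd I d y)\<bar> \<le> 1 * L2_set (\<lambda>k. vadd I d x k - vadd I d y k) I"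
          by (intro lip_onD[OF Cons(6)]) auto
        also have "\<dots> \<le> 1 * L2_set (\<lambda>k. x k - y k) I" using vd[of d x d y] by (simp add: L2_set_def)
        finally show "\<bar>F (vadd I d x) - F (vadd I d y)\<bar> \<le> 1 * L2_set (\<lambda>k. x k - y k) I" .
      qed
    qed (use Cons g in auto)
    then show "(LINT x|slaw I l. exp (t * F (vadd I d x))) \<le> exp \<Psi> * exp (t * G d)"
      by (simp add: G_def exp_add mult.commute)
  qed
  also have "\<dots> = exp \<Psi> * (LINT d|stepM I b \<mu>. exp (t * G d))" by simp
  also have "\<dots> \<le> exp \<Psi> * exp (t * (LINT x|stepM I b \<mu>. G x) + (LINT u|\<mu>. exp (t * L2_set u I) - 1 - t * L2_set u I))"
    using Cons(3)[of s] by (intro mult_left_mono stepM_exp_bound[OF I g(1) G1 GB Glip t]) (auto simp: s)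
  also have "(LINT x|stepM I b \<mu>. G x) = (LINT x|slaw I (s # l). F x)"
    unfolding s G_def using Cons(5) by (intro integral_slaw_Cons(1)[OF g, symmetric, where B=B]) auto
  finally show ?case by (simp add: \<Psi>_def s algebra_simps flip: exp_add)
qed

section \<open>Moments of walks\<close>

definition drift :: "'i set \<Rightarrow> (('i \<Rightarrow> real) \<times> ('i \<Rightarrow> real) measure) list \<Rightarrow> 'i \<Rightarrow> real" where
  "drift I l k = (\<Sum>s\<leftarrow>l. fst s k + (LINT u|snd s. u k))"

text \<open>An upper bound for the trace of the covariance matrix of the walk: the squared means of
  the jumps are not subtracted.\<close>

definition sqvar :: "'i set \<Rightarrow> (('i \<Rightarrow> real) \<times> ('i \<Rightarrow> real) measure) list \<Rightarrow> real" where
  "sqvar I l = (\<Sum>s\<leftarrow>l. (LINT u|snd s. (\<Sum>k\<in>I. (u k)\<^sup>2)))"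

lemma sqvar_nonneg: "0 \<le> sqvar I l"
  unfolding sqvar_def by (intro sum_list_nonneg) (auto intro!: Bochner_Integration.integral_nonneg sum_nonneg)

text \<open>An arbitrary shift \<open>y\<close> is carried along so that the first step can be
  absorbed into it in the induction. The bound is the decomposition into squared mean plus variance,
  with second moments of the jumps in place of variances.\<close>

lemma slaw_second_moment:
  assumes I: "finite I" and l: "list_all (good_step I) l"
    and i2: "\<And>s. s \<in> set l \<Longrightarrow> integrable (snd s) (\<lambda>u. \<Sum>k\<in>I. (u k)\<^sup>2)"
    and i1: "\<And>s k. s \<in> set l \<Longrightarrow> k \<in> I \<Longrightarrow> integrable (snd s) (\<lambda>u. u k)"
  shows "(\<integral>\<^sup>+x. ennreal (\<Sum>k\<in>I. (y k + x k)\<^sup>2) \<partial>slaw I l) \<le> ennreal ((\<Sum>k\<in>I. (y k + drift I l k)\<^sup>2) + sqvar I l)"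
  using l i2 i1
proof (induction l arbitrary: y)
  case Nil
  have "(\<lambda>x. ennreal (\<Sum>k\<in>I. (y k + x k)\<^sup>2)) \<in> borel_measurable (RI I)" using I by measurable
  then show ?case by (simp add: nn_integral_return drift_def sqvar_def)
next
  case (Cons s l)
  obtain b \<mu> where s: "s = (b, \<mu>)" by force
  have g: "good_step I (b, \<mu>)" "list_all (good_step I) l" using Cons(2) by (simp_all add: s)
  interpret L: prob_space "slaw I l" using g by (simp add: prob_space_slaw)
  interpret mu: finite_measure \<mu> using g by (simp add: good_step_def)
  note [measurable_cong] = good_step_sets(2)[OF g(1)]
  define m where "m = measure \<mu> (space \<mu>)"
  have m: "0 \<le> m" "m \<le> 1" using good_step_sets(3)[OF g(1)] by (simp_all add: m_def)
  define V where "V = sqvar I l"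
  have V: "0 \<le> V" by (simp add: V_def sqvar_nonneg)
  define z where "z k = y k + b k + drift I l k" for k
  define w where "w k = (LINT u|\<mu>. u k)" for k
  have iu: "integrable \<mu> (\<lambda>u. u k)" if "k \<in> I" for k using Cons(4)[of s] that by (simp add: s)
  have iu2: "integrable \<mu> (\<lambda>u. \<Sum>k\<in>I. (u k)\<^sup>2)" using Cons(3)[of s] by (simp add: s)
  have [measurable]: "(\<lambda>x. ennreal (\<Sum>k\<in>I. (y k + x k)\<^sup>2)) \<in> borel_measurable (RI I)" for y using I by measurable
  have IH: "(\<integral>\<^sup>+x. ennreal (\<Sum>k\<in>I. (y k + x k)\<^sup>2) \<partial>slaw I l) \<le> ennreal ((\<Sum>k\<in>I. (y k + drift I l k)\<^sup>2) + V)" for y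
    unfolding V_def by (rule Cons.IH) (use g Cons in auto)
  have eq: "(\<integral>\<^sup>+x. ennreal (\<Sum>k\<in>I. (y k + vadd I d x k)\<^sup>2) \<partial>slaw I l) = (\<integral>\<^sup>+x. ennreal (\<Sum>k\<in>I. ((y k + d k) + x k)\<^sup>2) \<partial>slaw I l)" for d
    by (intro nn_integral_cong arg_cong[where f=ennreal] sum.cong) (auto simp: algebra_simps)
  have sq: "(\<Sum>k\<in>I. (z k + u k)\<^sup>2) = (\<Sum>k\<in>I. (z k)\<^sup>2 + 2 * z k * u k) + (\<Sum>k\<in>I. (u k)\<^sup>2)" for u
    unfolding sum.distrib[symmetric] by (intro sum.cong) (auto simp: power2_sum)
  have "(\<integral>\<^sup>+x. ennreal (\<Sum>k\<in>I. (y k + x k)\<^sup>2) \<partial>slaw I (s # l)) =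
      (\<integral>\<^sup>+u. \<integral>\<^sup>+x. ennreal (\<Sum>k\<in>I. (y k + vadd I (vadd I b u) x k)\<^sup>2) \<partial>slaw I l \<partial>\<mu>) +
      ennreal (1 - m) * (\<integral>\<^sup>+x. ennreal (\<Sum>k\<in>I. (y k + vadd I b x k)\<^sup>2) \<partial>slaw I l)"
    unfolding s m_def by (rule nn_integral_slaw_Cons(2)[OF g]) measurable
  also have "\<dots> \<le> (\<integral>\<^sup>+u. ennreal ((\<Sum>k\<in>I. (z k + u k)\<^sup>2) + V) \<partial>\<mu>) + ennreal (1 - m) * ennreal ((\<Sum>k\<in>I. (z k)\<^sup>2) + V)"
  proof (intro add_mono mult_left_mono nn_integral_mono)
    fix u
    have "(\<Sum>k\<in>I. (y k + vadd I b u k + drift I l k)\<^sup>2) = (\<Sum>k\<in>I. (z k + u k)\<^sup>2)"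
      by (intro sum.cong) (auto simp: z_def algebra_simps)
    then show "(\<integral>\<^sup>+x. ennreal (\<Sum>k\<in>I. (y k + vadd I (vadd I b u) x k)\<^sup>2) \<partial>slaw I l) \<le> ennreal ((\<Sum>k\<in>I. (z k + u k)\<^sup>2) + V)"
      using IH[of "\<lambda>k. y k + vadd I b u k"] unfolding eq by simp
    show "(\<integral>\<^sup>+x. ennreal (\<Sum>k\<in>I. (y k + vadd I b x k)\<^sup>2) \<partial>slaw I l) \<le> ennreal ((\<Sum>k\<in>I. (z k)\<^sup>2) + V)"
      using IH[of "\<lambda>k. y k + b k"] unfolding eq z_def by simp
  qed simp
  also have "(\<integral>\<^sup>+u. ennreal ((\<Sum>k\<in>I. (z k + u k)\<^sup>2) + V) \<partial>\<mu>) = ennreal (LINT u|\<mu>. (\<Sum>k\<in>I. (z k + u k)\<^sup>2) + V)"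
  proof (rule nn_integral_eq_integral)
    show "integrable \<mu> (\<lambda>u. (\<Sum>k\<in>I. (z k + u k)\<^sup>2) + V)"
      unfolding sq using iu iu2 by simp
  qed (use V in \<open>auto intro!: add_nonneg_nonneg sum_nonneg\<close>)
  also have "(LINT u|\<mu>. (\<Sum>k\<in>I. (z k + u k)\<^sup>2) + V) = (LINT u|\<mu>. (\<Sum>k\<in>I. (z k)\<^sup>2 + 2 * z k * u k) + (\<Sum>k\<in>I. (u k)\<^sup>2) + V)"
    unfolding sq ..
  also have "\<dots> = (\<Sum>k\<in>I. m * (z k)\<^sup>2 + 2 * z k * w k) + (LINT u|\<mu>. (\<Sum>k\<in>I. (u k)\<^sup>2)) + m * V"
    using iu iu2 by (simp add: m_def w_def sum.distrib sum_distrib_left)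
  also have "ennreal ((\<Sum>k\<in>I. m * (z k)\<^sup>2 + 2 * z k * w k) + (LINT u|\<mu>. (\<Sum>k\<in>I. (u k)\<^sup>2)) + m * V) +
     ennreal (1 - m) * ennreal ((\<Sum>k\<in>I. (z k)\<^sup>2) + V) =
     ennreal (((\<Sum>k\<in>I. m * (z k)\<^sup>2 + 2 * z k * w k) + (LINT u|\<mu>. (\<Sum>k\<in>I. (u k)\<^sup>2)) + m * V) + (1 - m) * ((\<Sum>k\<in>I. (z k)\<^sup>2) + V))"
  proof -
    have "0 \<le> (\<Sum>k\<in>I. m * (z k)\<^sup>2 + 2 * z k * w k) + (LINT u|\<mu>. (\<Sum>k\<in>I. (u k)\<^sup>2)) + m * V"
    proof -
      have "0 \<le> (LINT u|\<mu>. (\<Sum>k\<in>I. (z k + u k)\<^sup>2) + V)"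
        using V by (intro Bochner_Integration.integral_nonneg add_nonneg_nonneg sum_nonneg) auto
      also have "\<dots> = (LINT u|\<mu>. (\<Sum>k\<in>I. (z k)\<^sup>2 + 2 * z k * u k) + (\<Sum>k\<in>I. (u k)\<^sup>2) + V)"
        unfolding sq ..
      also have "\<dots> = (\<Sum>k\<in>I. m * (z k)\<^sup>2 + 2 * z k * w k) + (LINT u|\<mu>. (\<Sum>k\<in>I. (u k)\<^sup>2)) + m * V"
        using iu iu2 by (simp add: m_def w_def sum.distrib sum_distrib_left)
      finally show ?thesis .
    qed
    then show ?thesis using m V
      by (simp add: ennreal_mult[symmetric] sum_nonneg ennreal_plus[symmetric] del: ennreal_plus)
  qed
  also have "\<dots> \<le> ennreal ((\<Sum>k\<in>I. (y k + drift I (s # l) k)\<^sup>2) + sqvar I (s # l))"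
  proof (rule ennreal_leI)
    have "(\<Sum>k\<in>I. m * (z k)\<^sup>2 + 2 * z k * w k) + (1 - m) * (\<Sum>k\<in>I. (z k)\<^sup>2) = (\<Sum>k\<in>I. (z k)\<^sup>2 + 2 * z k * w k)"
      unfolding sum_distrib_left sum.distrib[symmetric] by (intro sum.cong) (auto simp: algebra_simps)
    also have "\<dots> \<le> (\<Sum>k\<in>I. (y k + drift I (s # l) k)\<^sup>2)"
    proof (intro sum_mono)
      fix k
      \<comment> \<open>Adding \<open>(w k)^2\<close> completes the square to the new mean; this is
        the slack between second moment and variance.\<close>
      have "(z k)\<^sup>2 + 2 * z k * w k \<le> (z k + w k)\<^sup>2" by (simp add: power2_sum)
      also have "z k + w k = y k + drift I (s # l) k" by (simp add: z_def w_def drift_def s)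
      finally show "(z k)\<^sup>2 + 2 * z k * w k \<le> (y k + drift I (s # l) k)\<^sup>2" .
    qed
    finally show "((\<Sum>k\<in>I. m * (z k)\<^sup>2 + 2 * z k * w k) + (LINT u|\<mu>. (\<Sum>k\<in>I. (u k)\<^sup>2)) + m * V) + (1 - m) * ((\<Sum>k\<in>I. (z k)\<^sup>2) + V)
      \<le> (\<Sum>k\<in>I. (y k + drift I (s # l) k)\<^sup>2) + sqvar I (s # l)"
      unfolding distrib_left by (simp add: sqvar_def s V_def left_diff_distrib)
  qed
  finally show ?case .
qed

lemma sum_sq_eq: "(\<Sum>k\<in>I. (x k)\<^sup>2) = (L2_set x I)\<^sup>2"
  by (simp add: L2_set_def sum_nonneg)

text \<open>Cauchy-Schwarz in the form \<open>r \<le> r^2 / (2 * c) + c / 2\<close>, which is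
  optimal at \<open>c = sqrt A\<close>. For \<open>A = 0\<close> no positive \<open>c\<close> is
  optimal and \<open>c\<close> is sent to \<open>0\<close> instead.\<close>

lemma slaw_first_moment_small:
  assumes I: "finite I" and l: "list_all (good_step I) l"
    and i2: "\<And>s. s \<in> set l \<Longrightarrow> integrable (snd s) (\<lambda>u. \<Sum>k\<in>I. (u k)\<^sup>2)"
    and i1: "\<And>s k. s \<in> set l \<Longrightarrow> k \<in> I \<Longrightarrow> integrable (snd s) (\<lambda>u. u k)"
  shows "(\<integral>\<^sup>+x. ennreal (L2_set (\<lambda>k. y k + x k) I) \<partial>slaw I l) \<le>
     ennreal (L2_set (\<lambda>k. y k + drift I l k) I + sqrt (sqvar I l))"
proof -
  interpret L: prob_space "slaw I l" using l by (simp add: prob_space_slaw)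
  define A where "A = (\<Sum>k\<in>I. (y k + drift I l k)\<^sup>2) + sqvar I l"
  have A0: "0 \<le> A" unfolding A_def by (intro add_nonneg_nonneg sum_nonneg sqvar_nonneg) auto
  have [measurable]: "(\<lambda>x. ennreal (\<Sum>k\<in>I. (y k + x k)\<^sup>2)) \<in> borel_measurable (RI I)" using I by measurable
  have key: "(\<integral>\<^sup>+x. ennreal (L2_set (\<lambda>k. y k + x k) I) \<partial>slaw I l) \<le> ennreal (A / (2 * c) + c / 2)" if c: "c > 0" for c
  proof -
    have "(\<integral>\<^sup>+x. ennreal (L2_set (\<lambda>k. y k + x k) I) \<partial>slaw I l) \<le>
       (\<integral>\<^sup>+x. ennreal (1 / (2 * c)) * ennreal (\<Sum>k\<in>I. (y k + x k)\<^sup>2) + ennreal (c / 2) \<partial>slaw I l)"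
    proof (intro nn_integral_mono)
      fix x
      define r where "r = L2_set (\<lambda>k. y k + x k) I"
      have "0 \<le> (r - c)\<^sup>2 / (2 * c)" using c by simp
      also have "\<dots> = r\<^sup>2 / (2 * c) + c / 2 - r" using c by (simp add: power2_diff field_simps power2_eq_square)
      finally have "ennreal r \<le> ennreal (1 / (2 * c) * r\<^sup>2 + c / 2)" by (intro ennreal_leI) simp
      also have "\<dots> = ennreal (1 / (2 * c)) * ennreal (r\<^sup>2) + ennreal (c / 2)"
        using c by (subst ennreal_plus) (auto simp: ennreal_mult[symmetric])
      finally show "ennreal (L2_set (\<lambda>k. y k + x k) I) \<le> ennreal (1 / (2 * c)) * ennreal (\<Sum>k\<in>I. (y k + x k)\<^sup>2) + ennreal (c / 2)"
        by (simp add: sum_sq_eq r_def)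
    qed
    also have "\<dots> = ennreal (1 / (2 * c)) * (\<integral>\<^sup>+x. ennreal (\<Sum>k\<in>I. (y k + x k)\<^sup>2) \<partial>slaw I l) + ennreal (c / 2)"
      using L.emeasure_space_1 by (simp add: nn_integral_add nn_integral_cmult)
    also have "\<dots> \<le> ennreal (1 / (2 * c)) * ennreal A + ennreal (c / 2)"
      unfolding A_def by (intro add_mono mult_left_mono slaw_second_moment assms) auto
    also have "\<dots> = ennreal (A / (2 * c) + c / 2)"
      using c A0 by (simp add: ennreal_mult[symmetric])
    finally show ?thesis .
  qed
  have "(\<integral>\<^sup>+x. ennreal (L2_set (\<lambda>k. y k + x k) I) \<partial>slaw I l) \<le> ennreal (sqrt A)"
  proof (cases "A = 0")
    case True
    show ?thesis
    proof (rule ennreal_le_epsilon)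
      fix e :: real assume "0 < e"
      then show "(\<integral>\<^sup>+x. ennreal (L2_set (\<lambda>k. y k + x k) I) \<partial>slaw I l) \<le> ennreal (sqrt A) + ennreal e"
        using key[of "2 * e"] True by simp
    qed
  next
    case False
    then have "A > 0" using A0 by simp
    then show ?thesis using key[of "sqrt A"] by (simp add: real_div_sqrt field_simps)
  qed
  also have "\<dots> \<le> ennreal (L2_set (\<lambda>k. y k + drift I l k) I + sqrt (sqvar I l))"
  proof (rule ennreal_leI)
    show "sqrt A \<le> L2_set (\<lambda>k. y k + drift I l k) I + sqrt (sqvar I l)"
      unfolding A_def L2_set_def by (rule sqrt_add_le_add_sqrt) (auto intro: sum_nonneg sqvar_nonneg)
  qed
  finally show ?thesis .
qed

text \<open>Large jumps enter through the triangle inequality alone, since only their first moment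
  will be under control. \<open>M\<close> and \<open>c\<close> stand for the mean and the
  fluctuation of the small jumps; the steps in \<open>B\<close> have no deterministic part, so each
  adds just its integral of the norm.\<close>

lemma slaw_first_moment_big:
  assumes I: "finite I" and l: "list_all (good_step I) (B @ l)"
    and small: "\<And>y. (\<integral>\<^sup>+x. ennreal (L2_set (\<lambda>k. y k + x k) I) \<partial>slaw I l) \<le> ennreal (L2_set (\<lambda>k. y k + M k) I + c)"
    and c: "0 \<le> c"
    and B0: "\<And>s. s \<in> set B \<Longrightarrow> fst s = vzero I"
    and i: "\<And>s. s \<in> set B \<Longrightarrow> integrable (snd s) (\<lambda>u. L2_set u I)"
  shows "(\<integral>\<^sup>+x. ennreal (L2_set (\<lambda>k. y k + x k) I) \<partial>slaw I (B @ l)) \<le>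
     ennreal (L2_set (\<lambda>k. y k + M k) I + c + (\<Sum>s\<leftarrow>B. LINT u|snd s. L2_set u I))"
  using l B0 i
proof (induction B arbitrary: y)
  case Nil
  then show ?case using small by simp
next
  case (Cons s B)
  obtain \<mu> where s: "s = (vzero I, \<mu>)" using Cons(3)[of s] by (cases s) auto
  have g: "good_step I (vzero I, \<mu>)" "list_all (good_step I) (B @ l)" using Cons(2) by (simp_all add: s)
  interpret mu: finite_measure \<mu> using g by (simp add: good_step_def)
  note [measurable_cong] = good_step_sets(2)[OF g(1)]
  define m where "m = measure \<mu> (space \<mu>)"
  have m: "0 \<le> m" "m \<le> 1" using good_step_sets(3)[OF g(1)] by (simp_all add: m_def)
  define c' where "c' = c + (\<Sum>s\<leftarrow>B. LINT u|snd s. L2_set u I)"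
  have c': "0 \<le> c'" using c unfolding c'_def
    by (intro add_nonneg_nonneg sum_list_nonneg) (auto intro!: Bochner_Integration.integral_nonneg simp: L2_set_nonneg)
  have iu: "integrable \<mu> (\<lambda>u. L2_set u I)" using Cons(4)[of s] by (simp add: s)
  define a where "a = L2_set (\<lambda>k. y k + M k) I"
  have a: "0 \<le> a" by (simp add: a_def L2_set_nonneg)
  have [measurable]: "(\<lambda>x. ennreal (L2_set (\<lambda>k. y k + x k) I)) \<in> borel_measurable (RI I)" for y using I by measurable
  have IH: "(\<integral>\<^sup>+x. ennreal (L2_set (\<lambda>k. y k + x k) I) \<partial>slaw I (B @ l)) \<le> ennreal (L2_set (\<lambda>k. y k + M k) I + c')" for y
    using Cons.IH[of y] g Cons by (simp add: c'_def add.assoc)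
  have eq: "(\<integral>\<^sup>+x. ennreal (L2_set (\<lambda>k. y k + vadd I d x k) I) \<partial>slaw I (B @ l)) = (\<integral>\<^sup>+x. ennreal (L2_set (\<lambda>k. (y k + d k) + x k) I) \<partial>slaw I (B @ l))" for d
    by (intro nn_integral_cong arg_cong[where f=ennreal] L2_set_cong) (auto simp: algebra_simps)
  have "(\<integral>\<^sup>+x. ennreal (L2_set (\<lambda>k. y k + x k) I) \<partial>slaw I ((s # B) @ l)) =
      (\<integral>\<^sup>+u. \<integral>\<^sup>+x. ennreal (L2_set (\<lambda>k. y k + vadd I (vadd I (vzero I) u) x k) I) \<partial>slaw I (B @ l) \<partial>\<mu>) +
      ennreal (1 - m) * (\<integral>\<^sup>+x. ennreal (L2_set (\<lambda>k. y k + vadd I (vzero I) x k) I) \<partial>slaw I (B @ l))"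
    unfolding s m_def append_Cons by (rule nn_integral_slaw_Cons(2)[OF g]) measurable
  also have "\<dots> \<le> (\<integral>\<^sup>+u. ennreal (a + L2_set u I + c') \<partial>\<mu>) + ennreal (1 - m) * ennreal (a + c')"
  proof (intro add_mono mult_left_mono nn_integral_mono)
    fix u
    have "L2_set (\<lambda>k. y k + vadd I (vzero I) u k + M k) I = L2_set (\<lambda>k. (y k + M k) + u k) I"
      by (intro L2_set_cong) auto
    also have "\<dots> \<le> a + L2_set u I" unfolding a_def by (rule L2_set_triangle_ineq)
    finally show "(\<integral>\<^sup>+x. ennreal (L2_set (\<lambda>k. y k + vadd I (vadd I (vzero I) u) x k) I) \<partial>slaw I (B @ l)) \<le> ennreal (a + L2_set u I + c')"
      unfolding eq by (intro order_trans[OF IH] ennreal_leI) simp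
    have "L2_set (\<lambda>k. y k + vzero I k + M k) I = a"
      unfolding a_def by (intro L2_set_cong) auto
    then show "(\<integral>\<^sup>+x. ennreal (L2_set (\<lambda>k. y k + vadd I (vzero I) x k) I) \<partial>slaw I (B @ l)) \<le> ennreal (a + c')"
      using IH[of "\<lambda>k. y k + vzero I k"] unfolding eq by simp
  qed simp
  also have "(\<integral>\<^sup>+u. ennreal (a + L2_set u I + c') \<partial>\<mu>) = ennreal (LINT u|\<mu>. a + L2_set u I + c')"
    by (rule nn_integral_eq_integral) (use iu a c' in \<open>auto simp: L2_set_nonneg\<close>)
  also have "(LINT u|\<mu>. a + L2_set u I + c') = m * a + (LINT u|\<mu>. L2_set u I) + m * c'"
    using iu by (simp add: m_def)
  also have "ennreal (m * a + (LINT u|\<mu>. L2_set u I) + m * c') + ennreal (1 - m) * ennreal (a + c') =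
     ennreal (a + c' + (LINT u|\<mu>. L2_set u I))"
  proof -
    have "0 \<le> (LINT u|\<mu>. L2_set u I)" by (intro Bochner_Integration.integral_nonneg) (simp add: L2_set_nonneg)
    then have "ennreal (m * a + (LINT u|\<mu>. L2_set u I) + m * c') + ennreal (1 - m) * ennreal (a + c') =
      ennreal ((m * a + (LINT u|\<mu>. L2_set u I) + m * c') + (1 - m) * (a + c'))" using m a c'
      by (subst ennreal_mult[symmetric]) (auto intro!: ennreal_plus[symmetric])
    also have "(m * a + (LINT u|\<mu>. L2_set u I) + m * c') + (1 - m) * (a + c') = a + c' + (LINT u|\<mu>. L2_set u I)"
      by (simp add: algebra_simps)
    finally show ?thesis .
  qed
  finally show ?case by (simp add: a_def c'_def s algebra_simps)
qed

text \<open>Only the paths with no jump or exactly one jump among the \<open>n\<close> equal steps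
  are kept; \<open>e\<close> is the probability that a step does not jump, and
  \<open>\<kappa>\<close> is the loss caused by the remaining walk \<open>l\<close>. In the
  induction the first step either makes the single jump, after which the term without jumps is used,
  or does nothing.\<close>

lemma slaw_replicate_lower:
  fixes \<phi> :: "('i \<Rightarrow> real) \<Rightarrow> ennreal"
  assumes l: "list_all (good_step I) l" and g: "good_step I (vzero I, \<mu>)"
    and \<phi>[measurable]: "\<phi> \<in> borel_measurable (RI I)"
    and low: "\<And>y. y \<in> space (RI I) \<Longrightarrow> \<kappa> * \<phi> y \<le> (\<integral>\<^sup>+x. \<phi> (vadd I y x) \<partial>slaw I l)"
    and y: "y \<in> space (RI I)"
  defines "e \<equiv> ennreal (1 - measure \<mu> (space \<mu>))"
  shows "\<kappa> * (e ^ n * \<phi> y + of_nat n * e ^ (n - 1) * (\<integral>\<^sup>+u. \<phi> (vadd I y u) \<partial>\<mu>)) \<le>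
    (\<integral>\<^sup>+x. \<phi> (vadd I y x) \<partial>slaw I (replicate n (vzero I, \<mu>) @ l))"
  using y
proof (induction n arbitrary: y)
  case 0
  then show ?case using low by simp
next
  case (Suc n)
  note [measurable_cong] = good_step_sets(2)[OF g]
  note [measurable] = Suc(2)
  have sp: "space \<mu> = space (RI I)" by (rule sets_eq_imp_space_eq) (rule good_step_sets[OF g])
  let ?L = "slaw I (replicate n (vzero I, \<mu>) @ l)"
  have gl: "list_all (good_step I) (replicate n (vzero I, \<mu>) @ l)"
    using l g by (auto simp: list_all_iff)
  interpret L: prob_space ?L using gl by (rule prob_space_slaw)
  define K where "K y = (\<integral>\<^sup>+u. \<phi> (vadd I y u) \<partial>\<mu>)" for y
  \<comment> \<open>For \<open>n = 0\<close> the exponent \<open>n - 1\<close> is truncated to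
    \<open>0\<close>, but there the factor \<open>n\<close> vanishes.\<close>
  have pw: "of_nat n * e ^ (n - 1) * e = of_nat n * e ^ n"
    by (cases n) (auto simp: algebra_simps)
  have "\<kappa> * (e ^ Suc n * \<phi> y + of_nat (Suc n) * e ^ (Suc n - 1) * K y) =
     \<kappa> * (e ^ n * K y) + e * (\<kappa> * (e ^ n * \<phi> y + of_nat n * e ^ (n - 1) * K y))"
  proof -
    have 1: "e * (\<kappa> * (of_nat n * e ^ (n - 1) * K y)) = \<kappa> * (of_nat n * e ^ n * K y)"
      unfolding pw[symmetric] by (simp only: mult_ac)
    show ?thesis unfolding distrib_left 1 by (simp add: algebra_simps)
  qed
  also have "\<dots> \<le> \<kappa> * (e ^ n * K y) + e * (\<integral>\<^sup>+x. \<phi> (vadd I y x) \<partial>?L)"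
    unfolding K_def by (intro add_mono mult_left_mono Suc order_refl) simp
  also have "\<kappa> * (e ^ n * K y) = (\<integral>\<^sup>+u. \<kappa> * (e ^ n * \<phi> (vadd I y u)) \<partial>\<mu>)"
    unfolding K_def by (simp add: nn_integral_cmult)
  also have "\<dots> \<le> (\<integral>\<^sup>+u. (\<integral>\<^sup>+x. \<phi> (vadd I (vadd I y u) x) \<partial>?L) \<partial>\<mu>)"
  proof (intro nn_integral_mono)
    fix u
    have "\<kappa> * (e ^ n * \<phi> (vadd I y u)) \<le> \<kappa> * (e ^ n * \<phi> (vadd I y u) + of_nat n * e ^ (n - 1) * (\<integral>\<^sup>+x. \<phi> (vadd I (vadd I y u) x) \<partial>\<mu>))"
      by (intro mult_left_mono) auto
    also have "\<dots> \<le> (\<integral>\<^sup>+x. \<phi> (vadd I (vadd I y u) x) \<partial>?L)" by (rule Suc.IH) simp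
    finally show "\<kappa> * (e ^ n * \<phi> (vadd I y u)) \<le> (\<integral>\<^sup>+x. \<phi> (vadd I (vadd I y u) x) \<partial>?L)" .
  qed
  also have "(\<integral>\<^sup>+u. (\<integral>\<^sup>+x. \<phi> (vadd I (vadd I y u) x) \<partial>?L) \<partial>\<mu>) + e * (\<integral>\<^sup>+x. \<phi> (vadd I y x) \<partial>?L) =
     (\<integral>\<^sup>+x. \<phi> (vadd I y x) \<partial>slaw I ((vzero I, \<mu>) # (replicate n (vzero I, \<mu>) @ l)))"
  proof (subst nn_integral_slaw_Cons(2)[OF g gl])
    show "(\<lambda>x. \<phi> (vadd I y x)) \<in> borel_measurable (RI I)" by measurable
    have 1: "vadd I y (vadd I (vadd I (vzero I) u) x) = vadd I (vadd I y u) x" for u x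
      by (auto simp: vadd_def vzero_def fun_eq_iff)
    have 2: "vadd I y (vadd I (vzero I) x) = vadd I y x" for x
      by (auto simp: vadd_def vzero_def fun_eq_iff)
    show "(\<integral>\<^sup>+u. (\<integral>\<^sup>+x. \<phi> (vadd I (vadd I y u) x) \<partial>?L) \<partial>\<mu>) + e * (\<integral>\<^sup>+x. \<phi> (vadd I y x) \<partial>?L) =
      (\<integral>\<^sup>+u. (\<integral>\<^sup>+x. \<phi> (vadd I y (vadd I (vadd I (vzero I) u) x)) \<partial>?L) \<partial>\<mu>) + ennreal (1 - measure \<mu> (space \<mu>)) * (\<integral>\<^sup>+x. \<phi> (vadd I y (vadd I (vzero I) x)) \<partial>?L)"
      unfolding 1 2 e_def ..
  qed
  finally show ?case by (simp add: K_def)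
qed

text \<open>Jensen's inequality in linear form: \<open>exp (t * c - z) \<ge> 1 + t * c - z\<close>,
  and the right side has mean at least \<open>1\<close> when \<open>z = t |x|\<close> has mean at
  most \<open>t * c\<close>. The reverse triangle inequality reduces the claim to the factor
  \<open>exp (- z)\<close>, which is at most \<open>1\<close>, so the cap \<open>K\<close> survives
  the multiplication.\<close>

lemma slaw_exp_lower:
  assumes I: "finite I" and l: "list_all (good_step I) l" and t: "0 \<le> t" and K: "0 \<le> K"
    and c: "(\<integral>\<^sup>+x. ennreal (L2_set x I) \<partial>slaw I l) \<le> ennreal c" "0 \<le> c"
    and y: "y \<in> space (RI I)"
  shows "ennreal (exp (- (t * c))) * ennreal (min (exp (t * L2_set y I)) K) \<le>
    (\<integral>\<^sup>+x. ennreal (min (exp (t * L2_set (vadd I y x) I)) K) \<partial>slaw I l)"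
proof -
  interpret L: prob_space "slaw I l" using l by (rule prob_space_slaw)
  define \<phi> where "\<phi> y = min (exp (t * L2_set y I)) K" for y :: "'a \<Rightarrow> real"
  have \<phi>0: "0 \<le> \<phi> z" for z using K by (simp add: \<phi>_def)
  have [measurable]: "\<phi> \<in> borel_measurable (RI I)" "(\<lambda>x. L2_set x I) \<in> borel_measurable (RI I)"
    unfolding \<phi>_def[abs_def] using I by measurable
  note [measurable] = y
  have iL: "integrable (slaw I l) (\<lambda>x. L2_set x I)"
    using c by (subst integrable_iff_bounded) (auto simp: L2_set_nonneg intro: order_le_less_trans)
  have "ennreal (LINT x|slaw I l. L2_set x I) \<le> ennreal c"
    using c nn_integral_eq_integral[OF iL] by (simp add: L2_set_nonneg)
  then have Lc: "(LINT x|slaw I l. L2_set x I) \<le> c" using c by (simp add: ennreal_le_iff)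
  have point: "exp (- (t * c)) * \<phi> y * (1 + t * c - t * L2_set x I) \<le> \<phi> (vadd I y x)" for x
  proof -
    have "exp (- (t * c)) * \<phi> y * (1 + (t * c - t * L2_set x I)) \<le> exp (- (t * c)) * \<phi> y * exp (t * c - t * L2_set x I)"
      using \<phi>0 by (intro mult_left_mono exp_ge_add_one_self mult_nonneg_nonneg) auto
    also have "\<dots> = \<phi> y * exp (- (t * L2_set x I))" by (simp add: mult_ac flip: exp_add)
    also have "\<dots> \<le> \<phi> (vadd I y x)"
    proof -
      have "L2_set y I = L2_set (\<lambda>k. vadd I y x k + (- x k)) I" by (intro L2_set_cong) auto
      also have "\<dots> \<le> L2_set (vadd I y x) I + L2_set (\<lambda>k. - x k) I" by (rule L2_set_triangle_ineq)
      also have "L2_set (\<lambda>k. - x k) I = L2_set x I" by (simp add: L2_set_def)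
      finally have "t * L2_set y I + - (t * L2_set x I) \<le> t * L2_set (vadd I y x) I"
        using t mult_left_mono[of "L2_set y I" "L2_set (vadd I y x) I + L2_set x I" t] by (simp add: distrib_left)
      then have 1: "exp (t * L2_set y I) * exp (- (t * L2_set x I)) \<le> exp (t * L2_set (vadd I y x) I)"
        by (simp flip: exp_add)
      have 2: "K * exp (- (t * L2_set x I)) \<le> K"
        using t K by (intro mult_left_le) (auto simp: L2_set_nonneg)
      have "\<phi> y * exp (- (t * L2_set x I)) = min (exp (t * L2_set y I) * exp (- (t * L2_set x I))) (K * exp (- (t * L2_set x I)))"
        unfolding \<phi>_def by (simp add: min_mult_distrib_right)
      also have "\<dots> \<le> \<phi> (vadd I y x)" unfolding \<phi>_def using 1 2 by (intro min.mono)
      finally show ?thesis .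
    qed
    finally show ?thesis by (simp add: algebra_simps)
  qed
  have "exp (- (t * c)) * \<phi> y * 1 \<le> exp (- (t * c)) * \<phi> y * (1 + t * c - t * (LINT x|slaw I l. L2_set x I))"
    using Lc t \<phi>0 by (intro mult_left_mono) (auto intro!: mult_left_mono)
  also have "\<dots> = (LINT x|slaw I l. exp (- (t * c)) * \<phi> y * (1 + t * c - t * L2_set x I))"
    using iL L.prob_space by simp
  also have "\<dots> \<le> (LINT x|slaw I l. \<phi> (vadd I y x))"
  proof (intro integral_mono point)
    show "integrable (slaw I l) (\<lambda>x. \<phi> (vadd I y x))"
      by (rule L.integrable_const_bound[where B=K]) (use \<phi>0 in \<open>auto simp: \<phi>_def\<close>)
  qed (use iL in simp)
  finally have "ennreal (exp (- (t * c)) * \<phi> y) \<le> ennreal (LINT x|slaw I l. \<phi> (vadd I y x))"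
    by (intro ennreal_leI) simp
  also have "\<dots> = (\<integral>\<^sup>+x. ennreal (\<phi> (vadd I y x)) \<partial>slaw I l)"
  proof (rule nn_integral_eq_integral[symmetric])
    show "integrable (slaw I l) (\<lambda>x. \<phi> (vadd I y x))"
      by (rule L.integrable_const_bound[where B=K]) (use \<phi>0 in \<open>auto simp: \<phi>_def\<close>)
  qed (use \<phi>0 in auto)
  finally show ?thesis using \<phi>0 by (simp add: ennreal_mult \<phi>_def)
qed

section \<open>Infinitely divisible laws\<close>

text \<open>Both \<open>1 + c / n\<close> and \<open>exp (c / n)\<close> lie in the unit disc, so
  their powers differ by at most \<open>n\<close> times their difference, which is of second order
  in \<open>c / n\<close>. The constant \<open>3\<close> bounds \<open>exp 1\<close> in the Taylor
  remainder.\<close>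

lemma norm_one_plus_power_minus_exp:
  fixes c :: complex
  assumes n: "0 < n" "cmod c \<le> real n" and r: "Re c \<le> 0" and o: "cmod (1 + c / of_nat n) \<le> 1"
  shows "cmod ((1 + c / of_nat n) ^ n - exp c) \<le> 3 * (cmod c)\<^sup>2 / real n"
proof -
  define z where "z = c / of_nat n"
  have z: "cmod z \<le> 1" "Re z \<le> 0" using n r by (auto simp: z_def norm_divide divide_nonpos_nonneg)
  have "cmod (exp z - (1 + z)) \<le> exp \<bar>Re z\<bar> * (cmod z)\<^sup>2"
    using Taylor_exp[of z 1] by (simp add: power2_eq_square)
  also have "\<dots> \<le> 3 * (cmod z)\<^sup>2"
  proof (rule mult_right_mono)
    have "exp \<bar>Re z\<bar> \<le> exp 1" using z(1) abs_Re_le_cmod[of z] by (subst exp_le_cancel_iff) linarith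
    then show "exp \<bar>Re z\<bar> \<le> 3" using exp_le by linarith
  qed simp
  finally have 1: "cmod (exp z - (1 + z)) \<le> 3 * (cmod z)\<^sup>2" .
  have "exp c = exp z ^ n" using n by (simp add: z_def flip: exp_of_nat_mult)
  then have "cmod ((1 + z) ^ n - exp c) = cmod ((1 + z) ^ n - exp z ^ n)" by simp
  also have "\<dots> \<le> real n * cmod ((1 + z) - exp z)"
    using o z by (intro norm_power_diff) (auto simp: z_def)
  also have "\<dots> \<le> real n * (3 * (cmod z)\<^sup>2)"
    using 1 by (intro mult_left_mono) (auto simp: norm_minus_commute)
  also have "\<dots> = 3 * (cmod c)\<^sup>2 / real n"
    using n by (simp add: z_def norm_divide power2_eq_square)
  finally show ?thesis by (simp add: z_def)
qed

section \<open>Restricted and rescaled measures\<close>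

definition restr :: "'a measure \<Rightarrow> 'a set \<Rightarrow> real \<Rightarrow> 'a measure" where
  "restr M S c = density M (\<lambda>u. ennreal (c * indicator S u))"

lemma sets_restr[simp]: "sets (restr M S c) = sets M"
  and space_restr[simp]: "space (restr M S c) = space M"
  by (simp_all add: restr_def)

lemma nn_integral_restr:
  assumes S: "S \<in> sets M" "0 \<le> c" and f: "f \<in> borel_measurable M"
  shows "(\<integral>\<^sup>+u. f u \<partial>restr M S c) = ennreal c * (\<integral>\<^sup>+u. f u * indicator S u \<partial>M)"
proof -
  note [measurable] = S(1) f
  have "(\<integral>\<^sup>+u. f u \<partial>restr M S c) = (\<integral>\<^sup>+u. ennreal (c * indicator S u) * f u \<partial>M)"
    unfolding restr_def by (rule nn_integral_density) (use S f in auto)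
  also have "\<dots> = (\<integral>\<^sup>+u. ennreal c * (f u * indicator S u) \<partial>M)"
    by (intro nn_integral_cong) (auto simp: indicator_def)
  finally show ?thesis using S f by (simp add: nn_integral_cmult)
qed

lemma integral_restr:
  fixes f :: "'a \<Rightarrow> 'b::{banach, second_countable_topology}"
  assumes S: "S \<in> sets M" "0 \<le> c" and f: "f \<in> borel_measurable M"
  shows "(LINT u|restr M S c. f u) = c *\<^sub>R (LINT u:S|M. f u)"
proof -
  have "(LINT u|restr M S c. f u) = (LINT u|M. (c * indicator S u) *\<^sub>R f u)"
    unfolding restr_def by (rule integral_density) (use S f in auto)
  also have "\<dots> = (LINT u|M. c *\<^sub>R (indicator S u *\<^sub>R f u))" by (simp only: scaleR_scaleR)
  also have "\<dots> = c *\<^sub>R (LINT u:S|M. f u)" unfolding set_lebesgue_integral_def by (rule integral_scaleR_right)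
  finally show ?thesis .
qed

lemma integrable_restr:
  fixes f :: "'a \<Rightarrow> 'b::{banach, second_countable_topology}"
  assumes S: "S \<in> sets M" "0 \<le> c" and f: "f \<in> borel_measurable M" and i: "set_integrable M S f"
  shows "integrable (restr M S c) f"
proof -
  have "integrable M (\<lambda>u. c *\<^sub>R (indicator S u *\<^sub>R f u))" using i unfolding set_integrable_def by (rule integrable_scaleR_right)
  then have "integrable M (\<lambda>u. (c * indicator S u) *\<^sub>R f u)" by (simp only: scaleR_scaleR)
  then show ?thesis unfolding restr_def using S f by (subst integrable_density) auto
qed

lemma finite_restr:
  assumes S: "S \<in> sets M" "0 \<le> c" "emeasure M S < \<infinity>"
  shows "finite_measure (restr M S c)" "measure (restr M S c) (space (restr M S c)) = c * measure M S"
proof -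
  have e: "emeasure (restr M S c) (space (restr M S c)) = ennreal c * emeasure M S"
    using nn_integral_restr[OF S(1,2), of "\<lambda>_. 1"] S by (simp add: nn_integral_const)
  then show "finite_measure (restr M S c)"
    using S by (intro finite_measureI) (auto simp: ennreal_mult_eq_top_iff less_top)
  show "measure (restr M S c) (space (restr M S c)) = c * measure M S"
    using e S unfolding measure_def by (simp add: enn2real_mult)
qed

lemma set_integrable_bounded:
  fixes f :: "'a \<Rightarrow> 'b::{banach, second_countable_topology}"
  assumes "S \<in> sets M" "emeasure M S < \<infinity>" "f \<in> borel_measurable M" "\<And>x. x \<in> S \<Longrightarrow> norm (f x) \<le> B"
  shows "set_integrable M S f"
  unfolding set_integrable_def
  by (rule Bochner_Integration.integrable_bound[of _ "\<lambda>x. B * indicator S x"])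
     (use assms in \<open>auto intro!: AE_I2 split: split_indicator simp: integrable_indicator_iff intro: order_trans[OF _ abs_ge_self]\<close>)

lemma set_integral_i_of_real:
  assumes "set_integrable M S f"
  shows "set_integrable M S (\<lambda>u. \<i> * complex_of_real (f u))"
    "(LINT u:S|M. \<i> * complex_of_real (f u)) = \<i> * complex_of_real (LINT u:S|M. f u)"
proof -
  have e: "indicator S u *\<^sub>R (\<i> * complex_of_real (f u)) = \<i> * complex_of_real (indicator S u *\<^sub>R f u)" for u
    by (simp add: indicator_def)
  show "set_integrable M S (\<lambda>u. \<i> * complex_of_real (f u))"
    using assms unfolding set_integrable_def e by (intro integrable_mult_right integrable_of_real)
  show "(LINT u:S|M. \<i> * complex_of_real (f u)) = \<i> * complex_of_real (LINT u:S|M. f u)"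
    unfolding set_lebesgue_integral_def e integral_mult_right_zero integral_complex_of_real ..
qed

section \<open>Levy measures and compensation at a variable level\<close>

locale levy_law =
  fixes I :: "'i set" and \<beta> :: "'i \<Rightarrow> real" and \<nu> P :: "('i \<Rightarrow> real) measure"
  assumes fin: "finite I"
    and sets_nu: "sets \<nu> = sets (RI I)"
    and nu_zero: "emeasure \<nu> {vzero I} = 0"
    and nu_min: "(\<integral>\<^sup>+u. ennreal (min 1 ((L2_set u I)\<^sup>2)) \<partial>\<nu>) < \<infinity>"
    and prob_P: "prob_space P"
    and sets_P: "sets P = sets (RI I)"
    and char_P: "\<And>t. t \<in> space (RI I) \<Longrightarrow> charI I P t = exp (\<i> * complex_of_real (dot I t \<beta>) +
      (LINT u|\<nu>. iexp (dot I t u) - 1 - \<i> * complex_of_real (dot I t u * indicator {u. L2_set u I \<le> 1} u)))"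
begin

interpretation P: prob_space P by (rule prob_P)

lemma space_nu: "space \<nu> = space (RI I)"
  by (rule sets_eq_imp_space_eq) (rule sets_nu)

lemma measurable_nu_eq: "measurable \<nu> N = measurable (RI I) N"
  by (rule measurable_cong_sets) (simp_all add: sets_nu)

lemma comp_meas: "k \<in> I \<Longrightarrow> (\<lambda>u. u k) \<in> borel_measurable \<nu>"
  unfolding measurable_nu_eq by measurable

lemma nrm_meas: "(\<lambda>u. L2_set u I) \<in> borel_measurable \<nu>"
  unfolding measurable_nu_eq using fin by measurable

lemma dot_meas: "(\<lambda>u. dot I t u) \<in> borel_measurable \<nu>"
  unfolding measurable_nu_eq using dot_measurable[OF fin] .

definition tail :: "real \<Rightarrow> ('i \<Rightarrow> real) set" where
  "tail r = {u \<in> space \<nu>. r < L2_set u I}"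

definition shell :: "real \<Rightarrow> real \<Rightarrow> ('i \<Rightarrow> real) set" where
  "shell e r = {u \<in> space \<nu>. e < L2_set u I \<and> L2_set u I \<le> r}"

lemma tail_sets[simp]: "tail r \<in> sets \<nu>"
  and shell_sets[simp]: "shell e r \<in> sets \<nu>"
  unfolding tail_def shell_def using nrm_meas by measurable

lemma integrable_min: "integrable \<nu> (\<lambda>u. min 1 ((L2_set u I)\<^sup>2))"
  using nu_min nrm_meas by (subst integrable_iff_bounded) (auto simp: L2_set_nonneg)

lemma tail_finite: "0 < r \<Longrightarrow> emeasure \<nu> (tail r) < \<infinity>"
proof -
  assume r: "0 < r"
  have "ennreal (min 1 (r\<^sup>2)) * emeasure \<nu> (tail r) = (\<integral>\<^sup>+u. ennreal (min 1 (r\<^sup>2)) * indicator (tail r) u \<partial>\<nu>)"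
    by (simp add: nn_integral_cmult_indicator)
  also have "\<dots> \<le> (\<integral>\<^sup>+u. ennreal (min 1 ((L2_set u I)\<^sup>2)) \<partial>\<nu>)"
  proof (intro nn_integral_mono)
    fix u
    have "r < L2_set u I \<Longrightarrow> r\<^sup>2 \<le> (L2_set u I)\<^sup>2" using r by (intro power_mono) auto
    then show "ennreal (min 1 (r\<^sup>2)) * indicator (tail r) u \<le> ennreal (min 1 ((L2_set u I)\<^sup>2))"
      by (auto simp: tail_def indicator_def intro!: ennreal_leI min.mono)
  qed
  finally have "ennreal (min 1 (r\<^sup>2)) * emeasure \<nu> (tail r) < \<infinity>" using nu_min by (rule order_le_less_trans)
  moreover have "min 1 (r\<^sup>2) > 0" using r by simp
  ultimately show ?thesis by (auto simp: ennreal_mult_less_top)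
qed

lemma shell_finite: "0 < e \<Longrightarrow> emeasure \<nu> (shell e r) < \<infinity>"
  by (rule order_le_less_trans[OF emeasure_mono[OF _ tail_sets] tail_finite]) (auto simp: shell_def tail_def)

lemma square_integrable: "set_integrable \<nu> {u \<in> space \<nu>. L2_set u I \<le> r} (\<lambda>u. (L2_set u I)\<^sup>2)"
  unfolding set_integrable_def
proof (rule Bochner_Integration.integrable_bound)
  show "integrable \<nu> (\<lambda>u. max 1 (r\<^sup>2) * min 1 ((L2_set u I)\<^sup>2))" using integrable_min by simp
  note [measurable] = nrm_meas
  show "(\<lambda>u. indicat_real {u \<in> space \<nu>. L2_set u I \<le> r} u *\<^sub>R (L2_set u I)\<^sup>2) \<in> borel_measurable \<nu>" by measurable
  show "AE u in \<nu>. norm (indicat_real {u \<in> space \<nu>. L2_set u I \<le> r} u *\<^sub>R (L2_set u I)\<^sup>2) \<le> norm (max 1 (r\<^sup>2) * min 1 ((L2_set u I)\<^sup>2))"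
  proof (intro AE_I2)
    fix u
    define q where "q = (L2_set u I)\<^sup>2"
    have q: "0 \<le> q" by (simp add: q_def)
    have a: "q \<le> max 1 (r\<^sup>2) * min 1 q" if "L2_set u I \<le> r"
    proof (cases "q \<le> 1")
      case True
      then show ?thesis using mult_right_mono[of 1 "max 1 (r\<^sup>2)" q] q by simp
    next
      case False
      have "q \<le> r\<^sup>2" unfolding q_def using that by (intro power_mono) (auto simp: L2_set_nonneg)
      then show ?thesis using False by simp
    qed
    have b: "0 \<le> max 1 (r\<^sup>2) * min 1 q" using q by simp
    show "norm (indicat_real {u \<in> space \<nu>. L2_set u I \<le> r} u *\<^sub>R (L2_set u I)\<^sup>2) \<le> norm (max 1 (r\<^sup>2) * min 1 ((L2_set u I)\<^sup>2))"
      unfolding q_def[symmetric] using a b q by (auto simp: indicator_def)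
  qed
qed

definition V2r :: "real \<Rightarrow> real" where
  "V2r r = (LINT u:{u \<in> space \<nu>. L2_set u I \<le> r}|\<nu>. (L2_set u I)\<^sup>2)"

text \<open>The drift that belongs to compensation of the jumps up to \<open>r\<close> instead of
  \<open>1\<close>; at most one of the two shells is nonempty. For \<open>r = p_gam\<close> its norm
  is \<open>E_gam\<close>.\<close>

definition betar :: "real \<Rightarrow> 'i \<Rightarrow> real" where
  "betar r k = \<beta> k - (LINT u:shell r 1|\<nu>. u k) + (LINT u:shell 1 r|\<nu>. u k)"

definition expo :: "real \<Rightarrow> ('i \<Rightarrow> real) \<Rightarrow> ('i \<Rightarrow> real) \<Rightarrow> complex" where
  "expo r t u = iexp (dot I t u) - 1 - \<i> * complex_of_real (dot I t u * indicator {u. L2_set u I \<le> r} u)"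

lemma expo_meas: "expo r t \<in> borel_measurable \<nu>"
proof -
  note [measurable] = dot_meas nrm_meas
  show ?thesis unfolding expo_def[abs_def] indicator_def mem_Collect_eq by measurable
qed

lemma abs_dot_le: "\<bar>dot I t u\<bar> \<le> L2_set t I * L2_set u I"
proof -
  have "\<bar>dot I t u\<bar> \<le> (\<Sum>k\<in>I. \<bar>t k\<bar> * \<bar>u k\<bar>)" unfolding dot_def by (rule order_trans[OF sum_abs]) (simp add: abs_mult)
  then show ?thesis using L2_set_mult_ineq[of t u I] by linarith
qed

lemma iexp_remainder2: "cmod (iexp x - 1 - \<i> * complex_of_real x) \<le> x\<^sup>2"
proof -
  have "cmod (iexp x - 1 - \<i> * complex_of_real x) \<le> \<bar>x\<bar>\<^sup>2 / 2"
    using iexp_approx1[of x 1] by (simp add: power2_eq_square algebra_simps)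
  also have "\<dots> \<le> x\<^sup>2" by simp
  finally show ?thesis .
qed

lemma iexp_remainder0: "cmod (iexp x - 1) \<le> 2"
  using norm_triangle_ineq4[of "iexp x" 1] by simp

lemma expo_bound_small: "L2_set u I \<le> r \<Longrightarrow> cmod (expo r t u) \<le> (L2_set t I)\<^sup>2 * (L2_set u I)\<^sup>2"
proof -
  assume "L2_set u I \<le> r"
  then have "cmod (expo r t u) \<le> (dot I t u)\<^sup>2"
    unfolding expo_def using iexp_remainder2[of "dot I t u"] by simp
  also have "\<dots> \<le> (L2_set t I * L2_set u I)\<^sup>2"
    using abs_dot_le[of t u] power_mono[of "\<bar>dot I t u\<bar>" "L2_set t I * L2_set u I" 2] by simp
  finally show ?thesis by (simp add: power_mult_distrib)
qed

lemma expo_bound_big: "r < L2_set u I \<Longrightarrow> cmod (expo r t u) \<le> 2"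
  unfolding expo_def using iexp_remainder0[of "dot I t u"] by simp

text \<open>The integrand is of second order in the ball and bounded by \<open>2\<close> in the
  tail. Finiteness of the tail is assumed rather than \<open>0 < r\<close>, because the level
  \<open>p_gam\<close> to which this is applied may be \<open>0\<close>.\<close>

lemma set_integrable_expo:
  shows "set_integrable \<nu> {u \<in> space \<nu>. L2_set u I \<le> r} (expo r t)"
    and "emeasure \<nu> (tail r) < \<infinity> \<Longrightarrow> set_integrable \<nu> (tail r) (expo r t)"
    and "emeasure \<nu> (tail r) < \<infinity> \<Longrightarrow> integrable \<nu> (expo r t)"
proof -
  note [measurable] = nrm_meas expo_meas
  show 1: "set_integrable \<nu> {u \<in> space \<nu>. L2_set u I \<le> r} (expo r t)"
    unfolding set_integrable_def
  proof (rule Bochner_Integration.integrable_bound)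
    show "integrable \<nu> (\<lambda>u. (L2_set t I)\<^sup>2 * (indicator {u \<in> space \<nu>. L2_set u I \<le> r} u *\<^sub>R (L2_set u I)\<^sup>2))"
      using square_integrable[of r] by (auto simp: set_integrable_def)
    show "AE u in \<nu>. cmod (indicat_real {u \<in> space \<nu>. L2_set u I \<le> r} u *\<^sub>R expo r t u)
        \<le> norm ((L2_set t I)\<^sup>2 * (indicat_real {u \<in> space \<nu>. L2_set u I \<le> r} u *\<^sub>R (L2_set u I)\<^sup>2))"
      using expo_bound_small[of _ r t] by (auto split: split_indicator)
  qed measurable
  show 2: "set_integrable \<nu> (tail r) (expo r t)" if "emeasure \<nu> (tail r) < \<infinity>"
    by (rule set_integrable_bounded[where B=2]) (use that expo_meas expo_bound_big in \<open>auto simp: tail_def\<close>)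
  show "integrable \<nu> (expo r t)" if "emeasure \<nu> (tail r) < \<infinity>"
  proof -
    have "set_integrable \<nu> ({u \<in> space \<nu>. L2_set u I \<le> r} \<union> tail r) (expo r t)"
      using 1 2[OF that] by (rule set_integrable_Un) auto
    moreover have "{u \<in> space \<nu>. L2_set u I \<le> r} \<union> tail r = space \<nu>" by (auto simp: tail_def)
    ultimately have "set_integrable \<nu> (space \<nu>) (expo r t)" by simp
    then show ?thesis unfolding set_integrable_def
      by (rule Bochner_Integration.integrable_cong[THEN iffD1, rotated 2]) auto
  qed
qed

end

section \<open>Approximation by compound Poisson walks\<close>

context levy_law
begin

interpretation P: prob_space P by (rule prob_P)

text \<open>The exponent of the compound Poisson law whose jump measure is \<open>\<nu>\<close>
  restricted to \<open>S\<close>.\<close>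

definition cexp :: "('i \<Rightarrow> real) set \<Rightarrow> ('i \<Rightarrow> real) \<Rightarrow> complex" where
  "cexp S t = (LINT u:S|\<nu>. iexp (dot I t u) - 1)"

definition eps :: "nat \<Rightarrow> real" where "eps m = 1 / (real m + 1)"

text \<open>Quadratic in the masses, because \<open>(1 + c / n) ^ n\<close> differs from
  \<open>exp c\<close> by an error of order \<open>|c|^2 / n\<close>; the factor
  \<open>m + 1\<close> sends this error to \<open>0\<close>. The same number serves the small and
  the large jumps.\<close>

definition num :: "real \<Rightarrow> nat \<Rightarrow> nat" where
  "num r m = nat \<lceil>(real m + 1) * (1 + measure \<nu> (shell (eps m) r) + measure \<nu> (tail r))\<^sup>2\<rceil>"

text \<open>The mean of the jumps in the shell is subtracted, so the walk \<open>smalls\<close> has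
  mean exactly \<open>betar r\<close>.\<close>

definition bvec :: "real \<Rightarrow> nat \<Rightarrow> 'i \<Rightarrow> real" where
  "bvec r m k = betar r k - (LINT u:shell (eps m) r|\<nu>. u k)"

text \<open>\<open>bigs r m\<close> and \<open>smalls r m\<close> approximate the jumps above and below \<open>r\<close>; the number of steps grows
  fast enough that the compound Poisson characteristic function is reached although \<open>\<nu>\<close> may explode at \<open>0\<close>.\<close>

definition smalls :: "real \<Rightarrow> nat \<Rightarrow> (('i \<Rightarrow> real) \<times> ('i \<Rightarrow> real) measure) list" where
  "smalls r m = replicate (num r m) ((\<lambda>k\<in>I. bvec r m k / real (num r m)), restr \<nu> (shell (eps m) r) (1 / real (num r m)))"

definition bigs :: "real \<Rightarrow> nat \<Rightarrow> (('i \<Rightarrow> real) \<times> ('i \<Rightarrow> real) measure) list" where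
  "bigs r m = replicate (num r m) (vzero I, restr \<nu> (tail r) (1 / real (num r m)))"

lemma eps_pos: "0 < eps m" by (simp add: eps_def)

lemma shell_eps_finite: "emeasure \<nu> (shell (eps m) r) < \<infinity>"
  by (intro shell_finite eps_pos)

text \<open>The first estimate controls the error of the power limit; the second, from
  \<open>1 + 2 * a \<le> (1 + a)^2\<close>, keeps the mass of each step at most \<open>1\<close> and
  the modulus of the exponent at most the number of steps.\<close>

lemma num_ge:
  assumes "0 \<le> a" "a \<le> measure \<nu> (shell (eps m) r) + measure \<nu> (tail r)"
  shows "(real m + 1) * (1 + a)\<^sup>2 \<le> real (num r m)" "1 + 2 * a \<le> real (num r m)"
proof -
  let ?s = "measure \<nu> (shell (eps m) r) + measure \<nu> (tail r)"
  have "(real m + 1) * (1 + a)\<^sup>2 \<le> (real m + 1) * (1 + ?s)\<^sup>2"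
    using assms by (intro mult_left_mono power_mono) auto
  also have "\<dots> = (real m + 1) * (1 + measure \<nu> (shell (eps m) r) + measure \<nu> (tail r))\<^sup>2"
    by (simp add: add.assoc)
  also have "\<dots> \<le> real (num r m)" unfolding num_def by (rule of_nat_ceiling)
  finally show 1: "(real m + 1) * (1 + a)\<^sup>2 \<le> real (num r m)" .
  have "1 + 2 * a \<le> 1 * (1 + a)\<^sup>2" by (simp add: power2_eq_square algebra_simps)
  also have "\<dots> \<le> (real m + 1) * (1 + a)\<^sup>2" by (intro mult_right_mono) auto
  finally show "1 + 2 * a \<le> real (num r m)" using 1 by linarith
qed

lemma num_pos: "0 < num r m"
  using num_ge(2)[of 0 m r] by (auto intro!: gr0I)

lemma iexp_dot_meas: "(\<lambda>u. iexp (dot I t u)) \<in> borel_measurable \<nu>"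
  using dot_meas[of t] by measurable

text \<open>\<open>1 + cexp S t / n\<close> is \<open>1 - a / n\<close> plus a number of modulus at
  most \<open>a / n\<close>, where \<open>a\<close> is the mass of \<open>S\<close>, so it lies in
  the unit disc. Since \<open>cexp\<close> has modulus at most \<open>2 * a\<close>, the power
  differs from the exponential by at most \<open>3 * (2 * a)^2 / n\<close>, which explains the
  constant \<open>12\<close>.\<close>

lemma cexp_approx:
  assumes S: "S \<in> sets \<nu>" "emeasure \<nu> S < \<infinity>"
    and a: "measure \<nu> S \<le> measure \<nu> (shell (eps m) r) + measure \<nu> (tail r)"
  shows "cmod (1 + cexp S t / of_nat (num r m)) \<le> 1"
    and "cmod ((1 + cexp S t / of_nat (num r m)) ^ num r m - exp (cexp S t)) \<le> 12 / (real m + 1)"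
proof -
  define n where "n = num r m"
  define a where "a = measure \<nu> S"
  have a0: "0 \<le> a" by (simp add: a_def)
  have n: "0 < n" "(real m + 1) * (1 + a)\<^sup>2 \<le> real n" "1 + 2 * a \<le> real n"
    using num_ge[OF a0, of m r] a num_pos[of r m] by (auto simp: n_def a_def)
  have iS: "set_integrable \<nu> S (\<lambda>_. 1 :: complex)" "set_integrable \<nu> S (\<lambda>_. 1 :: real)"
    "set_integrable \<nu> S (\<lambda>_. 2 :: real)"
    using S by (auto intro!: set_integrable_bounded[where B=2])
  have iE: "set_integrable \<nu> S (\<lambda>u. iexp (dot I t u))"
    by (rule set_integrable_bounded[where B=1]) (use S iexp_dot_meas in auto)
  have one: "(LINT u:S|\<nu>. (1::complex)) = of_real a" "(LINT u:S|\<nu>. (1::real)) = a" "(LINT u:S|\<nu>. (2::real)) = 2 * a"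
    using S by (simp_all add: a_def set_lebesgue_integral_def scaleR_conv_of_real)
  have c: "cexp S t = (LINT u:S|\<nu>. iexp (dot I t u)) - of_real a"
    unfolding cexp_def using iS iE one by (simp add: set_integral_diff)
  have "cmod (LINT u:S|\<nu>. iexp (dot I t u)) \<le> (LINT u:S|\<nu>. cmod (iexp (dot I t u)))"
    using iE by (rule set_integral_norm_bound)
  then have E: "cmod (LINT u:S|\<nu>. iexp (dot I t u)) \<le> a" using one by (simp)
  have cb: "cmod (cexp S t) \<le> 2 * a"
    unfolding c using E a0 by (intro order_trans[OF norm_triangle_ineq4]) simp
  have re: "Re (cexp S t) \<le> 0"
    unfolding c using E complex_Re_le_cmod[of "LINT u:S|\<nu>. iexp (dot I t u)"] by simp
  have "1 + cexp S t / of_nat n = complex_of_real (1 - a / n) + (LINT u:S|\<nu>. iexp (dot I t u)) / of_nat n"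
    unfolding c by (simp add: diff_divide_distrib)
  also have "cmod \<dots> \<le> cmod (complex_of_real (1 - a / n)) + cmod ((LINT u:S|\<nu>. iexp (dot I t u)) / of_nat n)"
    by (rule norm_triangle_ineq)
  also have "cmod (complex_of_real (1 - a / n)) = 1 - a / n"
    using n a0 unfolding norm_of_real by (intro abs_of_nonneg) (simp add: field_simps)
  also have "cmod ((LINT u:S|\<nu>. iexp (dot I t u)) / of_nat n) \<le> a / n"
    using E n by (simp add: norm_divide divide_right_mono)
  finally have o: "cmod (1 + cexp S t / of_nat n) \<le> 1" by simp
  then show "cmod (1 + cexp S t / of_nat (num r m)) \<le> 1" by (simp add: n_def)
  have "cmod ((1 + cexp S t / of_nat n) ^ n - exp (cexp S t)) \<le> 3 * (cmod (cexp S t))\<^sup>2 / real n"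
    using n cb a0 by (intro norm_one_plus_power_minus_exp re o) auto
  also have "\<dots> \<le> 3 * (2 * a)\<^sup>2 / real n"
    using cb by (intro divide_right_mono mult_left_mono power_mono) auto
  also have "\<dots> \<le> 12 * ((1 + a)\<^sup>2 / real n)"
    using a0 power_mono[of a "1 + a" 2] n by (simp add: divide_right_mono)
  also have "(1 + a)\<^sup>2 / real n \<le> 1 / (real m + 1)"
    using n by (simp add: field_simps)
  finally show "cmod ((1 + cexp S t / of_nat (num r m)) ^ num r m - exp (cexp S t)) \<le> 12 / (real m + 1)"
    by (simp add: n_def)
qed

lemma good_smalls: "list_all (good_step I) (smalls r m)"
proof -
  note f = finite_restr[OF shell_sets _ shell_eps_finite, of "1 / real (num r m)"]
  have "measure \<nu> (shell (eps m) r) \<le> real (num r m)"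
    using num_ge(2)[of "measure \<nu> (shell (eps m) r)" m r] by simp
  then have "1 / real (num r m) * measure \<nu> (shell (eps m) r) \<le> 1" using num_pos[of r m] by (simp add: field_simps)
  then show ?thesis
    using f num_pos[of r m] by (auto simp: smalls_def good_step_def list_all_iff sets_nu space_PiM)
qed

lemma good_bigs: "emeasure \<nu> (tail r) < \<infinity> \<Longrightarrow> list_all (good_step I) (bigs r m)"
proof -
  assume "emeasure \<nu> (tail r) < \<infinity>"
  note f = finite_restr[OF tail_sets _ this, of "1 / real (num r m)"]
  have "measure \<nu> (tail r) \<le> real (num r m)"
    using num_ge(2)[of "measure \<nu> (tail r)" m r] by simp
  then have "1 / real (num r m) * measure \<nu> (tail r) \<le> 1" using num_pos[of r m] by (simp add: field_simps)
  then show ?thesis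
    using f num_pos[of r m] by (auto simp: bigs_def good_step_def list_all_iff sets_nu)
qed

lemma char_approx:
  assumes tf: "emeasure \<nu> (tail r) < \<infinity>"
  shows "charI I (slaw I (bigs r m @ smalls r m)) t =
    (1 + cexp (tail r) t / of_nat (num r m)) ^ num r m *
    (iexp (dot I t (bvec r m)) * (1 + cexp (shell (eps m) r) t / of_nat (num r m)) ^ num r m)"
proof -
  define n where "n = num r m"
  have n: "0 < n" using num_pos by (simp add: n_def)
  have i: "(LINT u|restr \<nu> S (1 / real n). iexp (dot I t u) - 1) = cexp S t / of_nat n" if "S \<in> sets \<nu>" for S
    using that iexp_dot_meas by (subst integral_restr) (auto simp: cexp_def scaleR_conv_of_real divide_inverse)
  have "dot I t (\<lambda>k\<in>I. bvec r m k / real n) = dot I t (bvec r m) / real n"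
    by (simp add: dot_def sum_divide_distrib)
  then have e: "iexp (dot I t (\<lambda>k\<in>I. bvec r m k / real n)) ^ n = iexp (dot I t (bvec r m))"
    using n by (simp flip: exp_of_nat_mult)
  show ?thesis
    using tf unfolding n_def[symmetric] e[symmetric]
    by (subst charI_slaw[OF fin])
       (simp_all add: good_bigs good_smalls, simp add: bigs_def smalls_def map_replicate prod_list_replicate
         i[OF tail_sets] i[OF shell_sets] power_mult_distrib dot_vzero flip: n_def)
qed

lemma set_integrable_comp:
  assumes "S \<in> sets \<nu>" "emeasure \<nu> S < \<infinity>" "\<And>u. u \<in> S \<Longrightarrow> L2_set u I \<le> B" "k \<in> I"
  shows "set_integrable \<nu> S (\<lambda>u. u k)"
  using assms(1,2) comp_meas[OF assms(4)]
  by (rule set_integrable_bounded[where B=B]) (use abs_le_L2_set[OF fin assms(4)] assms(3) in \<open>fastforce intro: order_trans\<close>)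

lemma set_integral_dot:
  assumes "S \<in> sets \<nu>" "emeasure \<nu> S < \<infinity>" "\<And>u. u \<in> S \<Longrightarrow> L2_set u I \<le> B"
  shows "set_integrable \<nu> S (\<lambda>u. dot I t u)" "(LINT u:S|\<nu>. dot I t u) = dot I t (\<lambda>k. LINT u:S|\<nu>. u k)"
proof -
  have i: "set_integrable \<nu> S (\<lambda>u. t k * u k)" if "k \<in> I" for k
    using set_integrable_comp[OF assms that] by simp
  then show "set_integrable \<nu> S (\<lambda>u. dot I t u)"
    unfolding set_integrable_def dot_def by (simp add: scaleR_sum_right del: real_scaleR_def)
  show "(LINT u:S|\<nu>. dot I t u) = dot I t (\<lambda>k. LINT u:S|\<nu>. u k)"
    using i unfolding set_integrable_def set_lebesgue_integral_def dot_def
    by (simp add: sum_distrib_left mult.left_commute)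
qed

lemma shell_integral_dot:
  assumes "emeasure \<nu> (shell e r) < \<infinity>"
  shows "set_integrable \<nu> (shell e r) (\<lambda>u. dot I t u)"
    "(LINT u:shell e r|\<nu>. dot I t u) = dot I t (\<lambda>k. LINT u:shell e r|\<nu>. u k)"
proof -
  have b: "\<And>u. u \<in> shell e r \<Longrightarrow> L2_set u I \<le> r" by (simp add: shell_def)
  show "set_integrable \<nu> (shell e r) (\<lambda>u. dot I t u)"
    "(LINT u:shell e r|\<nu>. dot I t u) = dot I t (\<lambda>k. LINT u:shell e r|\<nu>. u k)"
    by (rule set_integral_dot[OF shell_sets assms b], assumption)+
qed

text \<open>The deterministic part \<open>bvec\<close> contains exactly the compensator of the
  shell. Joined with it, the exponent becomes an integral of \<open>expo\<close>, which converges as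
  the shells grow even where the compensator alone diverges.\<close>

lemma exponent_approx:
  "iexp (dot I t (bvec r m)) * exp (cexp (shell (eps m) r) t) =
   exp (\<i> * complex_of_real (dot I t (betar r)) + (LINT u:shell (eps m) r|\<nu>. expo r t u))"
proof -
  let ?S = "shell (eps m) r"
  note d = shell_integral_dot[OF shell_eps_finite, of m r t]
  have iE: "set_integrable \<nu> ?S (\<lambda>u. iexp (dot I t u) - 1)"
    by (rule set_integrable_bounded[where B=2]) (use shell_eps_finite iexp_dot_meas iexp_remainder0 in auto)
  have iD: "set_integrable \<nu> ?S (\<lambda>u. \<i> * complex_of_real (dot I t u))"
    using d(1) by (rule set_integral_i_of_real)
  have "(LINT u:?S|\<nu>. expo r t u) = (LINT u:?S|\<nu>. (iexp (dot I t u) - 1) - \<i> * complex_of_real (dot I t u))"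
    unfolding expo_def set_lebesgue_integral_def
    by (intro Bochner_Integration.integral_cong) (auto simp: shell_def split: split_indicator)
  also have "\<dots> = cexp ?S t - \<i> * complex_of_real (LINT u:?S|\<nu>. dot I t u)"
    by (rule trans[OF set_integral_diff(2)[OF iE iD]]) (simp only: cexp_def set_integral_i_of_real(2)[OF d(1)])
  finally have 1: "(LINT u:?S|\<nu>. expo r t u) = cexp ?S t - \<i> * complex_of_real (LINT u:?S|\<nu>. dot I t u)" .
  have 2: "dot I t (bvec r m) = dot I t (betar r) - (LINT u:?S|\<nu>. dot I t u)"
  proof -
    have "dot I t (\<lambda>k. betar r k - (LINT u:?S|\<nu>. u k)) = dot I t (betar r) - dot I t (\<lambda>k. LINT u:?S|\<nu>. u k)"
      unfolding dot_def by (simp only: right_diff_distrib sum_subtractf)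
    then show ?thesis unfolding bvec_def[abs_def] d(2) .
  qed
  show ?thesis
    unfolding 1 2 exp_add[symmetric] mult_exp_exp of_real_diff by (simp add: algebra_simps)
qed

lemma exponent_limit:
  "(\<lambda>m. iexp (dot I t (bvec r m)) * exp (cexp (shell (eps m) r) t)) \<longlonglongrightarrow>
    exp (\<i> * complex_of_real (dot I t (betar r)) + (LINT u:{u \<in> space \<nu>. L2_set u I \<le> r}|\<nu>. expo r t u))"
  unfolding exponent_approx
proof (intro tendsto_exp tendsto_add tendsto_const)
  note [measurable] = nrm_meas expo_meas shell_sets
  show "(\<lambda>m. LINT u:shell (eps m) r|\<nu>. expo r t u) \<longlonglongrightarrow> (LINT u:{u \<in> space \<nu>. L2_set u I \<le> r}|\<nu>. expo r t u)"
    unfolding set_lebesgue_integral_def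
  proof (rule integral_dominated_convergence[where w="\<lambda>u. cmod (indicat_real {u \<in> space \<nu>. L2_set u I \<le> r} u *\<^sub>R expo r t u)"])
    show "integrable \<nu> (\<lambda>u. cmod (indicat_real {u \<in> space \<nu>. L2_set u I \<le> r} u *\<^sub>R expo r t u))"
      using set_integrable_expo(1)[of r t] by (intro integrable_norm) (simp add: set_integrable_def)
    show "AE u in \<nu>. cmod (indicat_real (shell (eps m) r) u *\<^sub>R expo r t u)
         \<le> cmod (indicat_real {u \<in> space \<nu>. L2_set u I \<le> r} u *\<^sub>R expo r t u)" for m
      by (auto simp: shell_def split: split_indicator)
    show "AE u in \<nu>. (\<lambda>m. indicat_real (shell (eps m) r) u *\<^sub>R expo r t u) \<longlonglongrightarrow> indicat_real {u \<in> space \<nu>. L2_set u I \<le> r} u *\<^sub>R expo r t u"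
    proof (intro AE_I2)
      fix u assume u: "u \<in> space \<nu>"
      show "(\<lambda>m. indicat_real (shell (eps m) r) u *\<^sub>R expo r t u) \<longlonglongrightarrow> indicat_real {u \<in> space \<nu>. L2_set u I \<le> r} u *\<^sub>R expo r t u"
      \<comment> \<open>The shells exhaust the ball except for the points of norm \<open>0\<close>,
        and there \<open>expo\<close> vanishes.\<close>
      proof (cases "L2_set u I = 0")
        case True
        have "dot I t u = 0" using abs_dot_le[of t u] True by simp
        then have "expo r t u = 0" by (simp add: expo_def)
        then show ?thesis by simp
      next
        case False
        then have pos: "0 < L2_set u I" by (simp add: order_less_le L2_set_nonneg)
        have "eps \<longlonglongrightarrow> 0" unfolding eps_def[abs_def] by real_asymp
        then have "eventually (\<lambda>m. eps m < L2_set u I) sequentially" using pos by (rule order_tendstoD)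
        then have "eventually (\<lambda>m. indicat_real (shell (eps m) r) u *\<^sub>R expo r t u = indicat_real {u \<in> space \<nu>. L2_set u I \<le> r} u *\<^sub>R expo r t u) sequentially"
          by eventually_elim (use u in \<open>auto simp: shell_def indicator_def\<close>)
        then show ?thesis by (rule tendsto_eventually)
      qed
    qed
  qed measurable
qed

lemma complex_rearrange: "\<i> * complex_of_real p + ((q + c) + (\<i> * complex_of_real y - \<i> * complex_of_real x)) =
        c + (\<i> * complex_of_real (p - x + y) + q)"
  by (simp add: algebra_simps)

text \<open>The integrands compensated at \<open>1\<close> and at \<open>r\<close> differ only on
  the shell between these levels, with a sign that depends on which is larger. This difference is
  linear in \<open>t\<close> and moves the drift from \<open>\<beta>\<close> to
  \<open>betar r\<close>.\<close>

lemma exponent_P_r: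
  assumes tf: "emeasure \<nu> (tail r) < \<infinity>"
  shows "\<i> * complex_of_real (dot I t \<beta>) + (LINT u|\<nu>. expo 1 t u) = cexp (tail r) t +
    (\<i> * complex_of_real (dot I t (betar r)) + (LINT u:{u \<in> space \<nu>. L2_set u I \<le> r}|\<nu>. expo r t u))"
proof -
  note er = set_integrable_expo[of r t]
  have s1: "emeasure \<nu> (shell r 1) < \<infinity>"
    by (rule order_le_less_trans[OF emeasure_mono[OF _ tail_sets] tf]) (auto simp: shell_def tail_def)
  have s2: "emeasure \<nu> (shell 1 r) < \<infinity>" by (rule shell_finite) simp
  note d1 = shell_integral_dot[OF s1, of t]
  note d2 = shell_integral_dot[OF s2, of t]
  have i1: "set_integrable \<nu> (shell r 1) (\<lambda>u. \<i> * complex_of_real (dot I t u))"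
    and i2: "set_integrable \<nu> (shell 1 r) (\<lambda>u. \<i> * complex_of_real (dot I t u))"
    by (rule set_integral_i_of_real(1)[OF d1(1)], rule set_integral_i_of_real(1)[OF d2(1)])
  have tl: "(LINT u:tail r|\<nu>. expo r t u) = cexp (tail r) t"
    unfolding expo_def cexp_def set_lebesgue_integral_def
    by (intro Bochner_Integration.integral_cong) (auto simp: tail_def split: split_indicator)
  have "(LINT u|\<nu>. expo r t u) = (LINT u:{u \<in> space \<nu>. L2_set u I \<le> r} \<union> tail r|\<nu>. expo r t u)"
    unfolding set_lebesgue_integral_def by (intro Bochner_Integration.integral_cong) (auto simp: tail_def indicator_def)
  also have "\<dots> = (LINT u:{u \<in> space \<nu>. L2_set u I \<le> r}|\<nu>. expo r t u) + cexp (tail r) t"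
    unfolding tl[symmetric] using er tf by (intro set_integral_Un) (auto simp: tail_def)
  finally have A: "(LINT u|\<nu>. expo r t u) = (LINT u:{u \<in> space \<nu>. L2_set u I \<le> r}|\<nu>. expo r t u) + cexp (tail r) t" .
  have "(LINT u|\<nu>. expo 1 t u) = (LINT u|\<nu>. expo r t u +
     (indicat_real (shell 1 r) u *\<^sub>R (\<i> * complex_of_real (dot I t u)) - indicat_real (shell r 1) u *\<^sub>R (\<i> * complex_of_real (dot I t u))))"
    by (intro Bochner_Integration.integral_cong) (auto simp: expo_def shell_def indicator_def)
  also have "\<dots> = (LINT u|\<nu>. expo r t u) + ((LINT u:shell 1 r|\<nu>. \<i> * complex_of_real (dot I t u)) - (LINT u:shell r 1|\<nu>. \<i> * complex_of_real (dot I t u)))"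
    using Bochner_Integration.integral_add[OF er(3)[OF tf] Bochner_Integration.integrable_diff[OF i2[unfolded set_integrable_def] i1[unfolded set_integrable_def]]]
      Bochner_Integration.integral_diff[OF i2[unfolded set_integrable_def] i1[unfolded set_integrable_def]]
    unfolding set_lebesgue_integral_def by metis
  finally have B: "(LINT u|\<nu>. expo 1 t u) = (LINT u|\<nu>. expo r t u) +
     (\<i> * complex_of_real (LINT u:shell 1 r|\<nu>. dot I t u) - \<i> * complex_of_real (LINT u:shell r 1|\<nu>. dot I t u))"
    by (simp only: set_integral_i_of_real(2)[OF d2(1)] set_integral_i_of_real(2)[OF d1(1)])
  have C: "dot I t (betar r) = dot I t \<beta> - (LINT u:shell r 1|\<nu>. dot I t u) + (LINT u:shell 1 r|\<nu>. dot I t u)"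

  proof -
    have "dot I t (\<lambda>k. \<beta> k - (LINT u:shell r 1|\<nu>. u k) + (LINT u:shell 1 r|\<nu>. u k)) =
      dot I t \<beta> - dot I t (\<lambda>k. LINT u:shell r 1|\<nu>. u k) + dot I t (\<lambda>k. LINT u:shell 1 r|\<nu>. u k)"
      unfolding dot_def by (simp only: right_diff_distrib distrib_left sum_subtractf sum.distrib)
    then show ?thesis unfolding betar_def[abs_def] d1(2) d2(2) .
  qed
  show ?thesis
    by (subst B, subst A, subst C) (rule complex_rearrange)
qed

lemma char_P_r:
  assumes tf: "emeasure \<nu> (tail r) < \<infinity>" and t: "t \<in> space (RI I)"
  shows "charI I P t = exp (cexp (tail r) t) *
    exp (\<i> * complex_of_real (dot I t (betar r)) + (LINT u:{u \<in> space \<nu>. L2_set u I \<le> r}|\<nu>. expo r t u))"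
proof -
  have 1: "charI I P t = exp (\<i> * complex_of_real (dot I t \<beta>) + (LINT u|\<nu>. expo 1 t u))"
    unfolding expo_def using char_P[OF t] .
  show ?thesis by (subst 1, subst exponent_P_r[OF tf, of t]) (rule exp_add)
qed

text \<open>The factors of the large jumps converge. For the small jumps only the difference between
  power and exponential tends to \<open>0\<close>, as \<open>cexp\<close> over growing shells may
  diverge; the drift factor has modulus \<open>1\<close>, so the difference stays small after
  multiplication and \<open>exponent_limit\<close> applies.\<close>

lemma char_approx_limit:
  assumes tf: "emeasure \<nu> (tail r) < \<infinity>" and t: "t \<in> space (RI I)"
  shows "(\<lambda>m. charI I (slaw I (bigs r m @ smalls r m)) t) \<longlonglongrightarrow> charI I P t"
proof -
  define z where "z m = (1 + cexp (tail r) t / of_nat (num r m)) ^ num r m" for m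
  define w where "w m = (1 + cexp (shell (eps m) r) t / of_nat (num r m)) ^ num r m" for m
  have 0: "(\<lambda>m. 12 / (real m + 1)) \<longlonglongrightarrow> 0" by real_asymp
  have z: "z \<longlonglongrightarrow> exp (cexp (tail r) t)"
  proof (rule Lim_null[THEN iffD2], rule Lim_null_comparison[OF _ 0], intro always_eventually allI)
    show "cmod (z m - exp (cexp (tail r) t)) \<le> 12 / (real m + 1)" for m
      unfolding z_def by (intro cexp_approx tf) auto
  qed
  have "(\<lambda>m. w m - exp (cexp (shell (eps m) r) t)) \<longlonglongrightarrow> 0"
  proof (rule Lim_null_comparison[OF _ 0], intro always_eventually allI)
    show "cmod (w m - exp (cexp (shell (eps m) r) t)) \<le> 12 / (real m + 1)" for m
      unfolding w_def by (intro cexp_approx shell_eps_finite) auto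
  qed
  then have "(\<lambda>m. iexp (dot I t (bvec r m)) * (w m - exp (cexp (shell (eps m) r) t))) \<longlonglongrightarrow> 0"
    by (rule Lim_null_comparison[OF always_eventually tendsto_norm_zero, rotated]) (simp add: norm_mult)
  from tendsto_add[OF this exponent_limit[of t r]]
  have "(\<lambda>m. iexp (dot I t (bvec r m)) * w m) \<longlonglongrightarrow> exp (\<i> * complex_of_real (dot I t (betar r)) + (LINT u:{u \<in> space \<nu>. L2_set u I \<le> r}|\<nu>. expo r t u))"
    by (simp only: right_diff_distrib diff_add_cancel add_0_left)
  from tendsto_mult[OF z this] show ?thesis
    unfolding char_approx[OF tf] char_P_r[OF tf t] z_def w_def .
qed

lemma approx_tendsto:
  assumes tf: "emeasure \<nu> (tail r) < \<infinity>"
    and F: "F \<in> borel_measurable (RI I)" "\<And>y. \<bar>F y\<bar> \<le> B" "lip_on I L F" "0 \<le> L"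
  shows "(\<lambda>m. LINT x|slaw I (bigs r m @ smalls r m). F x) \<longlonglongrightarrow> (LINT x|P. F x)"
  by (rule weak_conv_bounded_lipschitz[OF fin _ _ prob_P sets_P char_approx_limit[OF tf] F])
     (use good_smalls good_bigs[OF tf] in \<open>auto intro!: prob_space_slaw\<close>)

end

section \<open>Exponential moments\<close>

lemma exp_diff_le:
  fixes p q B :: real
  assumes "p \<le> B" "q \<le> B"
  shows "\<bar>exp p - exp q\<bar> \<le> exp B * \<bar>p - q\<bar>"
proof -
  have a: "exp q - exp p \<le> exp B * (q - p)" if "p \<le> q" "q \<le> B" for p q
  proof -
    have "exp q - exp p = exp q * (1 - exp (p - q))" by (simp add: right_diff_distrib flip: exp_add)
    also have "\<dots> \<le> exp q * (q - p)"
      using exp_ge_add_one_self[of "p - q"] by (intro mult_left_mono) (linarith, simp)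
    also have "\<dots> \<le> exp B * (q - p)" using that by (intro mult_right_mono) auto
    finally show ?thesis .
  qed
  show ?thesis
  proof (cases "p \<le> q")
    case True
    then have "exp p \<le> exp q" by simp
    with a[OF True assms(2)] True show ?thesis by (simp add: abs_if)
  next
    case False
    then have "exp q \<le> exp p" by simp
    with a[of q p] False assms(1) show ?thesis by (simp add: abs_if)
  qed
qed

lemma lip_on_exp:
  assumes "lip_on I L G" "\<And>x. G x \<le> B"
  shows "lip_on I (exp B * L) (\<lambda>x. exp (G x))"
  unfolding lip_on_def
proof (intro ballI)
  fix x y :: "'a \<Rightarrow> real" assume xy: "x \<in> space (RI I)" "y \<in> space (RI I)"
  have "\<bar>exp (G x) - exp (G y)\<bar> \<le> exp B * \<bar>G x - G y\<bar>" by (intro exp_diff_le assms)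
  also have "\<dots> \<le> exp B * (L * L2_set (\<lambda>k. x k - y k) I)"
    using lip_onD[OF assms(1) xy] by (intro mult_left_mono) auto
  finally show "\<bar>exp (G x) - exp (G y)\<bar> \<le> exp B * L * L2_set (\<lambda>k. x k - y k) I" by simp
qed

lemma lip_on_cmult:
  assumes "lip_on I L G"
  shows "lip_on I (\<bar>c\<bar> * L) (\<lambda>x. c * G x)"
  unfolding lip_on_def
proof (intro ballI)
  fix x y :: "'a \<Rightarrow> real" assume xy: "x \<in> space (RI I)" "y \<in> space (RI I)"
  have "\<bar>c * G x - c * G y\<bar> = \<bar>c\<bar> * \<bar>G x - G y\<bar>" by (simp add: abs_mult flip: right_diff_distrib)
  also have "\<dots> \<le> \<bar>c\<bar> * (L * L2_set (\<lambda>k. x k - y k) I)"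
    using lip_onD[OF assms xy] by (intro mult_left_mono) auto
  finally show "\<bar>c * G x - c * G y\<bar> \<le> \<bar>c\<bar> * L * L2_set (\<lambda>k. x k - y k) I" by simp
qed

lemma lip_on_min_norm: "0 \<le> t \<Longrightarrow> lip_on I t (\<lambda>x. min (t * L2_set x I) c)"
  unfolding lip_on_def
proof (intro ballI)
  fix x y :: "'a \<Rightarrow> real" assume t: "0 \<le> t"
  have "\<bar>min (t * L2_set x I) c - min (t * L2_set y I) c\<bar> \<le> \<bar>t * L2_set x I - t * L2_set y I\<bar>"
    by (auto simp: min_def)
  also have "\<dots> = t * \<bar>L2_set x I - L2_set y I\<bar>" using t by (simp add: abs_mult flip: right_diff_distrib)
  also have "\<dots> \<le> t * L2_set (\<lambda>k. x k - y k) I"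
    using t L2_set_diff_triangle[of x I y] by (intro mult_left_mono)
  finally show "\<bar>min (t * L2_set x I) c - min (t * L2_set y I) c\<bar> \<le> t * L2_set (\<lambda>k. x k - y k) I" .
qed

text \<open>\<open>ln (1 - x) \<ge> - x - 2 * x^2 \<ge> - 2 * x\<close> for
  \<open>0 \<le> x \<le> 1 / 2\<close>, with \<open>x = a / n\<close>. The bound does not depend on
  \<open>n\<close>, so it persists in the limit.\<close>

lemma one_minus_power_ge:
  fixes a :: real
  assumes "0 \<le> a" "2 * a \<le> real n" "0 < n"
  shows "exp (- (2 * a)) \<le> (1 - a / real n) ^ (n - 1)"
proof -
  define x where "x = a / real n"
  have x: "0 \<le> x" "x \<le> 1 / 2" using assms by (auto simp: x_def field_simps)
  have "- (2 * x) \<le> - x - 2 * x\<^sup>2" using x mult_right_mono[of x "1/2" x] by (simp add: power2_eq_square)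
  also have "\<dots> \<le> ln (1 - x)" using x by (intro ln_one_minus_pos_lower_bound)
  finally have "exp (- (2 * x)) \<le> 1 - x" using x by (simp add: ln_ge_iff)
  then have "exp (- (2 * x)) ^ n \<le> (1 - x) ^ n" by (intro power_mono) auto
  also have "\<dots> \<le> (1 - x) ^ (n - 1)" using x by (intro power_decreasing) auto
  also have "exp (- (2 * x)) ^ n = exp (- (2 * a))"
    using assms by (simp add: x_def flip: exp_of_nat_mult)
  finally show ?thesis by (simp add: x_def)
qed

lemma exp_taylor1:
  fixes x :: real
  assumes "0 \<le> x"
  shows "0 \<le> exp x - 1 - x" "exp x - 1 - x \<le> exp x * x\<^sup>2"
proof -
  show "0 \<le> exp x - 1 - x" using exp_ge_add_one_self[of x] by linarith
  then show "exp x - 1 - x \<le> exp x * x\<^sup>2"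
    using Taylor_exp_field[of x 1] assms by (simp add: power2_eq_square)
qed

section \<open>Moments carried between the law and its Levy measure\<close>

context levy_law
begin

interpretation P: prob_space P by (rule prob_P)

lemma drift_smalls: "k \<in> I \<Longrightarrow> drift I (smalls r m) k = betar r k"
  using num_pos[of r m] comp_meas[of k]
  by (simp add: drift_def smalls_def sum_list_replicate integral_restr bvec_def distrib_left diff_divide_distrib)

lemma sqvar_smalls: "sqvar I (smalls r m) \<le> V2r r"
proof -
  note [measurable] = nrm_meas
  have "sqvar I (smalls r m) = (LINT u:shell (eps m) r|\<nu>. (L2_set u I)\<^sup>2)"
    using num_pos[of r m] by (simp add: sqvar_def smalls_def sum_list_replicate sum_sq_eq integral_restr)
  also have "\<dots> \<le> V2r r"
    unfolding V2r_def set_lebesgue_integral_def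
  proof (rule integral_mono)
    show "integrable \<nu> (\<lambda>u. indicat_real {u \<in> space \<nu>. L2_set u I \<le> r} u *\<^sub>R (L2_set u I)\<^sup>2)"
      using square_integrable[of r] by (simp add: set_integrable_def)
    then show "integrable \<nu> (\<lambda>u. indicat_real (shell (eps m) r) u *\<^sub>R (L2_set u I)\<^sup>2)"
      by (rule Bochner_Integration.integrable_bound) (auto simp: shell_def indicator_def intro!: AE_I2)
  qed (auto simp: shell_def indicator_def)
  finally show ?thesis .
qed

lemma V2r_nonneg: "0 \<le> V2r r"
  unfolding V2r_def set_lebesgue_integral_def by (intro Bochner_Integration.integral_nonneg) auto

lemma smalls_first_moment:
  "(\<integral>\<^sup>+x. ennreal (L2_set (\<lambda>k. y k + x k) I) \<partial>slaw I (smalls r m)) \<le> ennreal (L2_set (\<lambda>k. y k + betar r k) I + sqrt (V2r r))"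
proof -
  let ?S = "shell (eps m) r"
  note [measurable] = nrm_meas
  have b: "\<And>u. u \<in> ?S \<Longrightarrow> L2_set u I \<le> r" by (simp add: shell_def)
  have i2: "set_integrable \<nu> ?S (\<lambda>u. \<Sum>k\<in>I. (u k)\<^sup>2)"
    unfolding sum_sq_eq using b shell_eps_finite
    by (intro set_integrable_bounded[where B="r\<^sup>2"]) (auto intro!: power_mono L2_set_nonneg)
  have "(\<integral>\<^sup>+x. ennreal (L2_set (\<lambda>k. y k + x k) I) \<partial>slaw I (smalls r m)) \<le>
    ennreal (L2_set (\<lambda>k. y k + drift I (smalls r m) k) I + sqrt (sqvar I (smalls r m)))"
    using i2 set_integrable_comp[OF shell_sets shell_eps_finite b] nrm_meas comp_meas
    by (intro slaw_first_moment_small fin good_smalls) (auto simp: smalls_def sum_sq_eq intro!: integrable_restr)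
  also have "\<dots> \<le> ennreal (L2_set (\<lambda>k. y k + betar r k) I + sqrt (V2r r))"
  proof (intro ennreal_leI add_mono)
    show "L2_set (\<lambda>k. y k + drift I (smalls r m) k) I \<le> L2_set (\<lambda>k. y k + betar r k) I"
      by (intro eq_refl L2_set_cong) (auto simp: drift_smalls)
  qed (use sqvar_smalls in auto)
  finally show ?thesis .
qed

lemma approx_first_moment:
  assumes tf: "emeasure \<nu> (tail r) < \<infinity>" and i: "set_integrable \<nu> (tail r) (\<lambda>u. L2_set u I)"
  shows "(\<integral>\<^sup>+x. ennreal (L2_set x I) \<partial>slaw I (bigs r m @ smalls r m)) \<le>
    ennreal (L2_set (betar r) I + sqrt (V2r r) + (LINT u:tail r|\<nu>. L2_set u I))"
proof -
  note [measurable] = nrm_meas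
  have ir: "integrable (restr \<nu> (tail r) (1 / real (num r m))) (\<lambda>u. L2_set u I)"
    using i by (intro integrable_restr) auto
  have "(\<integral>\<^sup>+x. ennreal (L2_set (\<lambda>k. 0 + x k) I) \<partial>slaw I (bigs r m @ smalls r m)) \<le>
     ennreal (L2_set (\<lambda>k. 0 + betar r k) I + sqrt (V2r r) + (\<Sum>s\<leftarrow>bigs r m. LINT u|snd s. L2_set u I))"
    using good_bigs[OF tf] good_smalls V2r_nonneg ir
    by (intro slaw_first_moment_big fin smalls_first_moment) (auto simp: bigs_def)
  also have "(\<Sum>s\<leftarrow>bigs r m. LINT u|snd s. L2_set u I) = (LINT u:tail r|\<nu>. L2_set u I)"
    using num_pos[of r m] by (simp add: bigs_def sum_list_replicate integral_restr)
  finally show ?thesis by simp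
qed

text \<open>The first moments of the walks are bounded uniformly in \<open>m\<close>, and the cap
  \<open>K\<close> makes the norm an admissible test function for the limit.\<close>

lemma P_truncated_norm:
  assumes tf: "emeasure \<nu> (tail r) < \<infinity>" and i: "set_integrable \<nu> (tail r) (\<lambda>u. L2_set u I)" and K: "0 \<le> K"
  shows "(LINT x|P. min (L2_set x I) K) \<le> L2_set (betar r) I + sqrt (V2r r) + (LINT u:tail r|\<nu>. L2_set u I)"
proof (rule LIMSEQ_le_const2)
  show "(\<lambda>m. LINT x|slaw I (bigs r m @ smalls r m). min (L2_set x I) K) \<longlonglongrightarrow> (LINT x|P. min (L2_set x I) K)"
    using K fin lip_on_min_norm[of 1 I K] by (intro approx_tendsto[OF tf, where B=K and L=1]) (auto simp: L2_set_nonneg)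
  show "\<exists>N. \<forall>n\<ge>N. (LINT x|slaw I (bigs r n @ smalls r n). min (L2_set x I) K) \<le> L2_set (betar r) I + sqrt (V2r r) + (LINT u:tail r|\<nu>. L2_set u I)"
  proof (intro exI[of _ 0] allI impI)
    fix m
    interpret Q: prob_space "slaw I (bigs r m @ smalls r m)"
      using good_bigs[OF tf] good_smalls by (intro prob_space_slaw) simp
    let ?C = "L2_set (betar r) I + sqrt (V2r r) + (LINT u:tail r|\<nu>. L2_set u I)"
    have C0: "0 \<le> ?C" unfolding set_lebesgue_integral_def
      by (intro add_nonneg_nonneg Bochner_Integration.integral_nonneg) (auto simp: L2_set_nonneg V2r_nonneg)
    have m: "(\<lambda>x. min (L2_set x I) K) \<in> borel_measurable (slaw I (bigs r m @ smalls r m))" using fin by measurable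
    have "integrable (slaw I (bigs r m @ smalls r m)) (\<lambda>x. min (L2_set x I) K)"
      by (rule Q.integrable_const_bound[where B=K]) (use m K in \<open>auto simp: L2_set_nonneg\<close>)
    then have "ennreal (LINT x|slaw I (bigs r m @ smalls r m). min (L2_set x I) K) = (\<integral>\<^sup>+x. ennreal (min (L2_set x I) K) \<partial>slaw I (bigs r m @ smalls r m))"
      using K by (intro nn_integral_eq_integral[symmetric]) (auto simp: L2_set_nonneg)
    also have "\<dots> \<le> (\<integral>\<^sup>+x. ennreal (L2_set x I) \<partial>slaw I (bigs r m @ smalls r m))"
      by (intro nn_integral_mono ennreal_leI) auto
    also have "\<dots> \<le> ennreal ?C" by (rule approx_first_moment[OF tf i])
    finally show "(LINT x|slaw I (bigs r m @ smalls r m). min (L2_set x I) K) \<le> ?C"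
      using C0 by (simp add: ennreal_le_iff)
  qed
qed

text \<open>The approximating walk makes exactly one big jump with positive probability, so its exponential moment
  dominates a multiple of that of \<open>\<nu>\<close> far from the origin.\<close>

lemma nu_exp_moment:
  assumes t: "0 \<le> t" and M: "(\<integral>\<^sup>+x. ennreal (exp (t * L2_set x I)) \<partial>P) < \<infinity>"
  shows "set_integrable \<nu> (tail 1) (\<lambda>u. exp (t * L2_set u I))"
proof -
  note [measurable] = nrm_meas tail_sets
  note [measurable_cong] = sets_P
  have tf: "emeasure \<nu> (tail 1) < \<infinity>" by (rule tail_finite) simp
  define \<Lambda> where "\<Lambda> = measure \<nu> (tail 1)"
  define c where "c = L2_set (betar 1) I + sqrt (V2r 1)"
  have c0: "0 \<le> c" by (simp add: c_def L2_set_nonneg V2r_nonneg)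
  \<comment> \<open>\<open>exp (- (t * c))\<close> is the loss from the small jumps, by
    \<open>slaw_exp_lower\<close>, and \<open>exp (- (2 * \<Lambda>))\<close> bounds from below the
    probability that the other \<open>n - 1\<close> steps do not jump. Neither depends on
    \<open>m\<close> or on the cap \<open>exp j\<close>.\<close>
  define d where "d = exp (- (t * c)) * exp (- (2 * \<Lambda>))"
  define \<phi> where "\<phi> j x = min (exp (t * L2_set x I)) (exp (real j))" for j :: nat and x :: "'i \<Rightarrow> real"
  have \<phi>_eq: "\<phi> j x = exp (min (t * L2_set x I) (real j))" for j x by (simp add: \<phi>_def min_def)
  have \<phi>_meas[measurable]: "\<phi> j \<in> borel_measurable (RI I)" for j unfolding \<phi>_def[abs_def] using fin by measurable
  have \<phi>_nu: "\<phi> j \<in> borel_measurable \<nu>" for j unfolding measurable_nu_eq by measurable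
  have \<phi>_bd: "0 \<le> \<phi> j x" "\<phi> j x \<le> exp (real j)" for j x by (auto simp: \<phi>_def)
  have key: "ennreal d * (\<integral>\<^sup>+u. ennreal (\<phi> j u) * indicator (tail 1) u \<partial>\<nu>) \<le> (\<integral>\<^sup>+x. ennreal (exp (t * L2_set x I)) \<partial>P)" for j
  proof -
    have lower: "ennreal d * (\<integral>\<^sup>+u. ennreal (\<phi> j u) * indicator (tail 1) u \<partial>\<nu>) \<le> ennreal (LINT x|slaw I (bigs 1 m @ smalls 1 m). \<phi> j x)" for m
    proof -
      define n where "n = num 1 m"
      have n: "0 < n" "2 * \<Lambda> \<le> real n"
        using num_pos[of 1 m] num_ge(2)[of \<Lambda> m 1] by (auto simp: n_def \<Lambda>_def)
      let ?\<mu> = "restr \<nu> (tail 1) (1 / real n)"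
      interpret Q: prob_space "slaw I (bigs 1 m @ smalls 1 m)"
        using good_bigs[OF tf] good_smalls by (intro prob_space_slaw) simp
      have mm: "measure ?\<mu> (space ?\<mu>) = \<Lambda> / real n"
        using finite_restr(2)[OF tail_sets _ tf, of "1 / real n"] by (simp add: \<Lambda>_def)
      have g: "good_step I (vzero I, ?\<mu>)"
        using good_bigs[OF tf, of m] n by (cases n) (auto simp: bigs_def n_def)
      define J where "J = (\<integral>\<^sup>+u. ennreal (\<phi> j u) * indicator (tail 1) u \<partial>\<nu>)"
      have J: "(\<integral>\<^sup>+u. ennreal (\<phi> j (vadd I (vzero I) u)) \<partial>?\<mu>) = ennreal (1 / real n) * J"
      proof -
        have "(\<integral>\<^sup>+u. ennreal (\<phi> j (vadd I (vzero I) u)) \<partial>?\<mu>) = (\<integral>\<^sup>+u. ennreal (\<phi> j u) \<partial>?\<mu>)"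
          by (intro nn_integral_cong) (simp add: space_nu)
        also have "\<dots> = ennreal (1 / real n) * J"
          unfolding J_def using \<phi>_nu[of j] by (intro nn_integral_restr) auto
        finally show ?thesis .
      qed
      have sm: "(\<integral>\<^sup>+x. ennreal (L2_set x I) \<partial>slaw I (smalls 1 m)) \<le> ennreal c"
        using smalls_first_moment[where y="\<lambda>_. 0" and r=1 and m=m] by (simp add: c_def)
      have "ennreal (exp (- (t * c))) * (ennreal (1 - measure ?\<mu> (space ?\<mu>)) ^ n * ennreal (\<phi> j (vzero I)) +
          of_nat n * ennreal (1 - measure ?\<mu> (space ?\<mu>)) ^ (n - 1) * (\<integral>\<^sup>+u. ennreal (\<phi> j (vadd I (vzero I) u)) \<partial>?\<mu>)) \<le>
        (\<integral>\<^sup>+x. ennreal (\<phi> j (vadd I (vzero I) x)) \<partial>slaw I (replicate n (vzero I, ?\<mu>) @ smalls 1 m))"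
      proof (rule slaw_replicate_lower[OF good_smalls g])
        show "ennreal (exp (- (t * c))) * ennreal (\<phi> j y) \<le> (\<integral>\<^sup>+x. ennreal (\<phi> j (vadd I y x)) \<partial>slaw I (smalls 1 m))"
          if "y \<in> space (RI I)" for y
          unfolding \<phi>_def using sm c0 t that by (intro slaw_exp_lower fin good_smalls) auto
      qed auto
      also have "\<dots> = (\<integral>\<^sup>+x. ennreal (\<phi> j x) \<partial>slaw I (bigs 1 m @ smalls 1 m))"
        unfolding bigs_def n_def[symmetric] by (intro nn_integral_cong) simp
      also have "\<dots> = ennreal (LINT x|slaw I (bigs 1 m @ smalls 1 m). \<phi> j x)"
        using \<phi>_bd by (intro nn_integral_eq_integral Q.integrable_const_bound[where B="exp (real j)"]) auto
      finally have "ennreal (exp (- (t * c))) * (ennreal (1 - \<Lambda> / real n) ^ n * ennreal (\<phi> j (vzero I)) +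
          of_nat n * ennreal (1 - \<Lambda> / real n) ^ (n - 1) * (ennreal (1 / real n) * J)) \<le> ennreal (LINT x|slaw I (bigs 1 m @ smalls 1 m). \<phi> j x)"
        unfolding mm J .
      moreover have "ennreal d * J \<le> ennreal (exp (- (t * c))) * (ennreal (1 - \<Lambda> / real n) ^ n * ennreal (\<phi> j (vzero I)) +
          of_nat n * ennreal (1 - \<Lambda> / real n) ^ (n - 1) * (ennreal (1 / real n) * J))"
      proof -
        have p: "0 \<le> 1 - \<Lambda> / real n" using n by (simp add: \<Lambda>_def field_simps)
        have "exp (- (2 * \<Lambda>)) \<le> (1 - \<Lambda> / real n) ^ (n - 1)"
          using n by (intro one_minus_power_ge) (auto simp: \<Lambda>_def)
        then have "ennreal (exp (- (2 * \<Lambda>))) \<le> ennreal (1 - \<Lambda> / real n) ^ (n - 1)"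
          using p by (simp add: ennreal_power ennreal_leI)
        also have "\<dots> = of_nat n * ennreal (1 - \<Lambda> / real n) ^ (n - 1) * ennreal (1 / real n)"
        proof -
          \<comment> \<open>The \<open>n\<close> possible positions of the single jump cancel its
            intensity \<open>1 / n\<close>.\<close>
          have "of_nat n * ennreal (1 / real n) = 1"
            using n by (simp add: ennreal_of_nat_eq_real_of_nat ennreal_mult[symmetric])
          then show ?thesis by (metis mult.assoc mult.commute mult.left_neutral)
        qed
        finally have "ennreal (exp (- (2 * \<Lambda>))) * J \<le> of_nat n * ennreal (1 - \<Lambda> / real n) ^ (n - 1) * ennreal (1 / real n) * J"
          by (rule mult_right_mono) simp
        then have "ennreal (exp (- (t * c))) * (ennreal (exp (- (2 * \<Lambda>))) * J) \<le> ennreal (exp (- (t * c))) * (ennreal (1 - \<Lambda> / real n) ^ n * ennreal (\<phi> j (vzero I)) +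
          of_nat n * ennreal (1 - \<Lambda> / real n) ^ (n - 1) * (ennreal (1 / real n) * J))"
          by (intro mult_left_mono add_increasing) (auto simp: mult.assoc)
        then show ?thesis by (simp add: d_def ennreal_mult mult.assoc)
      qed
      ultimately show ?thesis unfolding J_def by (rule order_trans[rotated])
    qed
    have lim: "(\<lambda>m. LINT x|slaw I (bigs 1 m @ smalls 1 m). \<phi> j x) \<longlonglongrightarrow> (LINT x|P. \<phi> j x)"
    proof (rule approx_tendsto[OF tf, where B="exp (real j)" and L="exp (real j) * t"])
      show "lip_on I (exp (real j) * t) (\<phi> j)" unfolding \<phi>_eq[abs_def]
        by (intro lip_on_exp lip_on_min_norm t) auto
    qed (use \<phi>_bd t in auto)
    have "ennreal d * (\<integral>\<^sup>+u. ennreal (\<phi> j u) * indicator (tail 1) u \<partial>\<nu>) \<le> ennreal (LINT x|P. \<phi> j x)"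
      by (rule LIMSEQ_le_const[OF tendsto_ennrealI[OF lim]]) (use lower in auto)
    also have "\<dots> = (\<integral>\<^sup>+x. ennreal (\<phi> j x) \<partial>P)"
      using \<phi>_bd by (intro nn_integral_eq_integral[symmetric] P.integrable_const_bound[where B="exp (real j)"]) auto
    also have "\<dots> \<le> (\<integral>\<^sup>+x. ennreal (exp (t * L2_set x I)) \<partial>P)"
      by (intro nn_integral_mono ennreal_leI) (simp add: \<phi>_def)
    finally show ?thesis .
  qed
  have mono: "incseq (\<lambda>j u. ennreal (\<phi> j u) * indicator (tail 1) u)"
    by (auto simp: incseq_def le_fun_def \<phi>_def intro!: mult_right_mono ennreal_leI min.mono)
  have sup: "(SUP j. ennreal (\<phi> j u) * indicator (tail 1) u) = ennreal (exp (t * L2_set u I)) * indicator (tail 1) u" for u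
  proof (rule antisym)
    show "(SUP j. ennreal (\<phi> j u) * indicator (tail 1) u) \<le> ennreal (exp (t * L2_set u I)) * indicator (tail 1) u"
      by (intro SUP_least mult_right_mono ennreal_leI) (auto simp: \<phi>_def)
    obtain j where "t * L2_set u I \<le> real j" using real_arch_simple by blast
    then have "\<phi> j u = exp (t * L2_set u I)" by (simp add: \<phi>_def)
    then show "ennreal (exp (t * L2_set u I)) * indicator (tail 1) u \<le> (SUP j. ennreal (\<phi> j u) * indicator (tail 1) u)"
      by (intro SUP_upper2[of j]) auto
  qed
  have mi: "(\<integral>\<^sup>+u. ennreal (exp (t * L2_set u I)) * indicator (tail 1) u \<partial>\<nu>) = (SUP j. \<integral>\<^sup>+u. ennreal (\<phi> j u) * indicator (tail 1) u \<partial>\<nu>)"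
    unfolding sup[symmetric]
  proof (intro nn_integral_monotone_convergence_SUP mono)
    note [measurable] = \<phi>_nu
    show "(\<lambda>u. ennreal (\<phi> j u) * indicator (tail 1) u) \<in> borel_measurable \<nu>" for j by measurable
  qed
  have "ennreal d * (\<integral>\<^sup>+u. ennreal (exp (t * L2_set u I)) * indicator (tail 1) u \<partial>\<nu>) \<le> (\<integral>\<^sup>+x. ennreal (exp (t * L2_set x I)) \<partial>P)"
    unfolding mi SUP_mult_left_ennreal using key by (intro SUP_least)
  then have "ennreal d * (\<integral>\<^sup>+u. ennreal (exp (t * L2_set u I)) * indicator (tail 1) u \<partial>\<nu>) < \<infinity>"
    using M by (rule order_le_less_trans)
  moreover have "ennreal d \<noteq> 0" by (simp add: d_def)
  ultimately have "(\<integral>\<^sup>+u. ennreal (exp (t * L2_set u I)) * indicator (tail 1) u \<partial>\<nu>) < \<infinity>"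
    by (auto simp: ennreal_mult_less_top)
  also have "(\<integral>\<^sup>+u. ennreal (exp (t * L2_set u I)) * indicator (tail 1) u \<partial>\<nu>) =
    (\<integral>\<^sup>+u. ennreal (norm (indicat_real (tail 1) u *\<^sub>R exp (t * L2_set u I))) \<partial>\<nu>)"
    by (intro nn_integral_cong) (auto simp: indicator_def)
  finally have fn: "(\<integral>\<^sup>+u. ennreal (norm (indicat_real (tail 1) u *\<^sub>R exp (t * L2_set u I))) \<partial>\<nu>) < \<infinity>" .
  have "(\<lambda>u. indicat_real (tail 1) u *\<^sub>R exp (t * L2_set u I)) \<in> borel_measurable \<nu>"
    using fin comp_meas by measurable
  then show ?thesis using fn unfolding set_integrable_def integrable_iff_bounded by blast
qed

section \<open>The exponential bound for the limit law\<close>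

definition psi :: "real \<Rightarrow> real" where
  "psi t = (LINT u|\<nu>. exp (t * L2_set u I) - 1 - t * L2_set u I)"

lemma set_integrable_norm_exp:
  assumes e: "set_integrable \<nu> (tail 1) (\<lambda>u. exp (t * L2_set u I))" and t: "0 \<le> t"
  shows "set_integrable \<nu> (tail 1) (\<lambda>u. exp (t * L2_set u I) - 1 - t * L2_set u I)"
    and "set_integrable \<nu> {u \<in> space \<nu>. L2_set u I \<le> 1} (\<lambda>u. exp (t * L2_set u I) - 1 - t * L2_set u I)"
    and "integrable \<nu> (\<lambda>u. exp (t * L2_set u I) - 1 - t * L2_set u I)"
proof -
  note [measurable] = nrm_meas tail_sets
  let ?g = "\<lambda>u. exp (t * L2_set u I) - 1 - t * L2_set u I"
  have g0: "0 \<le> ?g u" for u using t exp_taylor1(1)[of "t * L2_set u I"] by (simp add: L2_set_nonneg)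
  show 1: "set_integrable \<nu> (tail 1) ?g"
    unfolding set_integrable_def
  proof (rule Bochner_Integration.integrable_bound[OF e[unfolded set_integrable_def]])
    show "AE u in \<nu>. norm (indicat_real (tail 1) u *\<^sub>R ?g u) \<le> norm (indicat_real (tail 1) u *\<^sub>R exp (t * L2_set u I))"
    proof (intro AE_I2)
      fix u
      have "0 \<le> t * L2_set u I" using t by (simp add: L2_set_nonneg)
      then have "\<bar>?g u\<bar> \<le> exp (t * L2_set u I)" using g0[of u] by linarith
      then show "norm (indicat_real (tail 1) u *\<^sub>R ?g u) \<le> norm (indicat_real (tail 1) u *\<^sub>R exp (t * L2_set u I))"
        by (auto simp: indicator_def)
    qed
  qed measurable
  show 2: "set_integrable \<nu> {u \<in> space \<nu>. L2_set u I \<le> 1} ?g"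
    unfolding set_integrable_def
  proof (rule Bochner_Integration.integrable_bound)
    show "integrable \<nu> (\<lambda>u. (exp t * t\<^sup>2) * (indicat_real {u \<in> space \<nu>. L2_set u I \<le> 1} u *\<^sub>R (L2_set u I)\<^sup>2))"
      using square_integrable[of 1] by (auto simp: set_integrable_def)
    have "?g u \<le> exp t * t\<^sup>2 * (L2_set u I)\<^sup>2" if "L2_set u I \<le> 1" for u
    proof -
      have "?g u \<le> exp (t * L2_set u I) * (t * L2_set u I)\<^sup>2"
        using t by (intro exp_taylor1(2)) (simp add: L2_set_nonneg)
      also have "\<dots> \<le> exp t * (t * L2_set u I)\<^sup>2"
        using t that by (intro mult_right_mono) (auto simp: mult_left_le)
      finally show ?thesis by (simp add: power_mult_distrib)
    qed
    then show "AE u in \<nu>. norm (indicat_real {u \<in> space \<nu>. L2_set u I \<le> 1} u *\<^sub>R ?g u) \<le>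
       norm ((exp t * t\<^sup>2) * (indicat_real {u \<in> space \<nu>. L2_set u I \<le> 1} u *\<^sub>R (L2_set u I)\<^sup>2))"
      using g0 by (intro AE_I2) (auto simp: indicator_def)
  qed measurable
  have "set_integrable \<nu> ({u \<in> space \<nu>. L2_set u I \<le> 1} \<union> tail 1) ?g"
    using 2 1 by (rule set_integrable_Un) auto
  moreover have "{u \<in> space \<nu>. L2_set u I \<le> 1} \<union> tail 1 = space \<nu>" by (auto simp: tail_def)
  ultimately have "set_integrable \<nu> (space \<nu>) ?g" by simp
  then show "integrable \<nu> ?g" unfolding set_integrable_def
    by (rule Bochner_Integration.integrable_cong[THEN iffD1, rotated 2]) auto
qed

text \<open>For each walk the sum of the remainders is an integral over \<open>tail 1\<close> and
  one shell; the integrand is nonnegative, so it is at most \<open>psi t\<close>, whatever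
  \<open>m\<close> is. Both sides converge because \<open>F\<close> and \<open>exp (t * F)\<close>
  are bounded and Lipschitz.\<close>

lemma exp_bound_P:
  assumes t: "0 \<le> t" and e: "set_integrable \<nu> (tail 1) (\<lambda>u. exp (t * L2_set u I))"
    and F: "F \<in> borel_measurable (RI I)" "\<And>x. \<bar>F x\<bar> \<le> B" "lip_on I 1 F"
  shows "(LINT x|P. exp (t * F x)) \<le> exp (t * (LINT x|P. F x) + psi t)"
proof (rule LIMSEQ_le)
  note [measurable] = nrm_meas F(1)
  have tf: "emeasure \<nu> (tail 1) < \<infinity>" by (rule tail_finite) simp
  let ?g = "\<lambda>u. exp (t * L2_set u I) - 1 - t * L2_set u I"
  have g0: "0 \<le> ?g u" for u using t exp_taylor1(1)[of "t * L2_set u I"] by (simp add: L2_set_nonneg)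
  have tB: "t * F x \<le> t * B" for x using F(2)[of x] t by (intro mult_left_mono) auto
  show "(\<lambda>m. LINT x|slaw I (bigs 1 m @ smalls 1 m). exp (t * F x)) \<longlonglongrightarrow> (LINT x|P. exp (t * F x))"
    using lip_on_exp[OF lip_on_cmult[OF F(3), of t], of "t * B"] tB t
    by (intro approx_tendsto[OF tf, where B="exp (t * B)" and L="exp (t * B) * (\<bar>t\<bar> * 1)"]) auto
  show "(\<lambda>m. exp (t * (LINT x|slaw I (bigs 1 m @ smalls 1 m). F x) + psi t)) \<longlonglongrightarrow> exp (t * (LINT x|P. F x) + psi t)"
    by (intro tendsto_exp tendsto_add tendsto_mult tendsto_const approx_tendsto[OF tf F]) auto
  show "\<exists>N. \<forall>m\<ge>N. (LINT x|slaw I (bigs 1 m @ smalls 1 m). exp (t * F x)) \<le> exp (t * (LINT x|slaw I (bigs 1 m @ smalls 1 m). F x) + psi t)"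
  proof (intro exI[of _ 0] allI impI)
    fix m
    note ig = set_integrable_norm_exp[OF e t]
    have es: "set_integrable \<nu> (shell (eps m) 1) (\<lambda>u. exp (t * L2_set u I))"
      using shell_eps_finite t by (intro set_integrable_bounded[where B="exp t"]) (auto simp: shell_def mult_left_le)
    have igs: "set_integrable \<nu> (shell (eps m) 1) ?g"
      by (rule set_integrable_subset[OF ig(2)]) (auto simp: shell_def[symmetric], auto simp: shell_def)
    have "(LINT x|slaw I (bigs 1 m @ smalls 1 m). exp (t * F x)) \<le> exp (t * (LINT x|slaw I (bigs 1 m @ smalls 1 m). F x) +
      (\<Sum>s\<leftarrow>bigs 1 m @ smalls 1 m. LINT u|snd s. ?g u))"
      using good_bigs[OF tf] good_smalls e es
      by (intro slaw_exp_bound[OF fin _ t _ F]) (auto simp: bigs_def smalls_def intro!: integrable_restr)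
    also have "(\<Sum>s\<leftarrow>bigs 1 m @ smalls 1 m. LINT u|snd s. ?g u) = (LINT u:tail 1|\<nu>. ?g u) + (LINT u:shell (eps m) 1|\<nu>. ?g u)"
      using num_pos[of 1 m] by (simp add: bigs_def smalls_def sum_list_replicate integral_restr)
    also have "\<dots> \<le> psi t"
    proof -
      have "(LINT u:tail 1|\<nu>. ?g u) + (LINT u:shell (eps m) 1|\<nu>. ?g u) = (LINT u:tail 1 \<union> shell (eps m) 1|\<nu>. ?g u)"
        using ig(1) igs by (intro set_integral_Un[symmetric]) (auto simp: tail_def shell_def)
      also have "\<dots> \<le> psi t" unfolding psi_def set_lebesgue_integral_def
      proof (rule integral_mono)
        show "integrable \<nu> (\<lambda>u. indicat_real (tail 1 \<union> shell (eps m) 1) u *\<^sub>R ?g u)"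
          using set_integrable_Un[OF ig(1) igs] by (auto simp: set_integrable_def)
      qed (use g0 ig(3) in \<open>auto simp: indicator_def\<close>)
      finally show ?thesis .
    qed
    finally show "(LINT x|slaw I (bigs 1 m @ smalls 1 m). exp (t * F x)) \<le> exp (t * (LINT x|slaw I (bigs 1 m @ smalls 1 m). F x) + psi t)"
      by simp
  qed
qed

end

section \<open>Young pairs and concentration\<close>

text \<open>\<open>psi_diff\<close> expresses by secants that \<open>\<psi>\<close> is a convex
  primitive of \<open>h\<close>. All conditions stop strictly below \<open>T\<close>, where the
  integrals that define the instance may cease to be finite.\<close>

locale young_pair =
  fixes h \<psi> :: "real \<Rightarrow> real" and T :: ereal
  assumes T0: "0 < T"
    and h0: "h 0 = 0" and psi0: "\<psi> 0 = 0"
    and h_strict: "\<And>s t. 0 \<le> s \<Longrightarrow> s < t \<Longrightarrow> ereal t < T \<Longrightarrow> h s < h t"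
    and psi_diff: "\<And>s t. 0 \<le> s \<Longrightarrow> s < t \<Longrightarrow> ereal t < T \<Longrightarrow> (t - s) * h s \<le> \<psi> t - \<psi> s \<and> \<psi> t - \<psi> s \<le> (t - s) * h t"
    and h_cont: "\<And>t. 0 \<le> t \<Longrightarrow> ereal t < T \<Longrightarrow> continuous_on {0..t} h"
begin

lemma below_T: "x \<le> t \<Longrightarrow> ereal t < T \<Longrightarrow> ereal x < T"
  by (meson ereal_less_eq(3) order_le_less_trans)

lemma h_mono: "0 \<le> s \<Longrightarrow> s \<le> t \<Longrightarrow> ereal t < T \<Longrightarrow> h s \<le> h t"
  using h_strict[of s t] by (cases "s = t") auto

lemma h_nonneg: "0 \<le> t \<Longrightarrow> ereal t < T \<Longrightarrow> 0 \<le> h t"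
  using h_mono[of 0 t] h0 by simp

text \<open>\<open>psi_diff\<close> squeezes each difference quotient between the values of
  \<open>h\<close> at the two ends, and \<open>h\<close> is continuous.\<close>

lemma psi_deriv:
  assumes t: "0 \<le> t" "ereal t < T" and x: "x \<in> {0..t}"
  shows "(\<psi> has_vector_derivative h x) (at x within {0..t})"
proof -
  have lt: "ereal y < T" if "y \<le> t" for y using below_T[OF _ t(2)] that by auto
  have q: "\<bar>(\<psi> y - \<psi> x) / (y - x) - h x\<bar> \<le> \<bar>h y - h x\<bar>" if y: "y \<in> {0..t}" "y \<noteq> x" for y
  proof (cases "x < y")
    case True
    have "(y - x) * h x \<le> \<psi> y - \<psi> x" "\<psi> y - \<psi> x \<le> (y - x) * h y"
      using psi_diff[of x y] x y True lt by auto
    then have "h x \<le> (\<psi> y - \<psi> x) / (y - x)" "(\<psi> y - \<psi> x) / (y - x) \<le> h y"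
      using True by (simp_all add: field_simps)
    then show ?thesis by simp
  next
    case False
    then have yx: "y < x" using y by simp
    have "(x - y) * h y \<le> \<psi> x - \<psi> y" "\<psi> x - \<psi> y \<le> (x - y) * h x"
      using psi_diff[of y x] x y yx lt by auto
    then have "h y \<le> (\<psi> x - \<psi> y) / (x - y)" "(\<psi> x - \<psi> y) / (x - y) \<le> h x"
      using yx by (simp_all add: field_simps)
    moreover have "(\<psi> y - \<psi> x) / (y - x) = (\<psi> x - \<psi> y) / (x - y)"
      by (metis minus_diff_eq minus_divide_divide)
    ultimately show ?thesis by simp
  qed
  have "(h \<longlongrightarrow> h x) (at x within {0..t})" using h_cont[OF t] x by (auto simp: continuous_on)
  then have l: "((\<lambda>y. h y - h x) \<longlongrightarrow> 0) (at x within {0..t})" by (simp add: LIM_zero)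
  have "((\<lambda>y. (\<psi> y - \<psi> x) / (y - x) - h x) \<longlongrightarrow> 0) (at x within {0..t})"
    by (rule Lim_null_comparison[OF _ tendsto_rabs_zero[OF l]])
       (use q in \<open>auto simp: eventually_at_filter intro!: always_eventually\<close>)
  then have "((\<lambda>y. (\<psi> y - \<psi> x) / (y - x)) \<longlongrightarrow> h x) (at x within {0..t})" by (simp add: LIM_zero_iff)
  then show ?thesis
    by (simp add: has_real_derivative_iff_has_vector_derivative[symmetric] has_field_derivative_iff)
qed

lemma integral_h:
  assumes t: "0 \<le> t" "ereal t < T"
  shows "(LBINT s=0..ereal t. h s) = \<psi> t"
proof -
  have "(LBINT s=ereal 0..ereal t. h s) = \<psi> t - \<psi> 0"
    using t h_cont[OF t] psi_deriv[OF t] by (intro interval_integral_FTC_finite) auto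
  then show ?thesis by (simp add: psi0 zero_ereal_def)
qed

lemma h_ivt:
  assumes t: "0 \<le> t" "ereal t < T" and y: "0 < y" "y < h t"
  obtains s where "0 < s" "s < t" "h s = y"
proof -
  have "\<exists>s. 0 \<le> s \<and> s \<le> t \<and> h s = y"
    using t y h_cont[OF t] h0 by (intro IVT') auto
  then obtain s where s: "0 \<le> s" "s \<le> t" "h s = y" by auto
  then have "s \<noteq> 0" "s \<noteq> t" using y h0 by auto
  then show thesis using s by (intro that[of s]) auto
qed

text \<open>Formed exactly like \<open>h_inv\<close>, so that the two are identified by unfolding.
  Values outside the range of \<open>h\<close> are unspecified; the integrals below stay inside that
  range.\<close>

definition hinv :: "real \<Rightarrow> real" where
  "hinv = the_inv_into {s. 0 < s \<and> ereal s < T} h"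

lemma hinv_h: "0 < s \<Longrightarrow> ereal s < T \<Longrightarrow> hinv (h s) = s"
  unfolding hinv_def
proof (rule the_inv_into_f_f)
  show "inj_on h {s. 0 < s \<and> ereal s < T}"
  proof (rule inj_onI)
    fix x y assume "x \<in> {s. 0 < s \<and> ereal s < T}" "y \<in> {s. 0 < s \<and> ereal s < T}" "h x = h y"
    then show "x = y" using h_strict[of x y] h_strict[of y x] by (cases x y rule: linorder_cases) auto
  qed
qed auto

lemma area_bound:
  assumes t: "0 \<le> t" "ereal t < T" and le: "h t \<le> X"
  shows "(\<integral>\<^sup>+\<tau>. ennreal (X - h \<tau>) * indicator {0..t} \<tau> \<partial>lborel) = ennreal (t * X - \<psi> t)"
proof -
  have i: "set_integrable lborel {0..t} h" by (rule borel_integrable_atLeastAtMost') (rule h_cont[OF t])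
  have c: "set_integrable lborel {0..t} (\<lambda>_. X)" by (rule borel_integrable_atLeastAtMost') auto
  have H: "(LINT \<tau>:{0..t}|lborel. h \<tau>) = \<psi> t"
    using integral_FTC_atLeastAtMost[OF t(1) psi_deriv[OF t] h_cont[OF t]] by (simp add: psi0 set_lebesgue_integral_def)
  have "(\<integral>\<^sup>+\<tau>. ennreal (X - h \<tau>) * indicator {0..t} \<tau> \<partial>lborel) = (\<integral>\<^sup>+\<tau>. ennreal (indicator {0..t} \<tau> *\<^sub>R (X - h \<tau>)) \<partial>lborel)"
    by (intro nn_integral_cong) (auto simp: indicator_def)
  also have "\<dots> = ennreal (LINT \<tau>:{0..t}|lborel. X - h \<tau>)"
    unfolding set_lebesgue_integral_def
  proof (rule nn_integral_eq_integral)
    show "integrable lborel (\<lambda>\<tau>. indicat_real {0..t} \<tau> *\<^sub>R (X - h \<tau>))"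
      using set_integral_diff(1)[OF c i] by (simp add: set_integrable_def)
    show "AE \<tau> in lborel. 0 \<le> indicat_real {0..t} \<tau> *\<^sub>R (X - h \<tau>)"
    proof (intro AE_I2)
      fix \<tau> :: real
      show "0 \<le> indicat_real {0..t} \<tau> *\<^sub>R (X - h \<tau>)"
        using h_mono[of \<tau> t] t le by (cases "\<tau> \<in> {0..t}") (auto simp: indicator_def)
    qed
  qed
  also have "(LINT \<tau>:{0..t}|lborel. X - h \<tau>) = t * X - \<psi> t"
  proof -
    have "(LINT \<tau>:{0..t}|lborel. X) = t * X" using t by (simp add: set_lebesgue_integral_def)
    then show ?thesis unfolding set_integral_diff(2)[OF c i] H by simp
  qed
  finally show ?thesis .
qed

text \<open>The region under the graph of the inverse is the region above the graph of \<open>h\<close>.\<close>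

lemma integral_hinv_le:
  assumes X: "0 < X" and reach: "\<And>y. 0 < y \<Longrightarrow> y < X \<Longrightarrow> \<exists>t. 0 \<le> t \<and> ereal t < T \<and> y < h t"
    and c: "\<And>t. 0 \<le> t \<Longrightarrow> ereal t < T \<Longrightarrow> t * X - \<psi> t \<le> c"
  shows "(LBINT s=0..ereal X. hinv s) \<le> c"
proof -
  have c0: "0 \<le> c" using c[of 0] T0 psi0 by (simp add: zero_ereal_def)
  \<comment> \<open>\<open>h\<close> capped at \<open>X\<close>, made monotone and hence measurable
    on the whole line. Beyond \<open>T\<close> the value \<open>X\<close> is the right one, since by
    \<open>reach\<close> every level below \<open>X\<close> is exceeded before
    \<open>T\<close>.\<close>
  define g where "g \<tau> = (if \<tau> \<le> 0 then 0 else if ereal \<tau> < T then min (h \<tau>) X else X)" for \<tau>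
  have g_mono: "mono g"
  proof (rule monoI)
    fix s t :: real assume st: "s \<le> t"
    have "ereal s < T" if "ereal t < T" using below_T[OF st that] .
    then show "g s \<le> g t" using st X h_mono[of s t] h_nonneg[of t] by (auto simp: g_def min_def)
  qed
  have [measurable]: "g \<in> borel_measurable borel" using g_mono by (rule borel_measurable_mono)
  have gX: "g \<tau> \<le> X" for \<tau> using X by (auto simp: g_def)
  have hinv_set: "ennreal (hinv y) = (\<integral>\<^sup>+\<tau>. indicator {\<tau>. 0 < \<tau> \<and> g \<tau> < y} \<tau> \<partial>lborel)" if y: "0 < y" "y < X" for y
  proof -
    obtain t where t: "0 \<le> t" "ereal t < T" "y < h t" using reach[OF y] by auto
    from h_ivt[OF t(1,2) y(1) t(3)] obtain s where s: "0 < s" "s < t" "h s = y" by blast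
    have sT: "ereal s < T" using below_T[OF _ t(2)] s by auto
    have "{\<tau>. 0 < \<tau> \<and> g \<tau> < y} = {0<..<s}"
    proof (rule subset_antisym; rule subsetI)
      fix \<tau> assume a: "\<tau> \<in> {\<tau>. 0 < \<tau> \<and> g \<tau> < y}"
      then have "ereal \<tau> < T" "h \<tau> < y" using y by (auto simp: g_def split: if_splits)
      then have "\<not> s \<le> \<tau>" using h_mono[of s \<tau>] s by auto
      then show "\<tau> \<in> {0<..<s}" using a by auto
    next
      fix \<tau> assume a: "\<tau> \<in> {0<..<s}"
      then have "h \<tau> < y" using h_strict[of \<tau> s] s sT by auto
      then show "\<tau> \<in> {\<tau>. 0 < \<tau> \<and> g \<tau> < y}" using a y below_T[OF _ sT, of \<tau>] by (auto simp: g_def)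
    qed
    then show ?thesis using hinv_h[OF s(1) sT] s by simp
  qed
  have piece: "(\<integral>\<^sup>+\<tau>. ennreal (X - g \<tau>) * indicator {0<..t} \<tau> \<partial>lborel) \<le> ennreal c" if t: "0 \<le> t" "ereal t < T" for t
  proof -
    \<comment> \<open>\<open>t'\<close> is the place where \<open>h\<close> crosses the level
      \<open>X\<close>, or \<open>t\<close> itself if it does not; beyond \<open>t'\<close> the
      integrand \<open>X - g\<close> vanishes.\<close>
    obtain t' where t': "0 \<le> t'" "t' \<le> t" "h t' \<le> X" "\<And>\<tau>. t' < \<tau> \<Longrightarrow> \<tau> \<le> t \<Longrightarrow> X \<le> h \<tau>"
    proof (cases "h t \<le> X")
      case True
      then show thesis using t by (intro that[of t]) auto
    next
      case False
      then have "X < h t" by simp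
      from h_ivt[OF t X this] obtain s where s: "0 < s" "s < t" "h s = X" by blast
      have "X \<le> h \<tau>" if "s < \<tau>" "\<tau> \<le> t" for \<tau>
      proof -
        have "ereal \<tau> < T" using below_T[OF _ t(2)] that by auto
        then show ?thesis using h_mono[of s \<tau>] s that by auto
      qed
      then show thesis using s by (intro that[of s]) auto
    qed
    have t'T: "ereal t' < T" using below_T[OF t'(2) t(2)] .
    have "(\<integral>\<^sup>+\<tau>. ennreal (X - g \<tau>) * indicator {0<..t} \<tau> \<partial>lborel) \<le> (\<integral>\<^sup>+\<tau>. ennreal (X - h \<tau>) * indicator {0..t'} \<tau> \<partial>lborel)"
    proof (intro nn_integral_mono)
      fix \<tau> :: real
      show "ennreal (X - g \<tau>) * indicator {0<..t} \<tau> \<le> ennreal (X - h \<tau>) * indicator {0..t'} \<tau>"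
      proof (cases "0 < \<tau> \<and> \<tau> \<le> t")
        case True
        then have \<tau>T: "ereal \<tau> < T" using below_T[OF _ t(2)] by auto
        show ?thesis
        proof (cases "\<tau> \<le> t'")
          case True': True
          have "h \<tau> \<le> X" using h_mono[of \<tau> t'] True True' t' t'T by auto
          then show ?thesis using True True' \<tau>T by (auto simp: g_def)
        next
          case False
          then have "X \<le> h \<tau>" using t'(4)[of \<tau>] True by auto
          then have "g \<tau> = X" using True \<tau>T by (auto simp: g_def)
          then show ?thesis by simp
        qed
      qed (auto simp: indicator_def)
    qed
    also have "\<dots> = ennreal (t' * X - \<psi> t')" by (rule area_bound) (use t' t'T in auto)
    also have "\<dots> \<le> ennreal c" by (intro ennreal_leI c t' t'T)
    finally show ?thesis .
  qed
  \<comment> \<open>An exhaustion of \<open>(0, T)\<close>, which covers finite and infinite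
    \<open>T\<close> alike.\<close>
  obtain S :: "nat \<Rightarrow> real" where S: "incseq S" "\<And>i. 0 < S i" "\<And>i. ereal (S i) < T" "(\<lambda>i. ereal (S i)) \<longlonglongrightarrow> T"
    using ereal_incseq_approx[OF T0] by auto
  have total: "(\<integral>\<^sup>+\<tau>. ennreal (X - g \<tau>) * indicator {0<..} \<tau> \<partial>lborel) \<le> ennreal c"
  proof -
    have "(\<integral>\<^sup>+\<tau>. ennreal (X - g \<tau>) * indicator {0<..} \<tau> \<partial>lborel) \<le> (\<integral>\<^sup>+\<tau>. (SUP i. ennreal (X - g \<tau>) * indicator {0<..S i} \<tau>) \<partial>lborel)"
    proof (intro nn_integral_mono)
      fix \<tau> :: real
      show "ennreal (X - g \<tau>) * indicator {0<..} \<tau> \<le> (SUP i. ennreal (X - g \<tau>) * indicator {0<..S i} \<tau>)"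
      proof (cases "0 < \<tau> \<and> ereal \<tau> < T")
        case True
        then have "eventually (\<lambda>i. ereal \<tau> < ereal (S i)) sequentially" using S(4) by (intro order_tendstoD) auto
        then obtain i where "\<tau> < S i" by (auto simp: eventually_sequentially)
        then show ?thesis using True by (intro SUP_upper2[of i]) (auto simp: indicator_def)
      next
        case False
        then show ?thesis by (auto simp: g_def indicator_def)
      qed
    qed
    also have "\<dots> = (SUP i. \<integral>\<^sup>+\<tau>. ennreal (X - g \<tau>) * indicator {0<..S i} \<tau> \<partial>lborel)"
    proof (rule nn_integral_monotone_convergence_SUP)
      show "incseq (\<lambda>i \<tau>. ennreal (X - g \<tau>) * indicator {0<..S i} \<tau>)"
        using S(1) by (auto simp: incseq_def le_fun_def indicator_def intro: order_trans)
    qed auto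
    also have "\<dots> \<le> ennreal c" using S by (intro SUP_least piece less_imp_le) auto
    finally show ?thesis .
  qed
  have nn: "(\<integral>\<^sup>+y. ennreal (indicator {0<..<X} y *\<^sub>R hinv y) \<partial>lborel) \<le> ennreal c"
  proof -
    have "(\<integral>\<^sup>+y. ennreal (indicator {0<..<X} y *\<^sub>R hinv y) \<partial>lborel) =
       (\<integral>\<^sup>+y. \<integral>\<^sup>+\<tau>. indicator {(y, \<tau>). 0 < y \<and> y < X \<and> 0 < \<tau> \<and> g \<tau> < y} (y, \<tau>) \<partial>lborel \<partial>lborel)"
    proof (intro nn_integral_cong)
      fix y :: real
      show "ennreal (indicator {0<..<X} y *\<^sub>R hinv y) = (\<integral>\<^sup>+\<tau>. indicator {(y, \<tau>). 0 < y \<and> y < X \<and> 0 < \<tau> \<and> g \<tau> < y} (y, \<tau>) \<partial>lborel)"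
      proof (cases "0 < y \<and> y < X")
        case True
        then have "indicator {(y, \<tau>). 0 < y \<and> y < X \<and> 0 < \<tau> \<and> g \<tau> < y} (y, \<tau>) = (indicator {\<tau>. 0 < \<tau> \<and> g \<tau> < y} \<tau> :: ennreal)" for \<tau>
          by (auto simp: indicator_def)
        then show ?thesis using True hinv_set[of y] by simp
      qed (auto simp: indicator_def)
    qed
    also have "\<dots> = (\<integral>\<^sup>+\<tau>. \<integral>\<^sup>+y. indicator {(y, \<tau>). 0 < y \<and> y < X \<and> 0 < \<tau> \<and> g \<tau> < y} (y, \<tau>) \<partial>lborel \<partial>lborel)"
    proof (rule lborel_pair.Fubini'[symmetric])
      show "(\<lambda>(y, \<tau>). indicator {(y, \<tau>). 0 < y \<and> y < X \<and> 0 < \<tau> \<and> g \<tau> < y} (y, \<tau>)) \<in> borel_measurable (lborel \<Otimes>\<^sub>M lborel)"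
        by measurable
    qed
    also have "\<dots> \<le> (\<integral>\<^sup>+\<tau>. ennreal (X - g \<tau>) * indicator {0<..} \<tau> \<partial>lborel)"
    proof (intro nn_integral_mono)
      fix \<tau> :: real
      have "(\<integral>\<^sup>+y. indicator {(y, \<tau>). 0 < y \<and> y < X \<and> 0 < \<tau> \<and> g \<tau> < y} (y, \<tau>) \<partial>lborel) \<le> (\<integral>\<^sup>+y. indicator {0<..} \<tau> * indicator {g \<tau><..<X} y \<partial>lborel)"
        by (intro nn_integral_mono) (auto simp: indicator_def)
      also have "\<dots> = ennreal (X - g \<tau>) * indicator {0<..} \<tau>"
        using gX[of \<tau>] by (simp add: nn_integral_cmult mult.commute)
      finally show "(\<integral>\<^sup>+y. indicator {(y, \<tau>). 0 < y \<and> y < X \<and> 0 < \<tau> \<and> g \<tau> < y} (y, \<tau>) \<partial>lborel) \<le> ennreal (X - g \<tau>) * indicator {0<..} \<tau>" .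
    qed
    also have "\<dots> \<le> ennreal c" by (rule total)
    finally show ?thesis .
  qed
  have e: "(LBINT s=0..ereal X. hinv s) = (LINT y|lborel. indicator {0<..<X} y *\<^sub>R hinv y)"
    using X unfolding zero_ereal_def interval_lebesgue_integral_def set_lebesgue_integral_def einterval_eq by simp
  show ?thesis
  proof (cases "integrable lborel (\<lambda>y. indicat_real {0<..<X} y *\<^sub>R hinv y)")
    case True
    have "0 \<le> hinv y" if y: "0 < y" "y < X" for y
    proof -
      obtain t where t: "0 \<le> t" "ereal t < T" "y < h t" using reach[OF y] by auto
      from h_ivt[OF t(1,2) y(1) t(3)] obtain s where s: "0 < s" "s < t" "h s = y" by blast
      have sT: "ereal s < T" using below_T[OF _ t(2)] s by auto
      show ?thesis using hinv_h[OF s(1) sT] s by simp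
    qed
    then have "ennreal (LINT y|lborel. indicator {0<..<X} y *\<^sub>R hinv y) = (\<integral>\<^sup>+y. ennreal (indicator {0<..<X} y *\<^sub>R hinv y) \<partial>lborel)"
      by (intro nn_integral_eq_integral[symmetric] True AE_I2) (auto simp: indicator_def)
    then have "ennreal (LINT y|lborel. indicator {0<..<X} y *\<^sub>R hinv y) \<le> ennreal c" using nn by simp
    then show ?thesis unfolding e using c0 by (simp add: ennreal_le_iff)
  next
    \<comment> \<open>The integral of a function that is not integrable is \<open>0\<close> by
      convention, and \<open>0 \<le> c\<close> by the case \<open>t = 0\<close> of the
      hypothesis.\<close>
    case False
    then show ?thesis unfolding e using c0 by (simp add: not_integrable_integral_eq)
  qed
qed

end

section \<open>Concentration for an infinitely divisible law\<close>

locale levy_exp = levy_law +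
  assumes nu_nonzero: "emeasure \<nu> (space \<nu>) \<noteq> 0"
    and exp_mom: "\<exists>t>0. (\<integral>\<^sup>+x. ennreal (exp (t * L2_set x I)) \<partial>P) < \<infinity>"
begin

interpretation P: prob_space P by (rule prob_P)

definition hh :: "real \<Rightarrow> real" where
  "hh s = (LINT u|\<nu>. L2_set u I * (exp (s * L2_set u I) - 1))"

definition TT :: ereal where
  "TT = Sup (ereal ` {t. 0 \<le> t \<and> (\<integral>\<^sup>+x. ennreal (exp (t * L2_set x I)) \<partial>P) < \<infinity>})"

lemma below_TT:
  assumes "ereal s < TT"
  obtains t where "0 \<le> t" "s < t" "set_integrable \<nu> (tail 1) (\<lambda>u. exp (t * L2_set u I))"
proof -
  obtain t where "0 \<le> t" "s < t" "(\<integral>\<^sup>+x. ennreal (exp (t * L2_set x I)) \<partial>P) < \<infinity>"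
    using assms unfolding TT_def less_Sup_iff by auto
  then show thesis using nu_exp_moment[of t] by (intro that[of t]) auto
qed

lemma TT_pos: "0 < TT"
proof -
  obtain t where "0 < t" "(\<integral>\<^sup>+x. ennreal (exp (t * L2_set x I)) \<partial>P) < \<infinity>" using exp_mom by auto
  then have "ereal t \<le> TT" unfolding TT_def by (intro Sup_upper) auto
  then show ?thesis using \<open>0 < t\<close> by (meson ereal_less(2) order_less_le_trans)
qed

lemma exp_tail:
  assumes "0 \<le> s" "ereal s < TT"
  shows "set_integrable \<nu> (tail 1) (\<lambda>u. exp (s * L2_set u I))"
proof -
  obtain t where t: "0 \<le> t" "s < t" "set_integrable \<nu> (tail 1) (\<lambda>u. exp (t * L2_set u I))"
    using below_TT[OF assms(2)] .
  show ?thesis unfolding set_integrable_def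
  proof (rule Bochner_Integration.integrable_bound[OF t(3)[unfolded set_integrable_def]])
    show "(\<lambda>u. indicat_real (tail 1) u *\<^sub>R exp (s * L2_set u I)) \<in> borel_measurable \<nu>"
      using fin comp_meas tail_sets[of 1] by measurable
    show "AE u in \<nu>. norm (indicat_real (tail 1) u *\<^sub>R exp (s * L2_set u I)) \<le> norm (indicat_real (tail 1) u *\<^sub>R exp (t * L2_set u I))"
      using t by (intro AE_I2) (auto simp: indicator_def L2_set_nonneg intro!: mult_right_mono)
  qed
qed

lemma square_le_exp:
  fixes x d :: real
  assumes "0 \<le> x" "0 < d"
  shows "x\<^sup>2 \<le> 4 / d\<^sup>2 * exp (d * x)"
proof -
  have "d * x / 2 \<le> exp (d * x / 2)" using exp_ge_add_one_self[of "d * x / 2"] by linarith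
  then have "(d * x / 2)\<^sup>2 \<le> (exp (d * x / 2))\<^sup>2" using assms by (intro power_mono) auto
  also have "(exp (d * x / 2))\<^sup>2 = exp (d * x)" by (simp add: power2_eq_square flip: exp_add)
  finally show ?thesis using assms by (simp add: field_simps power2_eq_square)
qed

text \<open>In the tail the square is absorbed by the gap between \<open>s\<close> and some larger
  \<open>t\<close> with finite exponential integral, by \<open>square_le_exp\<close>; near the
  origin the exponential is bounded and the square itself is integrable.\<close>

lemma integrable_sq_exp:
  assumes "0 \<le> s" "ereal s < TT"
  shows "integrable \<nu> (\<lambda>u. (L2_set u I)\<^sup>2 * exp (s * L2_set u I))"
proof -
  obtain t where t: "0 \<le> t" "s < t" "set_integrable \<nu> (tail 1) (\<lambda>u. exp (t * L2_set u I))"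
    using below_TT[OF assms(2)] .
  define c where "c = 4 / (t - s)\<^sup>2"
  have c: "0 \<le> c" by (simp add: c_def)
  show ?thesis
  proof (rule Bochner_Integration.integrable_bound)
    show "integrable \<nu> (\<lambda>u. c * (indicat_real (tail 1) u *\<^sub>R exp (t * L2_set u I)) +
      exp s * (indicat_real {u \<in> space \<nu>. L2_set u I \<le> 1} u *\<^sub>R (L2_set u I)\<^sup>2))"
      using t(3) square_integrable[of 1] unfolding set_integrable_def by (intro Bochner_Integration.integrable_add integrable_mult_right)
    show "(\<lambda>u. (L2_set u I)\<^sup>2 * exp (s * L2_set u I)) \<in> borel_measurable \<nu>"
      using fin comp_meas by measurable
    show "AE u in \<nu>. norm ((L2_set u I)\<^sup>2 * exp (s * L2_set u I)) \<le> norm (c * (indicat_real (tail 1) u *\<^sub>R exp (t * L2_set u I)) +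
      exp s * (indicat_real {u \<in> space \<nu>. L2_set u I \<le> 1} u *\<^sub>R (L2_set u I)\<^sup>2))"
    proof (intro AE_I2)
      fix u assume u: "u \<in> space \<nu>"
      define r where "r = L2_set u I"
      have r: "0 \<le> r" by (simp add: r_def L2_set_nonneg)
      show "norm ((L2_set u I)\<^sup>2 * exp (s * L2_set u I)) \<le> norm (c * (indicat_real (tail 1) u *\<^sub>R exp (t * L2_set u I)) +
        exp s * (indicat_real {u \<in> space \<nu>. L2_set u I \<le> 1} u *\<^sub>R (L2_set u I)\<^sup>2))"
      proof (cases "r \<le> 1")
        case True
        have "r\<^sup>2 * exp (s * r) \<le> exp s * r\<^sup>2"
          using assms True by (subst mult.commute) (auto intro!: mult_right_mono simp: mult_left_le)
        then show ?thesis using u True c by (simp add: tail_def r_def)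
      next
        case False
        have "r\<^sup>2 * exp (s * r) \<le> (c * exp ((t - s) * r)) * exp (s * r)"
          unfolding c_def using r t by (intro mult_right_mono square_le_exp) auto
        also have "\<dots> = c * exp (t * r)" by (simp add: left_diff_distrib flip: exp_add)
        finally show ?thesis using u False c by (simp add: tail_def r_def)
      qed
    qed
  qed
qed

lemma exp_increment:
  fixes r s t :: real
  assumes "s \<le> t" "0 \<le> r"
  shows "(t - s) * r * exp (s * r) \<le> exp (t * r) - exp (s * r)"
    and "exp (t * r) - exp (s * r) \<le> (t - s) * r * exp (t * r)"
proof -
  have "exp (s * r) * ((t - s) * r) \<le> exp (s * r) * (exp ((t - s) * r) - 1)"
    using exp_ge_add_one_self[of "(t - s) * r"] by (intro mult_left_mono) (linarith, simp)
  then show "(t - s) * r * exp (s * r) \<le> exp (t * r) - exp (s * r)"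
    by (simp add: right_diff_distrib left_diff_distrib mult.commute flip: exp_add)
  have "exp (t * r) * (1 - exp (- ((t - s) * r))) \<le> exp (t * r) * ((t - s) * r)"
    using exp_ge_add_one_self[of "- ((t - s) * r)"] by (intro mult_left_mono) (linarith, simp)
  moreover have "exp (t * r) * (1 - exp (- ((t - s) * r))) = exp (t * r) - exp (s * r)"
    by (simp add: right_diff_distrib left_diff_distrib flip: exp_add)
  moreover have "exp (t * r) * ((t - s) * r) = (t - s) * r * exp (t * r)" by (rule mult.commute)
  ultimately show "exp (t * r) - exp (s * r) \<le> (t - s) * r * exp (t * r)" by linarith
qed

lemma integrable_hh:
  assumes "0 \<le> s" "ereal s < TT"
  shows "integrable \<nu> (\<lambda>u. L2_set u I * (exp (s * L2_set u I) - 1))"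
proof (rule Bochner_Integration.integrable_bound[OF integrable_mult_right[OF integrable_sq_exp[OF assms], of s]])
  show "(\<lambda>u. L2_set u I * (exp (s * L2_set u I) - 1)) \<in> borel_measurable \<nu>"
    using fin comp_meas by measurable
  show "AE u in \<nu>. norm (L2_set u I * (exp (s * L2_set u I) - 1)) \<le> norm (s * ((L2_set u I)\<^sup>2 * exp (s * L2_set u I)))"
  proof (intro AE_I2)
    fix u
    define r where "r = L2_set u I"
    have r: "0 \<le> r" by (simp add: r_def L2_set_nonneg)
    have "r * (exp (s * r) - 1) \<le> r * (s * r * exp (s * r))"
      using exp_increment(2)[of 0 s r] r assms by (intro mult_left_mono) auto
    moreover have "0 \<le> r * (exp (s * r) - 1)" using r assms by (intro mult_nonneg_nonneg) auto
    ultimately show "norm (L2_set u I * (exp (s * L2_set u I) - 1)) \<le> norm (s * ((L2_set u I)\<^sup>2 * exp (s * L2_set u I)))"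
      using assms r by (simp add: r_def[symmetric] power2_eq_square mult_ac)
  qed
qed

text \<open>Norm \<open>0\<close> means the origin, which carries no mass, while
  \<open>\<nu>\<close> is not zero. This is the source of strict monotonicity of \<open>hh\<close>
  and of positivity of \<open>V2r\<close>.\<close>

lemma not_AE_norm_zero: "\<not> (AE u in \<nu>. L2_set u I = 0)"
proof
  assume "AE u in \<nu>. L2_set u I = 0"
  then have "AE u in \<nu>. u \<in> {vzero I}"
    using AE_space
  proof eventually_elim
    case (elim u)
    then have "\<And>k. k \<in> I \<Longrightarrow> u k = 0" using fin by (simp add: L2_set_eq_0_iff)
    then show ?case using elim(2) unfolding space_nu
      by (auto simp: vzero_def space_PiM PiE_def extensional_def fun_eq_iff)
  qed
  have z: "{vzero I} \<in> sets \<nu>"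
  proof -
    have "{vzero I} = {u \<in> space \<nu>. L2_set u I = 0}"
      unfolding space_nu L2_set_eq_0_iff[OF fin]
      by (auto simp: vzero_def space_PiM PiE_def extensional_def fun_eq_iff)
    then show ?thesis using nrm_meas by simp
  qed
  have "AE u in \<nu>. u \<notin> {vzero I}" using nu_zero z by (intro AE_not_in) (auto simp: null_sets_def)
  with \<open>AE u in \<nu>. u \<in> {vzero I}\<close> have "AE u in \<nu>. False" by eventually_elim auto
  then obtain N where "space \<nu> \<subseteq> N" "emeasure \<nu> N = 0" "N \<in> sets \<nu>" by (auto elim: AE_E)
  then have "emeasure \<nu> (space \<nu>) = 0" using emeasure_mono[of "space \<nu>" N \<nu>] by simp
  then show False using nu_nonzero by simp
qed

lemma hh_strict:
  assumes s: "0 \<le> s" and st: "s < t" and t: "ereal t < TT"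
  shows "hh s < hh t"
proof -
  have sT: "ereal s < TT" using st t by (meson ereal_less_eq(3) less_imp_le order_le_less_trans)
  have tt: "0 \<le> t" using s st by simp
  note i = integrable_hh[OF s sT] integrable_hh[OF tt t]
  let ?d = "\<lambda>u. L2_set u I * (exp (t * L2_set u I) - 1) - L2_set u I * (exp (s * L2_set u I) - 1)"
  have d: "?d u = L2_set u I * (exp (t * L2_set u I) - exp (s * L2_set u I))" for u
    by (simp add: algebra_simps)
  have d0: "0 \<le> ?d u" for u
    unfolding d using st by (intro mult_nonneg_nonneg) (auto simp: L2_set_nonneg mult_right_mono)
  have dI: "(LINT u|\<nu>. ?d u) = hh t - hh s" unfolding hh_def using i by simp
  have "(LINT u|\<nu>. ?d u) \<noteq> 0"
  proof
    assume "(LINT u|\<nu>. ?d u) = 0"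
    then have "AE u in \<nu>. ?d u = 0"
      using i d0 by (subst (asm) integral_nonneg_eq_0_iff_AE) auto
    then have "AE u in \<nu>. L2_set u I = 0"
    proof eventually_elim
      case (elim u)
      then have "L2_set u I = 0 \<or> t * L2_set u I = s * L2_set u I" unfolding d by simp
      then show ?case using st by auto
    qed
    then show False using not_AE_norm_zero by simp
  qed
  moreover have "0 \<le> (LINT u|\<nu>. ?d u)" using d0 by (intro Bochner_Integration.integral_nonneg)
  ultimately show ?thesis using dI by simp
qed

lemma integrable_psi:
  assumes "0 \<le> s" "ereal s < TT"
  shows "integrable \<nu> (\<lambda>u. exp (s * L2_set u I) - 1 - s * L2_set u I)"
  using set_integrable_norm_exp(3)[OF exp_tail[OF assms] assms(1)] .

lemma psi_increment:
  assumes s: "0 \<le> s" and st: "s < t" and t: "ereal t < TT"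
  shows "(t - s) * hh s \<le> psi t - psi s" "psi t - psi s \<le> (t - s) * hh t"
proof -
  have sT: "ereal s < TT" using st t by (meson ereal_less_eq(3) less_imp_le order_le_less_trans)
  have tt: "0 \<le> t" using s st by simp
  note i = integrable_hh[OF s sT] integrable_hh[OF tt t] integrable_psi[OF s sT] integrable_psi[OF tt t]
  let ?d = "\<lambda>u. (exp (t * L2_set u I) - 1 - t * L2_set u I) - (exp (s * L2_set u I) - 1 - s * L2_set u I)"
  have D: "psi t - psi s = (LINT u|\<nu>. ?d u)"
    unfolding psi_def by (rule Bochner_Integration.integral_diff[OF i(4) i(3), symmetric])
  have iD: "integrable \<nu> ?d" by (rule Bochner_Integration.integrable_diff[OF i(4) i(3)])
  have "(t - s) * hh s = (LINT u|\<nu>. (t - s) * (L2_set u I * (exp (s * L2_set u I) - 1)))" unfolding hh_def using i by simp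
  also have "\<dots> \<le> (LINT u|\<nu>. ?d u)"
  proof (rule integral_mono)
    show "(t - s) * (L2_set u I * (exp (s * L2_set u I) - 1)) \<le> ?d u" for u
      using exp_increment(1)[of s t "L2_set u I"] st by (simp add: L2_set_nonneg algebra_simps)
  qed (use i(1) iD in \<open>auto simp del: Bochner_Integration.integrable_diff\<close>)
  finally show "(t - s) * hh s \<le> psi t - psi s" unfolding D .
  have "(LINT u|\<nu>. ?d u) \<le> (LINT u|\<nu>. (t - s) * (L2_set u I * (exp (t * L2_set u I) - 1)))"
  proof (rule integral_mono)
    show "?d u \<le> (t - s) * (L2_set u I * (exp (t * L2_set u I) - 1))" for u
      using exp_increment(2)[of s t "L2_set u I"] st by (simp add: L2_set_nonneg algebra_simps)
  qed (use i(2) iD in \<open>auto simp del: Bochner_Integration.integrable_diff\<close>)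
  also have "\<dots> = (t - s) * hh t" unfolding hh_def using i by simp
  finally show "psi t - psi s \<le> (t - s) * hh t" unfolding D .
qed

text \<open>The increment from \<open>x\<close> to \<open>y\<close> is at most \<open>y - x\<close>
  times the integral of \<open>|u|^2 * exp (t |u|)\<close>, finite because \<open>t\<close> is
  strictly below \<open>TT\<close>; so \<open>hh\<close> is even Lipschitz on the interval.\<close>

lemma hh_cont:
  assumes t: "0 \<le> t" "ereal t < TT"
  shows "continuous_on {0..t} hh"
proof -
  define M where "M = (LINT u|\<nu>. (L2_set u I)\<^sup>2 * exp (t * L2_set u I))"
  have lt: "ereal y < TT" if "y \<le> t" for y using that t by (meson ereal_less_eq(3) order_le_less_trans)
  have inc: "hh y - hh x \<le> M * (y - x)" if xy: "0 \<le> x" "x \<le> y" "y \<le> t" for x y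
  proof -
    have y0: "0 \<le> y" and xt: "x \<le> t" using xy by auto
    note i = integrable_hh[OF xy(1) lt[OF xt]] integrable_hh[OF y0 lt[OF xy(3)]] integrable_sq_exp[OF t]
    have "hh y - hh x = (LINT u|\<nu>. L2_set u I * (exp (y * L2_set u I) - 1) - L2_set u I * (exp (x * L2_set u I) - 1))"
      unfolding hh_def using i by simp
    also have "\<dots> \<le> (LINT u|\<nu>. (y - x) * ((L2_set u I)\<^sup>2 * exp (t * L2_set u I)))"
    proof (rule integral_mono)
      fix u
      define r where "r = L2_set u I"
      have r: "0 \<le> r" by (simp add: r_def L2_set_nonneg)
      have "r * (exp (y * r) - exp (x * r)) \<le> r * ((y - x) * r * exp (y * r))"
        using r xy by (intro mult_left_mono exp_increment) auto
      also have "\<dots> \<le> r * ((y - x) * r * exp (t * r))"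
        using r xy by (intro mult_left_mono) (auto intro: mult_right_mono)
      finally show "L2_set u I * (exp (y * L2_set u I) - 1) - L2_set u I * (exp (x * L2_set u I) - 1) \<le> (y - x) * ((L2_set u I)\<^sup>2 * exp (t * L2_set u I))"
        unfolding r_def[symmetric] by (simp add: power2_eq_square algebra_simps)
    qed (use i in auto)
    also have "\<dots> = M * (y - x)" unfolding M_def using i by simp
    finally show ?thesis .
  qed
  have mono: "hh x \<le> hh y" if "0 \<le> x" "x \<le> y" "y \<le> t" for x y
    using hh_strict[of x y] that lt by (cases "x = y") auto
  have "dist (hh x) (hh y) \<le> \<bar>M\<bar> * dist x y" if xy: "x \<in> {0..t}" "y \<in> {0..t}" for x y
  proof -
    have *: "dist (hh x) (hh y) \<le> \<bar>M\<bar> * dist x y" if "x \<le> y" "0 \<le> x" "y \<le> t" for x y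
    proof -
      have "hh y - hh x \<le> \<bar>M\<bar> * (y - x)"
        using inc[of x y] that mult_right_mono[of M "\<bar>M\<bar>" "y - x"] by linarith
      then show ?thesis using mono[of x y] that by (simp add: dist_real_def)
    qed
    show ?thesis using *[of x y] *[of y x] xy by (cases "x \<le> y") (auto simp: dist_commute)
  qed
  then have "\<bar>M\<bar>-lipschitz_on {0..t} hh" by (intro lipschitz_onI) auto
  then show ?thesis by (rule lipschitz_on_continuous_on)
qed

sublocale young: young_pair hh psi TT
proof
  show "0 < TT" by (rule TT_pos)
  show "hh 0 = 0" by (simp add: hh_def)
  show "psi 0 = 0" by (simp add: psi_def)
qed (use hh_strict psi_increment hh_cont in auto)

lemma chernoff:
  assumes t: "0 \<le> t" "ereal t < TT"
    and F: "F \<in> borel_measurable (RI I)" "\<And>x. \<bar>F x\<bar> \<le> B" "lip_on I 1 F"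
  shows "measure P {x \<in> space P. F x - (LINT y|P. F y) \<ge> X} \<le> exp (- (t * X - psi t))"
proof -
  note [measurable_cong] = sets_P
  note [measurable] = F(1)
  let ?m = "LINT y|P. F y"
  have e: "(LINT x|P. exp (t * F x)) \<le> exp (t * ?m + psi t)"
    by (rule exp_bound_P[OF t(1) exp_tail[OF t] F])
  have tB: "t * F x \<le> t * B" for x using F(2)[of x] t by (intro mult_left_mono) auto
  have ie: "integrable P (\<lambda>x. exp (t * F x))"
    by (rule P.integrable_const_bound[where B="exp (t * B)"]) (use tB in auto)
  have "exp (t * (?m + X)) * measure P {x \<in> space P. F x - ?m \<ge> X} = (LINT x|P. exp (t * (?m + X)) * indicator {x \<in> space P. F x - ?m \<ge> X} x)"
    by simp
  also have "\<dots> \<le> (LINT x|P. exp (t * F x))"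
  proof (rule integral_mono)
    fix x
    show "exp (t * (?m + X)) * indicator {x \<in> space P. F x - ?m \<ge> X} x \<le> exp (t * F x)"
      using t by (auto simp: indicator_def intro!: mult_left_mono)
  qed (use ie in \<open>auto simp: P.emeasure_eq_measure\<close>)
  also note e
  finally have "measure P {x \<in> space P. F x - ?m \<ge> X} \<le> exp (t * ?m + psi t) / exp (t * (?m + X))"
    by (simp add: field_simps)
  also have "\<dots> = exp (- (t * X - psi t))" by (simp add: algebra_simps flip: exp_diff)
  finally show ?thesis .
qed

text \<open>If \<open>p\<close> is the probability, the Chernoff bounds say
  \<open>t * X - psi t \<le> - ln p\<close> for all admissible \<open>t\<close>, and
  \<open>integral_hinv_le\<close> turns such a common bound into one for the integral of the
  inverse. No optimal \<open>t\<close> is chosen, so \<open>X\<close> may equal the left limit of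
  \<open>hh\<close> at \<open>TT\<close>.\<close>

lemma concentration_upper:
  assumes X: "0 < X" and reach: "\<And>y. 0 < y \<Longrightarrow> y < X \<Longrightarrow> \<exists>t. 0 \<le> t \<and> ereal t < TT \<and> y < hh t"
    and F: "F \<in> borel_measurable (RI I)" "\<And>x. \<bar>F x\<bar> \<le> B" "lip_on I 1 F"
  shows "measure P {x \<in> space P. F x - (LINT y|P. F y) \<ge> X} \<le> exp (- (LBINT s=0..ereal X. young.hinv s))"
proof -
  define p where "p = measure P {x \<in> space P. F x - (LINT y|P. F y) \<ge> X}"
  show ?thesis
  proof (cases "p = 0")
    case True
    then show ?thesis by (simp add: p_def)
  next
    case False
    then have p: "0 < p" by (simp add: p_def zero_less_measure_iff)
    have "(LBINT s=0..ereal X. young.hinv s) \<le> - ln p"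
    proof (rule young.integral_hinv_le[OF X reach])
      fix t assume t: "0 \<le> t" "ereal t < TT"
      have "p \<le> exp (- (t * X - psi t))" unfolding p_def by (rule chernoff[OF t F])
      then have "ln p \<le> - (t * X - psi t)" using p by (metis exp_gt_zero ln_exp ln_le_cancel_iff)
      then show "t * X - psi t \<le> - ln p" by simp
    qed
    then have "exp (ln p) \<le> exp (- (LBINT s=0..ereal X. young.hinv s))" by simp
    then have "p \<le> exp (- (LBINT s=0..ereal X. young.hinv s))" using p by simp
    then show ?thesis by (simp only: p_def)
  qed
qed

lemma concentration:
  assumes L: "0 < L" and d: "0 < d"
    and reach: "\<And>y. 0 < y \<Longrightarrow> y < d / L \<Longrightarrow> \<exists>t. 0 \<le> t \<and> ereal t < TT \<and> y < hh t"
    and F: "F \<in> borel_measurable (RI I)" "\<And>x. \<bar>F x\<bar> \<le> B" "lip_on I L F"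
  shows "measure P {x \<in> space P. \<bar>F x - (LINT y|P. F y)\<bar> \<ge> d} \<le> 2 * exp (- (LBINT s=0..ereal (d / L). young.hinv s))"
proof -
  note [measurable_cong] = sets_P
  note [measurable] = F(1)
  let ?m = "LINT y|P. F y"
  have X: "0 < d / L" using L d by simp
  have up: "measure P {x \<in> space P. c / L * F x - (LINT y|P. c / L * F y) \<ge> d / L} \<le> exp (- (LBINT s=0..ereal (d / L). young.hinv s))"
    if c: "\<bar>c\<bar> = 1" for c
  proof (rule concentration_upper[OF X reach])
    show "lip_on I 1 (\<lambda>x. c / L * F x)"
      using lip_on_cmult[OF F(3), of "c / L"] L c by simp
    show "\<bar>c / L * F x\<bar> \<le> B / L" for x
      using L c F(2)[of x] by (simp add: abs_mult divide_right_mono)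
  qed auto
  have "measure P {x \<in> space P. \<bar>F x - ?m\<bar> \<ge> d} \<le>
    measure P ({x \<in> space P. 1 / L * F x - (LINT y|P. 1 / L * F y) \<ge> d / L} \<union> {x \<in> space P. -1 / L * F x - (LINT y|P. -1 / L * F y) \<ge> d / L})"
    using L by (intro P.finite_measure_mono) (auto simp: field_simps abs_if split: if_splits)
  also have "\<dots> \<le> measure P {x \<in> space P. 1 / L * F x - (LINT y|P. 1 / L * F y) \<ge> d / L} + measure P {x \<in> space P. -1 / L * F x - (LINT y|P. -1 / L * F y) \<ge> d / L}"
    by (rule measure_Un_le) measurable
  also have "\<dots> \<le> 2 * exp (- (LBINT s=0..ereal (d / L). young.hinv s))"
    using up[of 1] up[of "-1"] by simp
  finally show ?thesis .
qed

lemma hh_nonneg: "0 \<le> t \<Longrightarrow> ereal t < TT \<Longrightarrow> 0 \<le> hh t"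
  by (rule young.h_nonneg)

lemma psi_nonneg: "0 \<le> t \<Longrightarrow> 0 \<le> psi t"
  unfolding psi_def
  by (intro Bochner_Integration.integral_nonneg exp_taylor1(1)) (simp add: L2_set_nonneg)

text \<open>Jumps of size at most \<open>1 / t\<close> contribute at most \<open>1 / (4 * t)\<close>, and \<open>1 / t \<le> h t\<close> because of the entropy condition.\<close>

lemma tail_first_moment:
  assumes t: "0 < t" "ereal t < TT" and q: "emeasure \<nu> (tail r) \<le> ennreal (1 / 4)" and ent: "1 \<le> t * hh t"
  shows "set_integrable \<nu> (tail r) (\<lambda>u. L2_set u I)" "(LINT u:tail r|\<nu>. L2_set u I) \<le> hh t"
proof -
  have t0: "0 \<le> t" using t by simp
  note ih = integrable_hh[OF t0 t(2)]
  \<comment> \<open>For a jump \<open>x > 1 / t\<close> one has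
    \<open>x * e \<le> x * (exp (t * x) - 1)\<close>. With \<open>e \<ge> 3 / 2\<close> the two
    contributions add up to at most \<open>(1 / 4 + 2 / 3) * hh t\<close>, which is below
    \<open>hh t\<close>.\<close>
  define e where "e = exp 1 - (1::real)"
  have e: "3 / 2 \<le> e" using exp_lower_Taylor_quadratic[of 1] by (simp add: e_def)
  have tf: "emeasure \<nu> (tail r) < \<infinity>" using q by (rule order_le_less_trans) simp
  have q': "measure \<nu> (tail r) \<le> 1 / 4"
    using q unfolding measure_def by (intro enn2real_leI) auto
  let ?w = "\<lambda>u. 1 / t * indicat_real (tail r) u + 1 / e * (L2_set u I * (exp (t * L2_set u I) - 1))"
  have iw: "integrable \<nu> ?w" using ih tf by (auto simp: integrable_indicator_iff)
  have pt: "indicat_real (tail r) u *\<^sub>R L2_set u I \<le> ?w u" for u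
  proof -
    define x where "x = L2_set u I"
    have x: "0 \<le> x" by (simp add: x_def L2_set_nonneg)
    have e0: "0 \<le> 1 / e * (x * (exp (t * x) - 1))" using e x t by auto
    show ?thesis
    proof (cases "x \<le> 1 / t")
      case True
      then show ?thesis using e0 x t unfolding x_def[symmetric] by (auto simp: indicator_def)
    next
      case False
      then have "exp 1 \<le> exp (t * x)" using t by (simp add: field_simps)
      then have "x * e \<le> x * (exp (t * x) - 1)" using x by (intro mult_left_mono) (simp_all add: e_def)
      then have "x \<le> 1 / e * (x * (exp (t * x) - 1))" using e by (simp add: field_simps)
      then have "x \<le> 1 / t + 1 / e * (x * (exp (t * x) - 1))" using t by (intro add_increasing) auto
      then show ?thesis using x t e0 unfolding x_def[symmetric] by (auto simp: indicator_def)
    qed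
  qed
  show i: "set_integrable \<nu> (tail r) (\<lambda>u. L2_set u I)"
    unfolding set_integrable_def
  proof (rule Bochner_Integration.integrable_bound[OF iw])
    show "(\<lambda>u. indicat_real (tail r) u *\<^sub>R L2_set u I) \<in> borel_measurable \<nu>"
      using fin comp_meas tail_sets[of r] by measurable
    show "AE u in \<nu>. norm (indicat_real (tail r) u *\<^sub>R L2_set u I) \<le> norm (?w u)"
    proof (intro AE_I2)
      fix u
      have "0 \<le> indicat_real (tail r) u *\<^sub>R L2_set u I" by (simp add: L2_set_nonneg)
      with pt[of u] show "norm (indicat_real (tail r) u *\<^sub>R L2_set u I) \<le> norm (?w u)" by simp
    qed
  qed
  have "(LINT u:tail r|\<nu>. L2_set u I) \<le> (LINT u|\<nu>. ?w u)"
    unfolding set_lebesgue_integral_def using i iw pt by (intro integral_mono) (auto simp: set_integrable_def)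
  also have "\<dots> = 1 / t * measure \<nu> (tail r) + 1 / e * hh t"
    unfolding hh_def using ih tf by (simp add: integrable_indicator_iff)
  also have "\<dots> \<le> hh t * (1 / 4) + (2 / 3) * hh t"
  proof (intro add_mono mult_mono)
    show "1 / t \<le> hh t" using ent t by (simp add: field_simps)
    show "1 / e \<le> 2 / 3" using e by (simp add: field_simps)
  qed (use q' hh_nonneg[OF t0 t(2)] in auto)
  also have "\<dots> \<le> hh t" using hh_nonneg[OF t0 t(2)] by simp
  finally show "(LINT u:tail r|\<nu>. L2_set u I) \<le> hh t" .
qed

text \<open>The mean of the truncated norm is at most \<open>G + hh t\<close>, so a norm above
  \<open>G + 2 * hh t\<close> is a deviation of at least \<open>hh t\<close>, and the Chernoff bound
  at \<open>t\<close> has exactly the stated exponent for this deviation. The bound by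
  \<open>ln 6\<close> serves to obtain \<open>1 \<le> t * hh t\<close>, using
  \<open>psi t \<ge> 0\<close> and \<open>1 \<le> ln 6\<close>.\<close>

lemma norm_tail:
  assumes t: "0 < t" "ereal t < TT" and q: "emeasure \<nu> (tail r) \<le> ennreal (1 / 4)"
    and ent: "ln 6 \<le> t * hh t - psi t"
    and G: "L2_set (betar r) I + sqrt (V2r r) \<le> G"
  shows "measure P {x \<in> space P. G + 2 * hh t < L2_set x I} \<le> exp (- (t * hh t - psi t))"
proof -
  note [measurable_cong] = sets_P
  have t0: "0 \<le> t" using t by simp
  have "1 \<le> ln (6::real)" using exp_le by (subst ln_ge_iff) auto
  then have e1: "1 \<le> t * hh t" using ent psi_nonneg[OF t0] by linarith
  have G0: "0 \<le> G" using G V2r_nonneg[of r] L2_set_nonneg[of "betar r" I] real_sqrt_ge_zero[of "V2r r"] by linarith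
  have h0: "0 \<le> hh t" by (rule hh_nonneg[OF t0 t(2)])
  define K where "K = G + 2 * hh t + 1"
  define F where "F x = min (L2_set x I) K" for x :: "'a \<Rightarrow> real"
  have tf: "emeasure \<nu> (tail r) < \<infinity>" using q by (rule order_le_less_trans) simp
  have "(LINT x|P. F x) \<le> L2_set (betar r) I + sqrt (V2r r) + (LINT u:tail r|\<nu>. L2_set u I)"
    unfolding F_def using G0 h0 by (intro P_truncated_norm tf tail_first_moment(1)[OF t q e1]) (simp add: K_def)
  also have "\<dots> \<le> G + hh t" using G tail_first_moment(2)[OF t q e1] by simp
  finally have m: "(LINT x|P. F x) \<le> G + hh t" .
  have Fm[measurable]: "F \<in> borel_measurable (RI I)" unfolding F_def[abs_def] using fin by measurable
  have "measure P {x \<in> space P. G + 2 * hh t < L2_set x I} \<le> measure P {x \<in> space P. F x - (LINT y|P. F y) \<ge> hh t}"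
  proof (rule P.finite_measure_mono)
    have "F x - (LINT y|P. F y) \<ge> hh t" if "G + 2 * hh t < L2_set x I" for x
    proof -
      have "G + 2 * hh t \<le> F x" using that by (simp add: F_def K_def)
      then show ?thesis using m by linarith
    qed
    then show "{x \<in> space P. G + 2 * hh t < L2_set x I} \<subseteq> {x \<in> space P. F x - (LINT y|P. F y) \<ge> hh t}" by blast
  qed measurable
  also have "\<dots> \<le> exp (- (t * hh t - psi t))"
  proof (rule chernoff[OF t0 t(2) Fm])
    show "\<bar>F x\<bar> \<le> K" for x
    proof -
      have "0 \<le> K" using G0 h0 by (simp add: K_def)
      then show ?thesis using L2_set_nonneg[of x I] by (simp add: F_def)
    qed
    show "lip_on I 1 F" using lip_on_min_norm[of 1 I K] by (simp add: F_def[abs_def])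
  qed
  finally show ?thesis .
qed

end

section \<open>Spectral statistics of Hermitian matrices\<close>

lemma adj_dim[simp]: "dim_row (mat_adjoint A) = dim_col A" "dim_col (mat_adjoint A) = dim_row A"
  by (simp_all add: mat_adjoint_def)

lemma adj_carrier[simp]: "A \<in> carrier_mat n m \<Longrightarrow> mat_adjoint A \<in> carrier_mat m n"
  by (rule carrier_matI) simp_all

lemma adj_index:
  fixes A :: "complex mat"
  assumes "i < dim_col A" "j < dim_row A"
  shows "mat_adjoint A $$ (i, j) = cnj (A $$ (j, i))"
  using assms unfolding mat_adjoint_def by (simp add: mat_of_rows_def conjugate_complex_def)

lemma adj_adj[simp]: "mat_adjoint (mat_adjoint (A :: complex mat)) = A"
  by (rule eq_matI) (simp_all add: adj_index)

lemma adj_mult: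
  fixes A :: "complex mat"
  assumes "A \<in> carrier_mat n k" "B \<in> carrier_mat k m"
  shows "mat_adjoint (A * B) = mat_adjoint B * mat_adjoint A"
  by (rule eq_matI) (use assms in \<open>auto simp: adj_index scalar_prod_def intro!: sum.cong\<close>)

lemma mult_index:
  assumes "A \<in> carrier_mat n k" "B \<in> carrier_mat k m" "i < n" "j < m"
  shows "(A * B) $$ (i, j) = (\<Sum>l<k. A $$ (i, l) * B $$ (l, j))"
  using assms by (auto simp: scalar_prod_def atLeast0LessThan)

lemma adj_four_block:
  fixes A :: "complex mat"
  assumes "A \<in> carrier_mat n n" "D \<in> carrier_mat m m"
  shows "mat_adjoint (four_block_mat A (0\<^sub>m n m) (0\<^sub>m m n) D) = four_block_mat (mat_adjoint A) (0\<^sub>m n m) (0\<^sub>m m n) (mat_adjoint D)"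
  by (rule eq_matI) (use assms in \<open>auto simp: adj_index\<close>)

text \<open>The start of the deflation in \<open>hermitian_diagonalization\<close>: Gram-Schmidt
  leaves the first vector of the completed basis unchanged, and normalising the columns makes the
  orthogonal family unitary. Only the first column is tied to \<open>A\<close>.\<close>

lemma orthonormal_eigenbasis_start:
  fixes A :: "complex mat"
  assumes A: "A \<in> carrier_mat n n" and n: "0 < n"
  obtains W e where "W \<in> carrier_mat n n" "mat_adjoint W * W = 1\<^sub>m n"
    "\<And>k. k < n \<Longrightarrow> (A * W) $$ (k, 0) = e * W $$ (k, 0)"
proof -
  obtain e where "e \<in> spectrum A" using spectrum_non_empty[OF A n] by auto
  then have "eigenvalue A e" by (simp add: spectrum_def)
  then obtain v where v: "v \<in> carrier_vec n" "v \<noteq> 0\<^sub>v n" "A *\<^sub>v v = e \<cdot>\<^sub>v v"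
    using A by (auto simp: eigenvalue_def eigenvector_def)
  interpret cof_vec_space n "TYPE(complex)" .
  define b where "b = basis_completion v"
  define ws where "ws = gram_schmidt n b"
  from basis_completion[OF v(1,2), folded b_def]
  have span_b: "span (set b) = carrier_vec n" and dist_b: "distinct b"
    and indep: "\<not> lin_dep (set b)" and b: "set b \<subseteq> carrier_vec n" and hdb: "hd b = v"
    and len_b: "length b = n" by auto
  from hdb len_b n obtain vs where bv: "b = v # vs" by (cases b, auto)
  from gram_schmidt_result[OF b dist_b indep refl, folded ws_def]
  have ws: "set ws \<subseteq> carrier_vec n" "corthogonal ws" "length ws = n"
    by (auto simp: len_b)
  from gram_schmidt_hd[OF v(1), of vs, folded bv] have hdws: "hd ws = v" unfolding ws_def .
  have ws0: "ws ! 0 = v" using hdws ws n by (cases ws) auto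
  have wsc: "ws ! j \<in> carrier_vec n" if "j < n" for j using ws that by auto
  have ip: "ws ! i \<bullet>c ws ! j = (\<Sum>k<n. ws ! i $ k * cnj (ws ! j $ k))" if "i < n" "j < n" for i j
    using wsc[OF that(1)] wsc[OF that(2)] by (simp add: scalar_prod_def atLeast0LessThan conjugate_complex_def)
  define q where "q j = (\<Sum>k<n. (cmod (ws ! j $ k))\<^sup>2)" for j
  have qq: "ws ! j \<bullet>c ws ! j = complex_of_real (q j)" if "j < n" for j
    unfolding ip[OF that that] q_def by (simp only: of_real_sum complex_norm_square)
  have q0: "0 < q j" if "j < n" for j
  proof -
    have "ws ! j \<bullet>c ws ! j \<noteq> 0" using corthogonalD[OF ws(2), of j j] that ws(3) by auto
    then have "q j \<noteq> 0" using qq[OF that] by auto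
    moreover have "0 \<le> q j" by (simp add: q_def sum_nonneg)
    ultimately show ?thesis by simp
  qed
  define W where "W = Matrix.mat n n (\<lambda>(i, j). ws ! j $ i / complex_of_real (sqrt (q j)))"
  have W: "W \<in> carrier_mat n n" by (simp add: W_def)
  have "mat_adjoint W * W = 1\<^sub>m n"
  proof (rule eq_matI)
    fix i j assume ij: "i < dim_row (1\<^sub>m n :: complex mat)" "j < dim_col (1\<^sub>m n :: complex mat)"
    then have ij: "i < n" "j < n" by auto
    have "(mat_adjoint W * W) $$ (i, j) = (\<Sum>k<n. cnj (W $$ (k, i)) * W $$ (k, j))"
      using W ij by (subst mult_index[OF adj_carrier[OF W] W]) (auto simp: adj_index)
    also have "\<dots> = (\<Sum>k<n. ws ! j $ k * cnj (ws ! i $ k) / (complex_of_real (sqrt (q i)) * complex_of_real (sqrt (q j))))"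
      using ij by (intro sum.cong) (auto simp: W_def)
    also have "\<dots> = (ws ! j \<bullet>c ws ! i) / (complex_of_real (sqrt (q i)) * complex_of_real (sqrt (q j)))"
      using ip[OF ij(2,1)] by (simp add: sum_divide_distrib)
    also have "\<dots> = (if i = j then 1 else 0)"
    proof (cases "i = j")
      case True
      have "complex_of_real (sqrt (q j)) * complex_of_real (sqrt (q j)) = complex_of_real (q j)"
        using q0[OF ij(2)] by (simp flip: of_real_mult)
      then show ?thesis using True qq[OF ij(2)] q0[OF ij(2)] by simp
    next
      case False
      then have "ws ! j \<bullet>c ws ! i = 0" using corthogonalD[OF ws(2), of j i] ij ws(3) by auto
      then show ?thesis using False by simp
    qed
    finally show "(mat_adjoint W * W) $$ (i, j) = 1\<^sub>m n $$ (i, j)" using ij by simp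
  qed (use W in auto)
  moreover have "(A * W) $$ (k, 0) = e * W $$ (k, 0)" if k: "k < n" for k
  proof -
    have "(A * W) $$ (k, 0) = (\<Sum>l<n. A $$ (k, l) * (v $ l / complex_of_real (sqrt (q 0))))"
      using n k by (subst mult_index[OF A W]) (auto simp: W_def ws0)
    also have "\<dots> = (\<Sum>l<n. A $$ (k, l) * v $ l) / complex_of_real (sqrt (q 0))"
      by (simp add: sum_divide_distrib)
    also have "(\<Sum>l<n. A $$ (k, l) * v $ l) = (A *\<^sub>v v) $ k"
      using A v(1) k by (simp add: scalar_prod_def atLeast0LessThan)
    also have "\<dots> / complex_of_real (sqrt (q 0)) = e * W $$ (k, 0)" using v k n by (simp add: W_def ws0)
    finally show ?thesis .
  qed
  ultimately show thesis using W that by blast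
qed

text \<open>In an orthonormal basis that starts with an eigenvector the first column of the matrix
  is \<open>e\<close> times the first unit vector. Hermitian symmetry clears the first row as well
  and makes \<open>e\<close> real, and the remaining block is again Hermitian, so induction on the
  size applies.\<close>

lemma hermitian_diagonalization:
  fixes A :: "complex mat"
  assumes "A \<in> carrier_mat n n" "mat_adjoint A = A"
  shows "\<exists>U\<in>carrier_mat n n. \<exists>l :: nat \<Rightarrow> real. mat_adjoint U * U = 1\<^sub>m n \<and>
    A = U * mat_diag n (\<lambda>i. complex_of_real (l i)) * mat_adjoint U"
  using assms
proof (induction n arbitrary: A)
  case 0
  show ?case
    by (rule bexI[of _ "1\<^sub>m 0"], intro exI conjI eq_matI) (use 0 in auto)
next
  case (Suc m)
  let ?n = "Suc m"
  note A = Suc.prems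
  obtain W e where W: "W \<in> carrier_mat ?n ?n" "mat_adjoint W * W = 1\<^sub>m ?n"
    and We: "\<And>k. k < ?n \<Longrightarrow> (A * W) $$ (k, 0) = e * W $$ (k, 0)"
    using orthonormal_eigenbasis_start[OF A(1)] by blast
  have Wa: "mat_adjoint W \<in> carrier_mat ?n ?n" using W by simp
  have WW: "W * mat_adjoint W = 1\<^sub>m ?n" by (rule mat_mult_left_right_inverse[OF Wa W(1) W(2)])
  define B where "B = mat_adjoint W * (A * W)"
  have B: "B \<in> carrier_mat ?n ?n" unfolding B_def using Wa A W by auto
  have Bh: "mat_adjoint B = B"
    unfolding B_def using Wa A W by (simp add: adj_mult[of _ ?n ?n _ ?n] assoc_mult_mat[of _ ?n ?n _ ?n _ ?n])
  have B0: "B $$ (i, 0) = e * (if i = 0 then 1 else 0)" if i: "i < ?n" for i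
  proof -
    have AW: "A * W \<in> carrier_mat ?n ?n" using A W by auto
    have "B $$ (i, 0) = (\<Sum>k<?n. mat_adjoint W $$ (i, k) * (A * W) $$ (k, 0))"
      unfolding B_def by (rule mult_index[OF Wa AW]) (use i in auto)
    also have "\<dots> = (\<Sum>k<?n. e * (mat_adjoint W $$ (i, k) * W $$ (k, 0)))"
      by (intro sum.cong) (auto simp: We simp del: index_mult_mat)
    also have "\<dots> = e * (mat_adjoint W * W) $$ (i, 0)"
      using i by (subst mult_index[OF Wa W(1)]) (auto simp: sum_distrib_left simp del: sum.lessThan_Suc)
    finally show ?thesis unfolding W(2) using i by simp
  qed
  have Bc: "B $$ (i, j) = cnj (B $$ (j, i))" if "i < ?n" "j < ?n" for i j
    using adj_index[of i B j] B that Bh by simp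
  define er where "er = Re e"
  have e: "e = complex_of_real er"
    using Bc[of 0 0] B0[of 0] by (simp add: er_def complex_eq_iff)
  define B3 where "B3 = Matrix.mat m m (\<lambda>(i, j). B $$ (Suc i, Suc j))"
  have B3: "B3 \<in> carrier_mat m m" by (simp add: B3_def)
  have B3h: "mat_adjoint B3 = B3"
  proof (rule eq_matI)
    fix i j assume "i < dim_row B3" "j < dim_col B3"
    then have ij: "i < m" "j < m" using B3 by auto
    have "cnj (B $$ (Suc j, Suc i)) = B $$ (Suc i, Suc j)" using Bc[of "Suc i" "Suc j"] ij by simp
    then show "mat_adjoint B3 $$ (i, j) = B3 $$ (i, j)" using ij by (simp add: adj_index B3_def)
  qed (use B3 in auto)
  obtain U3 l3 where U3: "U3 \<in> carrier_mat m m" "mat_adjoint U3 * U3 = 1\<^sub>m m"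
    and B3d: "B3 = U3 * mat_diag m (\<lambda>i. complex_of_real (l3 i)) * mat_adjoint U3"
    using Suc.IH[OF B3 B3h] by blast
  let ?z1 = "0\<^sub>m 1 m :: complex mat" and ?z2 = "0\<^sub>m m 1 :: complex mat"
  define Q where "Q = four_block_mat (1\<^sub>m 1) ?z1 ?z2 U3"
  define E where "E = Matrix.mat 1 1 (\<lambda>_. e)"
  define l where "l i = (if i = 0 then er else l3 (i - 1))" for i
  define D where "D = mat_diag ?n (\<lambda>i. complex_of_real (l i))"
  have E: "E \<in> carrier_mat 1 1" by (simp add: E_def)
  have Q: "Q \<in> carrier_mat ?n ?n" unfolding Q_def using four_block_carrier_mat[OF one_carrier_mat U3(1), of 1] by simp
  have Qa: "mat_adjoint Q = four_block_mat (1\<^sub>m 1) ?z1 ?z2 (mat_adjoint U3)"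
  proof -
    have "mat_adjoint (1\<^sub>m 1 :: complex mat) = 1\<^sub>m 1" by (rule eq_matI) (auto simp: adj_index)
    then show ?thesis unfolding Q_def using adj_four_block[OF one_carrier_mat U3(1)] by simp
  qed
  have U3a: "mat_adjoint U3 \<in> carrier_mat m m" using U3 by simp
  have QQ: "mat_adjoint Q * Q = 1\<^sub>m ?n"
    unfolding Qa unfolding Q_def
    by (subst mult_four_block_mat[OF one_carrier_mat zero_carrier_mat zero_carrier_mat U3a one_carrier_mat zero_carrier_mat zero_carrier_mat U3(1)])
       (use U3 U3a in \<open>simp add: left_mult_zero_mat[of _ m] right_mult_zero_mat[of _ _ m]\<close>)
  have Dd: "D = four_block_mat E ?z1 ?z2 (mat_diag m (\<lambda>i. complex_of_real (l3 i)))"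
    by (rule eq_matI) (auto simp: D_def mat_diag_def E_def l_def e)
  have Bd: "B = four_block_mat E ?z1 ?z2 B3"
  proof (rule eq_matI)
    fix i j assume "i < dim_row (four_block_mat E ?z1 ?z2 B3)" "j < dim_col (four_block_mat E ?z1 ?z2 B3)"
    then have ij: "i < ?n" "j < ?n" using E B3 by auto
    show "B $$ (i, j) = four_block_mat E ?z1 ?z2 B3 $$ (i, j)"
      using ij B0[of i] B0[of j] Bc[of 0 j] E B3
      by (cases i; cases j) (auto simp: E_def B3_def e)
  qed (use B E B3 in auto)
  have QDQ: "Q * D * mat_adjoint Q = B"
  proof -
    have dm: "mat_diag m (\<lambda>i. complex_of_real (l3 i)) \<in> carrier_mat m m" by simp
    have UD: "U3 * mat_diag m (\<lambda>i. complex_of_real (l3 i)) \<in> carrier_mat m m" using U3 by auto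
    have UDU: "U3 * mat_diag m (\<lambda>i. complex_of_real (l3 i)) * mat_adjoint U3 \<in> carrier_mat m m" using UD U3a by auto
    have "Q * D = four_block_mat E ?z1 ?z2 (U3 * mat_diag m (\<lambda>i. complex_of_real (l3 i)))"
      unfolding Q_def Dd
      by (subst mult_four_block_mat[OF one_carrier_mat zero_carrier_mat zero_carrier_mat U3(1) E zero_carrier_mat zero_carrier_mat dm])
         (use U3 E UD in \<open>simp add: left_mult_zero_mat[OF dm] left_mult_zero_mat[OF E] right_mult_zero_mat[OF U3(1)] right_mult_zero_mat[OF E]\<close>)
    then show ?thesis unfolding Qa Bd B3d
      by (simp only:) (subst mult_four_block_mat[OF E zero_carrier_mat zero_carrier_mat UD one_carrier_mat zero_carrier_mat zero_carrier_mat U3a],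
         use U3 U3a E UD in \<open>simp add: left_mult_zero_mat[OF U3a] right_mult_zero_mat[OF UD] right_mult_zero_mat[OF E] left_add_zero_mat[OF UDU]\<close>)
  qed
  have Dc: "D \<in> carrier_mat ?n ?n" by (simp add: D_def)
  have Qac: "mat_adjoint Q \<in> carrier_mat ?n ?n" using Q by simp
  define U where "U = W * Q"
  have U: "U \<in> carrier_mat ?n ?n" unfolding U_def using W Q by auto
  have Ua: "mat_adjoint U = mat_adjoint Q * mat_adjoint W" unfolding U_def by (rule adj_mult[OF W(1) Q])
  note as = assoc_mult_mat[of _ ?n ?n _ ?n _ ?n] and mc = mult_carrier_mat[of _ ?n ?n _ ?n]
  have "mat_adjoint W * (W * Q) = Q"
    using as[OF Wa W(1) Q] W(2) Q by simp
  then have UU: "mat_adjoint U * U = 1\<^sub>m ?n"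
    unfolding Ua unfolding U_def using as[OF Qac Wa, of "W * Q"] W(1) Q QQ by simp
  have "U * D * mat_adjoint U = W * (Q * D * mat_adjoint Q) * mat_adjoint W"
    unfolding Ua unfolding U_def using W(1) Wa Q Qac Dc by (simp add: as mc)
  also have "\<dots> = (W * mat_adjoint W) * A * (W * mat_adjoint W)"
    unfolding QDQ B_def using W(1) Wa A(1) by (simp add: as mc)
  also have "\<dots> = A" unfolding WW using A by simp
  finally show ?case using U UU unfolding D_def by (intro bexI[of _ U] exI[of _ l]) auto
qed

text \<open>The squared Hilbert-Schmidt norm.\<close>

definition hs :: "complex mat \<Rightarrow> real" where
  "hs X = (\<Sum>i<dim_row X. \<Sum>j<dim_col X. (cmod (X $$ (i, j)))\<^sup>2)"

lemma hs_trace: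
  assumes X: "X \<in> carrier_mat n m"
  shows "complex_of_real (hs X) = (\<Sum>j<m. (mat_adjoint X * X) $$ (j, j))"
proof -
  have "(\<Sum>j<m. (mat_adjoint X * X) $$ (j, j)) = (\<Sum>j<m. \<Sum>i<n. X $$ (i, j) * cnj (X $$ (i, j)))"
    using X by (intro sum.cong refl) (subst mult_index[OF adj_carrier[OF X] X], auto simp: adj_index mult.commute)
  also have "\<dots> = (\<Sum>i<n. \<Sum>j<m. X $$ (i, j) * cnj (X $$ (i, j)))" by (rule sum.swap)
  also have "\<dots> = complex_of_real (hs X)"
    using X unfolding hs_def by (simp only: of_real_sum complex_norm_square carrier_matD)
  finally show ?thesis ..
qed

lemma hs_adj: "hs (mat_adjoint X) = hs X"
  unfolding hs_def by (subst sum.swap) (simp add: adj_index)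

lemma hs_unitary_left:
  assumes U: "U \<in> carrier_mat n n" "mat_adjoint U * U = 1\<^sub>m n" and X: "X \<in> carrier_mat n m"
  shows "hs (U * X) = hs X"
proof -
  have Ua: "mat_adjoint U \<in> carrier_mat n n" using U by simp
  have UX: "U * X \<in> carrier_mat n m" using U X by auto
  have "mat_adjoint (U * X) * (U * X) = mat_adjoint X * (mat_adjoint U * (U * X))"
    unfolding adj_mult[OF U(1) X] by (rule assoc_mult_mat[OF adj_carrier[OF X] Ua UX])
  also have "mat_adjoint U * (U * X) = X"
    using assoc_mult_mat[OF Ua U(1) X] U(2) X by simp
  finally have "complex_of_real (hs (U * X)) = complex_of_real (hs X)"
    unfolding hs_trace[OF UX] hs_trace[OF X] by simp
  then show ?thesis by simp
qed

lemma hs_unitary_right: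
  assumes U: "U \<in> carrier_mat n n" "U * mat_adjoint U = 1\<^sub>m n" and X: "X \<in> carrier_mat m n"
  shows "hs (X * U) = hs X"
proof -
  have Ua: "mat_adjoint U \<in> carrier_mat n n" using U by simp
  have "hs (X * U) = hs (mat_adjoint U * mat_adjoint X)"
    unfolding adj_mult[OF X U(1), symmetric] hs_adj ..
  also have "\<dots> = hs (mat_adjoint X)"
    by (rule hs_unitary_left[OF Ua _ adj_carrier[OF X]]) (simp add: U(2))
  finally show ?thesis by (simp add: hs_adj)
qed

section \<open>Functional calculus in two eigenbases\<close>

definition diagonalizes :: "nat \<Rightarrow> complex mat \<Rightarrow> complex mat \<Rightarrow> (nat \<Rightarrow> real) \<Rightarrow> bool" where
  "diagonalizes n M U l \<longleftrightarrow> U \<in> carrier_mat n n \<and> mat_adjoint U * U = 1\<^sub>m n \<and> U * mat_adjoint U = 1\<^sub>m n \<and>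
     M = U * mat_diag n (\<lambda>i. complex_of_real (l i)) * mat_adjoint U"

text \<open>Each matrix acts diagonally on its own eigenbasis, so between the two bases their
  difference only multiplies the overlap of the \<open>i\<close>-th and \<open>j\<close>-th
  eigenvector by the difference of the eigenvalues. With \<open>M = M'\<close> this gives uniqueness
  of the functional calculus, and in general its Lipschitz bound.\<close>

lemma diagonalizes_intertwine:
  assumes d: "diagonalizes n M U l" and e: "diagonalizes n M' V l'"
  shows "mat_adjoint U * (M - M') * V =
    Matrix.mat n n (\<lambda>(i, j). complex_of_real (l i - l' j) * (mat_adjoint U * V) $$ (i, j))"
proof -
  let ?D = "mat_diag n (\<lambda>i. complex_of_real (l i))" and ?E = "mat_diag n (\<lambda>i. complex_of_real (l' i))"
  have U: "U \<in> carrier_mat n n" "mat_adjoint U * U = 1\<^sub>m n" and M: "M = U * ?D * mat_adjoint U"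
    and V: "V \<in> carrier_mat n n" "mat_adjoint V * V = 1\<^sub>m n" and M': "M' = V * ?E * mat_adjoint V"
    using d e by (auto simp: diagonalizes_def)
  have Ua: "mat_adjoint U \<in> carrier_mat n n" and Va: "mat_adjoint V \<in> carrier_mat n n" using U V by auto
  have D: "?D \<in> carrier_mat n n" "?E \<in> carrier_mat n n" by auto
  note as = assoc_mult_mat[of _ n n _ n _ n] and mc = mult_carrier_mat[of _ n n _ n]
  have Mc: "M \<in> carrier_mat n n" "M' \<in> carrier_mat n n" unfolding M M' using U Ua V Va by (auto simp: mc)
  have 1: "mat_adjoint U * M = ?D * mat_adjoint U"
  proof -
    have "mat_adjoint U * M = (mat_adjoint U * U) * (?D * mat_adjoint U)"
      unfolding M using U(1) Ua D by (simp add: as mc)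
    then show ?thesis unfolding U(2) using D Ua by (simp add: mc)
  qed
  have 2: "M' * V = V * ?E"
  proof -
    have "M' * V = V * ?E * (mat_adjoint V * V)"
      unfolding M' using V(1) Va D by (simp add: as mc)
    then show ?thesis unfolding V(2) using D V(1) by (simp add: mc)
  qed
  have W: "mat_adjoint U * V \<in> carrier_mat n n" using Ua V(1) by auto
  have "mat_adjoint U * (M - M') * V = mat_adjoint U * M * V - mat_adjoint U * M' * V"
    using Ua Mc V(1) by (simp add: mult_minus_distrib_mat[of _ n n _ n] minus_mult_distrib_mat[of _ n n _ _ n] mc)
  also have "mat_adjoint U * M * V = ?D * (mat_adjoint U * V)"
    unfolding 1 using D Ua V(1) by (simp add: as)
  also have "mat_adjoint U * M' * V = (mat_adjoint U * V) * ?E"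
    using Ua Mc V(1) D by (simp add: as 2)
  also have "?D * (mat_adjoint U * V) - (mat_adjoint U * V) * ?E = Matrix.mat n n (\<lambda>(i, j). complex_of_real (l i - l' j) * (mat_adjoint U * V) $$ (i, j))"
    unfolding mat_diag_mult_left[OF W] mat_diag_mult_right[OF W]
    by (rule eq_matI) (auto simp: algebra_simps simp del: index_mult_mat(1))
  finally show ?thesis .
qed

text \<open>For one and the same matrix the intertwining relation says that the overlap matrix
  \<open>W\<close> vanishes wherever the eigenvalues differ. Hence \<open>W\<close> also intertwines
  the two diagonal matrices obtained by applying \<open>f\<close>.\<close>

lemma diagonalizes_fun_unique:
  assumes d: "diagonalizes n M U l" and e: "diagonalizes n M V l'"
  shows "diagonalizes n (U * mat_diag n (\<lambda>i. complex_of_real (f (l i))) * mat_adjoint U) V (\<lambda>i. f (l' i))"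
proof -
  let ?D = "mat_diag n (\<lambda>i. complex_of_real (f (l i)))" and ?E = "mat_diag n (\<lambda>i. complex_of_real (f (l' i)))"
  have U: "U \<in> carrier_mat n n" "mat_adjoint U * U = 1\<^sub>m n" "U * mat_adjoint U = 1\<^sub>m n"
    and V: "V \<in> carrier_mat n n" "mat_adjoint V * V = 1\<^sub>m n" "V * mat_adjoint V = 1\<^sub>m n"
    and M: "M = U * mat_diag n (\<lambda>i. complex_of_real (l i)) * mat_adjoint U"
    using d e by (auto simp: diagonalizes_def)
  have Ua: "mat_adjoint U \<in> carrier_mat n n" and Va: "mat_adjoint V \<in> carrier_mat n n" using U V by auto
  note as = assoc_mult_mat[of _ n n _ n _ n] and mc = mult_carrier_mat[of _ n n _ n]
  have D: "?D \<in> carrier_mat n n" "?E \<in> carrier_mat n n" by auto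
  have Mc: "M \<in> carrier_mat n n" unfolding M using U Ua by (auto simp: mc)
  define W where "W = mat_adjoint U * V"
  have W: "W \<in> carrier_mat n n" using Ua V(1) by (auto simp: W_def)
  have "Matrix.mat n n (\<lambda>(i, j). complex_of_real (l i - l' j) * W $$ (i, j)) = mat_adjoint U * (M - M) * V"
    unfolding W_def using diagonalizes_intertwine[OF d e] by simp
  also have "\<dots> = 0\<^sub>m n n" using Ua V(1) Mc left_mult_zero_mat[OF V(1), of n] by (simp add: minus_r_inv_mat right_mult_zero_mat[OF Ua])
  finally have z: "complex_of_real (l i - l' j) * W $$ (i, j) = 0" if "i < n" "j < n" for i j
    using that by (metis (no_types, lifting) case_prod_conv index_mat(1) index_zero_mat(1))
  have DW: "?D * W = W * ?E"
    unfolding mat_diag_mult_left[OF W] mat_diag_mult_right[OF W]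
  proof (rule eq_matI)
    fix i j assume "i < dim_row (Matrix.mat n n (\<lambda>(i, j). W $$ (i, j) * complex_of_real (f (l' j))))"
      "j < dim_col (Matrix.mat n n (\<lambda>(i, j). W $$ (i, j) * complex_of_real (f (l' j))))"
    then have ij: "i < n" "j < n" by auto
    have "l i = l' j \<or> W $$ (i, j) = 0" using z[OF ij] by auto
    then show "Matrix.mat n n (\<lambda>(i, j). complex_of_real (f (l i)) * W $$ (i, j)) $$ (i, j) =
      Matrix.mat n n (\<lambda>(i, j). W $$ (i, j) * complex_of_real (f (l' j))) $$ (i, j)"
      using ij by auto
  qed auto
  have "U * ?D * mat_adjoint U = U * ?D * mat_adjoint U * (V * mat_adjoint V)"
    unfolding V(3) using U(1) Ua D by (simp add: mc)
  also have "\<dots> = U * (?D * W) * mat_adjoint V"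
    unfolding W_def using U(1) Ua D V(1) Va by (simp add: as mc)
  also have "\<dots> = (U * mat_adjoint U) * V * ?E * mat_adjoint V"
    unfolding DW unfolding W_def using U(1) Ua D V(1) Va by (simp add: as mc)
  also have "\<dots> = V * ?E * mat_adjoint V"
    unfolding U(3) using V(1) Va D by (simp add: mc)
  finally show ?thesis using V by (simp add: diagonalizes_def)
qed

lemma unitary_carrier:
  assumes "unitary U" "dim_row U = n"
  shows "U \<in> carrier_mat n n" "mat_adjoint U * U = 1\<^sub>m n" "U * mat_adjoint U = 1\<^sub>m n"
proof -
  show U: "U \<in> carrier_mat n n" using assms by (auto simp: unitary_def)
  show UU: "U * mat_adjoint U = 1\<^sub>m n" using assms by (auto simp: unitary_def)
  show "mat_adjoint U * U = 1\<^sub>m n" by (rule mat_mult_left_right_inverse[OF U adj_carrier[OF U] UU])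
qed

lemma diagonalizes_exists:
  assumes "hermitian M" "M \<in> carrier_mat n n"
  obtains U l where "diagonalizes n M U l"
proof -
  obtain U l where U: "U \<in> carrier_mat n n" "mat_adjoint U * U = 1\<^sub>m n" "M = U * mat_diag n (\<lambda>i. complex_of_real (l i)) * mat_adjoint U"
    using hermitian_diagonalization[OF assms(2)] assms(1) by (auto simp: hermitian_def)
  moreover have "U * mat_adjoint U = 1\<^sub>m n" by (rule mat_mult_left_right_inverse[OF adj_carrier[OF U(1)] U(1,2)])
  ultimately show thesis using that by (auto simp: diagonalizes_def)
qed

text \<open>The given diagonalisation provides a candidate for the definite description, and
  \<open>diagonalizes_fun_unique\<close> shows that any other one yields the same matrix.\<close>

lemma mat_fun_eq:
  assumes d: "diagonalizes n M U l"
  shows "mat_fun f M = U * mat_diag n (\<lambda>i. complex_of_real (f (l i))) * mat_adjoint U"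
proof -
  have U: "U \<in> carrier_mat n n" "mat_adjoint U * U = 1\<^sub>m n" "U * mat_adjoint U = 1\<^sub>m n"
    and M: "M = U * mat_diag n (\<lambda>i. complex_of_real (l i)) * mat_adjoint U"
    using d by (auto simp: diagonalizes_def)
  have n: "dim_row M = n" unfolding M using U by simp
  show ?thesis unfolding mat_fun_def n
  proof (rule the_equality)
    show "\<exists>U' l'. unitary U' \<and> dim_row U' = n \<and> M = U' * mat_diag n (\<lambda>i. complex_of_real (l' i)) * mat_adjoint U' \<and>
      U * mat_diag n (\<lambda>i. complex_of_real (f (l i))) * mat_adjoint U = U' * mat_diag n (\<lambda>i. complex_of_real (f (l' i))) * mat_adjoint U'"
      using U M by (intro exI[of _ U] exI[of _ l]) (auto simp: unitary_def)
  next
    fix B assume "\<exists>V l. unitary V \<and> dim_row V = n \<and> M = V * mat_diag n (\<lambda>i. complex_of_real (l i)) * mat_adjoint V \<and>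
      B = V * mat_diag n (\<lambda>i. complex_of_real (f (l i))) * mat_adjoint V"
    then obtain V l' where V: "unitary V" "dim_row V = n" "M = V * mat_diag n (\<lambda>i. complex_of_real (l' i)) * mat_adjoint V"
      "B = V * mat_diag n (\<lambda>i. complex_of_real (f (l' i))) * mat_adjoint V" by auto
    then have "diagonalizes n M V l'" using unitary_carrier[OF V(1,2)] by (auto simp: diagonalizes_def)
    from diagonalizes_fun_unique[OF d this, of f] show "B = U * mat_diag n (\<lambda>i. complex_of_real (f (l i))) * mat_adjoint U"
      unfolding V(4) by (simp add: diagonalizes_def)
  qed
qed

lemma unitary_columns:
  assumes "W \<in> carrier_mat n n" "mat_adjoint W * W = 1\<^sub>m n" "j < n"
  shows "(\<Sum>i<n. (cmod (W $$ (i, j)))\<^sup>2) = 1"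
proof -
  have "complex_of_real (\<Sum>i<n. (cmod (W $$ (i, j)))\<^sup>2) = (\<Sum>i<n. W $$ (i, j) * cnj (W $$ (i, j)))"
    by (simp only: of_real_sum complex_norm_square)
  also have "\<dots> = (mat_adjoint W * W) $$ (j, j)"
    using assms by (subst mult_index[OF adj_carrier[OF assms(1)] assms(1)]) (auto simp: adj_index mult.commute)
  also have "\<dots> = complex_of_real 1" unfolding assms(2) using assms(3) by simp
  finally show ?thesis using of_real_eq_iff by blast
qed

lemma unitary_rows:
  assumes "W \<in> carrier_mat n n" "W * mat_adjoint W = 1\<^sub>m n" "i < n"
  shows "(\<Sum>j<n. (cmod (W $$ (i, j)))\<^sup>2) = 1"
proof -
  have "(\<Sum>j<n. (cmod (mat_adjoint W $$ (j, i)))\<^sup>2) = 1"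
    using assms by (intro unitary_columns) auto
  then show ?thesis using assms by (simp add: adj_index)
qed

lemma tr_mat_fun:
  assumes d: "diagonalizes n M U l"
  shows "tr_N (mat_fun f M) = complex_of_real ((\<Sum>i<n. f (l i)) / real n)"
proof -
  let ?D = "mat_diag n (\<lambda>i. complex_of_real (f (l i)))"
  have U: "U \<in> carrier_mat n n" "mat_adjoint U * U = 1\<^sub>m n"
    using d by (auto simp: diagonalizes_def)
  have UD: "U * ?D \<in> carrier_mat n n" using U by auto
  have "(\<Sum>i<n. (U * ?D * mat_adjoint U) $$ (i, i)) = (\<Sum>i<n. \<Sum>k<n. complex_of_real (f (l k) * (cmod (U $$ (i, k)))\<^sup>2))"
  proof (intro sum.cong refl)
    fix i assume "i \<in> {..<n}"
    then have i: "i < n" by simp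
    have "(U * ?D * mat_adjoint U) $$ (i, i) = (\<Sum>k<n. (U * ?D) $$ (i, k) * mat_adjoint U $$ (k, i))"
      by (rule mult_index[OF UD adj_carrier[OF U(1)] i i])
    also have "\<dots> = (\<Sum>k<n. complex_of_real (f (l k) * (cmod (U $$ (i, k)))\<^sup>2))"
      using i U(1) unfolding mat_diag_mult_right[OF U(1)] of_real_mult complex_norm_square
      by (intro sum.cong) (auto simp: adj_index mult_ac)
    finally show "(U * ?D * mat_adjoint U) $$ (i, i) = (\<Sum>k<n. complex_of_real (f (l k) * (cmod (U $$ (i, k)))\<^sup>2))" .
  qed
  also have "\<dots> = complex_of_real (\<Sum>k<n. f (l k) * (\<Sum>i<n. (cmod (U $$ (i, k)))\<^sup>2))"
    by (subst sum.swap) (simp add: sum_distrib_left)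
  also have "(\<Sum>k<n. f (l k) * (\<Sum>i<n. (cmod (U $$ (i, k)))\<^sup>2)) = (\<Sum>k<n. f (l k))"
    using unitary_columns[OF U] by (intro sum.cong) auto
  finally show ?thesis unfolding tr_N_def mat_fun_eq[OF d] using U(1) by simp
qed

lemma hs_eigenvalues:
  assumes d: "diagonalizes n M U l"
  shows "hs M = (\<Sum>i<n. (l i)\<^sup>2)"
proof -
  have U: "U \<in> carrier_mat n n" "mat_adjoint U * U = 1\<^sub>m n" "U * mat_adjoint U = 1\<^sub>m n"
    and M: "M = U * mat_diag n (\<lambda>i. complex_of_real (l i)) * mat_adjoint U"
    using d by (auto simp: diagonalizes_def)
  have "hs M = hs (U * mat_diag n (\<lambda>i. complex_of_real (l i)))"
    unfolding M using U by (intro hs_unitary_right[of _ n _ n]) auto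
  also have "\<dots> = hs (mat_diag n (\<lambda>i. complex_of_real (l i)))"
    using U by (intro hs_unitary_left[of _ n _ n]) auto
  also have "\<dots> = (\<Sum>i<n. \<Sum>j<n. if j = i then (l j)\<^sup>2 else 0)"
    unfolding hs_def mat_diag_def dim_row_mat dim_col_mat by (intro sum.cong refl) auto
  finally show ?thesis by simp
qed

text \<open>With \<open>p i j = \<bar>\<langle>u i, v j\<rangle>\<bar>\<^sup>2\<close> doubly stochastic, both the difference of the traces and the
  squared Hilbert-Schmidt distance are sums over \<open>p\<close>, so Cauchy-Schwarz suffices.\<close>

lemma trace_lipschitz:
  assumes d: "diagonalizes n M U l" and e: "diagonalizes n M' V l'"
    and f: "\<And>x y. \<bar>f x - f y\<bar> \<le> \<bar>x - y\<bar>"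
  shows "\<bar>(\<Sum>i<n. f (l i)) - (\<Sum>i<n. f (l' i))\<bar> \<le> sqrt (real n * hs (M - M'))"
proof -
  have U: "U \<in> carrier_mat n n" "mat_adjoint U * U = 1\<^sub>m n" "U * mat_adjoint U = 1\<^sub>m n"
    and V: "V \<in> carrier_mat n n" "mat_adjoint V * V = 1\<^sub>m n" "V * mat_adjoint V = 1\<^sub>m n"
    and M: "M = U * mat_diag n (\<lambda>i. complex_of_real (l i)) * mat_adjoint U"
    and M': "M' = V * mat_diag n (\<lambda>i. complex_of_real (l' i)) * mat_adjoint V"
    using d e by (auto simp: diagonalizes_def)
  have Ua: "mat_adjoint U \<in> carrier_mat n n" and Va: "mat_adjoint V \<in> carrier_mat n n" using U V by auto
  note as = assoc_mult_mat[of _ n n _ n _ n] and mc = mult_carrier_mat[of _ n n _ n]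
  have Mc: "M - M' \<in> carrier_mat n n" unfolding M M' using U V Ua Va by (auto simp: mc)
  define W where "W = mat_adjoint U * V"
  have W: "W \<in> carrier_mat n n" using Ua V(1) by (auto simp: W_def)
  have Wa: "mat_adjoint W = mat_adjoint V * U" unfolding W_def using adj_mult[OF Ua V(1)] by simp
  have WW: "mat_adjoint W * W = 1\<^sub>m n"
  proof -
    have "mat_adjoint W * W = mat_adjoint V * (U * mat_adjoint U) * V"
      unfolding Wa unfolding W_def using U(1) V(1) Ua Va by (simp add: as mc)
    then show ?thesis unfolding U(3) using V Va by simp
  qed
  have WW': "W * mat_adjoint W = 1\<^sub>m n"
    by (rule mat_mult_left_right_inverse[OF adj_carrier[OF W] W WW])
  define p where "p i j = (cmod (W $$ (i, j)))\<^sup>2" for i j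
  have p0: "0 \<le> p i j" for i j by (simp add: p_def)
  have pr: "(\<Sum>j<n. p i j) = 1" if "i < n" for i unfolding p_def using unitary_rows[OF W WW' that] .
  have pc: "(\<Sum>i<n. p i j) = 1" if "j < n" for j unfolding p_def using unitary_columns[OF W WW that] .
  have H: "hs (M - M') = (\<Sum>i<n. \<Sum>j<n. (l i - l' j)\<^sup>2 * p i j)"
  proof -
    have "hs (M - M') = hs (mat_adjoint U * (M - M') * V)"
      using hs_unitary_right[OF V(1) V(3), of "mat_adjoint U * (M - M')" n] hs_unitary_left[OF Ua _ Mc] U(3) Ua Mc by (simp add: mc)
    also have "\<dots> = (\<Sum>i<n. \<Sum>j<n. (l i - l' j)\<^sup>2 * p i j)"
      unfolding diagonalizes_intertwine[OF d e] hs_def W_def[symmetric] p_def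
      by (auto intro!: sum.cong simp: norm_mult power_mult_distrib simp del: of_real_diff)
    finally show ?thesis .
  qed
  have "(\<Sum>i<n. f (l i)) - (\<Sum>j<n. f (l' j)) = (\<Sum>i<n. f (l i) * (\<Sum>j<n. p i j)) - (\<Sum>j<n. f (l' j) * (\<Sum>i<n. p i j))"
    using pr pc by (intro arg_cong2[where f="(-)"] sum.cong) auto
  also have "\<dots> = (\<Sum>i<n. \<Sum>j<n. f (l i) * p i j) - (\<Sum>i<n. \<Sum>j<n. f (l' j) * p i j)"
    unfolding sum_distrib_left by (subst (2) sum.swap) simp
  also have "\<dots> = (\<Sum>i<n. \<Sum>j<n. (f (l i) - f (l' j)) * p i j)"
    by (simp add: sum_subtractf left_diff_distrib)
  also have "\<bar>\<dots>\<bar> \<le> (\<Sum>i<n. \<Sum>j<n. \<bar>l i - l' j\<bar> * p i j)"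
    using f p0 by (intro order_trans[OF sum_abs] sum_mono) (auto simp: abs_mult intro!: mult_right_mono)
  also have "\<dots> = (\<Sum>(i, j)\<in>{..<n} \<times> {..<n}. \<bar>l i - l' j\<bar> * sqrt (p i j) * sqrt (p i j))"
    using p0 by (simp add: sum.cartesian_product mult.assoc)
  also have "\<dots> \<le> sqrt (\<Sum>(i, j)\<in>{..<n} \<times> {..<n}. (\<bar>l i - l' j\<bar> * sqrt (p i j))\<^sup>2) * sqrt (\<Sum>(i, j)\<in>{..<n} \<times> {..<n}. (sqrt (p i j))\<^sup>2)"
    using L2_set_mult_ineq[of "\<lambda>(i, j). \<bar>l i - l' j\<bar> * sqrt (p i j)" "\<lambda>(i, j). sqrt (p i j)" "{..<n} \<times> {..<n}"]
    by (simp add: L2_set_def split_beta' abs_mult p0)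
  also have "(\<Sum>(i, j)\<in>{..<n} \<times> {..<n}. (\<bar>l i - l' j\<bar> * sqrt (p i j))\<^sup>2) = hs (M - M')"
    unfolding H using p0 by (simp add: sum.cartesian_product power_mult_distrib)
  also have "(\<Sum>(i, j)\<in>{..<n} \<times> {..<n}. (sqrt (p i j))\<^sup>2) = (\<Sum>i<n. \<Sum>j<n. p i j)"
    using p0 by (simp add: sum.cartesian_product)
  also have "\<dots> = real n" using pr by simp
  finally show ?thesis by (simp add: real_sqrt_mult mult.commute)
qed

section \<open>The random matrix and interpolation by ramps\<close>

text \<open>A Lipschitz function is continuous in the finitely many coordinates. Restriction extends
  it to all functions, where for a countable index type the Borel sets of the product topology are
  the product sets; padding by \<open>0\<close> brings the result back to
  \<open>RI I\<close>.\<close>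

lemma lip_on_borel_measurable:
  fixes F :: "(('i :: countable) \<Rightarrow> real) \<Rightarrow> real"
  assumes I: "finite I" and F: "lip_on I L F"
  shows "F \<in> borel_measurable (RI I)"
proof -
  define G where "G x = F (restrict x I)" for x :: "'i \<Rightarrow> real"
  have rs: "restrict x I \<in> space (RI I)" for x :: "'i \<Rightarrow> real" by (simp add: space_PiM)
  have "continuous_on UNIV G"
    unfolding continuous_on_def
  proof (intro ballI)
    fix a :: "'i \<Rightarrow> real"
    have le: "norm (G x - G a) \<le> \<bar>L\<bar> * (\<Sum>k\<in>I. \<bar>x k - a k\<bar>)" for x
    proof -
      have "\<bar>G x - G a\<bar> \<le> L * L2_set (\<lambda>k. restrict x I k - restrict a I k) I"
        unfolding G_def by (intro lip_onD[OF F] rs)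
      also have "L2_set (\<lambda>k. restrict x I k - restrict a I k) I = L2_set (\<lambda>k. x k - a k) I"
        by (intro L2_set_cong) auto
      also have "L * L2_set (\<lambda>k. x k - a k) I \<le> \<bar>L\<bar> * L2_set (\<lambda>k. x k - a k) I"
        by (intro mult_right_mono) (auto simp: L2_set_nonneg)
      also have "\<dots> \<le> \<bar>L\<bar> * (\<Sum>k\<in>I. \<bar>x k - a k\<bar>)"
        by (intro mult_left_mono L2_set_le_sum_abs) auto
      finally show ?thesis by simp
    qed
    have c: "((\<lambda>x. x k) \<longlongrightarrow> a k) (at a)" for k
      using continuous_on_product_coordinates[of k] by (auto simp: continuous_on_def)
    have "((\<lambda>x. \<bar>L\<bar> * (\<Sum>k\<in>I. \<bar>x k - a k\<bar>)) \<longlongrightarrow> \<bar>L\<bar> * (\<Sum>k\<in>I. \<bar>a k - a k\<bar>)) (at a)"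
      by (intro tendsto_intros c)
    then have "((\<lambda>x. \<bar>L\<bar> * (\<Sum>k\<in>I. \<bar>x k - a k\<bar>)) \<longlongrightarrow> 0) (at a)" by simp
    then have "((\<lambda>x. G x - G a) \<longlongrightarrow> 0) (at a)"
      by (rule Lim_null_comparison[rotated]) (use le in auto)
    then show "(G \<longlongrightarrow> G a) (at a within UNIV)" by (simp add: LIM_zero_iff)
  qed
  then have "G \<in> borel_measurable borel" by (rule borel_measurable_continuous_onI)
  then have G: "G \<in> borel_measurable (Pi\<^sub>M UNIV (\<lambda>_. borel))"
    by (simp add: measurable_cong_sets[OF sets_PiM_equal_borel refl])
  have e: "(\<lambda>x k. if k \<in> I then x k else 0) \<in> RI I \<rightarrow>\<^sub>M Pi\<^sub>M UNIV (\<lambda>_. borel :: real measure)"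
  proof (rule measurable_PiM_single')
    show "(\<lambda>x. if k \<in> I then x k else 0) \<in> borel_measurable (RI I)" for k
      by (cases "k \<in> I") auto
  qed auto
  have "(\<lambda>x. G (\<lambda>k. if k \<in> I then x k else 0)) \<in> borel_measurable (RI I)"
    using measurable_compose[OF e G] .
  then show ?thesis
  proof (rule measurable_cong[THEN iffD1, rotated])
    fix x assume "x \<in> space (RI I)"
    then have "restrict (\<lambda>k. if k \<in> I then x k else 0) I = x"
      by (auto simp: space_PiM PiE_def extensional_def fun_eq_iff)
    then show "G (\<lambda>k. if k \<in> I then x k else 0) = F x" by (simp add: G_def)
  qed
qed

lemma finite_coords[simp]: "finite (coords N)"
  by (simp add: coords_def)

lemma omega_diff: "omega x i j - omega y i j = omega (\<lambda>k. x k - y k) i j"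
  by (auto simp: omega_def complex_eq_iff)

lemma omega_adj: "cnj (omega x j i) = omega x i j"
  by (auto simp: omega_def complex_eq_iff)

lemma omega_norm: "(cmod (omega d i j))\<^sup>2 \<le> (d (i, j))\<^sup>2 + (d (j, i))\<^sup>2"
  by (auto simp: omega_def cmod_power2)

text \<open>Each off-diagonal parameter occurs in the two entries at \<open>(i, j)\<close> and
  \<open>(j, i)\<close>. This factor \<open>2\<close> is the origin of every \<open>sqrt 2\<close>
  in the theorem.\<close>

lemma sum_omega_norm: "(\<Sum>i<N. \<Sum>j<N. (cmod (omega d i j))\<^sup>2) \<le> 2 * (L2_set d (coords N))\<^sup>2"
proof -
  have s: "(L2_set d (coords N))\<^sup>2 = (\<Sum>i<N. \<Sum>j<N. (d (i, j))\<^sup>2)"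
    unfolding sum_sq_eq[symmetric] coords_def by (simp add: sum.cartesian_product)
  have "(\<Sum>i<N. \<Sum>j<N. (cmod (omega d i j))\<^sup>2) \<le> (\<Sum>i<N. \<Sum>j<N. (d (i, j))\<^sup>2 + (d (j, i))\<^sup>2)"
    by (intro sum_mono omega_norm)
  also have "\<dots> = (\<Sum>i<N. \<Sum>j<N. (d (i, j))\<^sup>2) + (\<Sum>i<N. \<Sum>j<N. (d (j, i))\<^sup>2)"
    by (simp add: sum.distrib)
  also have "(\<Sum>i<N. \<Sum>j<N. (d (j, i))\<^sup>2) = (\<Sum>i<N. \<Sum>j<N. (d (i, j))\<^sup>2)" by (rule sum.swap)
  finally show ?thesis unfolding s by simp
qed

lemma XA_carrier[simp]: "XA N A x \<in> carrier_mat N N"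
  by (simp add: XA_def)

lemma XA_hermitian:
  assumes A: "A \<in> carrier_mat N N" "hermitian A"
  shows "hermitian (XA N A x)"
proof -
  have Aij: "cnj (A $$ (j, i)) = A $$ (i, j)" if "i < N" "j < N" for i j
    using adj_index[of i A j] A that by (simp add: hermitian_def)
  have "mat_adjoint (XA N A x) = XA N A x"
    by (rule eq_matI) (auto simp: XA_def adj_index Aij omega_adj)
  then show ?thesis by (simp add: hermitian_def XA_def)
qed

lemma weighted_hs:
  assumes N: "1 \<le> N" and A: "\<forall>i<N. \<forall>j<N. cmod (A $$ (i, j)) \<le> a" and a: "0 < a"
    and X: "X \<in> carrier_mat N N" "\<And>i j. i < N \<Longrightarrow> j < N \<Longrightarrow> X $$ (i, j) = complex_of_real (1 / sqrt (real N)) * A $$ (i, j) * omega d i j"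
  shows "hs X \<le> 2 * a\<^sup>2 / real N * (L2_set d (coords N))\<^sup>2"
proof -
  have "hs X = (\<Sum>i<N. \<Sum>j<N. (cmod (X $$ (i, j)))\<^sup>2)" using X(1) by (simp add: hs_def)
  also have "\<dots> \<le> (\<Sum>i<N. \<Sum>j<N. a\<^sup>2 / real N * (cmod (omega d i j))\<^sup>2)"
  proof (intro sum_mono)
    fix i j assume "i \<in> {..<N}" "j \<in> {..<N}"
    then have ij: "i < N" "j < N" by auto
    have "(cmod (X $$ (i, j)))\<^sup>2 = (cmod (A $$ (i, j)))\<^sup>2 / real N * (cmod (omega d i j))\<^sup>2"
      using N unfolding X(2)[OF ij] by (simp add: norm_mult norm_divide power_mult_distrib power_divide)
    also have "\<dots> \<le> a\<^sup>2 / real N * (cmod (omega d i j))\<^sup>2"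
      using A ij by (intro mult_right_mono divide_right_mono power_mono) auto
    finally show "(cmod (X $$ (i, j)))\<^sup>2 \<le> a\<^sup>2 / real N * (cmod (omega d i j))\<^sup>2" .
  qed
  also have "\<dots> = a\<^sup>2 / real N * (\<Sum>i<N. \<Sum>j<N. (cmod (omega d i j))\<^sup>2)" by (simp add: sum_distrib_left)
  also have "\<dots> \<le> a\<^sup>2 / real N * (2 * (L2_set d (coords N))\<^sup>2)"
    by (intro mult_left_mono sum_omega_norm) auto
  finally show ?thesis by (simp add: mult_ac)
qed

text \<open>An arbitrary enumeration of the eigenvalues. Sums of a function over them do not depend
  on the choice, and measurability of these sums comes from their Lipschitz continuity.\<close>

definition evals :: "nat \<Rightarrow> complex mat \<Rightarrow> (nat \<times> nat \<Rightarrow> real) \<Rightarrow> nat \<Rightarrow> real" where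
  "evals N A x = (SOME l. \<exists>U. diagonalizes N (XA N A x) U l)"

definition TrF :: "nat \<Rightarrow> complex mat \<Rightarrow> (real \<Rightarrow> real) \<Rightarrow> (nat \<times> nat \<Rightarrow> real) \<Rightarrow> real" where
  "TrF N A f x = (\<Sum>i<N. f (evals N A x i)) / real N"

lemma TrF_abs_le:
  assumes N: "1 \<le> N" and f: "\<And>t. \<bar>f t\<bar> \<le> w t"
  shows "\<bar>TrF N A f x\<bar> \<le> TrF N A w x"
proof -
  have "\<bar>\<Sum>i<N. f (evals N A x i)\<bar> \<le> (\<Sum>i<N. w (evals N A x i))"
    by (intro order_trans[OF sum_abs] sum_mono f)
  then show ?thesis using N by (simp add: TrF_def abs_divide divide_right_mono)
qed

lemma TrF_const: "1 \<le> N \<Longrightarrow> TrF N A (\<lambda>_. c) x = c"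
  by (simp add: TrF_def)

lemma TrF_add: "TrF N A (\<lambda>t. f t + g t) x = TrF N A f x + TrF N A g x"
  by (simp add: TrF_def sum.distrib add_divide_distrib)

lemma TrF_diff: "TrF N A (\<lambda>t. f t - g t) x = TrF N A f x - TrF N A g x"
  by (simp add: TrF_def sum_subtractf diff_divide_distrib)

lemma TrF_lincomb: "TrF N A (\<lambda>t. \<Sum>i\<in>S. c i * g i t) x = (\<Sum>i\<in>S. c i * TrF N A (g i) x)"
proof -
  have "(\<Sum>j<N. \<Sum>i\<in>S. c i * g i (evals N A x j)) = (\<Sum>i\<in>S. c i * (\<Sum>j<N. g i (evals N A x j)))"
    by (subst sum.swap) (simp add: sum_distrib_left)
  then show ?thesis unfolding TrF_def times_divide_eq_right sum_divide_distrib[symmetric] by simp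
qed

locale random_matrix =
  fixes N :: nat and A :: "complex mat" and a :: real
  assumes N: "1 \<le> N" and A: "A \<in> carrier_mat N N" "hermitian A"
    and a: "0 < a" and Aa: "\<forall>i<N. \<forall>j<N. cmod (A $$ (i, j)) \<le> a"
begin

lemma evals: "\<exists>U. diagonalizes N (XA N A x) U (evals N A x)"
proof -
  obtain U l where "diagonalizes N (XA N A x) U l"
    using diagonalizes_exists[OF XA_hermitian[OF A] XA_carrier] by blast
  then have "\<exists>l U. diagonalizes N (XA N A x) U l" by blast
  then show ?thesis unfolding evals_def by (rule someI_ex)
qed

lemma tr_eq_TrF: "tr_N (mat_fun f (XA N A x)) = complex_of_real (TrF N A f x)"
proof -
  obtain U where U: "diagonalizes N (XA N A x) U (evals N A x)" using evals by blast
  show ?thesis unfolding tr_mat_fun[OF U] TrF_def ..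
qed

definition lipc :: real where "lipc = sqrt 2 * a / real N"

lemma lipc_pos: "0 < lipc"
  using N a by (simp add: lipc_def)

text \<open>The squared Hilbert-Schmidt distance is at most \<open>2 * a^2 / N\<close> times the
  squared distance of the parameters, and \<open>trace_lipschitz\<close> bounds the normalised trace
  by \<open>1 / sqrt N\<close> times the Hilbert-Schmidt distance. The two factors
  \<open>1 / sqrt N\<close> combine to the \<open>1 / N\<close> in \<open>lipc\<close>.\<close>

lemma TrF_lip:
  assumes f: "\<And>s t. \<bar>f s - f t\<bar> \<le> \<bar>s - t\<bar>"
  shows "lip_on (coords N) lipc (TrF N A f)"
  unfolding lip_on_def
proof (intro ballI)
  fix x y
  let ?d = "L2_set (\<lambda>k. x k - y k) (coords N)"
  obtain U V where U: "diagonalizes N (XA N A x) U (evals N A x)" and V: "diagonalizes N (XA N A y) V (evals N A y)"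
    using evals by blast
  have h: "hs (XA N A x - XA N A y) \<le> 2 * a\<^sup>2 / real N * ?d\<^sup>2"
  proof (rule weighted_hs[OF N Aa a])
    show "XA N A x - XA N A y \<in> carrier_mat N N" by (intro minus_carrier_mat) simp
    show "(XA N A x - XA N A y) $$ (i, j) = complex_of_real (1 / sqrt (real N)) * A $$ (i, j) * omega (\<lambda>k. x k - y k) i j"
      if "i < N" "j < N" for i j
      using that by (simp add: XA_def omega_diff[symmetric] right_diff_distrib diff_divide_distrib)
  qed
  have "\<bar>TrF N A f x - TrF N A f y\<bar> = \<bar>(\<Sum>i<N. f (evals N A x i)) - (\<Sum>i<N. f (evals N A y i))\<bar> / real N"
    by (simp add: TrF_def abs_divide flip: diff_divide_distrib)
  also have "\<dots> \<le> sqrt (real N * hs (XA N A x - XA N A y)) / real N"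
    by (intro divide_right_mono trace_lipschitz[OF U V f]) auto
  also have "\<dots> \<le> sqrt (real N * (2 * a\<^sup>2 / real N * ?d\<^sup>2)) / real N"
    using h by (intro divide_right_mono real_sqrt_le_mono mult_left_mono) auto
  also have "real N * (2 * a\<^sup>2 / real N * ?d\<^sup>2) = 2 * (a * ?d)\<^sup>2"
    using N by (simp add: power_mult_distrib)
  also have "sqrt (2 * (a * ?d)\<^sup>2) / real N = lipc * ?d"
    using a by (simp add: real_sqrt_mult lipc_def L2_set_nonneg)
  finally show "\<bar>TrF N A f x - TrF N A f y\<bar> \<le> lipc * ?d" .
qed

lemma TrF_measurable:
  assumes f: "\<And>s t. \<bar>f s - f t\<bar> \<le> \<bar>s - t\<bar>"
  shows "TrF N A f \<in> borel_measurable (RI (coords N))"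
  by (rule lip_on_borel_measurable[OF finite_coords TrF_lip[OF f]])

text \<open>A single squared eigenvalue is at most their sum, the squared Hilbert-Schmidt norm.
  Averaging over the spectrum plays no part here, hence \<open>1 / sqrt N\<close> instead of
  \<open>1 / N\<close>; this is the factor in front of \<open>G2 + h t0\<close> in the
  theorem.\<close>

lemma evals_bound:
  assumes i: "i < N"
  shows "\<bar>evals N A x i\<bar> \<le> sqrt 2 * a / sqrt (real N) * L2_set x (coords N)"
proof -
  obtain U where U: "diagonalizes N (XA N A x) U (evals N A x)" using evals by blast
  have "(evals N A x i)\<^sup>2 \<le> (\<Sum>i<N. (evals N A x i)\<^sup>2)"
    using i by (intro member_le_sum) auto
  also have "\<dots> = hs (XA N A x)" by (rule hs_eigenvalues[OF U, symmetric])
  also have "\<dots> \<le> 2 * a\<^sup>2 / real N * (L2_set x (coords N))\<^sup>2"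
    by (rule weighted_hs[OF N Aa a]) (auto simp: XA_def)
  also have "\<dots> = (sqrt 2 * a / sqrt (real N) * L2_set x (coords N))\<^sup>2"
    by (simp add: power_mult_distrib power_divide)
  finally have "\<bar>evals N A x i\<bar>\<^sup>2 \<le> (sqrt 2 * a / sqrt (real N) * L2_set x (coords N))\<^sup>2" by simp
  then show ?thesis using a by (intro power2_le_imp_le[of "\<bar>evals N A x i\<bar>"]) (auto simp: L2_set_nonneg)
qed

end

text \<open>Piecewise linear interpolation as a combination of the fixed ramps \<open>ramp x d i\<close> with coefficients in \<open>[-1, 1]\<close>.\<close>

definition ramp :: "real \<Rightarrow> real \<Rightarrow> nat \<Rightarrow> real \<Rightarrow> real" where
  "ramp x d i t = max 0 (min d (t - (x + real i * d)))"

definition slope :: "(real \<Rightarrow> real) \<Rightarrow> real \<Rightarrow> real \<Rightarrow> nat \<Rightarrow> real" where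
  "slope f x d i = (f (x + real (Suc i) * d) - f (x + real i * d)) / d"

definition interp :: "(real \<Rightarrow> real) \<Rightarrow> real \<Rightarrow> real \<Rightarrow> nat \<Rightarrow> real \<Rightarrow> real" where
  "interp f x d n t = f x + (\<Sum>i<n. slope f x d i * ramp x d i t)"

lemma ramp_lip: "\<bar>ramp x d i s - ramp x d i t\<bar> \<le> \<bar>s - t\<bar>"
  unfolding ramp_def by (auto simp: max_def min_def)

lemma ramp_bound: "0 \<le> d \<Longrightarrow> \<bar>ramp x d i t\<bar> \<le> d"
  unfolding ramp_def by (auto simp: max_def min_def)

lemma slope_bound:
  assumes f: "\<And>s t. \<bar>f s - f t\<bar> \<le> \<bar>s - t\<bar>" and d: "0 < d"
  shows "\<bar>slope f x d i\<bar> \<le> 1"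
  using f[of "x + real (Suc i) * d" "x + real i * d"] d by (simp add: slope_def abs_divide algebra_simps)

lemma interp_left: "0 < d \<Longrightarrow> t \<le> x \<Longrightarrow> interp f x d n t = f x"
proof -
  assume d: "0 < d" and t: "t \<le> x"
  have "ramp x d i t = 0" for i
  proof -
    have "t - (x + real i * d) \<le> 0" using d t by (simp add: add_increasing2)
    then show ?thesis by (simp add: ramp_def)
  qed
  then show ?thesis by (simp add: interp_def)
qed

lemma interp_right: "0 < d \<Longrightarrow> x + real n * d \<le> t \<Longrightarrow> interp f x d n t = f (x + real n * d)"
proof (induction n)
  case 0
  then show ?case by (simp add: interp_def)
next
  case (Suc n)
  have e: "x + real (Suc n) * d = x + real n * d + d" by (simp add: algebra_simps)
  have "d \<le> t - (x + real n * d)" using Suc.prems(2) unfolding e by linarith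
  then have "ramp x d n t = d" using Suc.prems(1) by (simp add: ramp_def)
  moreover have "interp f x d n t = f (x + real n * d)" using Suc e by simp
  moreover have "interp f x d (Suc n) t = interp f x d n t + slope f x d n * ramp x d n t" by (simp add: interp_def)
  ultimately show ?case using Suc.prems(1) by (simp add: slope_def)
qed

text \<open>At relative position \<open>s\<close> in a cell the interpolant is the convex
  combination of the two node values, so the error is at most
  \<open>(1 - s) * (s * d) + s * ((1 - s) * d)\<close>, and this is at most
  \<open>d / 2\<close>.\<close>

lemma interp_error:
  assumes f: "\<And>s t. \<bar>f s - f t\<bar> \<le> \<bar>s - t\<bar>" and d: "0 < d"
  shows "x \<le> t \<Longrightarrow> t \<le> x + real n * d \<Longrightarrow> \<bar>f t - interp f x d n t\<bar> \<le> d / 2"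
proof (induction n)
  case 0
  then show ?case using d by (simp add: interp_def)
next
  case (Suc n)
  define y where "y = x + real n * d"
  have e: "x + real (Suc n) * d = y + d" by (simp add: y_def algebra_simps)
  have rec: "interp f x d (Suc n) t = interp f x d n t + slope f x d n * ramp x d n t" by (simp add: interp_def)
  show ?case
  proof (cases "t \<le> y")
    case True
    then have "ramp x d n t = 0" by (simp add: ramp_def y_def)
    then show ?thesis using Suc True rec by (simp add: y_def)
  next
    case False
    define s where "s = (t - y) / d"
    have s: "0 \<le> s" "s \<le> 1" "t = y + s * d" using False Suc.prems(2)[unfolded e] d by (auto simp: s_def field_simps)
    have "ramp x d n t = s * d" using s d by (simp add: ramp_def y_def[symmetric] mult_left_le_one_le)
    moreover have "interp f x d n t = f y" unfolding y_def by (rule interp_right[OF d]) (use False y_def in simp)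
    ultimately have "interp f x d (Suc n) t = f y + (f (y + d) - f y) * s"
      unfolding rec slope_def e y_def[symmetric] using d by simp
    then have "f t - interp f x d (Suc n) t = (1 - s) * (f t - f y) + s * (f t - f (y + d))"
      by (simp add: algebra_simps)
    also have "\<bar>\<dots>\<bar> \<le> (1 - s) * \<bar>f t - f y\<bar> + s * \<bar>f t - f (y + d)\<bar>"
      using s by (intro order_trans[OF abs_triangle_ineq]) (simp add: abs_mult)
    also have "\<dots> \<le> (1 - s) * (s * d) + s * ((1 - s) * d)"
    proof (intro add_mono mult_left_mono)
      show "\<bar>f t - f y\<bar> \<le> s * d" using f[of t y] s d by (simp add: abs_mult)
      have "\<bar>t - (y + d)\<bar> = (1 - s) * d"
        using s d by (simp add: abs_if algebra_simps mult_left_le_one_le)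
      then show "\<bar>f t - f (y + d)\<bar> \<le> (1 - s) * d" using f[of t "y + d"] by simp
    qed (use s in auto)
    also have "\<dots> = d / 2 - 2 * d * (s - 1 / 2)\<^sup>2" by (simp add: power2_eq_square algebra_simps)
    also have "\<dots> \<le> d / 2" using d by simp
    finally show ?thesis .
  qed
qed

section \<open>Levels reached by h before T\<close>

context young_pair
begin

text \<open>For a monotone function the left limit is the supremum of the values before it. In this
  form a level below the limit is visibly exceeded by some \<open>h t\<close>, which is what the
  concentration bound asks for.\<close>

lemma left_limit_le_SUP:
  "left_limit h T = (SUP t\<in>{t. 0 \<le> t \<and> ereal t < T}. ereal (h t))" (is "_ = ?l")
proof -
  have real_below: "\<exists>r. s = ereal r \<and> u < r" if "ereal u < s" "s < T" for s u
    using that by (cases s) auto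
  have "((\<lambda>s. ereal (h (real_of_ereal s))) \<longlongrightarrow> ?l) (at_left T)"
  proof (rule order_tendstoI)
    fix a assume "a < ?l"
    then obtain t where t: "0 \<le> t" "ereal t < T" "a < ereal (h t)" unfolding less_SUP_iff by auto
    have "\<forall>s>ereal t. s < T \<longrightarrow> a < ereal (h (real_of_ereal s))"
    proof (intro allI impI)
      fix s assume "ereal t < s" "s < T"
      with real_below obtain r where "s = ereal r" "t < r" by blast
      then show "a < ereal (h (real_of_ereal s))"
        using h_mono[of t r] t \<open>s < T\<close> by (auto intro: order_less_le_trans)
    qed
    then show "eventually (\<lambda>s. a < ereal (h (real_of_ereal s))) (at_left T)"
      using t(2) by (subst eventually_at_left) auto
  next
    fix a assume a: "?l < a"
    have "\<forall>s>ereal 0. s < T \<longrightarrow> ereal (h (real_of_ereal s)) < a"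
    proof (intro allI impI)
      fix s assume "ereal 0 < s" "s < T"
      with real_below obtain r where r: "s = ereal r" "0 < r" by blast
      then have "ereal (h r) \<le> ?l" using \<open>s < T\<close> by (intro SUP_upper) auto
      then show "ereal (h (real_of_ereal s)) < a" using a r by simp
    qed
    then show "eventually (\<lambda>s. ereal (h (real_of_ereal s)) < a) (at_left T)"
      using T0 by (subst eventually_at_left[of 0]) (auto simp: zero_ereal_def)
  qed
  moreover have "at_left T \<noteq> bot"
  proof
    assume "at_left T = bot"
    then have "eventually (\<lambda>_. False) (at_left T)" by simp
    then obtain b where "b < T" "\<forall>y>b. \<not> y < T" using T0 by (subst (asm) eventually_at_left[of 0]) auto
    then show False using dense by blast
  qed
  ultimately show ?thesis unfolding left_limit_def by (intro tendsto_Lim)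
qed

lemma reach_left_limit:
  assumes "ereal X \<le> left_limit h T" "y < X"
  shows "\<exists>t. 0 \<le> t \<and> ereal t < T \<and> y < h t"
proof -
  have "ereal y < left_limit h T" using assms by (meson less_ereal.simps(1) order_less_le_trans)
  then show ?thesis unfolding left_limit_le_SUP less_SUP_iff by auto
qed

end

lemma ereal_divide_bound:
  assumes "0 < c" "0 < n" "ereal d \<le> ereal c * H / ereal n"
  shows "ereal (n * d / c) \<le> H"
  using assms by (cases H) (auto simp: field_simps)

section \<open>The truncation level and the quantity G2\<close>

context levy_exp
begin

lemma V2r_mono: "x \<le> y \<Longrightarrow> V2r x \<le> V2r y"
  using square_integrable[of x] square_integrable[of y] unfolding V2r_def set_lebesgue_integral_def set_integrable_def
  by (intro integral_mono) (auto simp: indicator_def)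

lemma V2r_bounded: "V2r x \<le> (LINT u|\<nu>. (L2_set u I)\<^sup>2)"
  using square_integrable[of x] integrable_sq_exp[of 0] TT_pos
  unfolding V2r_def set_lebesgue_integral_def set_integrable_def
  by (intro integral_mono) (auto simp: indicator_def zero_ereal_def)

lemma V2r_pos: "\<exists>x. 0 < V2r x"
proof (rule ccontr)
  assume "\<nexists>x. 0 < V2r x"
  then have z: "V2r x = 0" for x using V2r_nonneg[of x] by (metis order_le_less)
  have "AE u in \<nu>. \<forall>n::nat. indicat_real {u \<in> space \<nu>. L2_set u I \<le> real n} u *\<^sub>R (L2_set u I)\<^sup>2 = 0"
    unfolding AE_all_countable
  proof
    fix n :: nat
    show "AE u in \<nu>. indicat_real {u \<in> space \<nu>. L2_set u I \<le> real n} u *\<^sub>R (L2_set u I)\<^sup>2 = 0"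
      using z[of "real n"] square_integrable[of "real n"]
      unfolding V2r_def set_lebesgue_integral_def set_integrable_def
      by (subst (asm) integral_nonneg_eq_0_iff_AE) auto
  qed
  with AE_space have "AE u in \<nu>. L2_set u I = 0"
  proof eventually_elim
    case (elim u)
    obtain n where "L2_set u I \<le> real n" using real_arch_simple by blast
    with elim(1) elim(2)[rule_format, of n] show ?case by simp
  qed
  then show False using not_AE_norm_zero by simp
qed

text \<open>Monotonicity of \<open>V2r\<close> gives
  \<open>V2r p \<le> V2r z \<le> \<gamma> * z^2\<close> for every admissible \<open>z\<close>, and
  only the right side is taken to the infimum; so the estimate holds at \<open>p\<close> although
  \<open>p\<close> itself need not be admissible.\<close>

lemma truncation_level:
  assumes g: "0 < \<gamma>"
  defines "p \<equiv> Inf {x. 0 < x \<and> 0 < V2r x / x\<^sup>2 \<and> V2r x / x\<^sup>2 \<le> \<gamma>}"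
  shows "0 \<le> p" "sqrt (V2r p) \<le> p * sqrt \<gamma>"
proof -
  let ?S = "{x. 0 < x \<and> 0 < V2r x / x\<^sup>2 \<and> V2r x / x\<^sup>2 \<le> \<gamma>}"
  define m where "m = (LINT u|\<nu>. (L2_set u I)\<^sup>2)"
  obtain x where x: "0 < V2r x" using V2r_pos by blast
  \<comment> \<open>An admissible point: \<open>x\<close> makes \<open>V2r\<close> positive, and
    \<open>sqrt (m / \<gamma>)\<close> makes \<open>\<gamma> * y^2\<close> exceed the total second
    moment \<open>m\<close>.\<close>
  define y where "y = max 1 (max x (sqrt (m / \<gamma>)))"
  have y: "1 \<le> y" "x \<le> y" "sqrt (m / \<gamma>) \<le> y" by (auto simp: y_def)
  have Vy: "0 < V2r y" using V2r_mono[OF y(2)] x by simp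
  have "m / \<gamma> \<le> y\<^sup>2" using y(3) y(1) by (intro sqrt_le_D)
  then have "V2r y \<le> \<gamma> * y\<^sup>2" using V2r_bounded[of y] g unfolding m_def[symmetric] by (simp add: field_simps)
  then have "y \<in> ?S" using y(1) Vy by (auto simp: field_simps)
  then have ne: "?S \<noteq> {}" by blast
  show "0 \<le> p" unfolding p_def using ne by (intro cInf_greatest) auto
  have bdd: "bdd_below ?S" by (intro bdd_belowI[of _ 0]) auto
  have "sqrt (V2r p / \<gamma>) \<le> z" if z: "z \<in> ?S" for z
  proof -
    have "p \<le> z" unfolding p_def using bdd z by (intro cInf_lower)
    then have "V2r p \<le> V2r z" by (rule V2r_mono)
    also have "\<dots> \<le> \<gamma> * z\<^sup>2" using z by (auto simp: field_simps)
    finally have "V2r p / \<gamma> \<le> z\<^sup>2" using g by (simp add: field_simps)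
    then show "sqrt (V2r p / \<gamma>) \<le> z" using z by (intro real_le_lsqrt) auto
  qed
  then have "sqrt (V2r p / \<gamma>) \<le> p" using cInf_greatest[OF ne, of "sqrt (V2r p / \<gamma>)", folded p_def] by blast
  then show "sqrt (V2r p) \<le> p * sqrt \<gamma>" using g by (simp add: real_sqrt_divide field_simps)
qed

end

text \<open>The description has a value only after existence and uniqueness of the root are known.
  The left-hand side has derivative \<open>- ln (1 + y / \<gamma>)\<close>, so it decreases strictly
  from \<open>0\<close>, and a point where it lies below \<open>ln (1 / 4)\<close> gives the root by
  intermediate values.\<close>

lemma k_gam_nonneg:
  assumes g: "0 < \<gamma>"
  shows "0 \<le> k_gam \<gamma> (1 / 4)"
proof -
  define f where "f y = y - (y + \<gamma>) * ln (1 + y / \<gamma>)" for y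
  have der: "(f has_real_derivative - ln (1 + y / \<gamma>)) (at y)" if "0 \<le> y" for y
  proof -
    have pos: "0 < 1 + y / \<gamma>" using g that by (simp add: add_pos_nonneg)
    have d: "(f has_real_derivative 1 - (1 * ln (1 + y / \<gamma>) + (1 / \<gamma> / (1 + y / \<gamma>)) * (y + \<gamma>))) (at y)"
      unfolding f_def
    proof (intro DERIV_diff DERIV_mult DERIV_ident)
      show "((\<lambda>y. y + \<gamma>) has_real_derivative 1) (at y)" by (auto intro!: derivative_eq_intros)
      show "((\<lambda>y. ln (1 + y / \<gamma>)) has_real_derivative 1 / \<gamma> / (1 + y / \<gamma>)) (at y)"
        using pos g by (auto intro!: derivative_eq_intros)
    qed
    have "(1 / \<gamma> / (1 + y / \<gamma>)) * (y + \<gamma>) = 1" using g that by (simp add: field_simps add_eq_0_iff)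
    with d show ?thesis by (simp only: mult_1) simp
  qed
  have cont: "continuous_on {0..u} f" for u
    by (rule DERIV_continuous_on[where D = "\<lambda>y. - ln (1 + y / \<gamma>)"]) (use der in \<open>auto intro: has_field_derivative_at_within\<close>)
  have dec: "f z < f y" if "0 \<le> y" "y < z" for y z
  proof (rule DERIV_neg_imp_decreasing_open[OF that(2)])
    fix x assume x: "y < x" "x < z"
    then have "0 < ln (1 + x / \<gamma>)" using that g by (intro ln_gt_zero) auto
    then show "\<exists>y. (f has_real_derivative y) (at x) \<and> y < 0"
      using der[of x] x that by (intro exI[of _ "- ln (1 + x / \<gamma>)"]) auto
  next
    show "continuous_on {y..z} f" by (rule continuous_on_subset[OF cont[of z]]) (use that in auto)
  qed
  \<comment> \<open>Chosen so that at \<open>Y = \<gamma> * (exp s - 1)\<close> the logarithm is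
    just \<open>s\<close>, and \<open>\<gamma> * (1 - s) = - ln 4\<close>.\<close>
  define s where "s = 1 + ln 4 / \<gamma>"
  have s: "1 \<le> s" using g by (simp add: s_def)
  define Y where "Y = \<gamma> * (exp s - 1)"
  have Y: "0 \<le> Y" using g s by (simp add: Y_def)
  have "1 + Y / \<gamma> = exp s" using g by (simp add: Y_def)
  then have "f Y = \<gamma> * ((1 - s) * exp s - 1)"
    by (simp add: f_def) (simp add: Y_def algebra_simps)
  also have "\<dots> \<le> \<gamma> * (1 - s)"
  proof (intro mult_left_mono)
    have "(s - 1) * 1 \<le> (s - 1) * exp s" using s by (intro mult_left_mono) auto
    then show "(1 - s) * exp s - 1 \<le> 1 - s" by (simp add: algebra_simps)
  qed (use g in simp)
  also have "\<dots> = ln (1 / 4)" using g by (simp add: s_def ln_div)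
  finally have fY: "f Y \<le> ln (1 / 4)" .
  have "f 0 = 0" by (simp add: f_def)
  then have f0: "ln (1 / 4) \<le> f 0" by simp
  obtain y where y: "0 \<le> y" "f y = ln (1 / 4)" using IVT2'[OF fY f0 Y cont] by auto
  have "\<exists>!y. 0 \<le> y \<and> f y = ln (1 / 4)"
  proof (rule ex1I[of _ y])
    fix z assume z: "0 \<le> z \<and> f z = ln (1 / 4)"
    then show "z = y" using y dec[of y z] dec[of z y] by (cases "y < z"; cases "z < y") auto
  qed (use y in auto)
  from theI'[OF this] show ?thesis unfolding k_gam_def f_def by blast
qed

section \<open>The two classes of test functions\<close>

lemma lip_seminormD:
  assumes "lip_seminorm f \<le> ereal 1"
  shows "\<bar>f x - f y\<bar> \<le> \<bar>x - y\<bar>"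
proof (cases "x = y")
  case False
  then have "ereal (\<bar>f x - f y\<bar> / \<bar>x - y\<bar>) \<le> ereal 1"
    using assms unfolding lip_seminorm_def SUP_le_iff by auto
  then show ?thesis using False by (simp add: field_simps)
qed simp

lemma Lip_bD:
  assumes "f \<in> Lip_b b 1"
  shows "\<bar>f x - f y\<bar> \<le> \<bar>x - y\<bar>" "\<bar>f x\<bar> \<le> b"
  using assms by (auto simp: Lip_b_def SUP_le_iff intro: lip_seminormD)

lemma lip_seminorm_zero: "lip_seminorm (\<lambda>_. 0) \<le> ereal 1"
  by (auto simp: lip_seminorm_def intro!: SUP_least)

text \<open>Values off \<open>K\<close> vanish by the support condition, and the Lipschitz bound
  carries this to the two end points, which may belong to \<open>K\<close>.
  \<open>Inf K + diameter K\<close> serves as the right end of an interval that contains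
  \<open>K\<close>.\<close>

lemma Lip_KD:
  assumes f: "f \<in> Lip_K K 1" and K: "compact K" "0 < diameter K"
  shows "\<bar>f x - f y\<bar> \<le> \<bar>x - y\<bar>" "x \<le> Inf K \<Longrightarrow> f x = 0" "Inf K + diameter K \<le> x \<Longrightarrow> f x = 0"
proof -
  show l: "\<bar>f x - f y\<bar> \<le> \<bar>x - y\<bar>" for x y
    using f by (intro lip_seminormD) (simp add: Lip_K_def)
  have z: "f t = 0" if "t \<notin> K" for t
  proof (rule ccontr)
    assume "f t \<noteq> 0"
    then have "t \<in> closure {x. f x \<noteq> 0}" by (intro closure_subset[THEN subsetD]) simp
    then show False using f that by (auto simp: Lip_K_def)
  qed
  have "K \<noteq> {}" using K(2) by auto
  have bd: "bounded K" using K(1) by (rule compact_imp_bounded)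
  then have bK: "bdd_below K" by (rule bounded_imp_bdd_below)
  have I: "Inf K \<in> K" using \<open>K \<noteq> {}\<close> bK K(1) by (intro closed_contains_Inf compact_imp_closed)
  have lim: "f x = 0" if out: "\<And>e. 0 < e \<Longrightarrow> f (x + s * e) = 0" "\<bar>s\<bar> = 1" for x s
  proof -
    have "\<bar>f x\<bar> \<le> 0 + e" if "0 < e" for e
    proof -
      have "\<bar>f x - 0\<bar> \<le> \<bar>x - (x + s * e)\<bar>" using l[of x "x + s * e"] unfolding out(1)[OF that] .
      then show ?thesis using that out(2) by (simp add: abs_mult)
    qed
    then have "\<bar>f x\<bar> \<le> 0" by (rule field_le_epsilon)
    then show ?thesis by simp
  qed
  show "f x = 0" if "x \<le> Inf K"
  proof (rule lim[of x "-1"])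
    fix e :: real assume e: "0 < e"
    have "x + -1 * e \<notin> K"
    proof
      assume "x + -1 * e \<in> K"
      then have "Inf K \<le> x + -1 * e" using bK by (rule cInf_lower)
      then show False using that e by simp
    qed
    then show "f (x + -1 * e) = 0" by (rule z)
  qed simp
  show "f x = 0" if "Inf K + diameter K \<le> x"
  proof (rule lim[of x 1])
    fix e :: real assume e: "0 < e"
    have "x + 1 * e \<notin> K"
    proof
      assume "x + 1 * e \<in> K"
      then have "dist (x + 1 * e) (Inf K) \<le> diameter K" using bd I by (intro diameter_bounded_bound)
      then show False using that e by (simp add: dist_real_def)
    qed
    then show "f (x + 1 * e) = 0" by (rule z)
  qed simp
qed

section \<open>Uniform deviation bounds\<close>

locale matrix_model = random_matrix N A a + levy_exp "coords N" \<beta> \<nu> P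
  for N :: nat and A :: "complex mat" and a :: real
    and \<beta> :: "nat \<times> nat \<Rightarrow> real" and \<nu> P :: "(nat \<times> nat \<Rightarrow> real) measure"
begin

interpretation P: prob_space P by (rule prob_P)

definition dev :: "(real \<Rightarrow> real) \<Rightarrow> (nat \<times> nat \<Rightarrow> real) \<Rightarrow> real" where
  "dev f x = TrF N A f x - (LINT y|P. TrF N A f y)"

lemma TrF_bounded: "(\<And>t. \<bar>f t\<bar> \<le> B) \<Longrightarrow> \<bar>TrF N A f x\<bar> \<le> B"
  using TrF_abs_le[OF N, of f "\<lambda>_. B" A x] by (simp add: TrF_const[OF N])

lemma TrF_integrable:
  assumes "\<And>s t. \<bar>f s - f t\<bar> \<le> \<bar>s - t\<bar>" "\<And>t. \<bar>f t\<bar> \<le> B"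
  shows "integrable P (TrF N A f)"
proof (rule P.integrable_const_bound[of _ B])
  show "TrF N A f \<in> borel_measurable P"
    using TrF_measurable[OF assms(1)] by (simp add: measurable_cong_sets[OF sets_P refl])
qed (use TrF_bounded[OF assms(2)] in auto)

text \<open>A constant has no deviation, so \<open>c0\<close> drops out. The approximation error
  enters twice, once at \<open>x\<close> and once in the mean; \<open>w\<close> is a function rather
  than a number because on an unbounded spectrum the error is not uniformly small.\<close>

lemma dev_combination:
  fixes f w :: "real \<Rightarrow> real" and g :: "nat \<Rightarrow> real \<Rightarrow> real"
  assumes f: "integrable P (TrF N A f)" and g: "\<And>i. i < m \<Longrightarrow> integrable P (TrF N A (g i))"
    and w: "integrable P (TrF N A w)"
    and c: "\<And>i. i < m \<Longrightarrow> \<bar>c i\<bar> \<le> 1" and e: "\<And>t. \<bar>f t - (c0 + (\<Sum>i<m. c i * g i t))\<bar> \<le> w t"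
  shows "\<bar>dev f x\<bar> \<le> (\<Sum>i<m. \<bar>dev (g i) x\<bar>) + TrF N A w x + (LINT y|P. TrF N A w y)"
proof -
  define r where "r y = TrF N A f y - (c0 + (\<Sum>i<m. c i * TrF N A (g i) y))" for y
  have r: "\<bar>r y\<bar> \<le> TrF N A w y" for y
  proof -
    have "r y = TrF N A (\<lambda>t. f t - (c0 + (\<Sum>i<m. c i * g i t))) y"
      unfolding r_def TrF_diff TrF_add TrF_lincomb TrF_const[OF N] ..
    then show ?thesis using TrF_abs_le[OF N e] by simp
  qed
  have isum: "integrable P (\<lambda>y. \<Sum>i<m. c i * TrF N A (g i) y)"
    using g by (intro Bochner_Integration.integrable_sum integrable_mult_right) simp
  then have ic: "integrable P (\<lambda>y. c0 + (\<Sum>i<m. c i * TrF N A (g i) y))"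
    by (intro Bochner_Integration.integrable_add P.integrable_const)
  then have ir: "integrable P r" unfolding r_def by (rule Bochner_Integration.integrable_diff[OF f])
  have "\<bar>LINT y|P. r y\<bar> \<le> (LINT y|P. \<bar>r y\<bar>)" by (rule integral_abs_bound)
  also have "\<dots> \<le> (LINT y|P. TrF N A w y)" using ir w r by (intro integral_mono) auto
  finally have Er: "\<bar>LINT y|P. r y\<bar> \<le> (LINT y|P. TrF N A w y)" .
  have "(LINT y|P. r y) = (LINT y|P. TrF N A f y) - (c0 + (\<Sum>i<m. c i * (LINT y|P. TrF N A (g i) y)))"
  proof -
    have "(LINT y|P. (\<Sum>i<m. c i * TrF N A (g i) y)) = (\<Sum>i<m. c i * (LINT y|P. TrF N A (g i) y))"
      using g by (subst Bochner_Integration.integral_sum) (auto intro: integrable_mult_right)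
    then show ?thesis unfolding r_def Bochner_Integration.integral_diff[OF f ic]
        Bochner_Integration.integral_add[OF P.integrable_const isum] by (simp add: P.prob_space)
  qed
  then have "dev f x = (\<Sum>i<m. c i * dev (g i) x) + (r x - (LINT y|P. r y))"
    by (simp add: dev_def r_def sum_subtractf right_diff_distrib)
  also have "\<bar>\<dots>\<bar> \<le> \<bar>\<Sum>i<m. c i * dev (g i) x\<bar> + (\<bar>r x\<bar> + \<bar>LINT y|P. r y\<bar>)" by linarith
  also have "\<bar>\<Sum>i<m. c i * dev (g i) x\<bar> \<le> (\<Sum>i<m. \<bar>dev (g i) x\<bar>)"
  proof (intro order_trans[OF sum_abs] sum_mono)
    fix i assume "i \<in> {..<m}"
    then have "\<bar>c i\<bar> * \<bar>dev (g i) x\<bar> \<le> 1 * \<bar>dev (g i) x\<bar>" by (intro mult_right_mono c) auto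
    then show "\<bar>c i * dev (g i) x\<bar> \<le> \<bar>dev (g i) x\<bar>" by (simp add: abs_mult)
  qed
  finally show ?thesis using r[of x] Er by linarith
qed

lemma dev_prob_le:
  assumes F: "F \<noteq> {}" and S: "S \<in> sets P" and d: "d' < d"
    and le: "\<And>x f. x \<in> space P \<Longrightarrow> x \<notin> S \<Longrightarrow> f \<in> F \<Longrightarrow> \<bar>dev f x\<bar> \<le> d'"
  shows "dev_prob N A P F d \<le> measure P S"
proof -
  have cm: "cmod (tr_N (mat_fun f (XA N A x)) - (LINT y|P. tr_N (mat_fun f (XA N A y)))) = \<bar>dev f x\<bar>" for f x
    unfolding tr_eq_TrF integral_complex_of_real dev_def
    by (simp flip: of_real_diff)
  let ?E = "{x \<in> space P. (SUP f\<in>F. \<bar>dev f x\<bar>) \<ge> d}"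
  have "?E \<subseteq> S"
  proof
    fix x assume x: "x \<in> ?E"
    show "x \<in> S"
    proof (rule ccontr)
      assume "x \<notin> S"
      then have "(SUP f\<in>F. \<bar>dev f x\<bar>) \<le> d'" using x le F by (intro cSUP_least) auto
      then show False using x d by simp
    qed
  qed
  \<comment> \<open>\<open>measure\<close> is \<open>0\<close> on sets outside
    \<open>sets P\<close>, so the bound holds in both cases.\<close>
  then have "measure P ?E \<le> measure P S"
    using S by (cases "?E \<in> sets P") (auto intro: P.finite_measure_mono simp: measure_notin_sets)
  then show ?thesis unfolding dev_prob_def cm .
qed

text \<open>The scheme shared by both parts: a union bound over the \<open>m\<close> test functions,
  each kept within \<open>e\<close> by concentration at level \<open>e / lipc\<close>, at the price
  of a factor \<open>2\<close> for the two tails. The premise \<open>small\<close> is where each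
  part balances its errors against \<open>d\<close>.\<close>

lemma dev_prob_interpolation:
  fixes w :: "real \<Rightarrow> real" and g :: "nat \<Rightarrow> real \<Rightarrow> real"
  assumes F: "F \<noteq> {}"
    and F_lip: "\<And>f s t. f \<in> F \<Longrightarrow> \<bar>f s - f t\<bar> \<le> \<bar>s - t\<bar>" and F_bound: "\<And>f t. f \<in> F \<Longrightarrow> \<bar>f t\<bar> \<le> B"
    and g_lip: "\<And>i s t. \<bar>g i s - g i t\<bar> \<le> \<bar>s - t\<bar>" and g_bound: "\<And>i t. \<bar>g i t\<bar> \<le> B'"
    and w: "integrable P (TrF N A w)"
    and approx: "\<And>f. f \<in> F \<Longrightarrow> \<exists>c0 c. (\<forall>i<m. \<bar>c i\<bar> \<le> 1) \<and> (\<forall>t. \<bar>f t - (c0 + (\<Sum>i<m. c i * g i t))\<bar> \<le> w t)"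
    and e: "0 < e" "ereal (e / lipc) \<le> left_limit hh TT"
    and small: "\<And>x. x \<in> space P \<Longrightarrow> (\<And>i. i < m \<Longrightarrow> \<bar>dev (g i) x\<bar> \<le> e) \<Longrightarrow>
      real m * e + TrF N A w x + (LINT y|P. TrF N A w y) \<le> d'" "d' < d"
  shows "dev_prob N A P F d \<le> 2 * real m * exp (- (LBINT s=0..ereal (e / lipc). young.hinv s))"
proof -
  note [measurable_cong] = sets_P
  define S where "S i = {x \<in> space P. \<bar>dev (g i) x\<bar> \<ge> e}" for i
  have S[measurable]: "S i \<in> sets P" for i
  proof -
    note [measurable] = TrF_measurable[OF g_lip[of i]]
    show ?thesis unfolding S_def dev_def by measurable
  qed
  have "measure P (S i) \<le> 2 * exp (- (LBINT s=0..ereal (e / lipc). young.hinv s))" for i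
    unfolding S_def dev_def
  proof (rule concentration[OF lipc_pos e(1)])
    show "\<exists>t. 0 \<le> t \<and> ereal t < TT \<and> y < hh t" if "y < e / lipc" for y
      using young.reach_left_limit[OF e(2) that] .
    show "TrF N A (g i) \<in> borel_measurable (RI (coords N))" by (rule TrF_measurable[OF g_lip])
    show "\<bar>TrF N A (g i) x\<bar> \<le> B'" for x by (rule TrF_bounded[OF g_bound])
    show "lip_on (coords N) lipc (TrF N A (g i))" by (rule TrF_lip[OF g_lip])
  qed
  then have "(\<Sum>i<m. measure P (S i)) \<le> real m * (2 * exp (- (LBINT s=0..ereal (e / lipc). young.hinv s)))"
    using sum_bounded_above[of "{..<m}" "\<lambda>i. measure P (S i)"] by simp
  moreover have "measure P (\<Union>i<m. S i) \<le> (\<Sum>i<m. measure P (S i))"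
    by (intro P.finite_measure_subadditive_finite) (use S in auto)
  moreover have "dev_prob N A P F d \<le> measure P (\<Union>i<m. S i)"
  proof (rule dev_prob_le[OF F _ small(2)])
    show "(\<Union>i<m. S i) \<in> sets P" using S by auto
    fix x f assume x: "x \<in> space P" "x \<notin> (\<Union>i<m. S i)" and f: "f \<in> F"
    have dg: "\<bar>dev (g i) x\<bar> \<le> e" if "i < m" for i using x that by (force simp: S_def)
    obtain c0 c where c: "\<And>i. i < m \<Longrightarrow> \<bar>c i\<bar> \<le> 1" "\<And>t. \<bar>f t - (c0 + (\<Sum>i<m. c i * g i t))\<bar> \<le> w t"
      using approx[OF f] by blast
    have "\<bar>dev f x\<bar> \<le> (\<Sum>i<m. \<bar>dev (g i) x\<bar>) + TrF N A w x + (LINT y|P. TrF N A w y)"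
      by (rule dev_combination[OF TrF_integrable[OF F_lip[OF f] F_bound[OF f]] TrF_integrable[OF g_lip g_bound] w c])
    also have "(\<Sum>i<m. \<bar>dev (g i) x\<bar>) \<le> real m * e"
      using sum_bounded_above[of "{..<m}" "\<lambda>i. \<bar>dev (g i) x\<bar>" e] dg by simp
    finally show "\<bar>dev f x\<bar> \<le> d'" using small(1)[OF x(1) dg] by linarith
  qed
  ultimately show ?thesis by simp
qed

text \<open>A statistic bounded by \<open>B\<close> deviates from its mean by at most
  \<open>2 * B\<close>. This disposes of values of \<open>d\<close> so large that a grid would have
  no cell or the equation for \<open>t0\<close> would give too little.\<close>

lemma dev_prob_trivial:
  assumes F: "F \<noteq> {}" and b: "\<And>f t. f \<in> F \<Longrightarrow> \<bar>f t\<bar> \<le> B" "2 * B < d"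
  shows "dev_prob N A P F d \<le> 0"
proof -
  have "dev_prob N A P F d \<le> measure P {}"
  proof (rule dev_prob_le[OF F _ b(2)])
    fix x f assume f: "f \<in> F"
    have "\<bar>LINT y|P. TrF N A f y\<bar> \<le> B"
    proof (cases "integrable P (TrF N A f)")
      case True
      have "\<bar>LINT y|P. TrF N A f y\<bar> \<le> (LINT y|P. \<bar>TrF N A f y\<bar>)" by (rule integral_abs_bound)
      also have "\<dots> \<le> (LINT y|P. B)" using True TrF_bounded[OF b(1)[OF f]] by (intro integral_mono) auto
      finally show ?thesis by (simp add: P.prob_space)
    next
      case False
      then show ?thesis using order_trans[OF abs_ge_zero b(1)[OF f]] by (simp add: not_integrable_integral_eq)
    qed
    moreover have "\<bar>TrF N A f x\<bar> \<le> B" by (rule TrF_bounded[OF b(1)[OF f]])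
    ultimately show "\<bar>dev f x\<bar> \<le> 2 * B" unfolding dev_def by linarith
  qed simp
  then show ?thesis by simp
qed

text \<open>With \<open>\<rho> = 4 D / d\<close>, a grid of
  \<open>n = \<lfloor>\<rho>\<rfloor>\<close> cells and the threshold
  \<open>e = d^2 / (8 D)\<close>, the ramps contribute at most \<open>\<rho> * e = d / 2\<close>.
  The interpolation error, counted for the value and for the mean, is \<open>D / n < d / 2\<close>
  because \<open>\<rho> < 2 n\<close>. The prefactor is
  \<open>2 n \<le> 2 \<rho> = 8 D / d\<close>.\<close>

lemma compact_support_deviation:
  assumes K: "compact K" and d: "0 < d"
    and lim: "ereal (d\<^sup>2) < ereal (8 * sqrt 2 * a * diameter K) * left_limit hh TT / ereal (real N)"
  shows "dev_prob N A P (Lip_K K 1) d \<le> 8 * diameter K / d *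
    exp (- (LBINT s=0..ereal (real N * d\<^sup>2 / (8 * sqrt 2 * a * diameter K)). young.hinv s))"
proof -
  define D where "D = diameter K"
  \<comment> \<open>For a degenerate \<open>K\<close> the right side of \<open>lim\<close> is
    \<open>0\<close>, also when the left limit is infinite, so \<open>lim\<close> fails.\<close>
  have "D \<noteq> 0"
  proof
    assume "D = 0"
    then show False using lim d by (simp add: D_def zero_ereal_def[symmetric])
  qed
  then have D: "0 < D" using diameter_ge_0[OF compact_imp_bounded[OF K]] by (simp add: D_def)
  note Lip = Lip_KD[OF _ K D[unfolded D_def], folded D_def]
  have F: "Lip_K K 1 \<noteq> {}" using lip_seminorm_zero by (auto simp: Lip_K_def intro!: exI[of _ "\<lambda>_. 0"])
  have bound: "\<bar>f t\<bar> \<le> D" if f: "f \<in> Lip_K K 1" for f t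
  proof (cases "Inf K \<le> t \<and> t \<le> Inf K + D")
    case True
    then show ?thesis using Lip(1)[OF f, of t "Inf K"] Lip(2)[OF f, of "Inf K"] by simp
  next
    case False
    then have "f t = 0" using Lip(2,3)[OF f, of t] by auto
    then show ?thesis using D by simp
  qed
  define X where "X = real N * d\<^sup>2 / (8 * sqrt 2 * a * D)"
  have X: "ereal X \<le> left_limit hh TT" unfolding X_def
    using N a D lim[folded D_def] by (intro ereal_divide_bound) auto
  define \<rho> where "\<rho> = 4 * D / d"
  have \<rho>: "0 < \<rho>" using D d by (simp add: \<rho>_def)
  show ?thesis unfolding D_def[symmetric] X_def[symmetric]
  \<comment> \<open>Here \<open>n\<close> would be \<open>0\<close>; but \<open>4 * D < d\<close>,
    and the functions are bounded by \<open>D\<close>, so the event is empty.\<close>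
  proof (cases "\<rho> < 1")
    case True
    then have "2 * D < d" using d D by (simp add: \<rho>_def field_simps)
    then have "dev_prob N A P (Lip_K K 1) d \<le> 0" using bound by (intro dev_prob_trivial[OF F])
    then show "dev_prob N A P (Lip_K K 1) d \<le> 8 * D / d * exp (- (LBINT s=0..ereal X. young.hinv s))"
      using D d by (auto intro: order_trans)
  next
    case False
    define n where "n = nat \<lfloor>\<rho>\<rfloor>"
    have n: "1 \<le> n" "real n \<le> \<rho>" "\<rho> < real n + 1" using False unfolding n_def by linarith+
    define \<Delta> where "\<Delta> = D / real n"
    have \<Delta>: "0 < \<Delta>" "real n * \<Delta> = D" using n D by (auto simp: \<Delta>_def)
    define e where "e = d\<^sup>2 / (8 * D)"
    have e: "0 < e" using d D by (simp add: e_def)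
    have eX: "e / lipc = X" using N a D by (simp add: e_def lipc_def X_def field_simps)
    have small: "real n * e + \<Delta> < d"
    proof -
      have d': "d = 4 * D / \<rho>" using D d by (simp add: \<rho>_def)
      have "real n * e \<le> \<rho> * e" using n e by (intro mult_right_mono) auto
      also have "\<rho> * e = d / 2" using D d by (simp add: \<rho>_def e_def power2_eq_square)
      finally have "real n * e \<le> d / 2" .
      moreover have "\<Delta> < d / 2"
      proof -
        have "\<rho> < 2 * real n" using n by simp
        then show ?thesis using D d n by (simp add: \<rho>_def \<Delta>_def field_simps)
      qed
      ultimately show ?thesis by simp
    qed
    have "dev_prob N A P (Lip_K K 1) d \<le> 2 * real n * exp (- (LBINT s=0..ereal (e / lipc). young.hinv s))"
    proof (rule dev_prob_interpolation[where w = "\<lambda>_. \<Delta> / 2" and g = "ramp (Inf K) \<Delta>" and B = D and B' = \<Delta>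
          and d' = "real n * e + \<Delta>" and F = "Lip_K K 1"])
      show "\<bar>f s - f t\<bar> \<le> \<bar>s - t\<bar>" if "f \<in> Lip_K K 1" for f s t using that by (rule Lip(1))
      show "\<bar>ramp (Inf K) \<Delta> i t\<bar> \<le> \<Delta>" for i t using \<Delta> by (intro ramp_bound) auto
      show "integrable P (TrF N A (\<lambda>_. \<Delta> / 2))" by (simp add: TrF_const[OF N, abs_def])
      show "ereal (e / lipc) \<le> left_limit hh TT" unfolding eX by (rule X)
      show "real n * e + TrF N A (\<lambda>_. \<Delta> / 2) x + (LINT y|P. TrF N A (\<lambda>_. \<Delta> / 2) y) \<le> real n * e + \<Delta>" for x
        by (simp add: TrF_const[OF N] P.prob_space)
    next
      fix f assume f: "f \<in> Lip_K K 1"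
      have "\<bar>f t - interp f (Inf K) \<Delta> n t\<bar> \<le> \<Delta> / 2" for t
      proof -
        consider "t \<le> Inf K" | "Inf K \<le> t" "t \<le> Inf K + D" | "Inf K + D \<le> t" by linarith
        then show ?thesis
        proof cases
          case 1
          then show ?thesis using interp_left[OF \<Delta>(1) 1, of f n] Lip(2)[OF f] \<Delta>(1) by simp
        next
          case 2
          then show ?thesis using interp_error[OF Lip(1)[OF f] \<Delta>(1), of "Inf K" t n] \<Delta>(2) by simp
        next
          case 3
          then show ?thesis using interp_right[OF \<Delta>(1), of "Inf K" n t f] Lip(3)[OF f] \<Delta> by simp
        qed
      qed
      then show "\<exists>c0 c. (\<forall>i<n. \<bar>c i\<bar> \<le> 1) \<and> (\<forall>t. \<bar>f t - (c0 + (\<Sum>i<n. c i * ramp (Inf K) \<Delta> i t))\<bar> \<le> \<Delta> / 2)"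
        unfolding interp_def using slope_bound[OF Lip(1)[OF f] \<Delta>(1)] by blast
    qed (use F bound ramp_lip e small in auto)
    also have "\<dots> \<le> 8 * D / d * exp (- (LBINT s=0..ereal X. young.hinv s))"
      unfolding eX using n D d by (intro mult_right_mono) (auto simp: \<rho>_def)
    finally show "dev_prob N A P (Lip_K K 1) d \<le> 8 * D / d * exp (- (LBINT s=0..ereal X. young.hinv s))" .
  qed
qed

text \<open>The errors add up to \<open>29 / 30\<close> of \<open>d\<close>: the \<open>n\<close>
  ramps and the penalty \<open>v\<close> cost \<open>(n + 2) * e \<le> 3 / 10 * d\<close>, where
  \<open>v\<close> counts twice; interpolation costs \<open>\<Delta> \<le> d / 3\<close>; and the
  mean of \<open>v\<close>, again counted twice, costs \<open>2 * d / 6\<close>. As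
  \<open>n + 2 \<le> 12 * (Q + b) / d\<close> and \<open>e = d^2 / C\<close>, the constant
  \<open>40\<close> produces the \<open>3 / 10\<close>.\<close>

lemma bounded_lipschitz_deviation:
  assumes b: "0 < b" and d: "0 < d" and t: "0 \<le> t" "ereal t < TT"
    and ent: "t * hh t - psi t = ln (12 * b / d)"
    and q: "emeasure \<nu> (tail r) \<le> ennreal (1 / 4)"
    and G: "L2_set (betar r) (coords N) + sqrt (V2r r) \<le> G"
  defines "C \<equiv> 40 * (sqrt 2 * a / sqrt (real N) * (G + hh t) + b)"
  assumes lim: "ereal (d\<^sup>2) \<le> ereal (sqrt 2 * a * C) * left_limit hh TT / ereal (real N)"
  shows "dev_prob N A P (Lip_b b 1) d \<le> C / d *
    exp (- (LBINT s=0..ereal (real N * d\<^sup>2 / (sqrt 2 * a * C)). young.hinv s))"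
proof -
  have G0: "0 \<le> G" using G V2r_nonneg[of r] L2_set_nonneg[of "betar r" "coords N"] real_sqrt_ge_zero[of "V2r r"] by linarith
  have h0: "0 \<le> hh t" by (rule hh_nonneg[OF t])
  define c where "c = sqrt 2 * a / sqrt (real N)"
  have c: "0 < c" using a N by (simp add: c_def)
  define Q where "Q = c * (G + hh t)"
  have Q: "0 \<le> Q" using c G0 h0 by (simp add: Q_def)
  have CQ: "C = 40 * (Q + b)" by (simp add: C_def Q_def c_def)
  have C: "0 < C" using Q b by (simp add: CQ)
  define X where "X = real N * d\<^sup>2 / (sqrt 2 * a * C)"
  have X: "ereal X \<le> left_limit hh TT" unfolding X_def
    using N a C lim by (intro ereal_divide_bound) auto
  have F: "Lip_b b 1 \<noteq> {}"
    using lip_seminorm_zero b by (auto simp: Lip_b_def intro!: exI[of _ "\<lambda>_. 0"])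
  show ?thesis unfolding X_def[symmetric]
  proof (cases "2 * b < d")
    case True
    then have "dev_prob N A P (Lip_b b 1) d \<le> 0" using Lip_bD(2) by (intro dev_prob_trivial[OF F])
    then show "dev_prob N A P (Lip_b b 1) d \<le> C / d * exp (- (LBINT s=0..ereal X. young.hinv s))"
      using C d by (auto intro: order_trans)
  next
    case False
    then have db: "d \<le> 2 * b" by simp
    \<comment> \<open>\<open>d \<le> 2 * b\<close> gives \<open>12 * b / d \<ge> 6\<close>, the
      entropy condition of \<open>norm_tail\<close>.\<close>
    have l6: "ln 6 \<le> t * hh t - psi t" unfolding ent using db d b by (subst ln_le_cancel_iff) (auto simp: field_simps)
    have "0 < ln (6::real)" by simp
    have t0: "0 < t"
    proof (rule ccontr)
      assume "\<not> 0 < t"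
      then have "t = 0" using t by simp
      then show False using l6 \<open>0 < ln 6\<close> by (simp add: psi_def)
    qed
    have hp: "0 < hh t" using hh_strict[of 0 t] hh_nonneg[of 0] t0 t TT_pos by (simp add: zero_ereal_def)
    \<comment> \<open>By \<open>evals_bound\<close> the spectrum lies in \<open>[-R, R]\<close>
      unless the norm exceeds \<open>G + 2 * hh t\<close>, the event estimated by
      \<open>norm_tail\<close>.\<close>
    define R where "R = c * (G + 2 * hh t)"
    have R: "0 < R" unfolding R_def using c G0 hp by (intro mult_pos_pos) auto
    have RQ: "R \<le> 2 * Q" using c G0 by (simp add: R_def Q_def algebra_simps)
    \<comment> \<open>So many cells that the mesh \<open>2 * R / n\<close> is at most
      \<open>d / 3\<close>.\<close>
    define n where "n = nat \<lceil>6 * R / d\<rceil>"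
    have "0 < 6 * R / d" using R d by simp
    then have n: "1 \<le> n" "6 * R / d \<le> real n" "real n < 6 * R / d + 1" unfolding n_def by linarith+
    define \<Delta> where "\<Delta> = 2 * R / real n"
    have \<Delta>: "0 < \<Delta>" "real n * \<Delta> = 2 * R" using n R by (auto simp: \<Delta>_def)
    have \<Delta>d: "\<Delta> \<le> d / 3" using n d R by (simp add: \<Delta>_def field_simps)
    define e where "e = d\<^sup>2 / C"
    have e: "0 < e" using d C by (simp add: e_def)
    have eX: "e / lipc = X" using N a C by (simp add: e_def lipc_def X_def field_simps)
    \<comment> \<open>\<open>R \<le> 2 * Q\<close> turns \<open>6 * R / d\<close> into
      \<open>12 * Q / d\<close>, and \<open>d \<le> 2 * b\<close> lets \<open>6 * b / d\<close>
      absorb the additive constant \<open>3\<close>.\<close>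
    have n2: "real n + 2 \<le> 12 * (Q + b) / d"
    proof -
      have "real n + 2 \<le> 6 * R / d + 3" using n by simp
      also have "\<dots> \<le> 12 * Q / d + 6 * b / d"
        using RQ db d by (intro add_mono) (auto simp: field_simps)
      also have "\<dots> \<le> 12 * (Q + b) / d" using b d by (simp add: field_simps)
      finally show ?thesis .
    qed
    have ne: "(real n + 2) * e \<le> 3 / 10 * d"
    proof -
      have "(real n + 2) * e \<le> 12 * (Q + b) / d * e" using n2 e by (intro mult_right_mono) auto
      also have "\<dots> = 3 / 10 * d"
      proof -
        have "12 * s / d * (d\<^sup>2 / (40 * s)) = 3 / 10 * d" if "0 < s" for s
          using that d by (simp add: power2_eq_square)
        then show ?thesis unfolding e_def CQ using add_nonneg_pos[OF Q b] .
      qed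
      finally show ?thesis .
    qed
    \<comment> \<open>Outside \<open>[-R, R]\<close> the interpolant is constant, so its error is at
      most both \<open>2 * b\<close> and the distance to the interval. This majorant is itself
      1-Lipschitz and bounded, hence it concentrates like a ramp and only its mean has to be
      small.\<close>
    define v where "v y = min (2 * b) (max 0 (\<bar>y\<bar> - R))" for y
    have v_lip: "\<bar>v y - v z\<bar> \<le> \<bar>y - z\<bar>" for y z unfolding v_def by (auto simp: min_def max_def)
    have v_bound: "\<bar>v y\<bar> \<le> 2 * b" "0 \<le> v y" for y using b unfolding v_def by (auto simp: min_def max_def)
    have iv: "integrable P (TrF N A v)" by (rule TrF_integrable[OF v_lip v_bound(1)])
    \<comment> \<open>\<open>v\<close> vanishes on the spectrum unless the exceptional event occurs,
      and that event has probability at most \<open>exp (- ln (12 * b / d)) = d / (12 * b)\<close>.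
      The factor \<open>12\<close> in the equation for \<open>t0\<close> thus leaves
      \<open>d / 6\<close>.\<close>
    have Ev: "(LINT y|P. TrF N A v y) \<le> d / 6"
    proof -
      define S where "S = {x \<in> space P. G + 2 * hh t < L2_set x (coords N)}"
      have Sm: "S \<in> sets P" using nrm_meas unfolding S_def measurable_nu_eq
        by (simp add: measurable_cong_sets[OF sets_P refl, symmetric])
      have "TrF N A v x \<le> 2 * b * indicat_real S x" if x: "x \<in> space P" for x
      proof (cases "x \<in> S")
        case True
        have "\<bar>TrF N A v x\<bar> \<le> 2 * b" by (rule TrF_bounded[OF v_bound(1)])
        then show ?thesis using True by simp
      next
        case False
        have "v (evals N A x i) = 0" if "i < N" for i
        proof -
          have "\<bar>evals N A x i\<bar> \<le> c * L2_set x (coords N)" using evals_bound[OF that] by (simp add: c_def)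
          also have "\<dots> \<le> R" unfolding R_def using False x c by (intro mult_left_mono) (auto simp: S_def)
          finally show ?thesis using b by (simp add: v_def)
        qed
        then show ?thesis using False by (simp add: TrF_def)
      qed
      then have "(LINT y|P. TrF N A v y) \<le> (LINT y|P. 2 * b * indicat_real S y)"
        using iv Sm by (intro integral_mono) (auto simp: P.emeasure_eq_measure)
      also have "\<dots> = 2 * b * measure P S" using Sm by simp
      also have "\<dots> \<le> 2 * b * exp (- ln (12 * b / d))"
        using norm_tail[OF t0 t(2) q l6 G] b unfolding S_def ent by (intro mult_left_mono) auto
      also have "exp (- ln (12 * b / d)) = d / (12 * b)" using b d by (simp add: exp_minus)
      also have "2 * b * (d / (12 * b)) = d / 6" using b by simp
      finally show ?thesis .
    qed
    \<comment> \<open>The penalty \<open>v\<close> is appended as the last test function; in every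
      approximation its coefficient is \<open>0\<close>, and it is listed only so that its own
      deviation is controlled.\<close>
    define g where "g i = (if i < n then ramp (- R) \<Delta> i else v)" for i
    define w where "w y = \<Delta> / 2 + v y" for y
    have w: "TrF N A w x = \<Delta> / 2 + TrF N A v x" for x
      unfolding w_def TrF_add TrF_const[OF N] ..
    have Ew: "(LINT y|P. TrF N A w y) = \<Delta> / 2 + (LINT y|P. TrF N A v y)"
      unfolding w[abs_def] using iv by (simp add: P.prob_space)
    have g_lip: "\<bar>g i y - g i z\<bar> \<le> \<bar>y - z\<bar>" for i y z using ramp_lip v_lip by (auto simp: g_def)
    have "dev_prob N A P (Lip_b b 1) d \<le> 2 * real (Suc n) * exp (- (LBINT s=0..ereal (e / lipc). young.hinv s))"
    proof (rule dev_prob_interpolation[where w = w and g = g and B = b and B' = "max \<Delta> (2 * b)" and F = "Lip_b b 1"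
          and d' = "3 / 10 * d + d / 3 + d / 3"])
      show "\<bar>f s - f u\<bar> \<le> \<bar>s - u\<bar>" if "f \<in> Lip_b b 1" for f s u using that by (rule Lip_bD(1))
      show "\<bar>f s\<bar> \<le> b" if "f \<in> Lip_b b 1" for f s using that by (rule Lip_bD(2))
      show "\<bar>g i y\<bar> \<le> max \<Delta> (2 * b)" for i y
        using ramp_bound[of \<Delta> "- R" i y] v_bound(1)[of y] \<Delta> by (auto simp: g_def)
      show "integrable P (TrF N A w)" unfolding w[abs_def] using iv by simp
      show "ereal (e / lipc) \<le> left_limit hh TT" unfolding eX by (rule X)
      show "real (Suc n) * e + TrF N A w x + (LINT y|P. TrF N A w y) \<le> 3 / 10 * d + d / 3 + d / 3"
        if "\<And>i. i < Suc n \<Longrightarrow> \<bar>dev (g i) x\<bar> \<le> e" for x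
      proof -
        have "\<bar>dev v x\<bar> \<le> e" using that[of n] by (simp add: g_def)
        then have "TrF N A v x \<le> e + d / 6" using Ev unfolding dev_def by linarith
        moreover have "real (Suc n) * e + e \<le> 3 / 10 * d" using ne by (simp add: algebra_simps)
        ultimately show ?thesis using \<Delta>d Ev unfolding w Ew[unfolded w] by linarith
      qed
      show "3 / 10 * d + d / 3 + d / 3 < d" using d by simp
    next
      fix f assume f: "f \<in> Lip_b b 1"
      note fl = Lip_bD(1)[OF f]
      define k where "k i = (if i < n then slope f (- R) \<Delta> i else 0)" for i
      have "\<bar>f y - interp f (- R) \<Delta> n y\<bar> \<le> w y" for y
      proof -
        consider "y \<le> - R" | "- R \<le> y" "y \<le> R" | "R \<le> y" by linarith
        then show ?thesis
        proof cases
          case 1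
          then show ?thesis using interp_left[OF \<Delta>(1) 1, of f n] fl[of y "- R"] Lip_bD(2)[OF f, of y] Lip_bD(2)[OF f, of "- R"] R \<Delta>(1)
            unfolding w_def v_def by auto
        next
          case 2
          then show ?thesis using interp_error[OF fl \<Delta>(1), of "- R" y n] \<Delta>(2) v_bound(2)[of y] by (simp add: w_def)
        next
          case 3
          then show ?thesis using interp_right[OF \<Delta>(1), of "- R" n y f] fl[of y R] Lip_bD(2)[OF f, of y] Lip_bD(2)[OF f, of R] R \<Delta>
            unfolding w_def v_def by auto
        qed
      qed
      moreover have "(\<Sum>i<Suc n. k i * g i y) = (\<Sum>i<n. slope f (- R) \<Delta> i * ramp (- R) \<Delta> i y)" for y
        by (simp add: k_def g_def)
      moreover have "\<bar>k i\<bar> \<le> 1" for i using slope_bound[OF fl \<Delta>(1)] by (simp add: k_def)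
      ultimately show "\<exists>c0 c. (\<forall>i<Suc n. \<bar>c i\<bar> \<le> 1) \<and> (\<forall>t. \<bar>f t - (c0 + (\<Sum>i<Suc n. c i * g i t))\<bar> \<le> w t)"
        unfolding interp_def by (intro exI[of _ "f (- R)"] exI[of _ k]) simp
    qed (use F g_lip e in auto)
    also have "\<dots> \<le> C / d * exp (- (LBINT s=0..ereal X. young.hinv s))"
      unfolding eX
    proof (intro mult_right_mono)
      have "2 * real (Suc n) \<le> 2 * (real n + 2)" by simp
      also have "\<dots> \<le> 2 * (12 * (Q + b) / d)" using n2 by (intro mult_left_mono) auto
      also have "\<dots> \<le> C / d" unfolding CQ using Q b d by (simp add: divide_right_mono)
      finally show "2 * real (Suc n) \<le> C / d" .
    qed simp
    finally show "dev_prob N A P (Lip_b b 1) d \<le> C / d * exp (- (LBINT s=0..ereal X. young.hinv s))" .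
  qed
qed

end

section \<open>Translation of the hypotheses and the quantities of the theorem\<close>

lemma ID_levy_exp:
  assumes ID: "ID N \<beta> \<nu> P" and exp_moment: "\<exists>t>0. exp_moment N P t < \<infinity>"
  shows "levy_exp (coords N) \<beta> \<nu> P"
proof -
  have v: "levy_measure N \<nu>" using ID by (simp add: ID_def)
  show ?thesis
  proof (intro levy_exp.intro levy_law.intro levy_exp_axioms.intro)
    show "sets \<nu> = sets (RI (coords N))" "emeasure \<nu> {vzero (coords N)} = 0" "emeasure \<nu> (space \<nu>) \<noteq> 0"
      "(\<integral>\<^sup>+u. ennreal (min 1 ((L2_set u (coords N))\<^sup>2)) \<partial>\<nu>) < \<infinity>"
      using v by (auto simp: levy_measure_def RN_def enorm_def vzero_def)
    show "prob_space P" "sets P = sets (RI (coords N))"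
      using ID by (auto simp: ID_def RN_def)
    show "\<exists>t>0. (\<integral>\<^sup>+x. ennreal (exp (t * L2_set x (coords N))) \<partial>P) < \<infinity>"
      using exp_moment by (simp add: exp_moment_def enorm_def)
    show "charI (coords N) P t = exp (\<i> * complex_of_real (dot (coords N) t \<beta>) +
      (LINT u|\<nu>. iexp (dot (coords N) t u) - 1 - \<i> * complex_of_real (dot (coords N) t u * indicator {u. L2_set u (coords N) \<le> 1} u)))"
      if "t \<in> space (RI (coords N))" for t
      using ID that unfolding ID_def RN_def charI_dot dot_def einner_def enorm_def by blast
  qed simp
qed

context levy_exp
begin

text \<open>In \<open>E_gam\<close> the domains of integration are not intersected with the space of
  \<open>\<nu>\<close>, unlike in \<open>shell\<close>; an integral over \<open>\<nu>\<close> sees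
  only points of the space.\<close>

lemma betar_unrestricted:
  "betar r k = \<beta> k - (LINT u:{u. r < L2_set u I \<and> L2_set u I \<le> 1}|\<nu>. u k)
    + (LINT u:{u. 1 < L2_set u I \<and> L2_set u I \<le> r}|\<nu>. u k)"
  unfolding betar_def shell_def set_lebesgue_integral_def
  by (intro arg_cong2[where f = "(+)"] arg_cong2[where f = "(-)"] refl Bochner_Integration.integral_cong)
    (auto simp: indicator_def)

lemma V2r_unrestricted: "V2r x = (LINT u:{u. L2_set u I \<le> x}|\<nu>. (L2_set u I)\<^sup>2)"
  unfolding V2r_def set_lebesgue_integral_def
  by (intro Bochner_Integration.integral_cong) (auto simp: indicator_def)

end

theorem theorem1p2:
  "\<exists>C::real. C > 0 \<and>
    (\<forall>(N::nat) (A::complex mat) (a::real) \<beta> \<nu> P.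
      N \<ge> 1 \<longrightarrow> A \<in> carrier_mat N N \<longrightarrow> hermitian A \<longrightarrow>
      a > 0 \<longrightarrow> (\<forall>i<N. \<forall>j<N. cmod (A $$ (i, j)) \<le> a) \<longrightarrow>
      ID N \<beta> \<nu> P \<longrightarrow> (\<exists>t>0. exp_moment N P t < \<infinity>) \<longrightarrow>
      (let T = T_sup N P; h = h_fun N \<nu>; hinv = h_inv N P \<nu>; hT = left_limit h T in
        (\<forall>K \<delta>. compact K \<longrightarrow> \<delta> > 0 \<longrightarrow>
           ereal (\<delta>\<^sup>2) < ereal (8 * sqrt 2 * a * diameter K) * hT / ereal (real N) \<longrightarrow>
           dev_prob N A P (Lip_K K 1) \<delta>
             \<le> 8 * diameter K / \<delta> *
                exp (- (LBINT s=0..ereal (real N * \<delta>\<^sup>2 / (8 * sqrt 2 * a * diameter K)). hinv s)))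
        \<and>
        (\<forall>b \<delta> \<gamma> t0. b > 0 \<longrightarrow> \<delta> > 0 \<longrightarrow>
           \<gamma> > 0 \<longrightarrow> nu_bar N \<nu> (p_gam N \<nu> \<gamma>) \<le> 1 / 4 \<longrightarrow>
           0 \<le> t0 \<longrightarrow> ereal t0 < T \<longrightarrow>
           t0 * h t0 - (LBINT s=0..ereal t0. h s) - ln (12 * b / \<delta>) = 0 \<longrightarrow>
           (let C\<delta>b = C * (sqrt 2 * a / sqrt (real N) * (G2 N \<beta> \<nu> \<gamma> + h t0) + b) in
             ereal (\<delta>\<^sup>2) \<le> ereal (sqrt 2 * a * C\<delta>b) * hT / ereal (real N) \<longrightarrow>
             dev_prob N A P (Lip_b b 1) \<delta>
               \<le> C\<delta>b / \<delta> *
                  exp (- (LBINT s=0..ereal (real N * \<delta>\<^sup>2 / (sqrt 2 * a * C\<delta>b)). hinv s))))))"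
proof (intro exI[of _ 40] conjI allI impI)
  show "(0::real) < 40" by simp
  fix N :: nat and A :: "complex mat" and a :: real and \<beta> \<nu> P
  assume A: "N \<ge> 1" "A \<in> carrier_mat N N" "hermitian A" "a > 0" "\<forall>i<N. \<forall>j<N. cmod (A $$ (i, j)) \<le> a"
    and ID: "ID N \<beta> \<nu> P" "\<exists>t>0. exp_moment N P t < \<infinity>"
  interpret levy_exp "coords N" \<beta> \<nu> P by (rule ID_levy_exp[OF ID])
  interpret random_matrix N A a using A by unfold_locales auto
  interpret matrix_model N A a \<beta> \<nu> P ..
  have T: "T_sup N P = TT" by (simp add: T_sup_def TT_def exp_moment_def enorm_def)
  have h: "h_fun N \<nu> = hh" by (simp add: h_fun_def[abs_def] hh_def[abs_def] enorm_def)
  have hinv: "h_inv N P \<nu> = young.hinv" by (simp add: h_inv_def young.hinv_def T h)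
  show "let T = T_sup N P; h = h_fun N \<nu>; hinv = h_inv N P \<nu>; hT = left_limit h T in
        (\<forall>K \<delta>. compact K \<longrightarrow> \<delta> > 0 \<longrightarrow>
           ereal (\<delta>\<^sup>2) < ereal (8 * sqrt 2 * a * diameter K) * hT / ereal (real N) \<longrightarrow>
           dev_prob N A P (Lip_K K 1) \<delta>
             \<le> 8 * diameter K / \<delta> *
                exp (- (LBINT s=0..ereal (real N * \<delta>\<^sup>2 / (8 * sqrt 2 * a * diameter K)). hinv s)))
        \<and>
        (\<forall>b \<delta> \<gamma> t0. b > 0 \<longrightarrow> \<delta> > 0 \<longrightarrow>
           \<gamma> > 0 \<longrightarrow> nu_bar N \<nu> (p_gam N \<nu> \<gamma>) \<le> 1 / 4 \<longrightarrow>
           0 \<le> t0 \<longrightarrow> ereal t0 < T \<longrightarrow>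
           t0 * h t0 - (LBINT s=0..ereal t0. h s) - ln (12 * b / \<delta>) = 0 \<longrightarrow>
           (let C\<delta>b = 40 * (sqrt 2 * a / sqrt (real N) * (G2 N \<beta> \<nu> \<gamma> + h t0) + b) in
             ereal (\<delta>\<^sup>2) \<le> ereal (sqrt 2 * a * C\<delta>b) * hT / ereal (real N) \<longrightarrow>
             dev_prob N A P (Lip_b b 1) \<delta>
               \<le> C\<delta>b / \<delta> *
                  exp (- (LBINT s=0..ereal (real N * \<delta>\<^sup>2 / (sqrt 2 * a * C\<delta>b)). hinv s))))"
    unfolding Let_def T h hinv
  proof (intro conjI allI impI)
    fix K :: "real set" and \<delta> :: real
    assume "compact K" "0 < \<delta>"
      "ereal (\<delta>\<^sup>2) < ereal (8 * sqrt 2 * a * diameter K) * left_limit hh TT / ereal (real N)"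
    then show "dev_prob N A P (Lip_K K 1) \<delta> \<le> 8 * diameter K / \<delta> *
        exp (- (LBINT s=0..ereal (real N * \<delta>\<^sup>2 / (8 * sqrt 2 * a * diameter K)). young.hinv s))"
      by (rule compact_support_deviation)
  next
    fix b \<delta> \<gamma> t0 :: real
    assume pos: "0 < b" "0 < \<delta>" and \<gamma>: "0 < \<gamma>" and q: "nu_bar N \<nu> (p_gam N \<nu> \<gamma>) \<le> 1 / 4"
      and t: "0 \<le> t0" "ereal t0 < TT"
      and ent: "t0 * hh t0 - (LBINT s=0..ereal t0. hh s) - ln (12 * b / \<delta>) = 0"
      and lim: "ereal (\<delta>\<^sup>2) \<le> ereal (sqrt 2 * a * (40 * (sqrt 2 * a / sqrt (real N) * (G2 N \<beta> \<nu> \<gamma> + hh t0) + b)))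
        * left_limit hh TT / ereal (real N)"
    define p where "p = p_gam N \<nu> \<gamma>"
    have V: "V2 N \<nu> = V2r" by (simp add: V2_def[abs_def] V2r_unrestricted[abs_def] enorm_def)
    \<comment> \<open>Folding \<open>V2\<close> first makes the infimum in
      \<open>truncation_level\<close> literally that of \<open>p_gam_def\<close>; afterwards the
      conclusion is returned to \<open>V2r\<close>.\<close>
    note lev = truncation_level[OF \<gamma>, folded V, folded p_gam_def, folded p_def, unfolded V]
    have E: "E_gam N \<beta> \<nu> \<gamma> = L2_set (betar p) (coords N)"
      unfolding E_gam_def L2_set_def betar_unrestricted p_def enorm_def ..
    \<comment> \<open>Of the three summands of \<open>G2\<close>, \<open>E_gam\<close> is the norm
      of the drift and \<open>p * sqrt \<gamma>\<close> bounds the fluctuation of the small jumps;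
      the summand with \<open>k_gam\<close> is nonnegative.\<close>
    have G: "L2_set (betar p) (coords N) + sqrt (V2r p) \<le> G2 N \<beta> \<nu> \<gamma>"
      using lev(2) mult_nonneg_nonneg[OF lev(1) k_gam_nonneg[OF \<gamma>]]
      unfolding G2_def E p_def[symmetric] by (simp add: distrib_left)
    have tail: "emeasure \<nu> (tail p) \<le> ennreal (1 / 4)"
      using q unfolding nu_bar_def tail_def p_def enorm_def by (simp add: ennreal_divide_numeral[symmetric])
    have ent': "t0 * hh t0 - psi t0 = ln (12 * b / \<delta>)" using ent unfolding young.integral_h[OF t] by simp
    show "dev_prob N A P (Lip_b b 1) \<delta> \<le>
        40 * (sqrt 2 * a / sqrt (real N) * (G2 N \<beta> \<nu> \<gamma> + hh t0) + b) / \<delta> *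
        exp (- (LBINT s=0..ereal (real N * \<delta>\<^sup>2 / (sqrt 2 * a * (40 * (sqrt 2 * a / sqrt (real N) * (G2 N \<beta> \<nu> \<gamma> + hh t0) + b)))). young.hinv s))"
      by (rule bounded_lipschitz_deviation[OF pos t ent' tail G lim])
  qed
qed

end
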